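(* Let $\alpha\in(0,1)$ be a Liouville number and let $\mathrm{T}$ be one of $\mathrm{II}_\infty$, $\mathrm{III}_\lambda$ (with $\lambda>1$), $\mathrm{III}_\infty$, $\mathrm{III}_0$. Then for every $r\in\mathbb{N}$ there is an element $f\in F_\alpha(\mathrm{T})$ such that $d_r(f,R_\alpha)<2^{-r}$.
   Context: $S^1=\mathbb{R}/\mathbb{Z}$, $m$ is Lebesgue measure on $S^1$, and $R_\alpha$ is the rotation $x\mapsto x+\alpha$. $F$ is the group of orientation preserving $C^\infty$ diffeomorphisms of $S^1$; $F_\alpha\subset F$ is the set of $f\in F$ with rotation number $\alpha$. A Liouville number is an irrational $\alpha$ such that for all $N\in\mathbb{N}$ and $\epsilon>0$ there are coprime $p,q\in\mathbb{N}$ with $|\alpha-p/q|<\epsilon q^{-N}$. For a $C^\infty$ function $\varphi$ on $S^1$, $\|\varphi\|_r=\max_{0\le i\le r}\sup_{x}|\varphi^{(i)}(x)|$. For $f,g\in F$, $d_r(f,g)=\max\{\|f-g\|_r,\|f^{-1}-g^{-1}\|_r\}$, where differences are read as real-valued functions on $S^1$ via lifts to $\mathbb{R}$ chosen so that the difference is as small as possible. A nonsingular automorphism of a Lebesgue measure space $(X,\mathcal{B},\mu)$ is a bimeasurable bijection $f$ between conull subsets of $X$ with $f_*\mu$ equivalent to $\mu$. It is ergodic if every $f$-invariant measurable set is null or conull. Each $f\in F$ is viewed as a nonsingular automorphism of $(S^1,m)$; for $\alpha$ irrational every $f\in F_\alpha$ is ergodic with respect to $m$. An ergodic $f$ is of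 type II if there is an $f$-invariant $\sigma$-finite measure $\nu$ equivalent to $\mu$; of type $\mathrm{II}_1$ if $\nu$ is finite and of type $\mathrm{II}_\infty$ if $\nu$ is infinite; it is of type III if it is not of type II. The ratio set $r(f)\subset[0,\infty)$ is the set of $t\in[0,\infty)$ such that for every $A\in\mathcal{B}$ with $\mu(A)>0$ and every $\epsilon>0$ there are $B\in\mathcal{B}$ and $i\in\mathbb{Z}$ with $\mu(B)>0$, $B\subset A$, $f^i(B)\subset A$ and $\frac{d(f^{-i})_*\mu}{d\mu}(x)\in(t-\epsilon,t+\epsilon)$ for all $x\in B$. A type III automorphism $f$ is of type $\mathrm{III}_\lambda$ ($\lambda>1$) if $r(f)=\lambda^{\mathbb{Z}}\cup\{0\}$, of type $\mathrm{III}_\infty$ if $r(f)=[0,\infty)$, and of type $\mathrm{III}_0$ if $r(f)=\{0,1\}$. $F_\alpha(\mathrm{T})$ is the set of $f\in F_\alpha$ of type $\mathrm{T}$. *)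

theory Defs
  imports "HOL-Analysis.Analysis"
begin

section \<open>The circle\<close>

quotient_type circle = real / "\<lambda>x y :: real. x - y \<in> \<int>"
proof (rule equivpI)
  show "reflp (\<lambda>x y :: real. x - y \<in> \<int>)"
    by (simp add: reflp_def)
  show "symp (\<lambda>x y :: real. x - y \<in> \<int>)"
    by (auto simp: symp_def intro: Ints_minus[of "_ - _", simplified])
  show "transp (\<lambda>x y :: real. x - y \<in> \<int>)"
  proof (rule transpI)
    fix x y z :: real
    assume "x - y \<in> \<int>" "y - z \<in> \<int>"
    then have "(x - y) + (y - z) \<in> \<int>" by (rule Ints_add)
    then show "x - z \<in> \<int>" by simp
  qed
qed

abbreviation proj :: "real \<Rightarrow> circle" where
  "proj \<equiv> abs_circle"

lift_definition rotation :: "real \<Rightarrow> circle \<Rightarrow> circle" is "\<lambda>\<alpha> x. x + \<alpha>"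
  by simp

text \<open>Lebesgue measure on the circle: a set is measurable iff its (periodic) preimage in the line
  is Lebesgue measurable, and its measure is read off on the fundamental domain.\<close>

definition circle_measure :: "circle measure" where
  "circle_measure =
     distr (lebesgue_on {0..<1}) (sigma UNIV {A. proj -` A \<in> sets lebesgue}) proj"

lemma space_circle_measure [simp]: "space circle_measure = UNIV"
  by (simp add: circle_measure_def)

lemma sets_circle_measure: "sets circle_measure = {A. proj -` A \<in> sets lebesgue}"
proof -
  have "sigma_algebra UNIV {A. proj -` A \<in> sets lebesgue}"
    unfolding sigma_algebra_iff2
    by (auto simp: vimage_Compl vimage_UN Compl_eq_Diff_UNIV[symmetric] Compl_in_sets_lebesgue)
  then show ?thesis
    by (simp add: circle_measure_def sigma_algebra.sigma_sets_eq)
qed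

lemma emeasure_circle_measure:
  assumes "A \<in> sets circle_measure"
  shows "emeasure circle_measure A = emeasure lebesgue (proj -` A \<inter> {0..<1})"
proof -
  have "proj \<in> measurable (lebesgue_on {0..<1}) (sigma UNIV {A. proj -` A \<in> sets lebesgue})"
    by (rule measurable_sigma_sets) (auto simp: sets_restrict_space)
  moreover have "A \<in> sets (sigma UNIV {A. proj -` A \<in> sets lebesgue})"
    using assms by (simp add: circle_measure_def)
  ultimately show ?thesis
    by (simp add: circle_measure_def emeasure_distr emeasure_restrict_space)
qed

section \<open>Smooth diffeomorphisms of the circle\<close>

definition smooth :: "(real \<Rightarrow> real) \<Rightarrow> bool" where
  "smooth G \<longleftrightarrow> (\<forall>n x. (deriv ^^ n) G field_differentiable at x)"

definition is_lift :: "(circle \<Rightarrow> circle) \<Rightarrow> (real \<Rightarrow> real) \<Rightarrow> bool" where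
  "is_lift f G \<longleftrightarrow> continuous_on UNIV G \<and> (\<forall>x. proj (G x) = f (proj x))"

text \<open>The projection is a local diffeomorphism and the line is simply connected, so a self-map of
  the circle is smooth iff it has a smooth lift.\<close>

definition smooth_circle_map :: "(circle \<Rightarrow> circle) \<Rightarrow> bool" where
  "smooth_circle_map f \<longleftrightarrow> (\<exists>G. is_lift f G \<and> smooth G)"

definition orientation_preserving :: "(circle \<Rightarrow> circle) \<Rightarrow> bool" where
  "orientation_preserving f \<longleftrightarrow> (\<exists>G. is_lift f G \<and> strict_mono G)"

definition diffeos :: "(circle \<Rightarrow> circle) set" where
  "diffeos = {f. bij f \<and> smooth_circle_map f \<and> smooth_circle_map (inv f) \<and>
                 orientation_preserving f}"

text \<open>The rotation number is only defined modulo 1; the choice of the lift accounts for this.\<close>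

definition has_rotation_number :: "(circle \<Rightarrow> circle) \<Rightarrow> real \<Rightarrow> bool" where
  "has_rotation_number f \<alpha> \<longleftrightarrow>
     (\<exists>G. is_lift f G \<and> (\<forall>x. (\<lambda>n. (G ^^ n) x / real n) \<longlonglongrightarrow> \<alpha>))"

definition diffeos_rot :: "real \<Rightarrow> (circle \<Rightarrow> circle) set" where
  "diffeos_rot \<alpha> = {f \<in> diffeos. has_rotation_number f \<alpha>}"

definition liouville :: "real \<Rightarrow> bool" where
  "liouville \<alpha> \<longleftrightarrow> \<alpha> \<notin> \<rat> \<and>
     (\<forall>N::nat. \<forall>\<epsilon>::real. \<epsilon> > 0 \<longrightarrow>
        (\<exists>p q::nat. q > 0 \<and> coprime p q \<and> \<bar>\<alpha> - real p / real q\<bar> < \<epsilon> / real q ^ N))"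

text \<open>Functions on the circle are represented by their 1-periodic pullbacks to the line.\<close>

definition Cr_norm :: "nat \<Rightarrow> (real \<Rightarrow> real) \<Rightarrow> real" where
  "Cr_norm r \<phi> = Max ((\<lambda>i. SUP x. \<bar>(deriv ^^ i) \<phi> x\<bar>) ` {..r})"

text \<open>Two lifts of the same map differ by an integer constant, so the infimum over lifts is
  attained; this is the choice of lifts making the difference as small as possible.\<close>

definition Cr_diff :: "nat \<Rightarrow> (circle \<Rightarrow> circle) \<Rightarrow> (circle \<Rightarrow> circle) \<Rightarrow> real" where
  "Cr_diff r f g = Inf {Cr_norm r (\<lambda>x. G x - H x) | G H. is_lift f G \<and> is_lift g H}"

definition d_Cr :: "nat \<Rightarrow> (circle \<Rightarrow> circle) \<Rightarrow> (circle \<Rightarrow> circle) \<Rightarrow> real" where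
  "d_Cr r f g = max (Cr_diff r f g) (Cr_diff r (inv f) (inv g))"

section \<open>Nonsingular automorphisms and their types\<close>

definition equivalent_measures :: "'a measure \<Rightarrow> 'a measure \<Rightarrow> bool" where
  "equivalent_measures M N \<longleftrightarrow>
     sets N = sets M \<and> absolutely_continuous M N \<and> absolutely_continuous N M"

text \<open>Circle diffeomorphisms are bijective everywhere, so automorphisms are taken to be
  bijections of the whole space rather than of conull subsets.\<close>

definition nonsingular_automorphism :: "'a measure \<Rightarrow> ('a \<Rightarrow> 'a) \<Rightarrow> bool" where
  "nonsingular_automorphism M f \<longleftrightarrow>
     bij_betw f (space M) (space M) \<and>
     f \<in> measurable M M \<and> inv_into (space M) f \<in> measurable M M \<and>
     equivalent_measures M (distr M M f)"

definition ergodic :: "'a measure \<Rightarrow> ('a \<Rightarrow> 'a) \<Rightarrow> bool" where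
  "ergodic M f \<longleftrightarrow> nonsingular_automorphism M f \<and>
     (\<forall>A \<in> sets M. f ` A = A \<longrightarrow> emeasure M A = 0 \<or> emeasure M (space M - A) = 0)"

definition invariant_measure :: "'a measure \<Rightarrow> ('a \<Rightarrow> 'a) \<Rightarrow> 'a measure \<Rightarrow> bool" where
  "invariant_measure M f \<nu> \<longleftrightarrow>
     sigma_finite_measure \<nu> \<and> equivalent_measures M \<nu> \<and> distr \<nu> \<nu> f = \<nu>"

definition type_II :: "'a measure \<Rightarrow> ('a \<Rightarrow> 'a) \<Rightarrow> bool" where
  "type_II M f \<longleftrightarrow> ergodic M f \<and> (\<exists>\<nu>. invariant_measure M f \<nu>)"

definition type_II_infinity :: "'a measure \<Rightarrow> ('a \<Rightarrow> 'a) \<Rightarrow> bool" where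
  "type_II_infinity M f \<longleftrightarrow>
     ergodic M f \<and> (\<exists>\<nu>. invariant_measure M f \<nu> \<and> emeasure \<nu> (space \<nu>) = \<infinity>)"

definition type_III :: "'a measure \<Rightarrow> ('a \<Rightarrow> 'a) \<Rightarrow> bool" where
  "type_III M f \<longleftrightarrow> ergodic M f \<and> \<not> type_II M f"

definition int_iterate :: "'a measure \<Rightarrow> ('a \<Rightarrow> 'a) \<Rightarrow> int \<Rightarrow> 'a \<Rightarrow> 'a" where
  "int_iterate M f i =
     (if 0 \<le> i then f ^^ nat i else inv_into (space M) f ^^ nat (- i))"

definition ratio_set :: "'a measure \<Rightarrow> ('a \<Rightarrow> 'a) \<Rightarrow> real set" where
  "ratio_set M f = {t. 0 \<le> t \<and>
     (\<forall>A \<in> sets M. \<forall>\<epsilon>::real. emeasure M A > 0 \<longrightarrow> \<epsilon> > 0 \<longrightarrow>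
        (\<exists>B \<in> sets M. \<exists>i::int. emeasure M B > 0 \<and> B \<subseteq> A \<and> int_iterate M f i ` B \<subseteq> A \<and>
           (\<forall>x\<in>B. \<exists>s \<in> {t - \<epsilon><..<t + \<epsilon>}. 0 \<le> s \<and>
              RN_deriv M (distr M M (int_iterate M f (- i))) x = ennreal s)))}"

datatype aut_type = II_infinity | III_lambda real | III_infinity | III_zero

fun has_type :: "'a measure \<Rightarrow> ('a \<Rightarrow> 'a) \<Rightarrow> aut_type \<Rightarrow> bool" where
  "has_type M f II_infinity \<longleftrightarrow> type_II_infinity M f"
| "has_type M f (III_lambda l) \<longleftrightarrow>
     type_III M f \<and> l > 1 \<and> ratio_set M f = range (\<lambda>k::int. l powi k) \<union> {0}"
| "has_type M f III_infinity \<longleftrightarrow> type_III M f \<and> ratio_set M f = {0..}"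
| "has_type M f III_zero \<longleftrightarrow> type_III M f \<and> ratio_set M f = {0, 1}"

definition diffeos_rot_type :: "real \<Rightarrow> aut_type \<Rightarrow> (circle \<Rightarrow> circle) set" where
  "diffeos_rot_type \<alpha> T = {f \<in> diffeos_rot \<alpha>. has_type circle_measure f T}"

end

theory Submission
  imports Defs "HOL-Computational_Algebra.Polynomial"
begin

text \<open>
  The diffeomorphism is a limit of conjugates \<open>H\<^sub>n R\<^sub>\<alpha> H\<^sub>n\<^sup>-\<^sup>1\<close> (Anosov--Katok method), where
  \<open>H\<^sub>n = H\<^sub>n\<^sub>-\<^sub>1 \<circ> S\<^sub>n\<close> and \<open>S\<^sub>n\<close> is the \<open>q\<^sub>n\<close>-fold lift of a diffeomorphism \<open>\<phi>\<^sub>n\<close> fixed in advance.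
  Since \<open>S\<^sub>n\<close> commutes with the rotation by \<open>p\<^sub>n/q\<^sub>n\<close>, two successive conjugates differ in
  \<open>C\<^sup>r\<close> by at most a constant times \<open>q\<^sub>n\<^sup>r \<bar>\<alpha> - p\<^sub>n/q\<^sub>n\<bar>\<close>, which is as small as we like for a
  Liouville number.

  The derivative of \<open>\<phi>\<^sub>n\<close> takes, up to a set of summable measure, only two values, with quotient \<open>t\<^sub>n\<close>.
  The Radon--Nikodym cocycle of the limit \<open>f\<close> is the coboundary limit of
  \<open>(H\<^sub>n\<^sup>-\<^sup>1)'\<close>, so its values are products of powers of the \<open>t\<^sub>n\<close> up to a bounded coboundary; conversely
  iterates of \<open>f\<close> that are close to \<open>H\<^sub>n R\<^sub>s H\<^sub>n\<^sup>-\<^sup>1\<close> with \<open>s\<close> a fraction of \<open>1/q\<^sub>n\<close> move the upper plateau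
  of the \<open>n\<close>-th stage onto the lower one, so every limit point of \<open>1/t\<^sub>n\<close> lies in the ratio set.
  The type is prescribed through \<open>t\<close>: all powers of \<open>\<lambda>\<close> infinitely often (type \<open>III\<^sub>\<lambda>\<close>), a dense set
  (\<open>III\<^sub>\<infinity>\<close>), \<open>2\<close> to the power \<open>2\<^sup>n\<close> (\<open>III\<^sub>0\<close>, since the powers become arbitrarily sparse). For \<open>II\<^sub>\<infinity>\<close> the
  upper plateau carries almost all the measure while having half the length, and \<open>(H\<^sub>n\<^sup>-\<^sup>1)'\<close>, suitably normalised,
  increases to the density of an infinite invariant measure.
\<close>

section \<open>Functions with bounded derivatives\<close>

text \<open>The profile \<open>\<phi> n\<close> is fixed before the denominator: its constants bound
  the C^r cost by a constant times \<open>q ^ r\<close>, and only afterwards is \<open>q\<close>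
  taken large and arithmetically good. Whatever is claimed about the limit must therefore survive
  small C^1 perturbations of the n-th conjugate. Two such conditions carry everything: a cocycle
  estimate, and the fact that finitely many iterates of the limit imitate all rotations in the
  coordinate of stage n. For the lower bound on the ratio set, the upper plateau has length
  \<open>1 / (M + 1)\<close> in each cell, with \<open>M\<close> an integer between \<open>t\<close>
  and \<open>t + 1\<close>. It then carries a fixed share of the measure, while \<open>M\<close>
  disjoint translates of it fit into the lower plateau. Each is contracted by about
  \<open>1 / t\<close>, so together they are comparable in size with the plateau itself, and no set
  of small measure can absorb them all; this takes the place of a density point argument. For the
  upper bound the transition arcs have summable measure, so that a set of positive measure sees only
  the two plateau values at all late stages.\<close>

primrec derivs_le :: "nat \<Rightarrow> real \<Rightarrow> (real \<Rightarrow> real) \<Rightarrow> bool" where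
  "derivs_le 0 B f \<longleftrightarrow> (\<forall>x. \<bar>f x\<bar> \<le> B)"
| "derivs_le (Suc n) B f \<longleftrightarrow> (\<forall>x. \<bar>f x\<bar> \<le> B) \<and> (\<exists>f'. (\<forall>x. (f has_real_derivative f' x) (at x)) \<and> derivs_le n B f')"

lemma derivs_le_bound: "derivs_le n B f \<Longrightarrow> \<bar>f x\<bar> \<le> B"
  by (cases n) auto

lemma derivs_le_nonneg: "derivs_le n B f \<Longrightarrow> 0 \<le> B"
  using derivs_le_bound[of n B f 0] by linarith

lemma derivs_le_SucI:
  assumes "\<And>x. \<bar>f x\<bar> \<le> B" "\<And>x. (f has_real_derivative f' x) (at x)" "derivs_le n B f'"
  shows "derivs_le (Suc n) B f"
  using assms by auto

lemma derivs_le_mono: "derivs_le n B f \<Longrightarrow> B \<le> C \<Longrightarrow> derivs_le n C f"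
proof (induction n arbitrary: f)
  case 0
  then show ?case by (auto intro: order_trans)
next
  case (Suc n)
  then obtain f' where f': "\<forall>x. (f has_real_derivative f' x) (at x)" "derivs_le n B f'" by auto
  show ?case
    by (rule derivs_le_SucI[where f' = f'])
      (use Suc f' in \<open>auto intro: order_trans\<close>)
qed

lemma derivs_le_SucD: "derivs_le (Suc n) B f \<Longrightarrow> derivs_le n B f"
proof (induction n arbitrary: f)
  case (Suc n)
  then obtain f' where "\<forall>x. (f has_real_derivative f' x) (at x)" "derivs_le (Suc n) B f'"
    by auto
  with Suc show ?case by auto
qed auto

lemma derivs_le_antimono: "derivs_le n B f \<Longrightarrow> m \<le> n \<Longrightarrow> derivs_le m B f"
  by (induction n) (auto simp del: derivs_le.simps dest: derivs_le_SucD simp: le_Suc_eq)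

text \<open>The recursion of \<open>derivs_le\<close> asserts differentiability together with one
  common bound for all orders up to n, so no separate smoothness hypothesis travels along; since
  derivatives are unique, its witness is \<open>deriv f\<close>.\<close>

lemma derivs_le_deriv:
  assumes "derivs_le (Suc n) B f"
  shows "derivs_le n B (deriv f)" "f field_differentiable at x" "(f has_real_derivative deriv f x) (at x)"
proof -
  obtain f' where f': "\<And>x. (f has_real_derivative f' x) (at x)" "derivs_le n B f'"
    using assms by auto
  then have "f' = deriv f"
    by (metis DERIV_imp_deriv ext)
  then show "derivs_le n B (deriv f)" "(f has_real_derivative deriv f x) (at x)"
    using f' by auto
  then show "f field_differentiable at x"
    by (auto simp: field_differentiable_def)
qed

lemma derivs_le_zero: "0 \<le> B \<Longrightarrow> derivs_le n B (\<lambda>x. 0)"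
proof (induction n)
  case (Suc n)
  then show ?case by (intro derivs_le_SucI[where f' = "\<lambda>x. 0"]) auto
qed auto

lemma derivs_le_const: "\<bar>c\<bar> \<le> B \<Longrightarrow> derivs_le n B (\<lambda>x. c)"
proof (cases n)
  case (Suc m)
  assume "\<bar>c\<bar> \<le> B"
  then show ?thesis unfolding Suc
    by (intro derivs_le_SucI[where f' = "\<lambda>x. 0"] derivs_le_zero) auto
qed auto

lemma derivs_le_add: "derivs_le n B f \<Longrightarrow> derivs_le n C g \<Longrightarrow> derivs_le n (B + C) (\<lambda>x. f x + g x)"
proof (induction n arbitrary: f g)
  case 0
  then show ?case by (auto intro: order_trans[OF abs_triangle_ineq] add_mono)
next
  case (Suc n)
  show ?case
  proof (rule derivs_le_SucI)
    show "\<bar>f x + g x\<bar> \<le> B + C" for x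
      using derivs_le_bound[OF Suc.prems(1), of x] derivs_le_bound[OF Suc.prems(2), of x] by linarith
    show "((\<lambda>x. f x + g x) has_real_derivative deriv f x + deriv g x) (at x)" for x
      by (intro derivative_intros derivs_le_deriv[OF Suc.prems(1)] derivs_le_deriv[OF Suc.prems(2)])
    show "derivs_le n (B + C) (\<lambda>x. deriv f x + deriv g x)"
      by (intro Suc.IH derivs_le_deriv(1)[OF Suc.prems(1)] derivs_le_deriv(1)[OF Suc.prems(2)])
  qed
qed

text \<open>Each differentiation brings out one factor \<open>q\<close>; as
  \<open>1 \<le> q\<close>, the factor \<open>q ^ n\<close> of the top order dominates all lower
  ones.\<close>

lemma derivs_le_scale: "derivs_le n B f \<Longrightarrow> 1 \<le> q \<Longrightarrow> derivs_le n (\<bar>c\<bar> * q ^ n * B) (\<lambda>x. c * f (q * x + s))"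
proof (induction n arbitrary: f c)
  case 0
  then show ?case by (auto simp: abs_mult intro: mult_left_mono)
next
  case (Suc n)
  have B: "0 \<le> B" using Suc.prems derivs_le_nonneg by blast
  show ?case
  proof (rule derivs_le_SucI)
    show "\<bar>c * f (q * x + s)\<bar> \<le> \<bar>c\<bar> * q ^ Suc n * B" for x
    proof -
      have "\<bar>c * f (q * x + s)\<bar> \<le> \<bar>c\<bar> * B"
        using derivs_le_bound[OF Suc.prems(1)] by (auto simp: abs_mult intro: mult_left_mono)
      also have "\<dots> \<le> \<bar>c\<bar> * q ^ Suc n * B"
        using Suc.prems(2) B one_le_power[of q "Suc n"] 
        by (metis (no_types, opaque_lifting) abs_ge_zero mult.right_neutral mult_left_mono mult_right_mono)
      finally show ?thesis .
    qed
    show "((\<lambda>x. c * f (q * x + s)) has_real_derivative (c * q) * deriv f (q * x + s)) (at x)" for x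
      by (auto intro!: derivative_eq_intros DERIV_chain2[OF derivs_le_deriv(3)[OF Suc.prems(1)]])
    have "derivs_le n (\<bar>c * q\<bar> * q ^ n * B) (\<lambda>x. (c * q) * deriv f (q * x + s))"
      by (intro Suc.IH derivs_le_deriv(1)[OF Suc.prems(1)] Suc.prems)
    then show "derivs_le n (\<bar>c\<bar> * q ^ Suc n * B) (\<lambda>x. (c * q) * deriv f (q * x + s))"
      using Suc.prems(2) by (simp add: abs_mult mult_ac)
  qed
qed

lemma derivs_le_cmult: "derivs_le n B f \<Longrightarrow> derivs_le n (\<bar>c\<bar> * B) (\<lambda>x. c * f x)"
  using derivs_le_scale[of n B f 1 c 0] by simp

lemma derivs_le_uminus: "derivs_le n B f \<Longrightarrow> derivs_le n B (\<lambda>x. - f x)"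
  using derivs_le_cmult[of n B f "-1"] by simp

lemma derivs_le_diff: "derivs_le n B f \<Longrightarrow> derivs_le n C g \<Longrightarrow> derivs_le n (B + C) (\<lambda>x. f x - g x)"
  using derivs_le_add[OF _ derivs_le_uminus, of n B f C g] by simp

text \<open>The order of the quantifiers is the content: \<open>D\<close> depends on n and the two
  bounds, never on the functions. The constants of a stage can then be fixed before \<open>q\<close>
  is known.\<close>

lemma derivs_le_mult: "\<exists>D. \<forall>f g. derivs_le n B f \<longrightarrow> derivs_le n C g \<longrightarrow> derivs_le n D (\<lambda>x. f x * g x)"
proof (induction n)
  case 0
  have "\<bar>f x * g x\<bar> \<le> \<bar>B\<bar> * \<bar>C\<bar>" if "derivs_le 0 B f" "derivs_le 0 C g" for f g x
    unfolding abs_mult using that[THEN derivs_le_bound, of x] by (intro mult_mono) auto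
  then have "\<forall>f g. derivs_le 0 B f \<longrightarrow> derivs_le 0 C g \<longrightarrow> derivs_le 0 (\<bar>B\<bar> * \<bar>C\<bar>) (\<lambda>x. f x * g x)"
    unfolding derivs_le.simps(1)[of "\<bar>B\<bar> * \<bar>C\<bar>"] by blast
  then show ?case by blast
next
  case (Suc n)
  then obtain D where D: "\<And>f g. derivs_le n B f \<Longrightarrow> derivs_le n C g \<Longrightarrow> derivs_le n D (\<lambda>x. f x * g x)" by blast
  have "derivs_le (Suc n) (\<bar>B\<bar> * \<bar>C\<bar> + (\<bar>D\<bar> + \<bar>D\<bar>)) (\<lambda>x. f x * g x)" if f: "derivs_le (Suc n) B f" and g: "derivs_le (Suc n) C g" for f g
  proof (rule derivs_le_SucI)
    show "\<bar>f x * g x\<bar> \<le> \<bar>B\<bar> * \<bar>C\<bar> + (\<bar>D\<bar> + \<bar>D\<bar>)" for x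
    proof -
      have "\<bar>f x * g x\<bar> \<le> \<bar>B\<bar> * \<bar>C\<bar>"
        unfolding abs_mult using f[THEN derivs_le_bound, of x] g[THEN derivs_le_bound, of x] by (intro mult_mono) auto
      then show ?thesis by linarith
    qed
    have DD: "D + D \<le> \<bar>B\<bar> * \<bar>C\<bar> + (\<bar>D\<bar> + \<bar>D\<bar>)"
      using mult_nonneg_nonneg[of "\<bar>B\<bar>" "\<bar>C\<bar>"] by linarith
    show "((\<lambda>x. f x * g x) has_real_derivative deriv f x * g x + f x * deriv g x) (at x)" for x
      by (auto intro!: derivative_eq_intros derivs_le_deriv(3)[OF f] derivs_le_deriv(3)[OF g])
    have "derivs_le n (D + D) (\<lambda>x. deriv f x * g x + f x * deriv g x)"
      by (intro derivs_le_add D derivs_le_deriv(1)[OF f] derivs_le_deriv(1)[OF g] derivs_le_SucD[OF f] derivs_le_SucD[OF g])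
    then show "derivs_le n (\<bar>B\<bar> * \<bar>C\<bar> + (\<bar>D\<bar> + \<bar>D\<bar>)) (\<lambda>x. deriv f x * g x + f x * deriv g x)"
      by (rule derivs_le_mono) (rule DD)
  qed
  then show ?case by blast
qed

text \<open>Lifts of circle maps are unbounded, so the inner function enters only through its
  derivative; the chain rule reduces each order to the previous one and a product.\<close>

lemma derivs_le_compose:
  "\<exists>D. \<forall>f g g'. derivs_le n B f \<longrightarrow> (\<forall>x. (g has_real_derivative g' x) (at x)) \<longrightarrow> derivs_le n C g' \<longrightarrow> derivs_le n D (\<lambda>x. f (g x))"
proof (induction n)
  case 0
  show ?case by (rule exI[of _ B]) auto
next
  case (Suc n)
  then obtain D where D: "\<And>f g g'. derivs_le n B f \<Longrightarrow> (\<And>x. (g has_real_derivative g' x) (at x)) \<Longrightarrow> derivs_le n C g' \<Longrightarrow> derivs_le n D (\<lambda>x. f (g x))"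
    by metis
  obtain E where E: "\<And>f g. derivs_le n D f \<Longrightarrow> derivs_le n C g \<Longrightarrow> derivs_le n E (\<lambda>x. f x * g x)" using derivs_le_mult by metis
  have "derivs_le (Suc n) (max B E) (\<lambda>x. f (g x))" if f: "derivs_le (Suc n) B f" and g: "\<And>x. (g has_real_derivative g' x) (at x)" and g': "derivs_le (Suc n) C g'" for f g g'
  proof (rule derivs_le_SucI)
    show "\<bar>f (g x)\<bar> \<le> max B E" for x using derivs_le_bound[OF f, of "g x"] by simp
    show "((\<lambda>x. f (g x)) has_real_derivative deriv f (g x) * g' x) (at x)" for x
      by (rule DERIV_chain2[OF derivs_le_deriv(3)[OF f] g])
    have "derivs_le n E (\<lambda>x. deriv f (g x) * g' x)"
      by (intro E D[OF derivs_le_deriv(1)[OF f] g] derivs_le_SucD[OF g'])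
    then show "derivs_le n (max B E) (\<lambda>x. deriv f (g x) * g' x)" by (rule derivs_le_mono) simp
  qed
  then show ?case by metis
qed

text \<open>The reciprocal reappears in its own derivative \<open>- f' / f\<^sup>2\<close>, so its
  bound of order n feeds the bound of order n + 1.\<close>

lemma derivs_le_inverse:
  assumes c: "0 < c"
  shows "\<exists>D. \<forall>f. derivs_le n B f \<longrightarrow> (\<forall>x. c \<le> f x) \<longrightarrow> derivs_le n D (\<lambda>x. inverse (f x))"
proof (induction n)
  case 0
  show ?case 
  proof (intro exI[of _ "inverse c"] allI impI)
    fix f :: "real \<Rightarrow> real" assume "\<forall>x. c \<le> f x"
    then show "derivs_le 0 (inverse c) (\<lambda>x. inverse (f x))" using c
      by (auto simp: abs_inverse intro!: le_imp_inverse_le) (metis abs_of_pos less_le_trans)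
  qed
next
  case (Suc n)
  then obtain D where D: "\<And>f. derivs_le n B f \<Longrightarrow> (\<forall>x. c \<le> f x) \<Longrightarrow> derivs_le n D (\<lambda>x. inverse (f x))" by blast
  obtain E where E: "\<And>f g. derivs_le n D f \<Longrightarrow> derivs_le n D g \<Longrightarrow> derivs_le n E (\<lambda>x. f x * g x)" using derivs_le_mult by metis
  obtain E' where E': "\<And>f g. derivs_le n B f \<Longrightarrow> derivs_le n E g \<Longrightarrow> derivs_le n E' (\<lambda>x. f x * g x)" using derivs_le_mult by metis
  have "derivs_le (Suc n) (max (inverse c) E') (\<lambda>x. inverse (f x))" if f: "derivs_le (Suc n) B f" and cf: "\<forall>x. c \<le> f x" for f
  proof (rule derivs_le_SucI)
    have pos: "f x > 0" for x using cf c by (meson less_le_trans)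
    show "\<bar>inverse (f x)\<bar> \<le> max (inverse c) E'" for x using cf c pos[of x]
      by (simp add: abs_inverse max.coboundedI1)
    show "((\<lambda>x. inverse (f x)) has_real_derivative - (deriv f x * (inverse (f x) * inverse (f x)))) (at x)" for x
      using pos[of x] by (auto intro!: derivative_eq_intros derivs_le_deriv(3)[OF f] simp: power2_eq_square field_simps)
    have "derivs_le n E' (\<lambda>x. - (deriv f x * (inverse (f x) * inverse (f x))))"
      by (intro derivs_le_uminus E' E D cf derivs_le_deriv(1)[OF f] derivs_le_SucD[OF f])
    then show "derivs_le n (max (inverse c) E') (\<lambda>x. - (deriv f x * (inverse (f x) * inverse (f x))))" by (rule derivs_le_mono) simp
  qed
  then show ?case by blast
qed

text \<open>The equation for \<open>L\<close> says that it inverts a function with derivative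
  \<open>h'\<close>. Its right-hand side involves \<open>L\<close> itself, so the bounds are
  bootstrapped: order n for \<open>L'\<close> gives order n + 1 for \<open>h' \<circ> L\<close>,
  hence for its reciprocal.\<close>

lemma derivs_le_inverse_function:
  assumes c: "0 < c"
  shows "\<exists>D. \<forall>h' L. derivs_le n B h' \<longrightarrow> (\<forall>x. c \<le> h' x) \<longrightarrow> (\<forall>x. (L has_real_derivative inverse (h' (L x))) (at x))
    \<longrightarrow> derivs_le n D (\<lambda>x. inverse (h' (L x)))"
proof (induction n)
  case 0
  obtain D where D: "\<And>f. derivs_le 0 B f \<Longrightarrow> (\<forall>x. c \<le> f x) \<Longrightarrow> derivs_le 0 D (\<lambda>x. inverse (f x))"
    using derivs_le_inverse[OF c, of 0 B] by blast
  show ?case using D by (intro exI[of _ D]) auto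
next
  case (Suc n)
  then obtain D where D: "\<And>h' L. derivs_le n B h' \<Longrightarrow> (\<And>x. c \<le> h' x) \<Longrightarrow> (\<And>x. (L has_real_derivative inverse (h' (L x))) (at x))
    \<Longrightarrow> derivs_le n D (\<lambda>x. inverse (h' (L x)))" by blast
  obtain E where E: "\<And>f g g'. derivs_le n B f \<Longrightarrow> (\<And>x. (g has_real_derivative g' x) (at x)) \<Longrightarrow> derivs_le n D g' \<Longrightarrow> derivs_le n E (\<lambda>x. f (g x))"
    using derivs_le_compose[of n B D] by metis
  obtain E1 where E1: "\<And>f g. derivs_le n E f \<Longrightarrow> derivs_le n D g \<Longrightarrow> derivs_le n E1 (\<lambda>x. f x * g x)" using derivs_le_mult by metis
  obtain B2 where B2: "\<And>f. derivs_le (Suc n) (max B (max E1 0)) f \<Longrightarrow> (\<forall>x. c \<le> f x) \<Longrightarrow> derivs_le (Suc n) B2 (\<lambda>x. inverse (f x))"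
    using derivs_le_inverse[OF c, of "Suc n" "max B (max E1 0)"] by blast
  have "derivs_le (Suc n) B2 (\<lambda>x. inverse (h' (L x)))"
    if h: "derivs_le (Suc n) B h'" and ch: "\<And>x. c \<le> h' x" and L: "\<And>x. (L has_real_derivative inverse (h' (L x))) (at x)" for h' L
  proof (rule B2)
    show "\<forall>x. c \<le> h' (L x)" using ch by blast
    show "derivs_le (Suc n) (max B (max E1 0)) (\<lambda>x. h' (L x))"
    proof (rule derivs_le_SucI)
      show "\<bar>h' (L x)\<bar> \<le> max B (max E1 0)" for x using derivs_le_bound[OF h, of "L x"] by simp
      show "((\<lambda>x. h' (L x)) has_real_derivative deriv h' (L x) * inverse (h' (L x))) (at x)" for x
        by (rule DERIV_chain2[OF derivs_le_deriv(3)[OF h] L])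
      have *: "derivs_le n D (\<lambda>x. inverse (h' (L x)))" by (rule D[OF derivs_le_SucD[OF h] ch L])
      have "derivs_le n E1 (\<lambda>x. deriv h' (L x) * inverse (h' (L x)))"
        by (intro E1 * E[OF derivs_le_deriv(1)[OF h] L])
      then show "derivs_le n (max B (max E1 0)) (\<lambda>x. deriv h' (L x) * inverse (h' (L x)))" by (rule derivs_le_mono) simp
    qed
  qed
  then show ?case by blast
qed

lemma DERIV_bound_lipschitz:
  fixes F :: "real \<Rightarrow> real"
  assumes "\<And>x. (F has_real_derivative F' x) (at x)" "\<And>x. \<bar>F' x\<bar> \<le> B"
  shows "\<bar>F x - F y\<bar> \<le> B * \<bar>x - y\<bar>"
  using field_differentiable_bound[of UNIV F F' B x y] assms by (auto simp: field_differentiable_bound)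

text \<open>Differentiation commutes with the shifts, so at each order the mean value theorem is
  applied to the derivative of \<open>F\<close> of that order.\<close>

lemma derivs_le_difference:
  assumes "\<And>x. (F has_real_derivative F' x) (at x)" "derivs_le n B F'"
  shows "derivs_le n (B * \<bar>\<tau> - \<sigma>\<bar>) (\<lambda>z. F (z + \<tau>) - F (z + \<sigma>))"
  using assms
proof (induction n arbitrary: F F')
  case 0
  then have "\<bar>F (z + \<tau>) - F (z + \<sigma>)\<bar> \<le> B * \<bar>(z + \<tau>) - (z + \<sigma>)\<bar>" for z
    by (intro DERIV_bound_lipschitz) auto
  then show ?case by simp
next
  case (Suc n)
  have "\<bar>F (z + \<tau>) - F (z + \<sigma>)\<bar> \<le> B * \<bar>(z + \<tau>) - (z + \<sigma>)\<bar>" for z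
    using Suc.prems derivs_le_bound by (intro DERIV_bound_lipschitz) auto
  then have 1: "\<bar>F (z + \<tau>) - F (z + \<sigma>)\<bar> \<le> B * \<bar>\<tau> - \<sigma>\<bar>" for z by simp
  show ?case
  proof (rule derivs_le_SucI)
    show "((\<lambda>z. F (z + \<tau>) - F (z + \<sigma>)) has_real_derivative F' (z + \<tau>) - F' (z + \<sigma>)) (at z)" for z
      using DERIV_shift Suc.prems(1) by (intro derivative_intros) blast+
    show "derivs_le n (B * \<bar>\<tau> - \<sigma>\<bar>) (\<lambda>z. F' (z + \<tau>) - F' (z + \<sigma>))"
      by (rule Suc.IH[OF derivs_le_deriv(3)[OF Suc.prems(2)] derivs_le_deriv(1)[OF Suc.prems(2)]])
  qed (rule 1)
qed

text \<open>The Weierstrass test applies to every derivative with the same majorant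
  \<open>b\<close>, so the series may be differentiated term by term.\<close>

lemma derivs_le_series:
  assumes "\<And>k. derivs_le n (b k) (u k)" "summable b"
  shows "derivs_le n (suminf b) (\<lambda>x. \<Sum>k. u k x)"
  using assms(1)
proof (induction n arbitrary: u)
  have gen: "\<bar>\<Sum>k. u k x\<bar> \<le> suminf b" if "\<And>k x. \<bar>u k x\<bar> \<le> b k" for u :: "nat \<Rightarrow> real \<Rightarrow> real" and x
  proof -
    have "summable (\<lambda>k. \<bar>u k x\<bar>)"
      by (rule summable_comparison_test[OF _ assms(2)]) (use that in auto)
    then have "\<bar>\<Sum>k. u k x\<bar> \<le> (\<Sum>k. \<bar>u k x\<bar>)" by (rule summable_rabs)
    also have "\<dots> \<le> suminf b" by (intro suminf_le that assms \<open>summable (\<lambda>k. \<bar>u k x\<bar>)\<close>)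
    finally show ?thesis .
  qed
  {
    case 0
    then show ?case using gen by auto
  next
    case (Suc n)
    have b: "\<bar>u k x\<bar> \<le> b k" for k x using Suc.prems derivs_le_bound by blast
    have b': "\<bar>deriv (u k) x\<bar> \<le> b k" for k x using Suc.prems derivs_le_bound derivs_le_deriv(1) by blast
    show ?case
    proof (rule derivs_le_SucI)
      show "\<bar>\<Sum>k. u k x\<bar> \<le> suminf b" for x using gen b by blast
      show "((\<lambda>x. \<Sum>k. u k x) has_real_derivative (\<Sum>k. deriv (u k) x)) (at x)" for x
      proof -
        have uc: "uniformly_convergent_on UNIV (\<lambda>n x. \<Sum>i<n. deriv (u i) x)"
          using Weierstrass_m_test[of UNIV "\<lambda>k. deriv (u k)" b] b' assms(2)
          by (auto simp: uniformly_convergent_on_def)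
        have sm: "summable (\<lambda>n. u n 0)"
          by (rule summable_comparison_test[OF _ assms(2)]) (use b in auto)
        have d: "(u n has_field_derivative deriv (u n) x) (at x within UNIV)" for n x
          using derivs_le_deriv(3)[OF Suc.prems] by simp
        show ?thesis
          using has_field_derivative_series'(2)[of UNIV u "\<lambda>k. deriv (u k)" 0 x, OF _ d uc _ sm] by simp
      qed
      show "derivs_le n (suminf b) (\<lambda>x. \<Sum>k. deriv (u k) x)"
        by (rule Suc.IH) (rule derivs_le_deriv(1)[OF Suc.prems])
    qed
  }
qed

section \<open>Smooth functions with all derivatives bounded\<close>

definition smooth_bdd :: "(real \<Rightarrow> real) \<Rightarrow> bool" where
  "smooth_bdd f \<longleftrightarrow> (\<forall>n. \<exists>B. derivs_le n B f)"

lemma smooth_bddI: "(\<And>n. \<exists>B. derivs_le n B f) \<Longrightarrow> smooth_bdd f" by (simp add: smooth_bdd_def)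

lemma smooth_bdd_deriv:
  assumes "smooth_bdd f"
  shows "smooth_bdd (deriv f)" "(f has_real_derivative deriv f x) (at x)" "f field_differentiable at x"
  using assms derivs_le_deriv unfolding smooth_bdd_def by blast+

lemma smooth_bdd_SucI:
  assumes "\<And>x. (f has_real_derivative f' x) (at x)" "smooth_bdd f'" "\<And>x. \<bar>f x\<bar> \<le> B"
  shows "smooth_bdd f"
proof (rule smooth_bddI)
  fix n
  obtain C where C: "derivs_le n C f'" using assms(2) unfolding smooth_bdd_def by blast
  have "derivs_le (Suc n) (max B C) f"
    using assms by (intro derivs_le_SucI[where f' = f'] derivs_le_mono[OF C]) (auto simp: max.coboundedI1)
  then show "\<exists>B. derivs_le n B f" using derivs_le_SucD by blast
qed

lemma smooth_bdd_higher: "smooth_bdd f \<Longrightarrow> smooth_bdd ((deriv ^^ n) f)"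
  by (induction n) (auto intro: smooth_bdd_deriv)

lemma smooth_bdd_imp_smooth: "smooth_bdd f \<Longrightarrow> smooth f"
  unfolding smooth_def using smooth_bdd_higher smooth_bdd_deriv(3) by blast

lemma smooth_bdd_bounded:
  assumes "smooth_bdd f"
  obtains B where "0 < B" "\<And>x. \<bar>f x\<bar> \<le> B"
proof -
  obtain B where "derivs_le 0 B f" using assms by (auto simp: smooth_bdd_def simp del: derivs_le.simps)
  then have "\<bar>f x\<bar> \<le> max B 1" for x using derivs_le_bound[of 0 B f x] by (simp add: max.coboundedI1)
  then show thesis by (intro that[of "max B 1"]) auto
qed

lemma smooth_bdd_const: "smooth_bdd (\<lambda>x. c)" 
  unfolding smooth_bdd_def using derivs_le_const by blast

lemma smooth_bdd_add: "smooth_bdd f \<Longrightarrow> smooth_bdd g \<Longrightarrow> smooth_bdd (\<lambda>x. f x + g x)"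
  unfolding smooth_bdd_def using derivs_le_add by blast

lemma smooth_bdd_mult: "smooth_bdd f \<Longrightarrow> smooth_bdd g \<Longrightarrow> smooth_bdd (\<lambda>x. f x * g x)"
  unfolding smooth_bdd_def using derivs_le_mult by meson

lemma smooth_bdd_cmult: "smooth_bdd f \<Longrightarrow> smooth_bdd (\<lambda>x. c * f x)"
  by (intro smooth_bdd_mult smooth_bdd_const)

lemma smooth_bdd_diff: "smooth_bdd f \<Longrightarrow> smooth_bdd g \<Longrightarrow> smooth_bdd (\<lambda>x. f x - g x)"
  unfolding smooth_bdd_def using derivs_le_diff by blast

lemma smooth_bdd_compose: "smooth_bdd f \<Longrightarrow> (\<And>x. (g has_real_derivative g' x) (at x)) \<Longrightarrow> smooth_bdd g' \<Longrightarrow> smooth_bdd (\<lambda>x. f (g x))"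
  unfolding smooth_bdd_def using derivs_le_compose by meson

lemma smooth_bdd_inverse: "smooth_bdd f \<Longrightarrow> 0 < c \<Longrightarrow> (\<And>x. c \<le> f x) \<Longrightarrow> smooth_bdd (\<lambda>x. inverse (f x))"
  unfolding smooth_bdd_def using derivs_le_inverse by meson

lemma smooth_bdd_inverse_function: "smooth_bdd h' \<Longrightarrow> 0 < c \<Longrightarrow> (\<And>x. c \<le> h' x) \<Longrightarrow> 
   (\<And>x. (L has_real_derivative inverse (h' (L x))) (at x)) \<Longrightarrow> smooth_bdd (\<lambda>x. inverse (h' (L x)))"
  unfolding smooth_bdd_def using derivs_le_inverse_function by meson

lemma derivs_le_higher: "derivs_le n B f \<Longrightarrow> i \<le> n \<Longrightarrow> \<bar>(deriv ^^ i) f x\<bar> \<le> B"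
proof (induction i arbitrary: n f)
  case 0 then show ?case using derivs_le_bound by simp
next
  case (Suc i)
  then obtain m where m: "n = Suc m" "i \<le> m" by (cases n) auto
  have "derivs_le m B (deriv f)" using Suc.prems(1) unfolding m(1) by (rule derivs_le_deriv(1))
  from Suc.IH[OF this m(2)] show ?case by (simp add: funpow_swap1)
qed

lemma Cr_norm_le:
  assumes "derivs_le r B f"
  shows "Cr_norm r f \<le> B"
  unfolding Cr_norm_def using derivs_le_higher[OF assms] by (auto intro!: cSUP_least)

section \<open>Lifts of circle diffeomorphisms and conjugates of rotations\<close>

text \<open>A lift to the line of an orientation preserving diffeomorphism. \<open>H\<close> itself
  is unbounded, so its smoothness is expressed through the derivative; the constants that
  compactness of the circle provides are recorded at once.\<close>

definition diffeo :: "(real \<Rightarrow> real) \<Rightarrow> bool" where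
  "diffeo H \<longleftrightarrow> (\<forall>x. (H has_real_derivative deriv H x) (at x)) \<and> smooth_bdd (deriv H) \<and>
     (\<exists>c>0. \<forall>x. c \<le> deriv H x) \<and> (\<forall>x. H (x + 1) = H x + 1)"

lemma diffeoI:
  assumes "\<And>x. (H has_real_derivative H' x) (at x)" "smooth_bdd H'" "0 < c" "\<And>x. c \<le> H' x" "\<And>x. H (x + 1) = H x + 1"
  shows "diffeo H"
proof -
  have "deriv H = H'" using assms(1) by (metis DERIV_imp_deriv ext)
  then show ?thesis using assms unfolding diffeo_def by auto
qed

lemma diffeo_DERIV: "diffeo H \<Longrightarrow> (H has_real_derivative deriv H x) (at x)"
  by (simp add: diffeo_def)

lemma diffeo_DERIV_within: "diffeo H \<Longrightarrow> (H has_real_derivative deriv H x) (at x within S)"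
  using diffeo_DERIV has_field_derivative_at_within by blast

lemma diffeo_smooth_bdd: "diffeo H \<Longrightarrow> smooth_bdd (deriv H)"
  by (simp add: diffeo_def)

lemma diffeo_add_1: "diffeo H \<Longrightarrow> H (x + 1) = H x + 1"
  by (simp add: diffeo_def)

lemma diffeo_bounds:
  assumes "diffeo H"
  obtains c C where "0 < c" "c \<le> C" "\<And>x. c \<le> deriv H x" "\<And>x. deriv H x \<le> C"
proof -
  obtain c where c: "0 < c" "\<And>x. c \<le> deriv H x" using assms by (auto simp: diffeo_def)
  obtain C where C: "\<And>x. \<bar>deriv H x\<bar> \<le> C" using smooth_bdd_bounded[OF diffeo_smooth_bdd[OF assms]] by blast
  then have "deriv H x \<le> C" for x by (meson abs_le_D1)
  then show thesis using that[of c C] c by (meson order_trans)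
qed

lemma diffeo_lower:
  assumes "diffeo H"
  obtains c where "0 < c" "\<And>x. c \<le> deriv H x"
  using assms by (auto simp: diffeo_def)

lemma diffeo_deriv_pos: "diffeo H \<Longrightarrow> 0 < deriv H x"
  by (metis diffeo_bounds less_le_trans)

lemma diffeo_cont: "diffeo H \<Longrightarrow> continuous_on S H"
  by (meson DERIV_isCont continuous_at_imp_continuous_on diffeo_DERIV)

lemma diffeo_deriv_cont: "diffeo H \<Longrightarrow> continuous_on S (deriv H)"
  by (meson smooth_bdd_deriv(2) DERIV_isCont continuous_at_imp_continuous_on diffeo_smooth_bdd)

lemma diffeo_less: "diffeo H \<Longrightarrow> x < y \<Longrightarrow> H x < H y"
  by (rule DERIV_pos_imp_increasing) (auto intro: diffeo_DERIV diffeo_deriv_pos)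

lemma diffeo_strict_mono: "diffeo H \<Longrightarrow> strict_mono H"
  by (simp add: diffeo_less strict_mono_def)

lemma diffeo_less_iff: "diffeo H \<Longrightarrow> H x < H y \<longleftrightarrow> x < y"
  using diffeo_strict_mono strict_mono_less by blast

lemma diffeo_le_iff: "diffeo H \<Longrightarrow> H x \<le> H y \<longleftrightarrow> x \<le> y"
  using diffeo_strict_mono strict_mono_less_eq by blast

lemma diffeo_inj: "diffeo H \<Longrightarrow> inj H"
  using diffeo_strict_mono strict_mono_imp_inj_on by blast

lemma diffeo_add_nat: "diffeo H \<Longrightarrow> H (x + real n) = H x + real n"
proof (induction n)
  case (Suc n)
  then show ?case using diffeo_add_1[of H "x + real n"] by (simp add: add_ac)
qed simp

lemma diffeo_add_int: "diffeo H \<Longrightarrow> H (x + of_int k) = H x + of_int k"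
proof (cases k rule: int_cases2)
  case (nonneg n)
  then show "diffeo H \<Longrightarrow> ?thesis" using diffeo_add_nat by simp
next
  case (nonpos n)
  show "diffeo H \<Longrightarrow> ?thesis" using diffeo_add_nat[of H "x + of_int k" n] nonpos by simp
qed

lemma diffeo_mvt:
  assumes "diffeo H" "x \<le> y" "\<And>z. x \<le> z \<Longrightarrow> z \<le> y \<Longrightarrow> a \<le> deriv H z \<and> deriv H z \<le> b"
  shows "a * (y - x) \<le> H y - H x" "H y - H x \<le> b * (y - x)"
proof -
  consider "x = y" | "x < y" using assms by linarith
  then have "a * (y - x) \<le> H y - H x \<and> H y - H x \<le> b * (y - x)"
  proof cases
    case 2
    then obtain z where z: "x < z" "z < y" "H y - H x = (y - x) * deriv H z"
      using MVT2[of x y H "deriv H"] diffeo_DERIV[OF assms(1)] by blast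
    then show ?thesis using assms(3)[of z] by (simp add: mult.commute mult_left_mono)
  qed simp
  then show "a * (y - x) \<le> H y - H x" "H y - H x \<le> b * (y - x)" by auto
qed

text \<open>The displacement is periodic, and for \<open>x\<close> in \<open>[0, 1)\<close> both
  \<open>H x - H 0\<close> and \<open>x\<close> lie between 0 and 1.\<close>

lemma diffeo_near_id: "diffeo H \<Longrightarrow> \<bar>H x - x\<bar> \<le> \<bar>H 0\<bar> + 1"
proof -
  assume H: "diffeo H"
  have "H x = H (frac x) + of_int \<lfloor>x\<rfloor>" using diffeo_add_int[OF H, of "frac x" "\<lfloor>x\<rfloor>"] by (simp add: frac_def)
  moreover have "H 0 \<le> H (frac x)" "H (frac x) \<le> H 1" using H diffeo_le_iff frac_ge_0 frac_lt_1[of x] by (auto simp: less_imp_le)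
  moreover have "H 1 = H 0 + 1" using diffeo_add_1[OF H, of 0] by simp
  moreover have "x = frac x + of_int \<lfloor>x\<rfloor>" by (simp add: frac_def)
  ultimately show ?thesis using frac_ge_0[of x] frac_lt_1[of x] by linarith
qed

lemma diffeo_surj: "diffeo H \<Longrightarrow> surj H"
proof -
  assume H: "diffeo H"
  show ?thesis
    unfolding surj_def
  proof
    fix y
    define b where "b = \<bar>H 0\<bar> + 1"
    have "H (y - b) \<le> y" "y \<le> H (y + b)"
      using diffeo_near_id[OF H, of "y - b"] diffeo_near_id[OF H, of "y + b"] unfolding b_def by linarith+
    moreover have "y - b \<le> y + b" unfolding b_def by simp
    ultimately show "\<exists>x. y = H x" using IVT'[of H "y - b" y "y + b"] diffeo_cont[OF H] by metis
  qed
qed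

lemma diffeo_bij: "diffeo H \<Longrightarrow> bij H"
  by (simp add: bij_def diffeo_inj diffeo_surj)

lemma diffeo_inv1 [simp]: "diffeo H \<Longrightarrow> H (inv H y) = y"
  by (simp add: diffeo_surj surj_f_inv_f)

lemma diffeo_inv2 [simp]: "diffeo H \<Longrightarrow> inv H (H x) = x"
  by (simp add: diffeo_inj)

lemma diffeo_inv_DERIV: "diffeo H \<Longrightarrow> (inv H has_real_derivative inverse (deriv H (inv H y))) (at y)"
proof -
  assume H: "diffeo H"
  have "isCont (inv H) (H (inv H y))"
    by (rule isCont_inverse_function[where d = 1 and x = "inv H y" and g = "inv H" and f = H]) (use H in \<open>auto intro: DERIV_isCont[OF diffeo_DERIV]\<close>)
  then have "isCont (inv H) y" using H by simp
  then show ?thesis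
    using DERIV_inverse_function[where f = H and g = "inv H" and x = y and D = "deriv H (inv H y)" and a = "y - 1" and b = "y + 1"]
      diffeo_DERIV[OF H] diffeo_deriv_pos[OF H] H by (simp add: less_imp_neq[symmetric])
qed

lemma diffeo_deriv_inv: "diffeo H \<Longrightarrow> deriv (inv H) y = inverse (deriv H (inv H y))"
  by (rule DERIV_imp_deriv) (rule diffeo_inv_DERIV)

text \<open>The inverse solves the equation of \<open>derivs_le_inverse_function\<close>, and the
  upper bound for \<open>deriv H\<close> becomes a lower bound for the derivative of the
  inverse.\<close>

lemma diffeo_inv: "diffeo H \<Longrightarrow> diffeo (inv H)"
proof -
  assume H: "diffeo H"
  obtain c C where c: "0 < c" "c \<le> C" "\<And>x. c \<le> deriv H x" "\<And>x. deriv H x \<le> C" using diffeo_bounds[OF H] by blast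
  show ?thesis
  proof (rule diffeoI)
    show "(inv H has_real_derivative inverse (deriv H (inv H x))) (at x)" for x by (rule diffeo_inv_DERIV[OF H])
    show "smooth_bdd (\<lambda>x. inverse (deriv H (inv H x)))"
      by (rule smooth_bdd_inverse_function[OF diffeo_smooth_bdd[OF H] c(1) c(3) diffeo_inv_DERIV[OF H]])
    show "0 < inverse C" using c by auto
    show "inverse C \<le> inverse (deriv H (inv H x))" for x
      using c diffeo_deriv_pos[OF H] by (intro le_imp_inverse_le) auto
    show "inv H (x + 1) = inv H x + 1" for x
      by (metis H diffeo_add_1 diffeo_inv1 diffeo_inv2)
  qed
qed

lemma diffeo_comp:
  assumes H: "diffeo H" and K: "diffeo K"
  shows "diffeo (\<lambda>x. H (K x))" "deriv (\<lambda>x. H (K x)) x = deriv H (K x) * deriv K x"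
proof -
  obtain c where c: "0 < c" "\<And>x. c \<le> deriv H x" using diffeo_lower[OF H] by blast
  obtain d where d: "0 < d" "\<And>x. d \<le> deriv K x" using diffeo_lower[OF K] by blast
  have D: "((\<lambda>x. H (K x)) has_real_derivative deriv H (K x) * deriv K x) (at x)" for x
    by (rule DERIV_chain2[OF diffeo_DERIV[OF H] diffeo_DERIV[OF K]])
  then show "deriv (\<lambda>x. H (K x)) x = deriv H (K x) * deriv K x" by (rule DERIV_imp_deriv)
  show "diffeo (\<lambda>x. H (K x))"
  proof (rule diffeoI[OF D])
    show "smooth_bdd (\<lambda>x. deriv H (K x) * deriv K x)"
      by (intro smooth_bdd_mult smooth_bdd_compose[OF diffeo_smooth_bdd[OF H] diffeo_DERIV[OF K]] diffeo_smooth_bdd[OF K])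
    show "0 < c * d" using c d by simp
    show "c * d \<le> deriv H (K x) * deriv K x" for x using c d diffeo_deriv_pos[OF H] by (intro mult_mono) (auto intro: less_imp_le)
    show "H (K (x + 1)) = H (K x) + 1" for x using assms by (simp add: diffeo_add_1)
  qed
qed

lemma diffeo_shift: "diffeo (\<lambda>x. x + s)"
  by (rule diffeoI[of _ "\<lambda>x. 1" 1]) (auto intro!: derivative_eq_intros smooth_bdd_const)

lemma diffeo_shift': "diffeo H \<Longrightarrow> diffeo (\<lambda>x. H x + s)"
  using diffeo_comp(1)[OF diffeo_shift[of s]] by simp

lemma diffeo_id: "diffeo (\<lambda>x. x)"
  using diffeo_shift[of 0] by simp

lemma diffeo_deriv_add_int: "diffeo H \<Longrightarrow> deriv H (x + of_int k) = deriv H x"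
proof -
  assume H: "diffeo H"
  have "((\<lambda>x. H (x + of_int k)) has_real_derivative deriv H (x + of_int k)) (at x)"
    using diffeo_DERIV[OF H, of "x + of_int k"] by (simp add: DERIV_shift)
  moreover have "(\<lambda>x. H (x + of_int k)) = (\<lambda>x. H x + of_int k)" using diffeo_add_int[OF H] by blast
  ultimately have "((\<lambda>x. H x + of_int k) has_real_derivative deriv H (x + of_int k)) (at x)" by simp
  moreover have "((\<lambda>x. H x + of_int k) has_real_derivative deriv H x) (at x)"
    by (auto intro!: derivative_eq_intros diffeo_DERIV[OF H])
  ultimately show ?thesis using DERIV_unique by blast
qed

lemma diffeo_minus_id_smooth_bdd: "diffeo H \<Longrightarrow> smooth_bdd (\<lambda>x. H x - x)"
  by (rule smooth_bdd_SucI[where f' = "\<lambda>x. deriv H x - 1" and B = "\<bar>H 0\<bar> + 1"])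
    (auto intro!: derivative_eq_intros diffeo_DERIV diffeo_near_id smooth_bdd_diff smooth_bdd_const diffeo_smooth_bdd)

lemma diffeo_lipschitz:
  assumes "diffeo H"
  obtains L where "0 < L" "\<And>x y. \<bar>H x - H y\<bar> \<le> L * \<bar>x - y\<bar>"
proof -
  obtain L where "0 < L" "\<And>x. \<bar>deriv H x\<bar> \<le> L" using smooth_bdd_bounded[OF diffeo_smooth_bdd[OF assms]] by blast
  then show thesis using DERIV_bound_lipschitz[OF diffeo_DERIV[OF assms]] that by blast
qed

lemma smooth_bdd_lipschitz:
  assumes "smooth_bdd f"
  obtains L where "0 < L" "\<And>x y. \<bar>f x - f y\<bar> \<le> L * \<bar>x - y\<bar>"
proof -
  obtain L where "0 < L" "\<And>x. \<bar>deriv f x\<bar> \<le> L" using smooth_bdd_bounded[OF smooth_bdd_deriv(1)[OF assms]] by blast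
  then show thesis using DERIV_bound_lipschitz[OF smooth_bdd_deriv(2)[OF assms]] that by blast
qed

lemma diffeo_smooth: "diffeo H \<Longrightarrow> smooth H"
  unfolding smooth_def
proof (intro allI)
  fix n x assume H: "diffeo H"
  show "(deriv ^^ n) H field_differentiable at x"
  proof (cases n)
    case 0
    then show ?thesis using diffeo_DERIV[OF H] by (auto simp: field_differentiable_def)
  next
    case (Suc m)
    then show ?thesis using smooth_bdd_imp_smooth[OF diffeo_smooth_bdd[OF H]] by (simp add: funpow_swap1 smooth_def)
  qed
qed

section \<open>Conjugates of rotations and rescaled profiles\<close>

definition conj_rot :: "(real \<Rightarrow> real) \<Rightarrow> real \<Rightarrow> real \<Rightarrow> real" where
  "conj_rot H s y = H (inv H y + s)"

lemma conj_rot_diffeo: "diffeo H \<Longrightarrow> diffeo (conj_rot H s)"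
  unfolding conj_rot_def[abs_def]
  using diffeo_comp(1)[OF diffeo_comp(1)[OF _ diffeo_shift] diffeo_inv, of H H s] by simp

lemma conj_rot_deriv: "diffeo H \<Longrightarrow> deriv (conj_rot H s) y = deriv H (inv H y + s) / deriv H (inv H y)"
proof -
  assume H: "diffeo H"
  have "(conj_rot H s has_real_derivative deriv H (inv H y + s) * (inverse (deriv H (inv H y)) + 0)) (at y)"
    unfolding conj_rot_def[abs_def]
    by (rule DERIV_chain2[OF diffeo_DERIV[OF H]]) (intro derivative_intros diffeo_inv_DERIV[OF H])
  then show ?thesis by (simp add: DERIV_imp_deriv divide_inverse)
qed

lemma conj_rot_add: "diffeo H \<Longrightarrow> conj_rot H s (conj_rot H t y) = conj_rot H (s + t) y"
  by (simp add: conj_rot_def add_ac)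

lemma conj_rot_0: "diffeo H \<Longrightarrow> conj_rot H 0 = (\<lambda>y. y)"
  by (auto simp: conj_rot_def)

lemma conj_rot_int: "diffeo H \<Longrightarrow> conj_rot H (s + of_int k) y = conj_rot H s y + of_int k"
  using diffeo_add_int[of H "inv H y + s" k] by (simp add: conj_rot_def add_ac)

lemma conj_rot_funpow: "diffeo H \<Longrightarrow> conj_rot H s ^^ n = conj_rot H (real n * s)"
  by (induction n) (auto simp: conj_rot_0 fun_eq_iff conj_rot_add algebra_simps)

text \<open>The lift of \<phi> through the q-fold covering of the circle: its derivative takes the
  same values as that of \<phi>, only their pattern is repeated \<open>q\<close> times per
  period.\<close>

definition rescale :: "nat \<Rightarrow> (real \<Rightarrow> real) \<Rightarrow> real \<Rightarrow> real" where
  "rescale q \<phi> x = \<phi> (real q * x) / real q"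

lemma rescale_deriv: "diffeo \<phi> \<Longrightarrow> 0 < q \<Longrightarrow> (rescale q \<phi> has_real_derivative deriv \<phi> (real q * x)) (at x)"
  unfolding rescale_def[abs_def]
  by (auto intro!: derivative_eq_intros DERIV_chain2[OF diffeo_DERIV])

lemma rescale_diffeo: 
  assumes "diffeo \<phi>" "0 < q"
  shows "diffeo (rescale q \<phi>)" "deriv (rescale q \<phi>) x = deriv \<phi> (real q * x)"
proof -
  obtain c where c: "0 < c" "\<And>x. c \<le> deriv \<phi> x" using diffeo_lower[OF assms(1)] by blast
  show "diffeo (rescale q \<phi>)"
  proof (rule diffeoI[OF rescale_deriv[OF assms]])
    show "smooth_bdd (\<lambda>x. deriv \<phi> (real q * x))"
      by (rule smooth_bdd_compose[OF diffeo_smooth_bdd[OF assms(1)], where g' = "\<lambda>x. real q"])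
         (auto intro!: derivative_eq_intros smooth_bdd_const)
    show "rescale q \<phi> (x + 1) = rescale q \<phi> x + 1" for x
      using diffeo_add_nat[OF assms(1), of "real q * x" q] assms(2) by (simp add: rescale_def distrib_left add_divide_distrib)
  qed (use c in auto)
  show "deriv (rescale q \<phi>) x = deriv \<phi> (real q * x)" by (rule DERIV_imp_deriv) (rule rescale_deriv[OF assms])
qed

lemma rescale_shift: "diffeo \<phi> \<Longrightarrow> 0 < q \<Longrightarrow> rescale q \<phi> (x + of_int k / real q) = rescale q \<phi> x + of_int k / real q"
  using diffeo_add_int[of \<phi> "real q * x" k] by (simp add: rescale_def distrib_left add_divide_distrib)

lemma inv_comp_apply: "diffeo H \<Longrightarrow> diffeo K \<Longrightarrow> inv (\<lambda>x. H (K x)) y = inv K (inv H y)"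
  using diffeo_bij o_inv_distrib[of H K] by (simp add: comp_def fun_eq_iff)

lemma conj_rot_rescale:
  assumes "diffeo K" "diffeo \<phi>" "0 < q"
  shows "conj_rot (\<lambda>x. K (rescale q \<phi> x)) (of_int p / real q) = conj_rot K (of_int p / real q)"
  using assms rescale_diffeo[OF assms(2,3)] by (simp add: conj_rot_def fun_eq_iff inv_comp_apply rescale_shift)

text \<open>The substitution \<open>z = q x\<close> turns \<open>K(\<phi>(q x)/q)\<close> into \<open>z \<mapsto> q K(\<phi>(z)/q)\<close>, whose derivatives of all
  orders are bounded independently of \<open>q\<close>; undoing it costs the factor \<open>q^n\<close>.\<close>

lemma conj_rot_rescale_estimate:
  assumes K: "diffeo K" and \<phi>: "diffeo \<phi>"
  obtains D where "0 < D" "\<And>q s t. 0 < q \<Longrightarrow>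
    derivs_le n (D * real q ^ n * \<bar>t - s\<bar>) (\<lambda>y. conj_rot (\<lambda>x. K (rescale q \<phi> x)) t y - conj_rot (\<lambda>x. K (rescale q \<phi> x)) s y)"
proof -
  obtain B1 where B1: "derivs_le n B1 (deriv K)" using diffeo_smooth_bdd[OF K] by (auto simp: smooth_bdd_def)
  obtain B2 where B2: "derivs_le n B2 (deriv \<phi>)" using diffeo_smooth_bdd[OF \<phi>] by (auto simp: smooth_bdd_def)
  have B2': "0 \<le> B2" using derivs_le_nonneg[OF B2] .
  obtain E1 where E1: "\<And>f g g'. derivs_le n B1 f \<Longrightarrow> (\<And>x. (g has_real_derivative g' x) (at x)) \<Longrightarrow> derivs_le n B2 g' \<Longrightarrow> derivs_le n E1 (\<lambda>x. f (g x))"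
    using derivs_le_compose[of n B1 B2] by metis
  obtain E2 where E2: "\<And>f g. derivs_le n E1 f \<Longrightarrow> derivs_le n B2 g \<Longrightarrow> derivs_le n E2 (\<lambda>x. f x * g x)" using derivs_le_mult by metis
  obtain c1 where c1: "0 < c1" "\<And>x. c1 \<le> deriv K x" using diffeo_lower[OF K] by blast
  obtain c2 where c2: "0 < c2" "\<And>x. c2 \<le> deriv \<phi> x" using diffeo_lower[OF \<phi>] by blast
  have c: "0 < c1 * c2" using c1 c2 by simp
  obtain E3 where E3: "\<And>h' L. derivs_le n E2 h' \<Longrightarrow> (\<And>x. c1 * c2 \<le> h' x) \<Longrightarrow> (\<And>x. (L has_real_derivative inverse (h' (L x))) (at x))
    \<Longrightarrow> derivs_le n E3 (\<lambda>x. inverse (h' (L x)))" using derivs_le_inverse_function[OF c, of n E2] by blast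
  obtain E4 where E4: "\<And>f g g'. derivs_le n E2 f \<Longrightarrow> (\<And>x. (g has_real_derivative g' x) (at x)) \<Longrightarrow> derivs_le n E3 g' \<Longrightarrow> derivs_le n E4 (\<lambda>x. f (g x))"
    using derivs_le_compose[of n E2 E3] by metis
  have main: "derivs_le n (\<bar>t - s\<bar> * real q ^ n * E4) (\<lambda>y. conj_rot (\<lambda>x. K (rescale q \<phi> x)) t y - conj_rot (\<lambda>x. K (rescale q \<phi> x)) s y)"
    if q: "0 < q" and ts: "t \<noteq> s" for q s t
  proof -
    define H where "H = (\<lambda>x. K (rescale q \<phi> x))"
    have H: "diffeo H" and H': "\<And>x. deriv H x = deriv K (rescale q \<phi> x) * deriv \<phi> (real q * x)"
      unfolding H_def using diffeo_comp[OF K rescale_diffeo(1)[OF \<phi> q]] rescale_diffeo(2)[OF \<phi> q] by auto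
    define h where "h z = real q * K (\<phi> z / real q)" for z
    define h' where "h' z = deriv K (\<phi> z / real q) * deriv \<phi> z" for z
    define L where "L z = real q * inv H (z / real q)" for z
    have q': "real q \<noteq> 0" using q by simp
    have hd: "(h has_real_derivative h' z) (at z)" for z
    proof -
      have "(h has_real_derivative real q * (deriv K (\<phi> z / real q) * (deriv \<phi> z / real q))) (at z)"
        unfolding h_def[abs_def]
        by (intro DERIV_cmult DERIV_chain2[OF diffeo_DERIV[OF K]] DERIV_cdivide diffeo_DERIV[OF \<phi>])
      then show ?thesis using q' by (simp add: h'_def)
    qed
    have "derivs_le n E1 (\<lambda>z. deriv K (\<phi> z / real q))"
    proof (rule E1[OF B1])
      show "((\<lambda>z. \<phi> z / real q) has_real_derivative (1 / real q) * deriv \<phi> z) (at z)" for z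
        using DERIV_cmult[OF diffeo_DERIV[OF \<phi>], of "1 / real q"] by simp
      have "\<bar>1 / real q\<bar> * B2 \<le> B2" using q mult_left_mono[of 1 "real q" B2] B2' by (simp add: divide_le_eq)
      then show "derivs_le n B2 (\<lambda>z. (1 / real q) * deriv \<phi> z)" using derivs_le_cmult[OF B2, of "1 / real q"] derivs_le_mono by blast
    qed
    then have h'B: "derivs_le n E2 h'" unfolding h'_def[abs_def] using E2 B2 by blast
    have h'c: "c1 * c2 \<le> h' z" for z
      unfolding h'_def using c1 c2 diffeo_deriv_pos[OF K] by (intro mult_mono) (auto intro: less_imp_le)
    have hH: "h (real q * x) = real q * H x" "h' (real q * x) = deriv H x" for x
      unfolding h'_def H' rescale_def using q by (auto simp: h_def H_def rescale_def)
    have Ld: "(L has_real_derivative inverse (h' (L z))) (at z)" for z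
    proof -
      have "(L has_real_derivative real q * (inverse (deriv H (inv H (z / real q))) * (1 / real q))) (at z)"
        unfolding L_def[abs_def]
        by (intro DERIV_cmult DERIV_chain2[OF diffeo_inv_DERIV[OF H]] DERIV_cdivide DERIV_ident)
      then show ?thesis using q unfolding L_def hH by simp
    qed
    \<comment> \<open>The difference quotient of \<open>h\<close> between the two rotations has
      derivatives bounded by \<open>E2\<close> whatever s and t are; composing with \<open>L\<close>
      turns it into the difference of the conjugates divided by \<open>t - s\<close>. The case
      \<open>t = s\<close> is treated apart.\<close>
    define v where "v z = (1 / (real q * (t - s))) * (h (z + real q * t) - h (z + real q * s))" for z
    have "derivs_le n (\<bar>1 / (real q * (t - s))\<bar> * (E2 * \<bar>real q * t - real q * s\<bar>)) v"
      unfolding v_def[abs_def] by (rule derivs_le_cmult[OF derivs_le_difference[OF hd h'B]])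
    moreover have "\<bar>1 / (real q * (t - s))\<bar> * (E2 * \<bar>real q * t - real q * s\<bar>) = E2"
      using q ts by (simp add: abs_mult right_diff_distrib[symmetric])
    ultimately have "derivs_le n E2 v" by simp
    then have "derivs_le n E4 (\<lambda>z. v (L z))"
      by (rule E4[OF _ Ld]) (rule E3[OF h'B h'c Ld])
    then have "derivs_le n (\<bar>t - s\<bar> * real q ^ n * E4) (\<lambda>y. (t - s) * v (L (real q * y + 0)))"
      using derivs_le_scale[of n E4 "\<lambda>z. v (L z)" "real q" "t - s" 0] q by simp
    moreover have "(t - s) * v (L (real q * y + 0)) = conj_rot H t y - conj_rot H s y" for y
    proof -
      have "L (real q * y + 0) = real q * inv H y" using q by (simp add: L_def)
      moreover have "h (real q * inv H y + real q * u) = real q * conj_rot H u y" for u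
        using hH(1)[of "inv H y + u"] by (simp add: conj_rot_def distrib_left)
      ultimately have "v (L (real q * y + 0)) = (1 / (real q * (t - s))) * (real q * (conj_rot H t y - conj_rot H s y))"
        by (simp add: v_def right_diff_distrib)
      then show ?thesis using q ts by simp
    qed
    ultimately show ?thesis unfolding H_def by (simp only:)
  qed
  show thesis
  proof (rule that)
    show "0 < max E4 1" by simp
    fix q :: nat and s t :: real assume q: "0 < q"
    show "derivs_le n (max E4 1 * real q ^ n * \<bar>t - s\<bar>) (\<lambda>y. conj_rot (\<lambda>x. K (rescale q \<phi> x)) t y - conj_rot (\<lambda>x. K (rescale q \<phi> x)) s y)"
    proof (cases "t = s")
      case True
      then show ?thesis by (simp add: derivs_le_zero)
    next
      case False
      have "\<bar>t - s\<bar> * real q ^ n * E4 \<le> \<bar>t - s\<bar> * real q ^ n * max E4 1"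
        by (intro mult_left_mono) auto
      then show ?thesis using derivs_le_mono[OF main[OF q False]] by (simp add: mult_ac)
    qed
  qed
qed

section \<open>Perturbation of conjugated rotations\<close>

text \<open>Values and first derivatives are all that the dynamical conditions on the limit see. The
  closeness concerns given lifts, so integer translates have to be supplied explicitly.\<close>

definition C1_close :: "real \<Rightarrow> (real \<Rightarrow> real) \<Rightarrow> (real \<Rightarrow> real) \<Rightarrow> bool" where
  "C1_close \<epsilon> F G \<longleftrightarrow> (\<forall>x. \<bar>F x - G x\<bar> \<le> \<epsilon> \<and> \<bar>deriv F x - deriv G x\<bar> \<le> \<epsilon>)"

lemma C1_close_mono: "C1_close \<epsilon> F G \<Longrightarrow> \<epsilon> \<le> \<delta> \<Longrightarrow> C1_close \<delta> F G"
  unfolding C1_close_def by (meson order_trans)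

lemma C1_close_trans: "C1_close \<epsilon> F G \<Longrightarrow> C1_close \<delta> G H \<Longrightarrow> C1_close (\<epsilon> + \<delta>) F H"
  unfolding C1_close_def by (smt (verit))

lemma derivs_le_imp_C1_close:
  assumes "derivs_le (Suc n) B (\<lambda>x. F x - G x)" "diffeo F" "diffeo G"
  shows "C1_close B F G"
proof -
  have "deriv (\<lambda>x. F x - G x) x = deriv F x - deriv G x" for x
    by (intro DERIV_imp_deriv derivative_intros diffeo_DERIV assms)
  then show ?thesis
    using derivs_le_bound[OF assms(1)] derivs_le_bound[OF derivs_le_deriv(1)[OF assms(1)]] unfolding C1_close_def by auto
qed

text \<open>The unscaled case, obtained from the rescaled estimate with the identity profile and
  \<open>q = 1\<close>.\<close>

lemma conj_rot_estimate:
  assumes K: "diffeo K"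
  obtains D where "0 < D" "\<And>s t. derivs_le n (D * \<bar>t - s\<bar>) (\<lambda>y. conj_rot K t y - conj_rot K s y)"
proof -
  obtain D where D: "0 < D" "\<And>q s t. 0 < q \<Longrightarrow>
    derivs_le n (D * real q ^ n * \<bar>t - s\<bar>) (\<lambda>y. conj_rot (\<lambda>x. K (rescale q (\<lambda>x. x) x)) t y - conj_rot (\<lambda>x. K (rescale q (\<lambda>x. x) x)) s y)"
    using conj_rot_rescale_estimate[OF K diffeo_id, of n] by blast
  show thesis using that[of D] D(1) D(2)[of 1] by (simp add: rescale_def)
qed

lemma conj_rot_lipschitz:
  assumes K: "diffeo K"
  obtains D where "0 < D" "\<And>s t. C1_close (D * \<bar>t - s\<bar>) (conj_rot K t) (conj_rot K s)"
proof -
  obtain D where "0 < D" "\<And>s t. derivs_le (Suc 0) (D * \<bar>t - s\<bar>) (\<lambda>y. conj_rot K t y - conj_rot K s y)"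
    using conj_rot_estimate[OF K] by blast
  then show thesis using that derivs_le_imp_C1_close conj_rot_diffeo[OF K] by blast
qed

section \<open>Stability of iterates under C^1 perturbations\<close>

lemma funpow_deriv:
  fixes F :: "real \<Rightarrow> real"
  assumes "\<And>x. (F has_real_derivative deriv F x) (at x)"
  shows "((F ^^ n) has_real_derivative deriv (F ^^ n) x) (at x)"
    "deriv (F ^^ Suc n) x = deriv F ((F ^^ n) x) * deriv (F ^^ n) x"
proof -
  have 0: "((F ^^ n) has_real_derivative deriv (F ^^ n) x) (at x)" for n x
  proof (induction n arbitrary: x)
    case 0
    have "((\<lambda>x::real. x) has_real_derivative 1) (at x)" by (rule DERIV_ident)
    then show ?case using DERIV_imp_deriv by (metis DERIV_ident eq_id_iff funpow_0 ext)
  next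
    case (Suc n)
    have "((\<lambda>x. F ((F ^^ n) x)) has_real_derivative deriv F ((F ^^ n) x) * deriv (F ^^ n) x) (at x)"
      by (rule DERIV_chain2[OF assms Suc.IH])
    then show ?case by (simp add: comp_def DERIV_imp_deriv)
  qed
  then show "((F ^^ n) has_real_derivative deriv (F ^^ n) x) (at x)" .
  have "((\<lambda>x. F ((F ^^ n) x)) has_real_derivative deriv F ((F ^^ n) x) * deriv (F ^^ n) x) (at x)"
    by (rule DERIV_chain2[OF assms 0])
  then show "deriv (F ^^ Suc n) x = deriv F ((F ^^ n) x) * deriv (F ^^ n) x"
    by (simp add: comp_def DERIV_imp_deriv)
qed

lemma diffeo_funpow: "diffeo F \<Longrightarrow> diffeo (F ^^ n)"
proof (induction n)
  case 0
  then show ?case using diffeo_id by (simp add: id_def)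
next
  case (Suc n)
  then show ?case using diffeo_comp(1)[of F "F ^^ n"] by (simp add: comp_def)
qed

text \<open>Composition is continuous in C^1 at \<open>F\<close> because \<open>deriv F\<close> is
  Lipschitz. The radius \<rho> depends on i, so only boundedly many iterates are controlled at
  once.\<close>

lemma C1_close_funpow:
  assumes F: "diffeo F" and "0 < \<epsilon>"
  shows "\<exists>\<rho>>0. \<forall>G. diffeo G \<longrightarrow> C1_close \<rho> G F \<longrightarrow> C1_close \<epsilon> (G ^^ i) (F ^^ i)"
  using \<open>0 < \<epsilon>\<close>
proof (induction i arbitrary: \<epsilon>)
  case 0
  then show ?case by (intro exI[of _ 1]) (auto simp: C1_close_def)
next
  case (Suc i)
  obtain L where L: "0 < L" "\<And>x y. \<bar>deriv F x - deriv F y\<bar> \<le> L * \<bar>x - y\<bar>"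
    using smooth_bdd_lipschitz[OF diffeo_smooth_bdd[OF F]] by blast
  obtain C where C: "0 < C" "\<And>x. \<bar>deriv F x\<bar> \<le> C" using smooth_bdd_bounded[OF diffeo_smooth_bdd[OF F]] by blast
  obtain B where B: "0 < B" "\<And>x. \<bar>deriv (F ^^ i) x\<bar> \<le> B" using smooth_bdd_bounded[OF diffeo_smooth_bdd[OF diffeo_funpow[OF F]]] by blast
  \<comment> \<open>One \<eta> for two demands: the value errs by at most
    \<open>\<eta> + C * \<eta>\<close>, the derivative by at most
    \<open>(\<eta> + L * \<eta>) * (B + 1) + C * \<eta>\<close>.\<close>
  define \<eta> where "\<eta> = min 1 (\<epsilon> / ((1 + L) * (B + 1) + C + 1))"
  have den: "0 < (1 + L) * (B + 1) + C + 1" using L C B by (simp add: add_pos_pos)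
  have \<eta>: "0 < \<eta>" "\<eta> \<le> 1" unfolding \<eta>_def using Suc.prems den by auto
  have "\<eta> * ((1 + L) * (B + 1) + C + 1) \<le> \<epsilon>"
    using den by (simp add: \<eta>_def min_def pos_le_divide_eq)
  then have \<eta>3: "(\<eta> + L * \<eta>) * (B + 1) + C * \<eta> \<le> \<epsilon>" "\<eta> + C * \<eta> \<le> \<epsilon>"
  proof -
    assume *: "\<eta> * ((1 + L) * (B + 1) + C + 1) \<le> \<epsilon>"
    have p: "0 \<le> \<eta> * L * (B + 1)" "0 \<le> \<eta> * B" using \<eta> L B by auto
    show "(\<eta> + L * \<eta>) * (B + 1) + C * \<eta> \<le> \<epsilon>" "\<eta> + C * \<eta> \<le> \<epsilon>" using * p \<eta> by (simp_all add: algebra_simps)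
  qed
  obtain \<rho> where \<rho>: "0 < \<rho>" "\<And>G. diffeo G \<Longrightarrow> C1_close \<rho> G F \<Longrightarrow> C1_close \<eta> (G ^^ i) (F ^^ i)"
    using Suc.IH[OF \<eta>(1)] by blast
  have "C1_close \<epsilon> (G ^^ Suc i) (F ^^ Suc i)" if G: "diffeo G" and c: "C1_close (min \<rho> \<eta>) G F" for G
  proof -
    have ci: "\<bar>(G ^^ i) x - (F ^^ i) x\<bar> \<le> \<eta>" "\<bar>deriv (G ^^ i) x - deriv (F ^^ i) x\<bar> \<le> \<eta>" for x
      using \<rho>(2)[OF G C1_close_mono[OF c]] by (auto simp: C1_close_def)
    have cc: "\<bar>G x - F x\<bar> \<le> \<eta>" "\<bar>deriv G x - deriv F x\<bar> \<le> \<eta>" for x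
      using c by (auto simp: C1_close_def)
    show ?thesis unfolding C1_close_def
    proof (intro allI conjI)
      fix x
      let ?u = "(G ^^ i) x" let ?v = "(F ^^ i) x"
      have "\<bar>F ?u - F ?v\<bar> \<le> C * \<bar>?u - ?v\<bar>" by (rule DERIV_bound_lipschitz[OF diffeo_DERIV[OF F] C(2)])
      also have "\<dots> \<le> C * \<eta>" using ci C by (intro mult_left_mono) auto
      finally show "\<bar>(G ^^ Suc i) x - (F ^^ Suc i) x\<bar> \<le> \<epsilon>" using cc(1)[of ?u] \<eta>3 by simp
      have "\<bar>deriv F ?u - deriv F ?v\<bar> \<le> L * \<bar>?u - ?v\<bar>" by (rule L)
      also have "\<dots> \<le> L * \<eta>" using ci L by (intro mult_left_mono) auto
      finally have a: "\<bar>deriv G ?u - deriv F ?v\<bar> \<le> \<eta> + L * \<eta>" using cc(2)[of ?u] by linarith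
      have b: "\<bar>deriv (G ^^ i) x\<bar> \<le> B + 1" using ci(2)[of x] B(2)[of x] \<eta> by linarith
      have e: "deriv (G ^^ Suc i) x - deriv (F ^^ Suc i) x = (deriv G ?u - deriv F ?v) * deriv (G ^^ i) x
          + deriv F ?v * (deriv (G ^^ i) x - deriv (F ^^ i) x)"
        using funpow_deriv(2)[OF diffeo_DERIV[OF F], of i x] funpow_deriv(2)[OF diffeo_DERIV[OF G], of i x]
        by (simp add: algebra_simps)
      have "\<bar>deriv (G ^^ Suc i) x - deriv (F ^^ Suc i) x\<bar> \<le> \<bar>deriv G ?u - deriv F ?v\<bar> * \<bar>deriv (G ^^ i) x\<bar>
          + \<bar>deriv F ?v\<bar> * \<bar>deriv (G ^^ i) x - deriv (F ^^ i) x\<bar>"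
        unfolding e by (metis abs_mult abs_triangle_ineq)
      also have "\<dots> \<le> (\<eta> + L * \<eta>) * (B + 1) + C * \<eta>"
        using a b ci C \<eta> L by (intro add_mono mult_mono) auto
      also have "\<dots> \<le> \<epsilon>" by (rule \<eta>3)
      finally show "\<bar>deriv (G ^^ Suc i) x - deriv (F ^^ Suc i) x\<bar> \<le> \<epsilon>" .
    qed
  qed
  moreover have "0 < min \<rho> \<eta>" using \<rho> \<eta> by simp
  ultimately show ?case by blast
qed

lemma C1_close_funpow_all:
  assumes F: "diffeo F" and "0 < \<epsilon>"
  shows "\<exists>\<rho>>0. \<forall>G. diffeo G \<longrightarrow> C1_close \<rho> G F \<longrightarrow> (\<forall>i\<le>N. C1_close \<epsilon> (G ^^ i) (F ^^ i))"
proof (induction N)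
  case 0
  show ?case using C1_close_funpow[OF assms, of 0] by (metis le_zero_eq)
next
  case (Suc N)
  then obtain \<rho> where \<rho>: "0 < \<rho>" "\<And>G. diffeo G \<Longrightarrow> C1_close \<rho> G F \<Longrightarrow> (\<forall>i\<le>N. C1_close \<epsilon> (G ^^ i) (F ^^ i))" by blast
  obtain \<rho>' where \<rho>': "0 < \<rho>'" "\<And>G. diffeo G \<Longrightarrow> C1_close \<rho>' G F \<Longrightarrow> C1_close \<epsilon> (G ^^ Suc N) (F ^^ Suc N)"
    using C1_close_funpow[OF assms, of "Suc N"] by blast
  have "\<forall>i\<le>Suc N. C1_close \<epsilon> (G ^^ i) (F ^^ i)" if "diffeo G" "C1_close (min \<rho> \<rho>') G F" for G
    using \<rho>(2)[OF that(1) C1_close_mono[OF that(2)]] \<rho>'(2)[OF that(1) C1_close_mono[OF that(2)]]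
    by (auto simp: le_Suc_eq)
  then show ?case using \<rho>(1) \<rho>'(1) by (intro exI[of _ "min \<rho> \<rho>'"]) auto
qed

text \<open>Kronecker's theorem made uniform in s: it is applied to the finitely many targets
  \<open>m / M\<close> only, and \<open>N\<close> is the largest multiple used. A uniform
  \<open>N\<close> is what the C^1 control of iterates requires.\<close>

lemma irrational_multiples_dense:
  fixes \<alpha> :: real
  assumes "\<alpha> \<notin> \<rat>" "0 < \<theta>"
  obtains N :: nat where "\<And>s. \<exists>i\<le>N. \<exists>k::int. \<bar>real i * \<alpha> + of_int k - s\<bar> < \<theta>"
proof -
  obtain M :: nat where M: "0 < M" "1 / real M < \<theta> / 2"
    by (metis assms(2) half_gt_zero nat_approx_posE zero_less_Suc)
  have "\<exists>i. \<bar>frac (real i * \<alpha>) - real m / real M\<bar> < \<theta> / 2" if "m \<le> M" for m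
    using Kronecker_approx_1_explicit[of \<alpha> "real m / real M" "\<theta> / 2"] assms that M
    by (metis divide_le_eq_1_pos divide_nonneg_nonneg half_gt_zero of_nat_0_le_iff of_nat_0_less_iff of_nat_le_iff)
  then obtain i where i: "\<And>m. m \<le> M \<Longrightarrow> \<bar>frac (real (i m) * \<alpha>) - real m / real M\<bar> < \<theta> / 2" by metis
  define N where "N = Max (i ` {..M})"
  show thesis
  proof (rule that[of N])
    fix s :: real
    define m where "m = nat \<lfloor>real M * frac s\<rfloor>"
    have "0 \<le> real M * frac s" by simp
    then have m1: "real m \<le> real M * frac s" "real M * frac s < real m + 1"
      unfolding m_def by linarith+
    have "real M * frac s < real M" using frac_lt_1[of s] M by simp
    then have mM: "m \<le> M" using m1 by linarith
    have "real m / real M \<le> frac s" "frac s < real m / real M + 1 / real M"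
      using m1 M by (simp_all add: field_simps)
    then have "\<bar>frac (real (i m) * \<alpha>) - frac s\<bar> < \<theta>" using i[OF mM] M by linarith
    then have "\<bar>real (i m) * \<alpha> + of_int (\<lfloor>s\<rfloor> - \<lfloor>real (i m) * \<alpha>\<rfloor>) - s\<bar> < \<theta>"
      by (simp add: frac_def)
    moreover have "i m \<le> N" unfolding N_def using mM by (intro Max_ge) auto
    ultimately show "\<exists>i\<le>N. \<exists>k::int. \<bar>real i * \<alpha> + of_int k - s\<bar> < \<theta>" by blast
  qed
qed

lemma deriv_add_const: "diffeo F \<Longrightarrow> deriv (\<lambda>y. F y + c) x = deriv F x"
  by (rule DERIV_imp_deriv) (auto intro!: derivative_eq_intros diffeo_DERIV)

text \<open>Every conjugated rotation, not only those by multiples of \<alpha>, is approximated by iterates of G: this is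
  what makes the ergodicity and ratio set arguments independent of the later stages.\<close>

lemma iterates_shadow_conj_rot:
  assumes H: "diffeo H" and \<alpha>: "\<alpha> \<notin> \<rat>" and \<epsilon>: "0 < \<epsilon>"
  shows "\<exists>\<rho>>0. \<forall>G. diffeo G \<longrightarrow> C1_close \<rho> G (conj_rot H \<alpha>) \<longrightarrow>
    (\<forall>s. \<exists>i. \<exists>k::int. C1_close \<epsilon> (\<lambda>y. (G ^^ i) y + of_int k) (conj_rot H s))"
proof -
  obtain D where D: "0 < D" "\<And>s t. C1_close (D * \<bar>t - s\<bar>) (conj_rot H t) (conj_rot H s)"
    using conj_rot_lipschitz[OF H] by blast
  obtain N where N: "\<And>s. \<exists>i\<le>N. \<exists>k::int. \<bar>real i * \<alpha> + of_int k - s\<bar> < \<epsilon> / (2 * D)"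
    using irrational_multiples_dense[OF \<alpha>, of "\<epsilon> / (2 * D)"] \<epsilon> D by auto
  obtain \<rho> where \<rho>: "0 < \<rho>" "\<And>G. diffeo G \<Longrightarrow> C1_close \<rho> G (conj_rot H \<alpha>) \<Longrightarrow> (\<forall>i\<le>N. C1_close (\<epsilon> / 2) (G ^^ i) (conj_rot H \<alpha> ^^ i))"
    using C1_close_funpow_all[OF conj_rot_diffeo[OF H], of "\<epsilon> / 2" \<alpha> N] \<epsilon> by auto
  have "\<exists>i. \<exists>k::int. C1_close \<epsilon> (\<lambda>y. (G ^^ i) y + of_int k) (conj_rot H s)"
    if G: "diffeo G" and c: "C1_close \<rho> G (conj_rot H \<alpha>)" for G s
  proof -
    obtain i and k :: int where ik: "i \<le> N" "\<bar>real i * \<alpha> + of_int k - s\<bar> < \<epsilon> / (2 * D)" using N by blast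
    have "C1_close (\<epsilon> / 2) (G ^^ i) (conj_rot H (real i * \<alpha>))"
      using \<rho>(2)[OF G c] ik by (simp add: conj_rot_funpow[OF H])
    then have "C1_close (\<epsilon> / 2) (\<lambda>y. (G ^^ i) y + of_int k) (\<lambda>y. conj_rot H (real i * \<alpha>) y + of_int k)"
      unfolding C1_close_def by (simp add: deriv_add_const diffeo_funpow[OF G] conj_rot_diffeo[OF H])
    moreover have "(\<lambda>y. conj_rot H (real i * \<alpha>) y + of_int k) = conj_rot H (real i * \<alpha> + of_int k)"
      using conj_rot_int[OF H] by auto
    moreover have "C1_close (\<epsilon> / 2) (conj_rot H (real i * \<alpha> + of_int k)) (conj_rot H s)"
    proof (rule C1_close_mono[OF D(2)])
      have "D * \<bar>real i * \<alpha> + of_int k - s\<bar> \<le> D * (\<epsilon> / (2 * D))" using ik D by (intro mult_left_mono) auto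
      then show "D * \<bar>real i * \<alpha> + of_int k - s\<bar> \<le> \<epsilon> / 2" using D by simp
    qed
    ultimately have "C1_close (\<epsilon> / 2 + \<epsilon> / 2) (\<lambda>y. (G ^^ i) y + of_int k) (conj_rot H s)"
      using C1_close_trans by metis
    then show ?thesis by auto
  qed
  then show ?thesis using \<rho>(1) by blast
qed

text \<open>Differentiating \<open>inv H (conj_rot H \<alpha> y) = inv H y + \<alpha>\<close> shows
  that the quotient is exactly 1 for the conjugated rotation: \<open>deriv (inv H)\<close> is the
  density of its invariant measure. The quotient depends continuously on \<open>G\<close> in C^1,
  uniformly in y.\<close>

lemma cocycle_near_conj_rot:
  assumes H: "diffeo H" and \<eta>: "0 < \<eta>"
  shows "\<exists>\<rho>>0. \<forall>G. diffeo G \<longrightarrow> C1_close \<rho> G (conj_rot H \<alpha>) \<longrightarrow>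
    (\<forall>y. \<bar>deriv G y * deriv (inv H) (G y) / deriv (inv H) y - 1\<bar> \<le> \<eta>)"
proof -
  let ?J = "deriv (inv H)" let ?F = "conj_rot H \<alpha>"
  obtain c where c: "0 < c" "\<And>x. c \<le> ?J x" using diffeo_lower[OF diffeo_inv[OF H]] by blast
  obtain C where C: "0 < C" "\<And>x. \<bar>?J x\<bar> \<le> C" using smooth_bdd_bounded[OF diffeo_smooth_bdd[OF diffeo_inv[OF H]]] by blast
  obtain L where L: "0 < L" "\<And>x y. \<bar>?J x - ?J y\<bar> \<le> L * \<bar>x - y\<bar>"
    using smooth_bdd_lipschitz[OF diffeo_smooth_bdd[OF diffeo_inv[OF H]]] by blast
  obtain B where B: "0 < B" "\<And>x. \<bar>deriv ?F x\<bar> \<le> B" using smooth_bdd_bounded[OF diffeo_smooth_bdd[OF conj_rot_diffeo[OF H]]] by blast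
  \<comment> \<open>The numerator moves by at most \<open>\<rho> * C + B * (L * \<rho>)\<close>,
    while the denominator is at least c.\<close>
  define \<rho> where "\<rho> = \<eta> * c / (C + B * L)"
  have CBL: "0 < C + B * L" using C B L by (simp add: add_pos_pos)
  have \<rho>: "0 < \<rho>" "\<rho> * C + B * (L * \<rho>) = \<eta> * c"
  proof -
    show "0 < \<rho>" unfolding \<rho>_def using \<eta> c CBL by simp
    have "\<rho> * C + B * (L * \<rho>) = \<rho> * (C + B * L)" by (simp add: algebra_simps)
    then show "\<rho> * C + B * (L * \<rho>) = \<eta> * c" unfolding \<rho>_def using CBL by simp
  qed
  have "\<bar>deriv G y * ?J (G y) / ?J y - 1\<bar> \<le> \<eta>" if G: "diffeo G" and cl: "C1_close \<rho> G ?F" for G y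
  proof -
    have Jpos: "0 < ?J y" using c(1) c(2)[of y] by linarith
    have F: "deriv ?F y * ?J (?F y) = ?J y"
      using diffeo_deriv_pos[OF H, of "inv H y + \<alpha>"] H
      by (simp add: conj_rot_deriv diffeo_deriv_inv conj_rot_def divide_inverse)
    have "\<bar>?J (G y) - ?J (?F y)\<bar> \<le> L * \<bar>G y - ?F y\<bar>" by (rule L)
    also have "\<dots> \<le> L * \<rho>" using cl L by (intro mult_left_mono) (auto simp: C1_close_def)
    finally have a: "\<bar>?J (G y) - ?J (?F y)\<bar> \<le> L * \<rho>" .
    have e: "deriv G y * ?J (G y) - ?J y = (deriv G y - deriv ?F y) * ?J (G y) + deriv ?F y * (?J (G y) - ?J (?F y))"
      by (subst F[symmetric]) (simp add: algebra_simps)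
    have "\<bar>deriv G y * ?J (G y) - ?J y\<bar> \<le> \<bar>deriv G y - deriv ?F y\<bar> * \<bar>?J (G y)\<bar> + \<bar>deriv ?F y\<bar> * \<bar>?J (G y) - ?J (?F y)\<bar>"
      unfolding e by (metis abs_mult abs_triangle_ineq)
    also have "\<dots> \<le> \<rho> * C + B * (L * \<rho>)"
      using cl C B a \<rho> by (intro add_mono mult_mono) (auto simp: C1_close_def)
    also have "\<dots> \<le> \<eta> * ?J y" unfolding \<rho>(2) using c \<eta> by (intro mult_left_mono) auto
    finally have "\<bar>deriv G y * ?J (G y) - ?J y\<bar> \<le> \<eta> * ?J y" .
    moreover have "deriv G y * ?J (G y) / ?J y - 1 = (deriv G y * ?J (G y) - ?J y) / ?J y" using Jpos by (simp add: field_simps)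
    ultimately show ?thesis using Jpos by (simp add: abs_divide divide_le_eq)
  qed
  then show ?thesis using \<rho>(1) by blast
qed

section \<open>Rational approximations with large denominators\<close>

lemma irrational_far_from_fractions:
  fixes \<alpha> :: real
  assumes "\<alpha> \<notin> \<rat>"
  shows "\<exists>\<delta>>0. \<forall>q<Q. \<forall>p::int. 0 < q \<longrightarrow> \<delta> \<le> \<bar>\<alpha> - of_int p / real q\<bar>"
proof (induction Q)
  case (Suc Q)
  then obtain \<delta> where \<delta>: "0 < \<delta>" "\<And>q p. q < Q \<Longrightarrow> 0 < q \<Longrightarrow> \<delta> \<le> \<bar>\<alpha> - of_int p / real q\<bar>" by blast
  show ?case
  proof (cases "Q = 0")
    case True
    then show ?thesis by (intro exI[of _ 1]) auto
  next
    case False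
    \<comment> \<open>For a single denominator \<open>Q\<close> the question is the distance of
      \<open>Q * \<alpha>\<close> to the integers, which is positive.\<close>
    define x where "x = real Q * \<alpha>"
    have "x \<notin> \<int>"
    proof
      assume "x \<in> \<int>"
      then have "x / real Q \<in> \<rat>" using Ints_subset_Rats by (intro Rats_divide) auto
      then show False using assms False by (simp add: x_def)
    qed
    then have f: "0 < frac x" "0 < 1 - frac x" using frac_gt_0_iff frac_lt_1[of x] by auto
    have "min (frac x) (1 - frac x) \<le> \<bar>x - of_int p\<bar>" for p
    proof (cases "p \<le> \<lfloor>x\<rfloor>")
      case True
      then have "of_int p \<le> (of_int \<lfloor>x\<rfloor> :: real)" by simp
      then show ?thesis unfolding frac_def by linarith
    next
      case False
      then have "of_int (\<lfloor>x\<rfloor> + 1) \<le> (of_int p :: real)" by linarith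
      then show ?thesis unfolding frac_def by linarith
    qed
    moreover have "\<bar>x - of_int p\<bar> = real Q * \<bar>\<alpha> - of_int p / real Q\<bar>" for p
    proof -
      have "x - of_int p = real Q * (\<alpha> - of_int p / real Q)" using False by (simp add: x_def right_diff_distrib)
      then show ?thesis by (simp add: abs_mult)
    qed
    ultimately have Qp: "min (frac x) (1 - frac x) / real Q \<le> \<bar>\<alpha> - of_int p / real Q\<bar>" for p
      using False by (simp add: pos_divide_le_eq mult.commute)
    show ?thesis
    proof (intro exI[of _ "min \<delta> (min (frac x) (1 - frac x) / real Q)"] conjI allI impI)
      show "0 < min \<delta> (min (frac x) (1 - frac x) / real Q)" using \<delta> f False by simp
      fix q p assume "q < Suc Q" "0 < q"
      then show "min \<delta> (min (frac x) (1 - frac x) / real Q) \<le> \<bar>\<alpha> - of_int p / real q\<bar>"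
        using \<delta>(2)[of q p] Qp[of p] by (cases "q = Q") (auto simp: min_le_iff_disj)
    qed
  qed
qed (auto intro: exI[of _ 1])

text \<open>Fractions with denominator below \<open>Q\<close> keep a distance \<delta> from
  \<alpha>; asking for the accuracy \<open>min \<epsilon> \<delta>\<close> instead of \<epsilon>
  rules them out.\<close>

lemma liouville_large_denominator:
  assumes "liouville \<alpha>" "0 < \<epsilon>"
  obtains p q :: nat where "Q \<le> q" "0 < q" "\<bar>\<alpha> - real p / real q\<bar> < \<epsilon> / real q ^ N"
proof -
  obtain \<delta> where \<delta>: "0 < \<delta>" "\<And>q p. q < Q \<Longrightarrow> 0 < q \<Longrightarrow> \<delta> \<le> \<bar>\<alpha> - of_int p / real q\<bar>"
    using irrational_far_from_fractions[of \<alpha> Q] assms(1) unfolding liouville_def by blast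
  obtain p q :: nat where pq: "0 < q" "\<bar>\<alpha> - real p / real q\<bar> < min \<epsilon> \<delta> / real q ^ N"
    using assms \<delta>(1) unfolding liouville_def by (metis min_less_iff_conj)
  have q1: "1 \<le> real q ^ N" using pq(1) by simp
  have "min \<epsilon> \<delta> / real q ^ N \<le> \<delta>"
    using q1 \<delta>(1) mult_left_mono[OF q1, of \<delta>] by (simp add: divide_le_eq min.coboundedI2)
  then have "\<bar>\<alpha> - of_int (int p) / real q\<bar> < \<delta>" using pq(2) by simp
  then have "Q \<le> q" using \<delta>(2)[of q "int p"] pq(1) by (meson linorder_not_le)
  moreover have "min \<epsilon> \<delta> / real q ^ N \<le> \<epsilon> / real q ^ N" using pq(1) by (simp add: divide_right_mono)
  ultimately show thesis using that pq by (meson less_le_trans)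
qed

text \<open>Both conjugates are compared with the rotation by \<open>p / q\<close>, at which they
  coincide. The conjugates of \<open>- \<alpha>\<close> are followed as well: the distance involves
  the inverses, and their convergence makes the limit invertible.\<close>

lemma conj_rot_step:
  assumes K: "diffeo K" and \<phi>: "diffeo \<phi>" and \<alpha>: "liouville \<alpha>" and \<epsilon>: "0 < \<epsilon>"
  obtains q where "Q \<le> q" "0 < q"
    "derivs_le r \<epsilon> (\<lambda>y. conj_rot (\<lambda>x. K (rescale q \<phi> x)) \<alpha> y - conj_rot K \<alpha> y)"
    "derivs_le r \<epsilon> (\<lambda>y. conj_rot (\<lambda>x. K (rescale q \<phi> x)) (- \<alpha>) y - conj_rot K (- \<alpha>) y)"
proof -
  obtain D1 where D1: "0 < D1" "\<And>q s t. 0 < q \<Longrightarrow>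
    derivs_le r (D1 * real q ^ r * \<bar>t - s\<bar>) (\<lambda>y. conj_rot (\<lambda>x. K (rescale q \<phi> x)) t y - conj_rot (\<lambda>x. K (rescale q \<phi> x)) s y)"
    using conj_rot_rescale_estimate[OF K \<phi>] by blast
  obtain D2 where D2: "0 < D2" "\<And>s t. derivs_le r (D2 * \<bar>t - s\<bar>) (\<lambda>y. conj_rot K t y - conj_rot K s y)"
    using conj_rot_estimate[OF K] by blast
  \<comment> \<open>The exponent r cancels the factor \<open>q ^ r\<close> that comes with
    \<open>D1\<close>; the denominator \<open>D1 + D2\<close> covers the errors of both
    conjugates.\<close>
  obtain p q :: nat where pq: "Q \<le> q" "0 < q" "\<bar>\<alpha> - real p / real q\<bar> < (\<epsilon> / (D1 + D2)) / real q ^ r"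
    using liouville_large_denominator[OF \<alpha>, of "\<epsilon> / (D1 + D2)" Q r] \<epsilon> D1(1) D2(1)
    by (metis add_pos_pos divide_pos_pos)
  let ?H = "\<lambda>x. K (rescale q \<phi> x)"
  have eq: "derivs_le r \<epsilon> (\<lambda>y. conj_rot ?H a y - conj_rot K a y)" if a: "\<bar>a - of_int b / real q\<bar> = \<bar>\<alpha> - real p / real q\<bar>" for a and b :: int
  proof -
    let ?s = "of_int b / real q :: real"
    let ?d = "\<bar>\<alpha> - real p / real q\<bar>"
    have A: "derivs_le r (D1 * real q ^ r * \<bar>a - ?s\<bar> + D2 * \<bar>?s - a\<bar>)
       (\<lambda>y. (conj_rot ?H a y - conj_rot ?H ?s y) + (conj_rot K ?s y - conj_rot K a y))"
      by (intro derivs_le_add D1 D2 pq)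
    have e: "conj_rot ?H ?s = conj_rot K ?s" by (rule conj_rot_rescale[OF K \<phi> pq(2)])
    have le: "D1 * real q ^ r * \<bar>a - ?s\<bar> + D2 * \<bar>?s - a\<bar> \<le> \<epsilon>"
    proof -
      have "D1 * real q ^ r * \<bar>a - ?s\<bar> + D2 * \<bar>?s - a\<bar> = (D1 * real q ^ r + D2) * ?d"
        using a by (simp add: abs_minus_commute distrib_right)
      also have "\<dots> \<le> ((D1 + D2) * real q ^ r) * ?d"
      proof (intro mult_right_mono)
        have "1 \<le> real q ^ r" using pq(2) by simp
        then show "D1 * real q ^ r + D2 \<le> (D1 + D2) * real q ^ r"
          using D2(1) mult_left_mono[of 1 "real q ^ r" D2] by (simp add: distrib_right)
      qed simp
      also have "\<dots> \<le> ((D1 + D2) * real q ^ r) * ((\<epsilon> / (D1 + D2)) / real q ^ r)"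
        using pq(3) D1(1) D2(1) by (intro mult_left_mono) auto
      also have "\<dots> = \<epsilon>" using D1(1) D2(1) pq(2) by simp
      finally show ?thesis .
    qed
    show ?thesis using derivs_le_mono[OF A le] by (simp add: e)
  qed
  show thesis
  proof (rule that[OF pq(1,2) eq eq])
    show "\<bar>\<alpha> - of_int (int p) / real q\<bar> = \<bar>\<alpha> - real p / real q\<bar>" by simp
    show "\<bar>- \<alpha> - of_int (- int p) / real q\<bar> = \<bar>\<alpha> - real p / real q\<bar>" by (simp add: abs_minus_commute)
  qed
qed

section \<open>Successive conjugation for Liouville numbers\<close>

text \<open>With tolerances at least halved at every stage, the moves of half a tolerance made from
  stage n on add up to no more than the tolerance at n.\<close>

lemma halving_sum:
  fixes \<rho> :: "nat \<Rightarrow> real"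
  assumes "\<And>k. 0 \<le> \<rho> k" "\<And>k. \<rho> (Suc k) \<le> \<rho> k / 2"
  shows "summable (\<lambda>j. \<rho> (j + n) / 2)" "(\<Sum>j. \<rho> (j + n) / 2) \<le> \<rho> n" "\<rho> \<longlonglongrightarrow> 0"
proof -
  have le: "\<rho> (j + n) \<le> \<rho> n * (1 / 2) ^ j" for j n
  proof (induction j)
    case (Suc j)
    then show ?case using assms(2)[of "j + n"] by simp
  qed simp
  have sm: "summable (\<lambda>j. \<rho> n * (1 / 2) ^ Suc j)"
    by (intro summable_mult summable_Suc_iff[THEN iffD2] summable_geometric) auto
  have *: "\<rho> (j + n) / 2 \<le> \<rho> n * (1 / 2) ^ Suc j" for j using le[of j n] by simp
  show s: "summable (\<lambda>j. \<rho> (j + n) / 2)"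
    by (rule summable_comparison_test[OF _ sm]) (use * assms(1) in auto)
  have "(\<Sum>j. \<rho> (j + n) / 2) \<le> (\<Sum>j. \<rho> n * (1 / 2) ^ Suc j)"
    by (rule suminf_le[OF * s sm])
  also have "\<dots> = \<rho> n"
    using sums_mult[OF power_half_series, of "\<rho> n"] by (simp add: sums_iff)
  finally show "(\<Sum>j. \<rho> (j + n) / 2) \<le> \<rho> n" .
  have "(\<lambda>j. \<rho> 0 * (1 / 2) ^ j) \<longlonglongrightarrow> 0"
    by (intro tendsto_mult_right_zero LIMSEQ_realpow_zero) auto
  then show "\<rho> \<longlonglongrightarrow> 0"
    by (rule Lim_null_comparison[rotated]) (use le[of _ 0] assms(1) in auto)
qed

text \<open>The order \<open>r + k\<close> increases with k, so the convergence takes place at every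
  order; the k-th approximation is controlled to order \<open>r + k\<close> by the tail of the
  series of increments.\<close>

lemma smooth_limit:
  assumes "\<And>k. 0 \<le> \<rho> k" "\<And>k. \<rho> (Suc k) \<le> \<rho> k / 2"
    and "\<And>k. derivs_le (r + k) (\<rho> k / 2) (\<lambda>x. g (Suc k) x - g k x)"
  obtains G where "\<And>k. derivs_le (r + k) (\<rho> k) (\<lambda>x. G x - g k x)"
proof -
  define u where "u k x = g (Suc k) x - g k x" for k x
  define G where "G x = g 0 x + (\<Sum>j. u j x)" for x
  have ub: "\<bar>u k x\<bar> \<le> \<rho> k / 2" for k x using derivs_le_bound[OF assms(3)] by (simp add: u_def)
  have sm: "summable (\<lambda>k. u k x)" for x
    by (rule summable_comparison_test[OF _ halving_sum(1)[of \<rho> 0, OF assms(1,2)]]) (use ub in auto)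
  show thesis
  proof (rule that[of G])
    fix k
    have "derivs_le (r + k) (\<Sum>j. \<rho> (j + k) / 2) (\<lambda>x. \<Sum>j. u (j + k) x)"
    proof (rule derivs_le_series)
      show "derivs_le (r + k) (\<rho> (j + k) / 2) (u (j + k))" for j
        using derivs_le_antimono[OF assms(3), of "r + k" "j + k"] by (simp add: u_def[abs_def])
    qed (rule halving_sum(1)[of \<rho>, OF assms(1,2)])
    then have "derivs_le (r + k) (\<rho> k) (\<lambda>x. \<Sum>j. u (j + k) x)"
      using derivs_le_mono halving_sum(2)[of \<rho>, OF assms(1,2)] by blast
    moreover have "(\<Sum>j. u (j + k) x) = G x - g k x" for x
    proof -
      have "(\<Sum>j<k. u j x) = g k x - g 0 x" unfolding u_def by (rule sum_lessThan_telescope)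
      then show ?thesis using suminf_split_initial_segment[OF sm, of x k] by (simp add: G_def)
    qed
    ultimately show "derivs_le (r + k) (\<rho> k) (\<lambda>x. G x - g k x)" by (simp only:)
  qed
qed

lemma smooth_bdd_limit:
  assumes "\<And>k. derivs_le (r + k) (\<rho> k) (\<lambda>x. G x - g k x)" "\<And>k. diffeo (g k)"
  shows "smooth_bdd (\<lambda>x. G x - x)"
proof (rule smooth_bddI)
  fix n
  have "derivs_le n (\<rho> n) (\<lambda>x. G x - g n x)" using derivs_le_antimono[OF assms(1)[of n]] by simp
  moreover obtain B where "derivs_le n B (\<lambda>x. g n x - x)" using diffeo_minus_id_smooth_bdd[OF assms(2)] by (auto simp: smooth_bdd_def)
  ultimately have "derivs_le n (\<rho> n + B) (\<lambda>x. (G x - g n x) + (g n x - x))" by (rule derivs_le_add)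
  then show "\<exists>B. derivs_le n B (\<lambda>x. G x - x)" by auto
qed

text \<open>A smooth limit of diffeomorphisms may have critical points. Here the inverses converge
  too, and their limit inverts the limit of the maps.\<close>

lemma diffeo_limit:
  assumes \<rho>: "\<rho> \<longlonglongrightarrow> 0"
    and G: "\<And>k. derivs_le (r + k) (\<rho> k) (\<lambda>x. G x - g k x)" and L: "\<And>k. derivs_le (r + k) (\<rho> k) (\<lambda>x. L x - l k x)"
    and g: "\<And>k. diffeo (g k)" and l: "\<And>k. diffeo (l k)" and gl: "\<And>k x. g k (l k x) = x" and lg: "\<And>k x. l k (g k x) = x"
  shows "diffeo G" "inv G = L"
proof -
  have der: "\<exists>F'. (\<forall>x. (F has_real_derivative F' x) (at x)) \<and> smooth_bdd F'" if F: "smooth_bdd (\<lambda>x. F x - x)" for F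
  proof (intro exI conjI allI)
    have "((\<lambda>x. (F x - x) + x) has_real_derivative deriv (\<lambda>x. F x - x) x + 1) (at x)" for x
      by (intro derivative_intros smooth_bdd_deriv(2)[OF F])
    then show "(F has_real_derivative deriv (\<lambda>x. F x - x) x + 1) (at x)" for x by simp
    show "smooth_bdd (\<lambda>x. deriv (\<lambda>x. F x - x) x + 1)" by (intro smooth_bdd_add smooth_bdd_const smooth_bdd_deriv F)
  qed
  obtain G' where G': "\<And>x. (G has_real_derivative G' x) (at x)" "smooth_bdd G'" using der[OF smooth_bdd_limit[OF G g]] by blast
  obtain L' where L': "\<And>x. (L has_real_derivative L' x) (at x)" "smooth_bdd L'" using der[OF smooth_bdd_limit[OF L l]] by blast
  have lim: "(\<lambda>k. g k x) \<longlonglongrightarrow> G x" "(\<lambda>k. l k x) \<longlonglongrightarrow> L x" for x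
  proof -
    have "(\<lambda>k. G x - g k x) \<longlonglongrightarrow> 0" "(\<lambda>k. L x - l k x) \<longlonglongrightarrow> 0"
      by (rule Lim_null_comparison[OF _ \<rho>]; use derivs_le_bound[OF G] derivs_le_bound[OF L] in auto)+
    from tendsto_diff[OF tendsto_const this(1), of "G x"] tendsto_diff[OF tendsto_const this(2), of "L x"]
    show "(\<lambda>k. g k x) \<longlonglongrightarrow> G x" "(\<lambda>k. l k x) \<longlonglongrightarrow> L x" by simp_all
  qed
  have comp: "F (M x) = x"
    if F: "\<And>k. derivs_le (r + k) (\<rho> k) (\<lambda>x. F x - f k x)" and F': "\<And>x. (F has_real_derivative F' x) (at x)"
      and M: "(\<lambda>k. m k x) \<longlonglongrightarrow> M x" and fm: "\<And>k. f k (m k x) = x" for F F' f M m x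
  proof -
    have "(\<lambda>k. F (m k x)) \<longlonglongrightarrow> F (M x)"
      using isCont_tendsto_compose[OF DERIV_isCont[OF F'] M] .
    moreover have "(\<lambda>k. F (m k x) - x) \<longlonglongrightarrow> 0"
    proof (rule Lim_null_comparison[OF _ \<rho>])
      have "\<bar>F (m k x) - x\<bar> \<le> \<rho> k" for k using derivs_le_bound[OF F, of "m k x" k] fm[of k] by simp
      then show "\<forall>\<^sub>F k in sequentially. norm (F (m k x) - x) \<le> \<rho> k" by simp
    qed
    then have "(\<lambda>k. F (m k x)) \<longlonglongrightarrow> x" by (simp add: LIM_zero_iff)
    ultimately show ?thesis using LIMSEQ_unique by blast
  qed
  have GL: "G (L x) = x" for x by (rule comp[OF G G'(1) lim(2) gl])
  have LG: "L (G x) = x" for x by (rule comp[OF L L'(1) lim(1) lg])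
  show "inv G = L" by (rule inv_unique_comp) (auto simp: GL LG)
  obtain B where B: "0 < B" "\<And>x. \<bar>L' x\<bar> \<le> B" using smooth_bdd_bounded[OF L'(2)] by blast
  \<comment> \<open>A limit of increasing maps cannot decrease, which fixes the sign; the bound away
    from 0 then comes from the chain rule for \<open>L \<circ> G\<close>.\<close>
  have G'0: "0 \<le> G' x" for x
  proof (rule ccontr)
    assume "\<not> 0 \<le> G' x"
    then obtain d where d: "0 < d" "\<forall>h>0. h < d \<longrightarrow> G (x + h) < G x"
      using DERIV_neg_dec_right[OF G'(1), of x] by auto
    have "G x \<le> G (x + d / 2)"
    proof (rule LIMSEQ_le[OF lim(1) lim(1)])
      show "\<exists>N. \<forall>n\<ge>N. g n x \<le> g n (x + d / 2)" using d by (auto simp: diffeo_le_iff[OF g])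
    qed
    then show False using d by (metis field_sum_of_halves half_gt_zero less_add_same_cancel1 not_le)
  qed
  have lower: "inverse B \<le> G' x" for x
  proof -
    have "((\<lambda>x. L (G x)) has_real_derivative L' (G x) * G' x) (at x)"
      by (rule DERIV_chain2[OF L'(1) G'(1)])
    moreover have "((\<lambda>x. L (G x)) has_real_derivative 1) (at x)" unfolding LG by (rule DERIV_ident)
    ultimately have "L' (G x) * G' x = 1" by (rule DERIV_unique)
    moreover have "L' (G x) * G' x \<le> B * G' x" using B(2)[of "G x"] G'0[of x] by (intro mult_right_mono) auto
    ultimately show ?thesis using B(1) by (simp add: inverse_eq_divide pos_divide_le_eq mult.commute)
  qed
  show "diffeo G"
  proof (rule diffeoI[OF G' _ lower])
    show "0 < inverse B" using B by simp
    show "G (x + 1) = G x + 1" for x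
    proof -
      have "(\<lambda>k. g k x + 1) \<longlonglongrightarrow> G (x + 1)" using lim(1)[of "x + 1"] by (simp add: diffeo_add_1[OF g])
      moreover have "(\<lambda>k. g k x + 1) \<longlonglongrightarrow> G x + 1" by (intro tendsto_intros lim)
      ultimately show ?thesis by (rule LIMSEQ_unique)
    qed
  qed
qed

text \<open>Since \<open>K\<close> fixes 0 it moves no point by more than 1, and it enters once
  forwards and once backwards. The bound does not involve \<open>K\<close>, so it passes to the
  limit and yields the rotation number.\<close>

lemma conj_rot_displacement:
  assumes K: "diffeo K" and K0: "K 0 = 0"
  shows "\<bar>conj_rot K s x - x - s\<bar> \<le> 2"
  using diffeo_near_id[OF K, of "inv K x + s"] diffeo_near_id[OF K, of "inv K x"] K0 diffeo_inv1[OF K, of x]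
  unfolding conj_rot_def by simp

text \<open>For a fixed exponent, uniform closeness of the maps and continuity of \<open>G\<close>
  at the limiting orbit point carry the convergence one step further.\<close>

lemma iterates_tendsto:
  fixes G :: "real \<Rightarrow> real"
  assumes "\<rho> \<longlonglongrightarrow> 0" "\<And>k x. \<bar>G x - g k x\<bar> \<le> \<rho> k" "diffeo G"
  shows "(\<lambda>k. (g k ^^ i) x) \<longlonglongrightarrow> (G ^^ i) x"
proof (induction i)
  case (Suc i)
  have "(\<lambda>k. G ((g k ^^ i) x) - g k ((g k ^^ i) x)) \<longlonglongrightarrow> 0"
    by (rule Lim_null_comparison[OF _ assms(1)]) (use assms(2) in auto)
  moreover have "(\<lambda>k. G ((g k ^^ i) x)) \<longlonglongrightarrow> G ((G ^^ i) x)"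
    using isCont_tendsto_compose[OF DERIV_isCont[OF diffeo_DERIV[OF assms(3)]] Suc] .
  ultimately have "(\<lambda>k. G ((g k ^^ i) x) - (G ((g k ^^ i) x) - g k ((g k ^^ i) x))) \<longlonglongrightarrow> G ((G ^^ i) x) - 0"
    by (intro tendsto_diff)
  then show ?case by simp
qed simp

text \<open>\<Psi> is any requirement met by all large q, and \<Phi> any requirement on the limit that is open around the
  n-th conjugate; later stages stay within the tolerance of the earlier ones.\<close>

theorem liouville_construction:
  fixes \<phi> :: "nat \<Rightarrow> real \<Rightarrow> real" and r :: nat and \<alpha> \<delta> :: real
    and \<Psi> :: "nat \<Rightarrow> (real \<Rightarrow> real) \<Rightarrow> nat \<Rightarrow> bool" and \<Phi> :: "nat \<Rightarrow> (real \<Rightarrow> real) \<Rightarrow> nat \<Rightarrow> (real \<Rightarrow> real) \<Rightarrow> bool"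
  assumes \<alpha>: "liouville \<alpha>" and \<delta>: "0 < \<delta>" and \<phi>: "\<And>n. diffeo (\<phi> n)" and \<phi>0: "\<And>n. \<phi> n 0 = 0"
    and \<Psi>: "\<And>n K. diffeo K \<Longrightarrow> \<exists>Q. \<forall>q\<ge>Q. \<Psi> n K q"
    and \<Phi>: "\<And>n K q. diffeo K \<Longrightarrow> 0 < q \<Longrightarrow>
      \<exists>\<rho>>0. \<forall>G. diffeo G \<longrightarrow> C1_close \<rho> G (conj_rot (\<lambda>x. K (rescale q (\<phi> n) x)) \<alpha>) \<longrightarrow> \<Phi> n K q G"
  obtains K q G where "\<And>n. diffeo (K n)" "K 0 = (\<lambda>x. x)" "\<And>n. K n 0 = 0" "\<And>n. K (Suc n) = (\<lambda>x. K n (rescale (q n) (\<phi> n) x))"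
    "\<And>n. 0 < q n" "\<And>n. \<Psi> n (K n) (q n)" "diffeo G" "\<And>n. \<Phi> n (K n) (q n) G"
    "derivs_le r \<delta> (\<lambda>x. G x - (x + \<alpha>))" "derivs_le r \<delta> (\<lambda>x. inv G x - (x - \<alpha>))"
    "\<And>i x. \<bar>(G ^^ i) x - x - real i * \<alpha>\<bar> \<le> 2"
proof -
  \<comment> \<open>A state is a conjugacy together with a tolerance: all later conjugates, and the
    limit, have to stay within that tolerance of the current one.\<close>
  define P where "P n s \<longleftrightarrow> diffeo (fst s) \<and> 0 < snd s \<and> (n = 0 \<longrightarrow> s = (\<lambda>x. x, \<delta>))"
    for n :: nat and s :: "(real \<Rightarrow> real) \<times> real"
  define R where "R n s s' \<longleftrightarrow> (\<exists>q>0. fst s' = (\<lambda>x. fst s (rescale q (\<phi> n) x)) \<and> \<Psi> n (fst s) q \<and>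
     derivs_le (Suc r + n) (snd s / 2) (\<lambda>y. conj_rot (fst s') \<alpha> y - conj_rot (fst s) \<alpha> y) \<and>
     derivs_le (Suc r + n) (snd s / 2) (\<lambda>y. conj_rot (fst s') (- \<alpha>) y - conj_rot (fst s) (- \<alpha>) y) \<and>
     snd s' \<le> snd s / 2 \<and> (\<forall>G. diffeo G \<longrightarrow> C1_close (snd s') G (conj_rot (fst s') \<alpha>) \<longrightarrow> \<Phi> n (fst s) q G))"
    for n and s s' :: "(real \<Rightarrow> real) \<times> real"
  have "\<exists>f. \<forall>n. P n (f n) \<and> R n (f n) (f (Suc n))"
  proof (rule dependent_nat_choice)
    show "\<exists>s. P 0 s" unfolding P_def using \<delta> diffeo_id by auto
    fix s n assume "P n s"
    then have K: "diffeo (fst s)" and \<rho>: "0 < snd s" by (auto simp: P_def)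
    obtain Q where Q: "\<And>q. Q \<le> q \<Longrightarrow> \<Psi> n (fst s) q" using \<Psi>[OF K] by blast
    obtain q where q: "Q \<le> q" "0 < q"
      "derivs_le (Suc r + n) (snd s / 2) (\<lambda>y. conj_rot (\<lambda>x. (fst s) (rescale q (\<phi> n) x)) \<alpha> y - conj_rot (fst s) \<alpha> y)"
      "derivs_le (Suc r + n) (snd s / 2) (\<lambda>y. conj_rot (\<lambda>x. (fst s) (rescale q (\<phi> n) x)) (- \<alpha>) y - conj_rot (fst s) (- \<alpha>) y)"
      using conj_rot_step[OF K \<phi>[of n] \<alpha> half_gt_zero[OF \<rho>]] by blast
    obtain \<rho>' where \<rho>': "0 < \<rho>'" "\<And>G. diffeo G \<Longrightarrow> C1_close \<rho>' G (conj_rot (\<lambda>x. (fst s) (rescale q (\<phi> n) x)) \<alpha>) \<Longrightarrow> \<Phi> n (fst s) q G"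
      using \<Phi>[OF K q(2), of n] by blast
    \<comment> \<open>The new tolerance is at most the radius \<rho>' within which the requirement
      \<Phi> of this stage holds, and at most half the old one.\<close>
    let ?s = "(\<lambda>x. (fst s) (rescale q (\<phi> n) x), min \<rho>' (snd s / 2))"
    have "P (Suc n) ?s"
      using diffeo_comp(1)[OF K rescale_diffeo(1)[OF \<phi>[of n] q(2)]] \<rho>' \<rho> by (simp add: P_def)
    moreover have "R n s ?s"
      unfolding R_def using q Q[OF q(1)] \<rho>'(2) C1_close_mono by (intro exI[of _ q]) (auto intro: min.cobounded1)
    ultimately show "\<exists>s'. P (Suc n) s' \<and> R n s s'" by blast
  qed
  then obtain f where f: "\<And>n. P n (f n)" "\<And>n. R n (f n) (f (Suc n))" by blast
  define K where "K n = fst (f n)" for n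
  define \<rho> where "\<rho> n = snd (f n)" for n
  have K: "diffeo (K n)" and \<rho>pos: "0 < \<rho> n" for n using f(1)[of n] by (auto simp: P_def K_def \<rho>_def)
  have K0: "K 0 = (\<lambda>x. x)" and \<rho>0: "\<rho> 0 = \<delta>" using f(1)[of 0] by (auto simp: P_def K_def \<rho>_def)
  have "\<exists>q. \<forall>n. 0 < q n \<and> K (Suc n) = (\<lambda>x. K n (rescale (q n) (\<phi> n) x)) \<and> \<Psi> n (K n) (q n) \<and>
     derivs_le (Suc r + n) (\<rho> n / 2) (\<lambda>y. conj_rot (K (Suc n)) \<alpha> y - conj_rot (K n) \<alpha> y) \<and>
     derivs_le (Suc r + n) (\<rho> n / 2) (\<lambda>y. conj_rot (K (Suc n)) (- \<alpha>) y - conj_rot (K n) (- \<alpha>) y) \<and>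
     \<rho> (Suc n) \<le> \<rho> n / 2 \<and> (\<forall>G. diffeo G \<longrightarrow> C1_close (\<rho> (Suc n)) G (conj_rot (K (Suc n)) \<alpha>) \<longrightarrow> \<Phi> n (K n) (q n) G)"
    using f(2) unfolding R_def K_def[symmetric] \<rho>_def[symmetric] by (intro choice) auto
  then obtain q where q: "\<And>n. 0 < q n" and Ks: "\<And>n. K (Suc n) = (\<lambda>x. K n (rescale (q n) (\<phi> n) x))"
    and \<Psi>q: "\<And>n. \<Psi> n (K n) (q n)"
    and d1: "\<And>n. derivs_le (Suc r + n) (\<rho> n / 2) (\<lambda>y. conj_rot (K (Suc n)) \<alpha> y - conj_rot (K n) \<alpha> y)"
    and d2: "\<And>n. derivs_le (Suc r + n) (\<rho> n / 2) (\<lambda>y. conj_rot (K (Suc n)) (- \<alpha>) y - conj_rot (K n) (- \<alpha>) y)"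
    and \<rho>h: "\<And>n. \<rho> (Suc n) \<le> \<rho> n / 2"
    and \<Phi>q: "\<And>n G. diffeo G \<Longrightarrow> C1_close (\<rho> (Suc n)) G (conj_rot (K (Suc n)) \<alpha>) \<Longrightarrow> \<Phi> n (K n) (q n) G"
    by metis
  have \<rho>n: "0 \<le> \<rho> n" for n using \<rho>pos[of n] by simp
  obtain G where G: "\<And>k. derivs_le (Suc r + k) (\<rho> k) (\<lambda>x. G x - conj_rot (K k) \<alpha> x)"
    using smooth_limit[of \<rho>, OF \<rho>n \<rho>h d1] by blast
  obtain L where L: "\<And>k. derivs_le (Suc r + k) (\<rho> k) (\<lambda>x. L x - conj_rot (K k) (- \<alpha>) x)"
    using smooth_limit[of \<rho>, OF \<rho>n \<rho>h d2] by blast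
  have \<rho>lim: "\<rho> \<longlonglongrightarrow> 0" by (rule halving_sum(3)[of \<rho>, OF \<rho>n \<rho>h])
  have ldG: "diffeo G" "inv G = L"
    using diffeo_limit[OF \<rho>lim G L conj_rot_diffeo[OF K] conj_rot_diffeo[OF K]]
    by (simp_all add: conj_rot_add[OF K] conj_rot_0[OF K])
  have Kn0: "K n 0 = 0" for n
    by (induction n) (simp_all add: K0 Ks rescale_def \<phi>0)
  have c0: "conj_rot (K 0) s x = x + s" for s x
  proof -
    have "inv (\<lambda>x::real. x) = (\<lambda>x. x)" using inv_id unfolding id_def .
    then show ?thesis by (simp add: K0 conj_rot_def)
  qed
  show thesis
  proof (rule that[of K q G])
    show "\<Phi> n (K n) (q n) G" for n
      using \<Phi>q[OF ldG(1)] derivs_le_imp_C1_close[of "r + Suc n" "\<rho> (Suc n)" G] G[of "Suc n"] conj_rot_diffeo[OF K] ldG(1) by simp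
    show "derivs_le r \<delta> (\<lambda>x. G x - (x + \<alpha>))" using derivs_le_antimono[OF G[of 0], of r] by (simp add: c0 \<rho>0)
    show "derivs_le r \<delta> (\<lambda>x. inv G x - (x - \<alpha>))" using derivs_le_antimono[OF L[of 0], of r] by (simp add: c0 \<rho>0 ldG)
    show "\<bar>(G ^^ i) x - x - real i * \<alpha>\<bar> \<le> 2" for i x
    proof (rule LIMSEQ_le_const2)
      have "(\<lambda>k. (conj_rot (K k) \<alpha> ^^ i) x) \<longlonglongrightarrow> (G ^^ i) x"
        by (rule iterates_tendsto[OF \<rho>lim _ ldG(1)]) (rule derivs_le_bound[OF G])
      then show "(\<lambda>k. \<bar>(conj_rot (K k) \<alpha> ^^ i) x - x - real i * \<alpha>\<bar>) \<longlonglongrightarrow> \<bar>(G ^^ i) x - x - real i * \<alpha>\<bar>"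
        by (intro tendsto_intros)
      show "\<exists>N. \<forall>n\<ge>N. \<bar>(conj_rot (K n) \<alpha> ^^ i) x - x - real i * \<alpha>\<bar> \<le> 2"
        using conj_rot_displacement[OF K Kn0] by (simp add: conj_rot_funpow[OF K])
    qed
  qed (use K K0 Kn0 Ks q \<Psi>q ldG in auto)
qed

section \<open>Two-valued smooth profiles\<close>

text \<open>The class of functions p(1/x) exp(-1/x), extended by 0 to the left, is closed under differentiation.\<close>

definition flat_poly :: "real poly \<Rightarrow> real \<Rightarrow> real" where
  "flat_poly p x = (if 0 < x then poly p (1 / x) * exp (- (1 / x)) else 0)"

text \<open>Horner's scheme: for each further factor \<open>u\<close>, half of the exponent pays for
  \<open>u\<close> and half for the remaining polynomial.\<close>

lemma poly_le_exp:
  fixes p :: "real poly"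
  assumes "0 < c"
  shows "\<exists>M\<ge>0. \<forall>u\<ge>0. \<bar>poly p u\<bar> \<le> M * exp (c * u)"
  using assms
proof (induction p arbitrary: c)
  case 0
  then show ?case by (intro exI[of _ 0]) auto
next
  case (pCons a p)
  obtain M where M: "0 \<le> M" "\<And>u. 0 \<le> u \<Longrightarrow> \<bar>poly p u\<bar> \<le> M * exp (c / 2 * u)"
    using pCons.IH[of "c / 2"] pCons.prems by auto
  have "\<bar>poly (pCons a p) u\<bar> \<le> (\<bar>a\<bar> + 2 / c * M) * exp (c * u)" if u: "0 \<le> u" for u
  proof -
    have "c / 2 * u \<le> exp (c / 2 * u)" using exp_ge_add_one_self[of "c / 2 * u"] by linarith
    then have ue: "u \<le> 2 / c * exp (c / 2 * u)" using pCons.prems by (simp add: field_simps)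
    have "\<bar>poly (pCons a p) u\<bar> \<le> \<bar>a\<bar> + u * \<bar>poly p u\<bar>"
      using abs_triangle_ineq[of a "u * poly p u"] u by (simp add: abs_mult)
    also have "\<dots> \<le> \<bar>a\<bar> * exp (c * u) + (2 / c * exp (c / 2 * u)) * (M * exp (c / 2 * u))"
      using u ue M pCons.prems mult_left_mono[of 1 "exp (c * u)" "\<bar>a\<bar>"] by (intro add_mono mult_mono) auto
    also have "\<dots> = (\<bar>a\<bar> + 2 / c * M) * exp (c * u)"
      by (simp add: algebra_simps exp_add[symmetric])
    finally show ?thesis .
  qed
  moreover have "0 \<le> \<bar>a\<bar> + 2 / c * M" using M pCons.prems by simp
  ultimately show ?case by blast
qed

lemma flat_poly_bound:
  obtains M where "0 \<le> M" "\<And>x. \<bar>flat_poly p x\<bar> \<le> M"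
proof -
  obtain M where M: "0 \<le> M" "\<And>u. 0 \<le> u \<Longrightarrow> \<bar>poly p u\<bar> \<le> M * exp (1 * u)"
    using poly_le_exp[of 1 p] by auto
  have "\<bar>flat_poly p x\<bar> \<le> M" for x
    using M(1) M(2)[of "1 / x"] by (auto simp: flat_poly_def abs_mult exp_minus inverse_eq_divide divide_le_eq)
  then show thesis using that M by blast
qed

text \<open>With \<open>u = 1 / x\<close>, the inner derivative contributes the factor
  \<open>u\<^sup>2\<close>, which is the polynomial \<open>[:0, 0, 1:]\<close>, and the two terms of
  the product rule give \<open>p - pderiv p\<close>. Only the point 0 needs an estimate.\<close>

lemma flat_poly_DERIV: "(flat_poly p has_real_derivative flat_poly ([:0, 0, 1:] * (p - pderiv p)) x) (at x)"
proof -
  consider "x < 0" | "x = 0" | "0 < x" by linarith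
  then show ?thesis
  proof cases
    case 1
    have "((\<lambda>x. 0) has_real_derivative 0) (at x)" by simp
    then have "(flat_poly p has_real_derivative 0) (at x)"
      by (rule has_field_derivative_transform_within_open[of _ _ _ "{..<0}"]) (use 1 in \<open>auto simp: flat_poly_def\<close>)
    then show ?thesis using 1 by (simp add: flat_poly_def)
  next
    case 3
    have "((\<lambda>x. poly p (1 / x) * exp (- (1 / x))) has_real_derivative
      flat_poly ([:0, 0, 1:] * (p - pderiv p)) x) (at x)"
      using 3 by (auto intro!: derivative_eq_intros DERIV_chain2[OF poly_DERIV] simp: flat_poly_def)
        (simp add: field_simps power2_eq_square)
    then show ?thesis
      by (rule has_field_derivative_transform_within_open[of _ _ _ "{0<..}"]) (use 3 in \<open>auto simp: flat_poly_def\<close>)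
  next
    case 2
    \<comment> \<open>Boundedness for the polynomial \<open>[:0, 0, 1:] * p\<close> is quadratic
      decay at 0 for \<open>p\<close>.\<close>
    obtain M where M: "0 \<le> M" "\<And>x. \<bar>flat_poly ([:0, 0, 1:] * p) x\<bar> \<le> M" using flat_poly_bound by blast
    have le: "\<bar>flat_poly p h\<bar> \<le> M * h\<^sup>2" for h
    proof (cases "0 < h")
      case True
      have "flat_poly ([:0, 0, 1:] * p) h = flat_poly p h / h\<^sup>2"
        using True by (simp add: flat_poly_def power2_eq_square)
      then show ?thesis using M(2)[of h] True by (simp add: abs_divide divide_le_eq)
    qed (simp add: flat_poly_def M)
    have "(\<lambda>h. (flat_poly p (0 + h) - flat_poly p 0) / h) \<midarrow>0\<rightarrow> 0"
    proof (rule Lim_null_comparison)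
      show "\<forall>\<^sub>F h in at 0. norm ((flat_poly p (0 + h) - flat_poly p 0) / h) \<le> M * \<bar>h\<bar>"
      proof (rule always_eventually, rule allI)
        fix h :: real
        show "norm ((flat_poly p (0 + h) - flat_poly p 0) / h) \<le> M * \<bar>h\<bar>"
          using le[of h] M by (cases "h = 0") (auto simp: abs_divide flat_poly_def divide_le_eq power2_eq_square mult.assoc abs_mult[symmetric])
      qed
      show "(\<lambda>h. M * \<bar>h\<bar>) \<midarrow>0\<rightarrow> 0" by (auto intro!: tendsto_eq_intros)
    qed
    then show ?thesis using 2 by (simp add: DERIV_def flat_poly_def)
  qed
qed

lemma flat_poly_smooth_bdd: "smooth_bdd (flat_poly p)"
proof (rule smooth_bddI)
  fix n
  show "\<exists>B. derivs_le n B (flat_poly p)"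
  proof (induction n arbitrary: p)
    case 0
    then show ?case using flat_poly_bound[of p] by (metis derivs_le.simps(1))
  next
    case (Suc n)
    obtain B where B: "derivs_le n B (flat_poly ([:0, 0, 1:] * (p - pderiv p)))" using Suc by blast
    obtain M where M: "0 \<le> M" "\<And>x. \<bar>flat_poly p x\<bar> \<le> M" using flat_poly_bound by blast
    have "derivs_le (Suc n) (max M B) (flat_poly p)"
      by (rule derivs_le_SucI[OF _ flat_poly_DERIV derivs_le_mono[OF B]]) (use M in \<open>auto intro: max.coboundedI1\<close>)
    then show ?case by blast
  qed
qed

text \<open>The usual quotient \<open>g x / (g x + g (1 - x))\<close> with
  \<open>g x = exp (- (1 / x))\<close> for positive x. One of \<open>x\<close> and
  \<open>1 - x\<close> is at least 1/2, which keeps the denominator above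
  \<open>exp (- 2)\<close>.\<close>

lemma smooth_step_exists:
  obtains \<sigma> :: "real \<Rightarrow> real" where "smooth_bdd \<sigma>" "\<And>x. 0 \<le> \<sigma> x" "\<And>x. \<sigma> x \<le> 1" "\<And>x. x \<le> 0 \<Longrightarrow> \<sigma> x = 0" "\<And>x. 1 \<le> x \<Longrightarrow> \<sigma> x = 1"
proof -
  define g where "g = flat_poly 1"
  have g: "g x = (if 0 < x then exp (- (1 / x)) else 0)" for x by (simp add: g_def flat_poly_def)
  have g0: "0 \<le> g x" for x by (simp add: g)
  have gh: "exp (- 2) \<le> g x" if "1 / 2 \<le> x" for x using that by (simp add: g field_simps)
  have den: "exp (- 2) \<le> g x + g (1 - x)" for x
    using gh[of x] gh[of "1 - x"] g0[of x] g0[of "1 - x"] by (cases "1 / 2 \<le> x") auto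
  have D: "smooth_bdd g" unfolding g_def by (rule flat_poly_smooth_bdd)
  have D': "smooth_bdd (\<lambda>x. g (1 - x))"
    by (rule smooth_bdd_compose[OF D, where g' = "\<lambda>x. - 1"]) (auto intro!: derivative_eq_intros smooth_bdd_const)
  show thesis
  proof (rule that[of "\<lambda>x. g x * inverse (g x + g (1 - x))"])
    show "smooth_bdd (\<lambda>x. g x * inverse (g x + g (1 - x)))"
      by (intro smooth_bdd_mult smooth_bdd_inverse[of _ "exp (- 2)"] smooth_bdd_add D D' den) auto
    show "0 \<le> g x * inverse (g x + g (1 - x))" for x using g0 by (simp add: add_nonneg_nonneg)
    have "0 < g x + g (1 - x)" for x using den[of x] exp_gt_zero[of "-2 :: real"] by linarith
    then show "g x * inverse (g x + g (1 - x)) \<le> 1" for x using g0[of "1 - x"] by (simp add: divide_inverse[symmetric])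
    show "g x * inverse (g x + g (1 - x)) = 0" if "x \<le> 0" for x using that by (simp add: g)
    show "g x * inverse (g x + g (1 - x)) = 1" if "1 \<le> x" for x using that by (simp add: g)
  qed
qed

section \<open>Periodic bumps and profiles with prescribed plateaus\<close>

lemma smooth_bdd_cos: "smooth_bdd (\<lambda>x::real. cos (a * x + b))"
proof -
  have "derivs_le n 1 (\<lambda>x. cos (x + b)) \<and> derivs_le n 1 (\<lambda>x. sin (x + b)) \<and> derivs_le n 1 (\<lambda>x. - sin (x + b))" for n
  proof (induction n)
    case (Suc n)
    have "derivs_le (Suc n) 1 (\<lambda>x. cos (x + b))"
      by (rule derivs_le_SucI[where f' = "\<lambda>x. - sin (x + b)"]) (use Suc in \<open>auto intro!: derivative_eq_intros\<close>)
    moreover have "derivs_le (Suc n) 1 (\<lambda>x. sin (x + b))"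
      by (rule derivs_le_SucI[where f' = "\<lambda>x. cos (x + b)"]) (use Suc in \<open>auto intro!: derivative_eq_intros\<close>)
    ultimately show ?case using derivs_le_uminus by blast
  qed auto
  then have "smooth_bdd (\<lambda>x. cos (x + b))" by (intro smooth_bddI) blast
  then show ?thesis
    by (rule smooth_bdd_compose[where g' = "\<lambda>x. a"]) (auto intro!: derivative_eq_intros smooth_bdd_const)
qed

lemma cos_le_on_complement:
  assumes "0 \<le> a" "a \<le> y" "y \<le> 2 * pi - a"
  shows "cos y \<le> cos a"
proof (cases "y \<le> pi")
  case True
  then show ?thesis using assms by (intro cos_monotone_0_pi_le) auto
next
  case False
  have "cos y = cos (2 * pi - y)" by simp
  also have "\<dots> \<le> cos a" using assms False by (intro cos_monotone_0_pi_le) auto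
  finally show ?thesis .
qed

text \<open>A smooth step applied to a cosine is periodic without any gluing. The cosine centred at
  \<open>w / 2\<close> exceeds the level \<open>cos (pi * w)\<close> only inside the arc of length
  \<open>w\<close>, and is at least \<open>cos (pi * (w - 2 * \<delta>))\<close> on the arc
  shortened by \<delta> at both ends; \<open>v\<close> sends these two levels to 0 and 1.\<close>

lemma periodic_bump_exists:
  fixes w \<delta> :: real
  assumes "0 < \<delta>" "2 * \<delta> < w" "w \<le> 1"
  obtains \<beta> :: "real \<Rightarrow> real" where "smooth_bdd \<beta>" "\<And>x. 0 \<le> \<beta> x" "\<And>x. \<beta> x \<le> 1" "\<And>x. \<beta> (x + 1) = \<beta> x"
    "\<And>x. w \<le> x \<Longrightarrow> x \<le> 1 \<Longrightarrow> \<beta> x = 0" "\<And>x. \<delta> \<le> x \<Longrightarrow> x \<le> w - \<delta> \<Longrightarrow> \<beta> x = 1"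
proof -
  obtain \<sigma> :: "real \<Rightarrow> real" where \<sigma>: "smooth_bdd \<sigma>" "\<And>x. 0 \<le> \<sigma> x" "\<And>x. \<sigma> x \<le> 1" "\<And>x. x \<le> 0 \<Longrightarrow> \<sigma> x = 0" "\<And>x. 1 \<le> x \<Longrightarrow> \<sigma> x = 1"
    using smooth_step_exists by blast
  define \<kappa> where "\<kappa> = cos (pi * (w - 2 * \<delta>)) - cos (pi * w)"
  have \<kappa>: "0 < \<kappa>"
  proof -
    have "pi * w \<le> pi" using assms by simp
    then have "cos (pi * w) < cos (pi * (w - 2 * \<delta>))" using assms by (intro cos_monotone_0_pi) auto
    then show ?thesis by (simp add: \<kappa>_def)
  qed
  define v where "v x = (1 / \<kappa>) * (cos (2 * pi * x + - pi * w) - cos (pi * w))" for x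
  have v: "smooth_bdd v" unfolding v_def[abs_def] by (intro smooth_bdd_cmult smooth_bdd_diff smooth_bdd_cos smooth_bdd_const)
  show thesis
  proof (rule that[of "\<lambda>x. \<sigma> (v x)"])
    show "smooth_bdd (\<lambda>x. \<sigma> (v x))" by (rule smooth_bdd_compose[OF \<sigma>(1) smooth_bdd_deriv(2)[OF v] smooth_bdd_deriv(1)[OF v]])
    show "\<sigma> (v (x + 1)) = \<sigma> (v x)" for x
    proof -
      have "cos (2 * pi * (x + 1) + - pi * w) = cos ((2 * pi * x + - pi * w) + 2 * pi)" by (simp add: algebra_simps)
      also have "\<dots> = cos (2 * pi * x + - pi * w)" by (rule cos_periodic)
      finally show ?thesis by (simp add: v_def)
    qed
    show "\<sigma> (v x) = 0" if x: "w \<le> x" "x \<le> 1" for x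
    proof (rule \<sigma>(4))
      have "cos (2 * pi * x + - pi * w) \<le> cos (pi * w)"
      proof (rule cos_le_on_complement)
        show "0 \<le> pi * w" using assms by simp
        have "pi * w \<le> pi * x" "pi * x \<le> pi" using x by auto
        then show "pi * w \<le> 2 * pi * x + - pi * w" "2 * pi * x + - pi * w \<le> 2 * pi - pi * w" by auto
      qed
      then show "v x \<le> 0" using \<kappa> by (simp add: v_def divide_le_0_iff)
    qed
    show "\<sigma> (v x) = 1" if x: "\<delta> \<le> x" "x \<le> w - \<delta>" for x
    proof (rule \<sigma>(5))
      define y where "y = \<bar>2 * pi * x + - pi * w\<bar>"
      have "\<bar>2 * x - w\<bar> \<le> w - 2 * \<delta>" using x by auto
      then have "pi * \<bar>2 * x - w\<bar> \<le> pi * (w - 2 * \<delta>)" by simp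
      moreover have "y = pi * \<bar>2 * x - w\<bar>"
      proof -
        have "2 * pi * x + - pi * w = pi * (2 * x - w)" by (simp add: algebra_simps)
        then show ?thesis unfolding y_def by (simp only: abs_mult) simp
      qed
      moreover have "pi * (w - 2 * \<delta>) \<le> pi * 1" using assms by (intro mult_left_mono) auto
      ultimately have "cos (pi * (w - 2 * \<delta>)) \<le> cos y" by (intro cos_monotone_0_pi_le) (auto simp: y_def)
      then have "cos (pi * (w - 2 * \<delta>)) \<le> cos (2 * pi * x + - pi * w)" unfolding y_def by (simp only: cos_abs_real)
      then show "1 \<le> v x" using \<kappa> by (simp add: v_def \<kappa>_def)
    qed
  qed (use \<sigma> in auto)
qed

text \<open>t is the quotient of the upper and the lower value of the derivative, w the length of the arc
  where it exceeds the lower value, and \<delta> the length of each transition; the last two inequalities fix lo through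
  the mean value 1 of the derivative.\<close>

definition shape :: "real \<Rightarrow> real \<Rightarrow> real \<Rightarrow> (real \<Rightarrow> real) \<Rightarrow> real \<Rightarrow> bool" where
  "shape t w \<delta> \<phi> lo \<longleftrightarrow> diffeo \<phi> \<and> \<phi> 0 = 0 \<and> 0 < lo \<and> (\<forall>x. lo \<le> deriv \<phi> x \<and> deriv \<phi> x \<le> lo * t) \<and>
     (\<forall>x. w \<le> x \<and> x \<le> 1 \<longrightarrow> deriv \<phi> x = lo) \<and> (\<forall>x. \<delta> \<le> x \<and> x \<le> w - \<delta> \<longrightarrow> deriv \<phi> x = lo * t) \<and>
     1 \<le> lo * (1 + (t - 1) * w) \<and> lo * (1 + (t - 1) * (w - 2 * \<delta>)) \<le> 1"

text \<open>The derivative is prescribed up to a constant as \<open>1 + (t - 1) * \<beta>\<close>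
  and divided by its integral \<open>T\<close> over a period, so that \<open>lo = 1 / T\<close>. The
  lengths of the plateaus enclose \<open>T\<close> between the two expressions in
  \<open>shape\<close>.\<close>

lemma shape_exists:
  assumes t: "1 < t" and "0 < \<delta>" "2 * \<delta> < w" "w \<le> 1"
  obtains \<phi> lo where "shape t w \<delta> \<phi> lo"
proof -
  obtain \<beta> :: "real \<Rightarrow> real" where \<beta>: "smooth_bdd \<beta>" "\<And>x. 0 \<le> \<beta> x" "\<And>x. \<beta> x \<le> 1" "\<And>x. \<beta> (x + 1) = \<beta> x"
    "\<And>x. w \<le> x \<Longrightarrow> x \<le> 1 \<Longrightarrow> \<beta> x = 0" "\<And>x. \<delta> \<le> x \<Longrightarrow> x \<le> w - \<delta> \<Longrightarrow> \<beta> x = 1"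
    using periodic_bump_exists[OF assms(2-4)] by blast
  define \<psi> where "\<psi> x = 1 + (t - 1) * \<beta> x" for x
  have \<psi>: "smooth_bdd \<psi>" unfolding \<psi>_def[abs_def] by (intro smooth_bdd_add smooth_bdd_cmult smooth_bdd_const \<beta>)
  have \<psi>b: "1 \<le> \<psi> x" "\<psi> x \<le> t" for x
  proof -
    have "\<psi> x \<le> 1 + (t - 1) * 1" unfolding \<psi>_def using \<beta>(3) t by (intro add_left_mono mult_left_mono) auto
    then show "\<psi> x \<le> t" by simp
    show "1 \<le> \<psi> x" using \<beta>(2)[of x] t by (simp add: \<psi>_def)
  qed
  have "\<exists>F. \<forall>x :: real. -\<infinity> < ereal x \<longrightarrow> ereal x < \<infinity> \<longrightarrow> (F has_vector_derivative \<psi> x) (at x)"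
    by (rule einterval_antiderivative) (auto intro: DERIV_isCont[OF smooth_bdd_deriv(2)[OF \<psi>]])
  then obtain F where F: "\<And>x. (F has_real_derivative \<psi> x) (at x)"
    by (auto simp: has_real_derivative_iff_has_vector_derivative)
  have mvt: "a * (y - x) \<le> F y - F x \<and> F y - F x \<le> b * (y - x)"
    if xy: "x \<le> y" and ab: "\<And>z. x \<le> z \<Longrightarrow> z \<le> y \<Longrightarrow> a \<le> \<psi> z \<and> \<psi> z \<le> b" for a b x y
  proof (cases "x = y")
    case False
    then obtain z where z: "x < z" "z < y" "F y - F x = (y - x) * \<psi> z" using MVT2[of x y F \<psi>] xy F by auto
    then show ?thesis using ab[of z] xy by (simp add: mult.commute mult_left_mono)
  qed simp
  define T where "T = F 1 - F 0"
  have T1: "1 + (t - 1) * (w - 2 * \<delta>) \<le> T"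
  proof -
    have "1 * (\<delta> - 0) \<le> F \<delta> - F 0" using mvt[of 0 \<delta> 1 t] assms \<psi>b by auto
    moreover have "t * (w - \<delta> - \<delta>) \<le> F (w - \<delta>) - F \<delta>" using mvt[of \<delta> "w - \<delta>" t t] assms \<beta>(6) by (auto simp: \<psi>_def)
    moreover have "1 * (1 - (w - \<delta>)) \<le> F 1 - F (w - \<delta>)" using mvt[of "w - \<delta>" 1 1 t] assms \<psi>b by auto
    ultimately show ?thesis by (simp add: T_def algebra_simps)
  qed
  have T2: "T \<le> 1 + (t - 1) * w"
  proof -
    have "F w - F 0 \<le> t * (w - 0)" using mvt[of 0 w 1 t] assms \<psi>b by auto
    moreover have "F 1 - F w \<le> 1 * (1 - w)" using mvt[of w 1 1 1] assms \<beta>(5) by (auto simp: \<psi>_def)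
    ultimately show ?thesis by (simp add: T_def algebra_simps)
  qed
  have T0: "0 < T" using mvt[of 0 1 1 t] \<psi>b by (auto simp: T_def)
  \<comment> \<open>\<open>\<psi>\<close> is periodic, so the increment of \<open>F\<close> over a
    period is the same from every starting point.\<close>
  have Fper: "F (x + 1) - F x = T" for x
  proof -
    have "((\<lambda>x. F (x + 1) - F x) has_real_derivative \<psi> (x + 1) - \<psi> x) (at x)" for x
      by (intro derivative_intros DERIV_shift[THEN iffD1] F)
    then have "((\<lambda>x. F (x + 1) - F x) has_real_derivative 0) (at x)" for x by (simp add: \<psi>_def \<beta>)
    then have "F (x + 1) - F x = F (0 + 1) - F 0" using DERIV_isconst_all[of "\<lambda>x. F (x + 1) - F x" x 0] by blast
    then show ?thesis by (simp add: T_def)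
  qed
  define \<phi> where "\<phi> x = (1 / T) * (F x - F 0)" for x
  have D: "(\<phi> has_real_derivative (1 / T) * \<psi> x) (at x)" for x
    unfolding \<phi>_def[abs_def] by (rule DERIV_cmult) (rule DERIV_cong[OF DERIV_diff[OF F DERIV_const]], simp)
  have d: "deriv \<phi> x = (1 / T) * \<psi> x" for x by (rule DERIV_imp_deriv[OF D])
  have "diffeo \<phi>"
  proof (rule diffeoI[OF D smooth_bdd_cmult[OF \<psi>]])
    show "0 < 1 / T" using T0 by simp
    show "1 / T \<le> 1 / T * \<psi> x" for x using \<psi>b(1)[of x] T0 by (simp add: divide_right_mono)
    show "\<phi> (x + 1) = \<phi> x + 1" for x
      using Fper[of x] T0 by (simp add: \<phi>_def field_simps)
  qed
  then have "shape t w \<delta> \<phi> (1 / T)"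
    unfolding shape_def d using T0 T1 T2 \<psi>b \<beta>(5,6)
    by (auto simp: \<phi>_def \<psi>_def divide_right_mono)
  then show thesis by (rule that)
qed

section \<open>Lebesgue measure on the circle\<close>

lemma diffeo_image_lebesgue:
  assumes F: "diffeo F" and S: "S \<in> sets lebesgue"
  shows "F ` S \<in> sets lebesgue"
proof (rule differentiable_image_in_sets_lebesgue[OF S])
  show "F differentiable_on S"
    using diffeo_DERIV_within[OF F] by (auto simp: differentiable_on_def real_differentiable_def)
qed simp

lemma diffeo_vimage_lebesgue:
  assumes F: "diffeo F" and S: "S \<in> sets lebesgue"
  shows "F -` S \<in> sets lebesgue"
  using diffeo_image_lebesgue[OF diffeo_inv[OF F] S] bij_vimage_eq_inv_image[OF diffeo_bij[OF F]] by metis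

text \<open>The change of variables formula speaks about absolutely integrable functions; confining
  \<open>S\<close> to an interval makes the measure of the image finite and the constant 1
  integrable on it.\<close>

lemma emeasure_diffeo_image:
  assumes F: "diffeo F" and S: "S \<in> sets lebesgue" "S \<subseteq> {a..b}"
  shows "emeasure lebesgue (F ` S) = (\<integral>\<^sup>+x. ennreal (deriv F x) * indicator S x \<partial>lebesgue)"
proof -
  have "F ` S \<subseteq> {F a..F b}" using S(2) diffeo_le_iff[OF F] by auto
  then have bd: "bounded (F ` S)" using bounded_closed_interval bounded_subset by blast
  then have lm: "F ` S \<in> lmeasurable"
    using diffeo_image_lebesgue[OF F S(1)] bounded_set_imp_lmeasurable by blast
  let ?b = "measure lebesgue (F ` S)"
  have "(\<lambda>x. 1 :: real) absolutely_integrable_on F ` S \<and> integral (F ` S) (\<lambda>x. 1) = ?b"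
    using lm lmeasurable_iff_integrable_on lmeasure_integral[OF lm] by (auto simp: absolutely_integrable_on_iff_nonneg)
  then have "(\<lambda>x. \<bar>deriv F x\<bar> * 1) absolutely_integrable_on S \<and> integral S (\<lambda>x. \<bar>deriv F x\<bar> * 1) = ?b"
    using has_absolute_integral_change_of_variables_1'[OF S(1) diffeo_DERIV_within[OF F], of "\<lambda>x. 1" ?b] diffeo_inj[OF F] inj_on_subset
    by auto
  then have "(deriv F has_integral ?b) S"
    using diffeo_deriv_pos[OF F] by (auto simp: abs_of_pos set_lebesgue_integral_eq_integral(1) intro!: integrable_integral has_integral_integrable_integral[THEN iffD2])
  then have "(\<integral>\<^sup>+x. ennreal (deriv F x) * indicator S x \<partial>lborel) = ennreal ?b"
    using diffeo_deriv_pos[OF F] less_imp_le by (intro nn_integral_has_integral_lebesgue') auto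
  then show ?thesis using lm by (simp add: nn_integral_completion emeasure_eq_measure2)
qed

lemma emeasure_lebesgue_shift: "emeasure lebesgue ((\<lambda>x. x + c) ` S) = emeasure lebesgue (S :: real set)"
  using emeasure_lebesgue_affine[of 1 c S] by (simp add: add.commute)

text \<open>The half-open interval contains an integer; cutting there and translating both pieces by
  integers reassembles \<open>[0, 1)\<close>.\<close>

lemma emeasure_fundamental_domain:
  fixes P :: "real set"
  assumes P: "P \<in> sets lebesgue" and per: "\<And>x. x + 1 \<in> P \<longleftrightarrow> x \<in> P"
  shows "emeasure lebesgue (P \<inter> {a..<a + 1}) = emeasure lebesgue (P \<inter> {0..<1})"
proof -
  have pern: "x + real n \<in> P \<longleftrightarrow> x \<in> P" for x n
  proof (induction n)
    case (Suc n)
    then show ?case using per[of "x + real n"] by (simp add: add_ac)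
  qed simp
  have peri: "x + of_int k \<in> P \<longleftrightarrow> x \<in> P" for x k
  proof (cases k rule: int_cases2)
    case (nonpos n)
    then show ?thesis using pern[of "x + of_int k" n] by simp
  qed (use pern in simp)
  define n where "n = \<lceil>a\<rceil>"
  have n: "a \<le> of_int n" "of_int n < a + 1" unfolding n_def by linarith+
  have e1: "(\<lambda>x. x + of_int n) ` (P \<inter> {0..<a + 1 - of_int n}) = P \<inter> {of_int n..<a + 1}"
  proof (intro equalityI subsetI)
    fix y assume "y \<in> P \<inter> {of_int n..<a + 1}"
    then show "y \<in> (\<lambda>x. x + of_int n) ` (P \<inter> {0..<a + 1 - of_int n})"
      using peri[of "y - of_int n" n] by (intro image_eqI[of _ _ "y - of_int n"]) auto
  qed (auto simp: peri)
  have e2: "(\<lambda>x. x + of_int (n - 1)) ` (P \<inter> {a + 1 - of_int n..<1}) = P \<inter> {a..<of_int n}"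
  proof (intro equalityI subsetI)
    fix y assume "y \<in> P \<inter> {a..<of_int n}"
    then show "y \<in> (\<lambda>x. x + of_int (n - 1)) ` (P \<inter> {a + 1 - of_int n..<1})"
      using peri[of "y - of_int (n - 1)" "n - 1"] by (intro image_eqI[of _ _ "y - of_int (n - 1)"]) auto
  qed (auto simp: peri simp del: of_int_diff)
  have "P \<inter> {a..<a + 1} = (P \<inter> {of_int n..<a + 1}) \<union> (P \<inter> {a..<of_int n})" using n by auto
  then have "emeasure lebesgue (P \<inter> {a..<a + 1}) = emeasure lebesgue (P \<inter> {of_int n..<a + 1}) + emeasure lebesgue (P \<inter> {a..<of_int n})"
    using P by (simp, subst plus_emeasure) auto
  also have "\<dots> = emeasure lebesgue (P \<inter> {0..<a + 1 - of_int n}) + emeasure lebesgue (P \<inter> {a + 1 - of_int n..<1})"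
    unfolding e1[symmetric] e2[symmetric] emeasure_lebesgue_shift ..
  also have "\<dots> = emeasure lebesgue ((P \<inter> {0..<a + 1 - of_int n}) \<union> (P \<inter> {a + 1 - of_int n..<1}))"
    using P by (subst plus_emeasure) auto
  also have "(P \<inter> {0..<a + 1 - of_int n}) \<union> (P \<inter> {a + 1 - of_int n..<1}) = P \<inter> {0..<1}" using n by auto
  finally show ?thesis .
qed

section \<open>Circle maps and functions given by periodic data on the line\<close>

lemma proj_eq_iff: "proj x = proj y \<longleftrightarrow> (\<exists>k::int. x = y + of_int k)"
proof -
  have "proj x = proj y \<longleftrightarrow> x - y \<in> \<int>" by (rule circle.abs_eq_iff)
  also have "\<dots> \<longleftrightarrow> (\<exists>k::int. x = y + of_int k)"
    by (metis Ints_cases Ints_of_int add_diff_cancel_left' diff_add_cancel add.commute)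
  finally show ?thesis .
qed

lemma proj_rep [simp]: "proj (rep_circle c) = c"
  by (rule Quotient3_abs_rep[OF Quotient3_circle])

lemma proj_surj: obtains x where "c = proj x"
  by (metis proj_rep)

lemma rep_proj: obtains k :: int where "rep_circle (proj x) = x + of_int k"
  using proj_eq_iff[of "rep_circle (proj x)" x] by auto

lemma proj_add_int [simp]: "proj (x + of_int k) = proj x"
  using proj_eq_iff by blast

lemma proj_add_1 [simp]: "proj (x + 1) = proj x"
  using proj_add_int[of x 1] by simp

text \<open>\<open>rep_circle\<close> picks an arbitrary representative, not the one in
  \<open>[0, 1)\<close>; for lifts commuting with integer translations the choice does not matter,
  which is \<open>cmap_proj\<close>.\<close>

definition cmap :: "(real \<Rightarrow> real) \<Rightarrow> circle \<Rightarrow> circle" where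
  "cmap G c = proj (G (rep_circle c))"

definition cfun :: "(real \<Rightarrow> real) \<Rightarrow> circle \<Rightarrow> real" where
  "cfun h c = h (rep_circle c)"

lemma cmap_proj: "diffeo G \<Longrightarrow> cmap G (proj x) = proj (G x)"
  unfolding cmap_def by (metis rep_proj diffeo_add_int proj_add_int)

lemma cfun_proj: "(\<And>x. h (x + 1) = h x) \<Longrightarrow> cfun h (proj x) = h x"
proof -
  assume h: "\<And>x. h (x + 1) = h x"
  have hn: "h (x + real n) = h x" for x n
  proof (induction n)
    case (Suc n)
    then show ?case using h[of "x + real n"] by (simp add: add_ac)
  qed simp
  obtain k :: int where k: "rep_circle (proj x) = x + of_int k" by (rule rep_proj)
  show ?thesis
  proof (cases k rule: int_cases2)
    case (nonpos n)
    then show ?thesis using hn[of "x + of_int k" n] k by (simp add: cfun_def)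
  qed (use hn k in \<open>simp add: cfun_def\<close>)
qed

lemma cfun_deriv_proj: "diffeo G \<Longrightarrow> cfun (deriv G) (proj x) = deriv G x"
  by (rule cfun_proj) (use diffeo_deriv_add_int[of G _ 1] in simp)

lemma cmap_comp: "diffeo G \<Longrightarrow> diffeo H \<Longrightarrow> cmap G (cmap H c) = cmap (\<lambda>x. G (H x)) c"
  by (metis cmap_proj cmap_def)

lemma cmap_id [simp]: "cmap (\<lambda>x. x) c = c"
  by (simp add: cmap_def)

lemma cmap_inv1 [simp]: "diffeo G \<Longrightarrow> cmap G (cmap (inv G) c) = c"
  by (simp add: cmap_comp diffeo_inv)

lemma cmap_inv2 [simp]: "diffeo G \<Longrightarrow> cmap (inv G) (cmap G c) = c"
  by (simp add: cmap_comp diffeo_inv)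

lemma cmap_bij: "diffeo G \<Longrightarrow> bij (cmap G)"
  by (rule bij_betw_byWitness[of _ "cmap (inv G)"]) auto

lemma inv_cmap: "diffeo G \<Longrightarrow> inv (cmap G) = cmap (inv G)"
  by (rule inv_unique_comp) (auto simp: fun_eq_iff)

lemma cmap_funpow: "diffeo G \<Longrightarrow> cmap G ^^ n = cmap (G ^^ n)"
proof (induction n)
  case 0
  then show ?case by (auto simp: fun_eq_iff cmap_def)
next
  case (Suc n)
  then show ?case using cmap_comp[OF _ diffeo_funpow, of G G n] by (auto simp: fun_eq_iff comp_def)
qed

lemma vimage_proj_cmap_image: "diffeo G \<Longrightarrow> proj -` (cmap G ` A) = G ` (proj -` A)"
proof (intro equalityI subsetI)
  fix y assume G: "diffeo G" and "y \<in> proj -` (cmap G ` A)"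
  then obtain c where c: "c \<in> A" "proj y = cmap G c" by auto
  obtain x where x: "c = proj x" by (rule proj_surj)
  obtain k :: int where "y = G x + of_int k" using c x cmap_proj[OF G] proj_eq_iff by metis
  then have "y = G (x + of_int k)" by (simp add: diffeo_add_int[OF G])
  then show "y \<in> G ` (proj -` A)" using c x by (intro image_eqI[of _ _ "x + of_int k"]) auto
qed (auto simp: cmap_proj[symmetric])

lemma vimage_proj_cmap_vimage: "diffeo G \<Longrightarrow> proj -` (cmap G -` A) = G -` (proj -` A)"
  by (auto simp: cmap_proj)

lemma cmap_image_eq: "diffeo G \<Longrightarrow> cmap G ` A = cmap (inv G) -` A"
  by (auto simp: image_iff intro!: bexI[of _ "cmap (inv G) _"])

lemma cmap_vimage_eq: "diffeo G \<Longrightarrow> cmap G -` A = cmap (inv G) ` A"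
  using bij_vimage_eq_inv_image[OF cmap_bij, of G A] inv_cmap[of G] by simp

section \<open>Lebesgue measure of the circle under diffeomorphisms\<close>

abbreviation "cm \<equiv> circle_measure"

lemma sets_cm_iff: "A \<in> sets cm \<longleftrightarrow> proj -` A \<in> sets lebesgue"
  by (simp add: sets_circle_measure)

lemma cmap_image_sets: "diffeo G \<Longrightarrow> A \<in> sets cm \<Longrightarrow> cmap G ` A \<in> sets cm"
  by (simp add: sets_cm_iff vimage_proj_cmap_image diffeo_image_lebesgue)

lemma cmap_measurable: "diffeo G \<Longrightarrow> cmap G \<in> measurable cm cm"
  by (rule measurableI) (simp_all add: sets_cm_iff vimage_proj_cmap_vimage diffeo_vimage_lebesgue)

lemma cfun_measurable:
  assumes "continuous_on UNIV h" "\<And>x. h (x + 1) = h x"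
  shows "cfun h \<in> borel_measurable cm"
proof (rule measurableI)
  fix B :: "real set" assume "B \<in> sets borel"
  have "proj -` (cfun h -` B) = h -` B" using cfun_proj[of h, OF assms(2)] by auto
  moreover have "h -` B \<in> sets borel"
    using measurable_sets[OF borel_measurable_continuous_onI[OF assms(1)] \<open>B \<in> sets borel\<close>] by simp
  ultimately show "cfun h -` B \<inter> space cm \<in> sets cm" by (simp add: sets_cm_iff)
qed auto

lemma cfun_deriv_measurable: "diffeo G \<Longrightarrow> cfun (deriv G) \<in> borel_measurable cm"
  by (rule cfun_measurable) (use diffeo_deriv_cont diffeo_deriv_add_int[of G _ 1] in auto)

lemma cfun_deriv_pos: "diffeo G \<Longrightarrow> 0 < cfun (deriv G) c"
  by (simp add: cfun_def diffeo_deriv_pos)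

lemma nn_integral_cm:
  assumes f: "f \<in> borel_measurable cm"
  shows "integral\<^sup>N cm f = (\<integral>\<^sup>+x. f (proj x) * indicator {0..<1} x \<partial>lebesgue)"
proof -
  let ?s = "sigma UNIV {A. proj -` A \<in> sets lebesgue}"
  have "proj \<in> measurable (lebesgue_on {0..<1}) ?s"
    by (rule measurable_sigma_sets) (auto simp: sets_restrict_space)
  then have "integral\<^sup>N cm f = (\<integral>\<^sup>+x. f (proj x) \<partial>lebesgue_on {0..<1})"
    using f unfolding circle_measure_def by (rule nn_integral_distr)
  also have "\<dots> = (\<integral>\<^sup>+x. f (proj x) * indicator {0..<1} x \<partial>lebesgue)"
    by (rule nn_integral_restrict_space) auto
  finally show ?thesis .
qed

text \<open>A lift sends \<open>[0, 1)\<close> to \<open>[G 0, G 0 + 1)\<close>, again a fundamental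
  domain. The image may therefore be measured there, where it is the image of a subset of
  \<open>[0, 1)\<close> and the change of variables applies.\<close>

lemma emeasure_cmap_image:
  assumes G: "diffeo G" and A: "A \<in> sets cm"
  shows "emeasure cm (cmap G ` A) = (\<integral>\<^sup>+c. ennreal (cfun (deriv G) c) * indicator A c \<partial>cm)"
proof -
  let ?P = "proj -` A"
  have P: "?P \<in> sets lebesgue" using A by (simp add: sets_cm_iff)
  have GP: "x + 1 \<in> G ` ?P \<longleftrightarrow> x \<in> G ` ?P" for x
    unfolding vimage_proj_cmap_image[OF G, symmetric] by simp
  have "emeasure cm (cmap G ` A) = emeasure lebesgue (G ` ?P \<inter> {0..<1})"
    using emeasure_circle_measure[OF cmap_image_sets[OF G A]] by (simp add: vimage_proj_cmap_image[OF G])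
  also have "\<dots> = emeasure lebesgue (G ` ?P \<inter> {G 0..<G 0 + 1})"
    by (rule emeasure_fundamental_domain[symmetric, OF diffeo_image_lebesgue[OF G P] GP])
  also have "G ` ?P \<inter> {G 0..<G 0 + 1} = G ` (?P \<inter> {0..<1})"
    using diffeo_add_1[OF G, of 0] diffeo_le_iff[OF G] diffeo_less_iff[OF G, of _ 1] by auto
  also have "emeasure lebesgue \<dots> = (\<integral>\<^sup>+x. ennreal (deriv G x) * indicator (?P \<inter> {0..<1}) x \<partial>lebesgue)"
    by (rule emeasure_diffeo_image[OF G, of _ 0 1]) (use P in auto)
  also have "\<dots> = (\<integral>\<^sup>+x. (ennreal (cfun (deriv G) (proj x)) * indicator A (proj x)) * indicator {0..<1} x \<partial>lebesgue)"
    by (intro nn_integral_cong) (auto simp: cfun_deriv_proj[OF G] indicator_def)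
  also have "\<dots> = (\<integral>\<^sup>+c. ennreal (cfun (deriv G) c) * indicator A c \<partial>cm)"
    by (rule nn_integral_cm[symmetric]) (use cfun_deriv_measurable[OF G] A in measurable)
  finally show ?thesis .
qed

lemma emeasure_cm_UNIV: "emeasure cm UNIV = 1"
proof -
  have "emeasure cm UNIV = emeasure lebesgue {0..<1::real}"
    using emeasure_circle_measure[of UNIV] sets.top[of cm] by simp
  then show ?thesis by simp
qed

interpretation cm: finite_measure cm
  by (rule finite_measureI) (simp add: emeasure_cm_UNIV)

text \<open>This fits the convention of the ratio set: the density of the push-forward under the
  inverse is the derivative of the map itself.\<close>

lemma distr_cmap_inv:
  assumes G: "diffeo G"
  shows "distr cm cm (cmap (inv G)) = density cm (\<lambda>c. ennreal (cfun (deriv G) c))"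
proof (rule measure_eqI)
  fix A assume "A \<in> sets (distr cm cm (cmap (inv G)))"
  then have A: "A \<in> sets cm" by simp
  have "emeasure (distr cm cm (cmap (inv G))) A = emeasure cm (cmap G ` A)"
    using A cmap_measurable[OF diffeo_inv[OF G]] by (simp add: emeasure_distr cmap_image_eq[OF G])
  also have "\<dots> = emeasure (density cm (\<lambda>c. ennreal (cfun (deriv G) c))) A"
    using A cfun_deriv_measurable[OF G] by (simp add: emeasure_cmap_image[OF G] emeasure_density)
  finally show "emeasure (distr cm cm (cmap (inv G))) A = emeasure (density cm (\<lambda>c. ennreal (cfun (deriv G) c))) A" .
qed simp

lemma inv_inv_diffeo: "diffeo G \<Longrightarrow> inv (inv G) = G"
  by (simp add: inv_inv_eq diffeo_bij)

lemma equivalent_density: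
  assumes f: "f \<in> borel_measurable M" and pos: "AE x in M. 0 < f x"
  shows "equivalent_measures M (density M f)"
proof -
  have "absolutely_continuous (density M f) M"
    unfolding absolutely_continuous_def
  proof
    fix N assume "N \<in> null_sets (density M f)"
    then have N: "N \<in> sets M" "AE x in M. x \<in> N \<longrightarrow> f x = 0"
      using null_sets_density_iff[OF f] by auto
    have "AE x in M. x \<notin> N" using N(2) pos by eventually_elim auto
    then show "N \<in> null_sets M" using N(1) AE_iff_null_sets by blast
  qed
  moreover have "absolutely_continuous M (density M f)"
    unfolding absolutely_continuous_def
  proof
    fix N assume N: "N \<in> null_sets M"
    then have "AE x in M. x \<notin> N" by (rule AE_not_in)
    then show "N \<in> null_sets (density M f)" using N null_sets_density_iff[OF f] by auto
  qed
  ultimately show ?thesis by (simp add: equivalent_measures_def)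
qed

lemma cmap_nonsingular:
  assumes G: "diffeo G"
  shows "nonsingular_automorphism cm (cmap G)"
proof -
  have "distr cm cm (cmap G) = density cm (\<lambda>c. ennreal (cfun (deriv (inv G)) c))"
    using distr_cmap_inv[OF diffeo_inv[OF G]] by (simp add: inv_inv_diffeo[OF G])
  moreover have "equivalent_measures cm (density cm (\<lambda>c. ennreal (cfun (deriv (inv G)) c)))"
    using cfun_deriv_measurable[OF diffeo_inv[OF G]] cfun_deriv_pos[OF diffeo_inv[OF G]] by (intro equivalent_density) auto
  ultimately show ?thesis
    using cmap_bij[OF G] cmap_measurable[OF G] cmap_measurable[OF diffeo_inv[OF G]]
    by (simp add: nonsingular_automorphism_def inv_cmap[OF G])
qed

section \<open>Integer iterates and their Radon-Nikodym derivatives\<close>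

definition iter :: "(real \<Rightarrow> real) \<Rightarrow> int \<Rightarrow> real \<Rightarrow> real" where
  "iter G i = (if 0 \<le> i then G ^^ nat i else inv G ^^ nat (- i))"

lemma iter_diffeo: "diffeo G \<Longrightarrow> diffeo (iter G i)"
  by (simp add: iter_def diffeo_funpow diffeo_inv)

lemma funpow_inv_funpow: "diffeo G \<Longrightarrow> (G ^^ n) ((inv G ^^ n) x) = x"
proof (induction n arbitrary: x)
  case (Suc n)
  then show ?case by (simp add: funpow_swap1)
qed simp

lemma iter_inverse: "diffeo G \<Longrightarrow> iter G i (iter G (- i) x) = x"
  using funpow_inv_funpow[of G "nat i"] funpow_inv_funpow[OF diffeo_inv, of G "nat (- i)"]
  by (auto simp: iter_def inv_inv_diffeo)

lemma inv_iter: "diffeo G \<Longrightarrow> inv (iter G i) = iter G (- i)"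
  by (rule inv_unique_comp) (use iter_inverse[of G i] iter_inverse[of G "- i"] in \<open>auto simp: fun_eq_iff\<close>)

lemma int_iterate_cmap: "diffeo G \<Longrightarrow> int_iterate cm (cmap G) i = cmap (iter G i)"
  by (simp add: int_iterate_def iter_def inv_cmap cmap_funpow diffeo_inv)

lemma deriv_iter_neg: "diffeo G \<Longrightarrow> cfun (deriv (iter G (- i))) (cmap (iter G i) c) = inverse (cfun (deriv (iter G i)) c)"
proof -
  assume G: "diffeo G"
  obtain x where c: "c = proj x" by (rule proj_surj)
  have "deriv (inv (iter G i)) (iter G i x) = inverse (deriv (iter G i) x)"
    using iter_diffeo[OF G] by (simp add: diffeo_deriv_inv)
  then show ?thesis
    using iter_diffeo[OF G] by (simp add: c cmap_proj cfun_deriv_proj inv_iter[OF G])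
qed

lemma RN_deriv_iterate:
  assumes G: "diffeo G"
  shows "AE c in cm. RN_deriv cm (distr cm cm (int_iterate cm (cmap G) (- i))) c = ennreal (cfun (deriv (iter G i)) c)"
proof -
  have "distr cm cm (int_iterate cm (cmap G) (- i)) = density cm (\<lambda>c. ennreal (cfun (deriv (iter G i)) c))"
    using distr_cmap_inv[OF iter_diffeo[OF G], of i] by (simp add: int_iterate_cmap[OF G] inv_iter[OF G])
  then have "AE c in cm. ennreal (cfun (deriv (iter G i)) c) = RN_deriv cm (distr cm cm (int_iterate cm (cmap G) (- i))) c"
    using cfun_deriv_measurable[OF iter_diffeo[OF G]] by (intro cm.RN_deriv_unique) auto
  then show ?thesis by eventually_elim simp
qed

text \<open>Radon-Nikodym derivatives are fixed only almost everywhere, so in both directions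
  \<open>B\<close> is trimmed by a null set; on the rest the number \<open>s\<close> of the
  definition is the true derivative.\<close>

lemma ratio_set_cmap:
  assumes G: "diffeo G"
  shows "t \<in> ratio_set cm (cmap G) \<longleftrightarrow> 0 \<le> t \<and>
    (\<forall>A\<in>sets cm. \<forall>\<epsilon>>0. 0 < emeasure cm A \<longrightarrow> (\<exists>B\<in>sets cm. \<exists>i. 0 < emeasure cm B \<and> B \<subseteq> A \<and>
       cmap (iter G i) ` B \<subseteq> A \<and> (\<forall>c\<in>B. \<bar>cfun (deriv (iter G i)) c - t\<bar> < \<epsilon>)))" (is "_ \<longleftrightarrow> ?R")
proof -
  let ?RN = "\<lambda>i. RN_deriv cm (distr cm cm (int_iterate cm (cmap G) (- i)))"
  let ?D = "\<lambda>i. cfun (deriv (iter G i))"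
  have restrict: "\<exists>B'\<in>sets cm. emeasure cm B' = emeasure cm B \<and> B' \<subseteq> B \<and> (\<forall>c\<in>B'. ?RN i c = ennreal (?D i c))"
    if B: "B \<in> sets cm" for B i
  proof -
    obtain N where N: "N \<in> null_sets cm" "\<And>c. c \<notin> N \<Longrightarrow> ?RN i c = ennreal (?D i c)"
      using AE_E3[OF RN_deriv_iterate[OF G, of i]] by auto
    show ?thesis
      using N B emeasure_Diff_null_set[OF N(1) B] by (intro bexI[of _ "B - N"]) auto
  qed
  have Dpos: "0 < ?D i c" for i c by (rule cfun_deriv_pos[OF iter_diffeo[OF G]])
  show ?thesis
  proof
    assume t: "t \<in> ratio_set cm (cmap G)"
    show ?R
    proof (intro conjI ballI allI impI)
      show "0 \<le> t" using t by (simp add: ratio_set_def)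
      fix A and \<epsilon> :: real assume A: "A \<in> sets cm" "0 < \<epsilon>" "0 < emeasure cm A"
      have "\<forall>A \<in> sets cm. \<forall>\<epsilon>::real. emeasure cm A > 0 \<longrightarrow> \<epsilon> > 0 \<longrightarrow>
        (\<exists>B \<in> sets cm. \<exists>i::int. emeasure cm B > 0 \<and> B \<subseteq> A \<and> int_iterate cm (cmap G) i ` B \<subseteq> A \<and>
           (\<forall>x\<in>B. \<exists>s \<in> {t - \<epsilon><..<t + \<epsilon>}. 0 \<le> s \<and> ?RN i x = ennreal s))"
        using t unfolding ratio_set_def mem_Collect_eq by (rule conjunct2)
      from this[rule_format, OF A(1,3,2)]
      obtain B i where B: "B \<in> sets cm" "0 < emeasure cm B" "B \<subseteq> A" "int_iterate cm (cmap G) i ` B \<subseteq> A"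
        and B5: "\<forall>c\<in>B. \<exists>s\<in>{t - \<epsilon><..<t + \<epsilon>}. 0 \<le> s \<and> ?RN i c = ennreal s" by (elim bexE exE conjE)
      obtain B' where B': "B' \<in> sets cm" "emeasure cm B' = emeasure cm B" "B' \<subseteq> B" "\<And>c. c \<in> B' \<Longrightarrow> ?RN i c = ennreal (?D i c)"
        using restrict[OF B(1), of i] by (elim bexE conjE) (rule that, assumption, assumption, assumption, erule (1) bspec)
      have "\<bar>?D i c - t\<bar> < \<epsilon>" if c: "c \<in> B'" for c
      proof -
        obtain s where s: "s \<in> {t - \<epsilon><..<t + \<epsilon>}" "0 \<le> s" "?RN i c = ennreal s" using B5 B'(3) c by blast
        then have "?D i c = s" using B'(4)[OF c] Dpos[of i c] by (simp add: less_imp_le)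
        then show ?thesis using s by auto
      qed
      then have "\<forall>c\<in>B'. \<bar>?D i c - t\<bar> < \<epsilon>" by (rule ballI)
      moreover have "cmap (iter G i) ` B' \<subseteq> A"
        using image_mono[OF B'(3)] B(4) unfolding int_iterate_cmap[OF G] by (rule subset_trans)
      moreover have "0 < emeasure cm B'" "B' \<subseteq> A" using B B' by auto
      ultimately show "\<exists>B\<in>sets cm. \<exists>i. 0 < emeasure cm B \<and> B \<subseteq> A \<and>
         cmap (iter G i) ` B \<subseteq> A \<and> (\<forall>c\<in>B. \<bar>?D i c - t\<bar> < \<epsilon>)"
        by (intro bexI[OF _ B'(1)] exI[of _ i] conjI)
    qed
  next
    assume R: ?R
    show "t \<in> ratio_set cm (cmap G)"
      unfolding ratio_set_def
    proof (intro CollectI conjI ballI allI impI)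
      show "0 \<le> t" using R by simp
      fix A and \<epsilon> :: real assume A: "A \<in> sets cm" "0 < emeasure cm A" "0 < \<epsilon>"
      have "\<forall>A\<in>sets cm. \<forall>\<epsilon>>0. 0 < emeasure cm A \<longrightarrow> (\<exists>B\<in>sets cm. \<exists>i. 0 < emeasure cm B \<and> B \<subseteq> A \<and>
         cmap (iter G i) ` B \<subseteq> A \<and> (\<forall>c\<in>B. \<bar>?D i c - t\<bar> < \<epsilon>))" using R by (rule conjunct2)
      from this[rule_format, OF A(1,3,2)]
      obtain B i where B: "B \<in> sets cm" "0 < emeasure cm B" "B \<subseteq> A" "cmap (iter G i) ` B \<subseteq> A"
        and B5: "\<forall>c\<in>B. \<bar>?D i c - t\<bar> < \<epsilon>" by (elim bexE exE conjE)
      obtain B' where B': "B' \<in> sets cm" "emeasure cm B' = emeasure cm B" "B' \<subseteq> B" "\<And>c. c \<in> B' \<Longrightarrow> ?RN i c = ennreal (?D i c)"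
        using restrict[OF B(1), of i] by (elim bexE conjE) (rule that, assumption, assumption, assumption, erule (1) bspec)
      have "\<exists>s\<in>{t - \<epsilon><..<t + \<epsilon>}. 0 \<le> s \<and> ?RN i c = ennreal s" if c: "c \<in> B'" for c
      proof (rule bexI[of _ "?D i c"])
        show "0 \<le> ?D i c \<and> ?RN i c = ennreal (?D i c)" using B'(4)[OF c] Dpos[of i c] by simp
        show "?D i c \<in> {t - \<epsilon><..<t + \<epsilon>}" using bspec[OF B5, of c] B'(3) c by (auto simp: abs_less_iff)
      qed
      then have "\<forall>x\<in>B'. \<exists>s \<in> {t - \<epsilon><..<t + \<epsilon>}. 0 \<le> s \<and> ?RN i x = ennreal s" by (rule ballI)
      moreover have "0 < emeasure cm B'" "B' \<subseteq> A" using B B' by auto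
      moreover have "int_iterate cm (cmap G) i ` B' \<subseteq> A" using B(4) B'(3) unfolding int_iterate_cmap[OF G] by auto
      ultimately show "\<exists>B\<in>sets cm. \<exists>i. emeasure cm B > 0 \<and> B \<subseteq> A \<and> int_iterate cm (cmap G) i ` B \<subseteq> A \<and>
           (\<forall>x\<in>B. \<exists>s \<in> {t - \<epsilon><..<t + \<epsilon>}. 0 \<le> s \<and>
              RN_deriv cm (distr cm cm (int_iterate cm (cmap G) (- i))) x = ennreal s)"
        by (intro bexI[OF _ B'(1)] exI[of _ i] conjI)
    qed
  qed
qed

section \<open>The ratio set\<close>

lemma cmap_image_null_iff:
  assumes F: "diffeo F" and B: "B \<in> sets cm"
  shows "emeasure cm (cmap F ` B) = 0 \<longleftrightarrow> emeasure cm B = 0"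
proof -
  have *: "emeasure cm (cmap F ` B) = 0" if "diffeo F" "B \<in> sets cm" "emeasure cm B = 0" for F B
  proof -
    have "AE c in cm. c \<notin> B" using that by (intro AE_not_in) auto
    then have "(\<integral>\<^sup>+c. ennreal (cfun (deriv F) c) * indicator B c \<partial>cm) = (\<integral>\<^sup>+c. 0 \<partial>cm)"
      by (intro nn_integral_cong_AE) auto
    then show ?thesis using emeasure_cmap_image[OF that(1,2)] by simp
  qed
  have "cmap (inv F) ` (cmap F ` B) = B" using F by (simp add: image_image)
  then show ?thesis using *[OF F B] *[OF diffeo_inv[OF F] cmap_image_sets[OF F B]] by metis
qed

lemma cmap_image_pos: "diffeo F \<Longrightarrow> B \<in> sets cm \<Longrightarrow> 0 < emeasure cm B \<Longrightarrow> 0 < emeasure cm (cmap F ` B)"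
  using cmap_image_null_iff by (simp add: zero_less_iff_neq_zero)

lemma cmap_image_le:
  assumes F: "diffeo F" and B: "B \<in> sets cm" and b: "\<And>c. c \<in> B \<Longrightarrow> cfun (deriv F) c \<le> b"
  shows "emeasure cm (cmap F ` B) \<le> ennreal b * emeasure cm B"
proof -
  have "emeasure cm (cmap F ` B) = (\<integral>\<^sup>+c. ennreal (cfun (deriv F) c) * indicator B c \<partial>cm)"
    by (rule emeasure_cmap_image[OF F B])
  also have "\<dots> \<le> (\<integral>\<^sup>+c. ennreal b * indicator B c \<partial>cm)"
    by (intro nn_integral_mono) (auto simp: indicator_def b ennreal_leI)
  also have "\<dots> = ennreal b * emeasure cm B" by (rule nn_integral_cmult_indicator[OF B])
  finally show ?thesis .
qed

lemma ratio_setI: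
  assumes "diffeo G" "0 \<le> t"
    and "\<And>A \<epsilon>. A \<in> sets cm \<Longrightarrow> 0 < \<epsilon> \<Longrightarrow> 0 < emeasure cm A \<Longrightarrow> \<exists>B\<in>sets cm. \<exists>i. 0 < emeasure cm B \<and> B \<subseteq> A \<and>
       cmap (iter G i) ` B \<subseteq> A \<and> (\<forall>c\<in>B. \<bar>cfun (deriv (iter G i)) c - t\<bar> < \<epsilon>)"
  shows "t \<in> ratio_set cm (cmap G)"
  unfolding ratio_set_cmap[OF assms(1)] using assms(2,3) by (intro conjI ballI allI impI)

lemma ratio_setD:
  assumes G: "diffeo G" and t: "t \<in> ratio_set cm (cmap G)" and A: "A \<in> sets cm" "0 < \<epsilon>" "0 < emeasure cm A"
  obtains B i where "B \<in> sets cm" "0 < emeasure cm B" "B \<subseteq> A" "cmap (iter G i) ` B \<subseteq> A"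
    "\<And>c. c \<in> B \<Longrightarrow> \<bar>cfun (deriv (iter G i)) c - t\<bar> < \<epsilon>"
proof -
  have "\<forall>A\<in>sets cm. \<forall>\<epsilon>>0. 0 < emeasure cm A \<longrightarrow> (\<exists>B\<in>sets cm. \<exists>i. 0 < emeasure cm B \<and> B \<subseteq> A \<and>
       cmap (iter G i) ` B \<subseteq> A \<and> (\<forall>c\<in>B. \<bar>cfun (deriv (iter G i)) c - t\<bar> < \<epsilon>))"
    using t unfolding ratio_set_cmap[OF G] by (rule conjunct2)
  from this[rule_format, OF A]
  obtain B i where B: "B \<in> sets cm" "0 < emeasure cm B" "B \<subseteq> A" "cmap (iter G i) ` B \<subseteq> A"
    "\<forall>c\<in>B. \<bar>cfun (deriv (iter G i)) c - t\<bar> < \<epsilon>" by (elim bexE exE conjE)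
  then show thesis using that[of B i] by blast
qed

lemma ratio_set_nonneg: "t \<in> ratio_set M f \<Longrightarrow> 0 \<le> t"
  unfolding ratio_set_def by (drule CollectD, rule conjunct1)

lemma one_in_ratio_set:
  assumes G: "diffeo G"
  shows "1 \<in> ratio_set cm (cmap G)"
proof (rule ratio_setI[OF G])
  fix A and \<epsilon> :: real assume A: "A \<in> sets cm" "0 < \<epsilon>" "0 < emeasure cm A"
  have "iter G 0 = (\<lambda>x. x)" by (auto simp: iter_def)
  then have "cmap (iter G 0) c = c" "cfun (deriv (iter G 0)) c = 1" for c by (simp_all add: cfun_def)
  then have "cmap (iter G 0) ` A \<subseteq> A" "\<forall>c\<in>A. \<bar>cfun (deriv (iter G 0)) c - 1\<bar> < \<epsilon>" using A by auto
  then show "\<exists>B\<in>sets cm. \<exists>i. 0 < emeasure cm B \<and> B \<subseteq> A \<and>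
       cmap (iter G i) ` B \<subseteq> A \<and> (\<forall>c\<in>B. \<bar>cfun (deriv (iter G i)) c - 1\<bar> < \<epsilon>)"
    using A by (intro bexI[OF _ A(1)] exI[of _ 0] conjI) auto
qed simp

text \<open>Use the image of \<open>B\<close> and the iterate \<open>- i\<close>: it returns to
  \<open>B\<close>, and its derivative at an image point is the reciprocal.\<close>

lemma ratio_set_inverse:
  assumes G: "diffeo G" and t: "t \<in> ratio_set cm (cmap G)" "0 < t"
  shows "inverse t \<in> ratio_set cm (cmap G)"
proof (rule ratio_setI[OF G])
  show "0 \<le> inverse t" using t by simp
  fix A and \<epsilon> :: real assume A: "A \<in> sets cm" "0 < \<epsilon>" "0 < emeasure cm A"
  \<comment> \<open>The first term keeps the derivative above \<open>t / 2\<close>; the second turns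
    closeness to t into closeness \<epsilon> of the reciprocals.\<close>
  define \<eta> where "\<eta> = min (t / 2) (\<epsilon> * t * t / 2)"
  have \<eta>: "0 < \<eta>" using t A by (simp add: \<eta>_def)
  obtain B i where B: "B \<in> sets cm" "0 < emeasure cm B" "B \<subseteq> A" "cmap (iter G i) ` B \<subseteq> A"
    "\<And>c. c \<in> B \<Longrightarrow> \<bar>cfun (deriv (iter G i)) c - t\<bar> < \<eta>"
    using ratio_setD[OF G t(1) A(1) \<eta> A(3)] by blast
  let ?F = "iter G i"
  have F: "diffeo ?F" by (rule iter_diffeo[OF G])
  have eq: "cmap (iter G (- i)) (cmap ?F c) = c" for c
    using cmap_inv2[OF F] by (simp add: inv_iter[OF G])
  have "\<forall>c\<in>cmap ?F ` B. \<bar>cfun (deriv (iter G (- i))) c - inverse t\<bar> < \<epsilon>"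
  proof
    fix c' assume "c' \<in> cmap ?F ` B"
    then obtain c where c: "c \<in> B" "c' = cmap ?F c" by blast
    let ?D = "cfun (deriv ?F) c"
    have D: "\<bar>?D - t\<bar> < \<eta>" by (rule B(5)[OF c(1)])
    then have D2: "t / 2 < ?D" unfolding \<eta>_def by linarith
    have "\<bar>inverse ?D - inverse t\<bar> = \<bar>?D - t\<bar> / (?D * t)"
    proof -
      have "inverse ?D - inverse t = - ((?D - t) / (?D * t))" using D2 t by (simp add: field_simps)
      moreover have "0 < ?D * t" using D2 t by simp
      ultimately show ?thesis by (simp add: abs_divide)
    qed
    also have "\<dots> < \<epsilon>"
    proof -
      have "\<bar>?D - t\<bar> < \<epsilon> * t * t / 2" using D by (simp add: \<eta>_def)
      also have "\<dots> = \<epsilon> * (t / 2 * t)" by simp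
      also have "\<dots> \<le> \<epsilon> * (?D * t)" using D2 t A by (intro mult_left_mono mult_right_mono) auto
      finally show ?thesis using D2 t by (simp add: pos_divide_less_eq)
    qed
    finally show "\<bar>cfun (deriv (iter G (- i))) c' - inverse t\<bar> < \<epsilon>"
      unfolding c(2) deriv_iter_neg[OF G] .
  qed
  moreover have "cmap (iter G (- i)) ` (cmap ?F ` B) \<subseteq> A" using B(3) by (auto simp: eq)
  ultimately show "\<exists>B\<in>sets cm. \<exists>i. 0 < emeasure cm B \<and> B \<subseteq> A \<and>
       cmap (iter G i) ` B \<subseteq> A \<and> (\<forall>c\<in>B. \<bar>cfun (deriv (iter G i)) c - inverse t\<bar> < \<epsilon>)"
    using B(4) cmap_image_pos[OF F B(1,2)]
    by (intro bexI[OF _ cmap_image_sets[OF F B(1)]] exI[of _ "- i"] conjI)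
qed

section \<open>Invariant measures and the ratio 0\<close>

lemma invariant_measure_iter:
  assumes G: "diffeo G" and s: "sets \<nu> = sets cm" and inv: "distr \<nu> \<nu> (cmap G) = \<nu>" and B: "B \<in> sets cm"
  shows "emeasure \<nu> (cmap (iter G i) ` B) = emeasure \<nu> B"
proof -
  have sp: "space \<nu> = UNIV" using sets_eq_imp_space_eq[OF s] by simp
  have m: "cmap G \<in> measurable \<nu> \<nu>" using cmap_measurable[OF G] measurable_cong_sets[OF s s] by blast
  have v: "emeasure \<nu> (cmap G -` X) = emeasure \<nu> X" if "X \<in> sets cm" for X
    using emeasure_distr[OF m, of X] that s inv sp by simp
  have bwd: "emeasure \<nu> (cmap (inv G) ` X) = emeasure \<nu> X" if "X \<in> sets cm" for X
    using v[OF that] cmap_vimage_eq[OF G] by simp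
  have fwd: "emeasure \<nu> (cmap G ` X) = emeasure \<nu> X" if "X \<in> sets cm" for X
  proof -
    have "cmap (inv G) ` (cmap G ` X) = X" using G by (simp add: image_image)
    then show ?thesis using bwd[OF cmap_image_sets[OF G that]] by simp
  qed
  have pow: "emeasure \<nu> (cmap (F ^^ n) ` B) = emeasure \<nu> B"
    if F: "diffeo F" and "\<And>X. X \<in> sets cm \<Longrightarrow> emeasure \<nu> (cmap F ` X) = emeasure \<nu> X" for F n
  proof (induction n)
    case 0
    then show ?case by (simp add: id_def)
  next
    case (Suc n)
    have "cmap (F ^^ Suc n) ` B = cmap F ` (cmap (F ^^ n) ` B)"
      using cmap_comp[OF F diffeo_funpow[OF F]] by (simp add: image_image comp_def)
    then show ?case using that(2)[OF cmap_image_sets[OF diffeo_funpow[OF F] B]] Suc by (simp only:)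
  qed
  show ?thesis using pow[OF G fwd] pow[OF diffeo_inv[OF G] bwd] by (simp add: iter_def)
qed

text \<open>Where an invariant density is pinched between two constants, a return to the same region
  can change Lebesgue measure only by a bounded factor; the ratio 0 provides returns that shrink it
  more strongly.\<close>

lemma not_type_II_if_zero_in_ratio_set:
  assumes G: "diffeo G" and z: "0 \<in> ratio_set cm (cmap G)"
  shows "\<not> type_II cm (cmap G)"
proof
  assume "type_II cm (cmap G)"
  then obtain \<nu> where \<nu>: "sigma_finite_measure \<nu>" "equivalent_measures cm \<nu>" "distr \<nu> \<nu> (cmap G) = \<nu>"
    by (auto simp: type_II_def invariant_measure_def)
  have s: "sets \<nu> = sets cm" and ac: "absolutely_continuous cm \<nu>" and ac': "absolutely_continuous \<nu> cm"
    using \<nu>(2) by (auto simp: equivalent_measures_def)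
  define w where "w = RN_deriv cm \<nu>"
  have wm: "w \<in> borel_measurable cm" by (simp add: w_def)
  have d: "density cm w = \<nu>" unfolding w_def using ac s by (rule cm.density_RN_deriv)
  have fin: "AE c in cm. w c \<noteq> \<infinity>" unfolding w_def by (rule cm.RN_deriv_finite[OF \<nu>(1) ac s])
  have pos: "AE c in cm. w c \<noteq> 0"
  proof -
    let ?N = "{c \<in> space cm. w c = 0}"
    have N: "?N \<in> sets cm" using wm by measurable
    have "emeasure \<nu> ?N = (\<integral>\<^sup>+c. w c * indicator ?N c \<partial>cm)" using wm N d emeasure_density by metis
    also have "\<dots> = (\<integral>\<^sup>+c. 0 \<partial>cm)" by (intro nn_integral_cong) (auto simp: indicator_def)
    finally have "?N \<in> null_sets \<nu>" using N s by auto
    then have "?N \<in> null_sets cm" using ac' by (auto simp: absolutely_continuous_def)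
    from AE_not_in[OF this] show ?thesis by eventually_elim auto
  qed
  \<comment> \<open>Dyadic shells of the density; one of them has positive measure because the
    density is finite and nonzero almost everywhere.\<close>
  define A where "A k = {c \<in> space cm. ennreal (2 powr of_int k) \<le> w c \<and> w c \<le> ennreal (2 * 2 powr of_int k)}" for k :: int
  have Am: "A k \<in> sets cm" for k unfolding A_def using wm by measurable
  have "\<exists>k. emeasure cm (A k) \<noteq> 0"
  proof (rule ccontr)
    assume "\<not> ?thesis"
    then have "AE c in cm. \<forall>k. c \<notin> A k"
      using Am by (subst AE_all_countable) (auto intro!: AE_not_in)
    then have "AE c in cm. False"
      using fin pos
    proof eventually_elim
      fix c assume c: "w c \<noteq> \<infinity>" "w c \<noteq> 0" "\<forall>k. c \<notin> A k"
      then obtain x where x: "w c = ennreal x" "0 < x" by (cases "w c") (auto simp: less_le)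
      define k where "k = \<lfloor>log 2 x\<rfloor>"
      have "2 powr of_int k \<le> 2 powr (log 2 x)" "2 powr (log 2 x) \<le> 2 powr (1 + of_int k)"
        unfolding k_def by (intro powr_mono; linarith)+
      then have "2 powr of_int k \<le> x" "x \<le> 2 * 2 powr of_int k" using x by (simp_all add: powr_add)
      then have "c \<in> A k" using x by (auto simp: A_def intro!: ennreal_leI)
      then show False using c by blast
    qed
    then have "emeasure cm (space cm) = 0"
      using AE_iff_measurable[of "space cm" cm "\<lambda>_. False"] sets.top[of cm] by simp
    then show False using emeasure_cm_UNIV by simp
  qed
  then obtain k where k: "0 < emeasure cm (A k)" by (auto simp: zero_less_iff_neq_zero)
  \<comment> \<open>Contraction by 1/4 beats the factor 2 between the two ends of a shell.\<close>
  obtain B i where B: "B \<in> sets cm" "0 < emeasure cm B" "B \<subseteq> A k" "cmap (iter G i) ` B \<subseteq> A k"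
    "\<And>c. c \<in> B \<Longrightarrow> \<bar>cfun (deriv (iter G i)) c - 0\<bar> < 1 / 4"
    using ratio_setD[OF G z Am _ k, of "1 / 4"] by auto
  let ?p = "2 powr of_int k :: real" and ?FB = "cmap (iter G i) ` B"
  have FB: "?FB \<in> sets cm" by (rule cmap_image_sets[OF iter_diffeo[OF G] B(1)])
  obtain b where b: "emeasure cm B = ennreal b" "0 < b"
    using B(2) cm.emeasure_finite[of B] by (cases "emeasure cm B") (auto simp: ennreal_less_zero_iff)
  have "ennreal ?p * emeasure cm B = (\<integral>\<^sup>+c. ennreal ?p * indicator B c \<partial>cm)"
    by (rule nn_integral_cmult_indicator[symmetric, OF B(1)])
  also have "\<dots> \<le> (\<integral>\<^sup>+c. w c * indicator B c \<partial>cm)"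
    using B(3) by (intro nn_integral_mono) (auto simp: indicator_def A_def)
  also have "\<dots> = emeasure \<nu> B" using wm B(1) d emeasure_density by metis
  also have "\<dots> = emeasure \<nu> ?FB" by (rule invariant_measure_iter[OF G s \<nu>(3) B(1), symmetric])
  also have "\<dots> = (\<integral>\<^sup>+c. w c * indicator ?FB c \<partial>cm)" using wm FB d emeasure_density by metis
  also have "\<dots> \<le> (\<integral>\<^sup>+c. ennreal (2 * ?p) * indicator ?FB c \<partial>cm)"
    using B(4) by (intro nn_integral_mono) (auto simp: indicator_def A_def)
  also have "\<dots> = ennreal (2 * ?p) * emeasure cm ?FB" by (rule nn_integral_cmult_indicator[OF FB])
  also have "\<dots> \<le> ennreal (2 * ?p) * (ennreal (1 / 4) * emeasure cm B)"
  proof (intro mult_left_mono cmap_image_le iter_diffeo[OF G] B(1))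
    show "cfun (deriv (iter G i)) c \<le> 1 / 4" if "c \<in> B" for c using B(5)[OF that] by linarith
  qed simp
  finally have "ennreal (?p * b) \<le> ennreal (2 * ?p * (1 / 4 * b))"
    using b by (simp add: ennreal_mult[symmetric])
  then have "?p * b \<le> 2 * ?p * (1 / 4 * b)" using b by (subst (asm) ennreal_le_iff) auto
  then show False using b by simp
qed

section \<open>Criteria for ergodicity and for elements of the ratio set\<close>

definition unit_partition :: "nat \<Rightarrow> (nat \<Rightarrow> real) \<Rightarrow> bool" where
  "unit_partition N a \<longleftrightarrow> a 0 = 0 \<and> a N = 1 \<and> (\<forall>j<N. a j < a (Suc j))"

lemma unit_partition_cover:
  assumes "unit_partition N a" "0 \<le> x" "x < 1"
  obtains j where "j < N" "x \<in> {a j..<a (Suc j)}"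
proof -
  have "\<exists>j<n. x \<in> {a j..<a (Suc j)}" if "x < a n" for n
    using that
  proof (induction n)
    case 0
    then show ?case using assms by (simp add: unit_partition_def)
  next
    case (Suc n)
    then show ?case by (cases "x < a n") (auto simp: less_Suc_eq)
  qed
  from this[of N] show thesis using that assms by (auto simp: unit_partition_def)
qed

lemma unit_partition_mono:
  assumes "unit_partition N a" "i \<le> j" "j \<le> N"
  shows "a i \<le> a j"
  using assms(2,3)
proof (induction j)
  case (Suc j)
  have "a j < a (Suc j)" using assms(1) Suc.prems(2) by (auto simp: unit_partition_def)
  then show ?case using Suc by (cases "i = Suc j") auto
qed simp

lemma unit_partition_disjoint:
  assumes "unit_partition N a"
  shows "disjoint_family_on (\<lambda>j. {a j..<a (Suc j)}) {..<N}"
  unfolding disjoint_family_on_def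
proof (intro ballI impI)
  fix i j assume ij: "i \<in> {..<N}" "j \<in> {..<N}" "i \<noteq> j"
  show "{a i..<a (Suc i)} \<inter> {a j..<a (Suc j)} = {}"
  proof (cases "i < j")
    case True
    then have "a (Suc i) \<le> a j" using unit_partition_mono[OF assms] ij by auto
    then show ?thesis by auto
  next
    case False
    then have "a (Suc j) \<le> a i" using unit_partition_mono[OF assms] ij by auto
    then show ?thesis by auto
  qed
qed

section \<open>Regularity of Lebesgue measure along fine partitions\<close>

lemma inner_compact_outer_open:
  fixes S :: "real set"
  assumes S: "S \<in> sets lebesgue" "S \<subseteq> {0<..<1}" and \<epsilon>: "0 < \<epsilon>"
  obtains K U where "compact K" "K \<subseteq> S" "S \<subseteq> U" "open U" "U \<subseteq> {0<..<1}"
    "measure lebesgue (U - K) < \<epsilon>" "measure lebesgue S \<le> measure lebesgue K + \<epsilon>"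
proof -
  obtain T where T: "open T" "S \<subseteq> T" "T - S \<in> lmeasurable" "emeasure lebesgue (T - S) < ennreal (\<epsilon> / 2)"
    using sets_lebesgue_outer_open[OF S(1), of "\<epsilon> / 2"] \<epsilon> by auto
  obtain K where K: "closed K" "K \<subseteq> S" "S - K \<in> lmeasurable" "emeasure lebesgue (S - K) < ennreal (\<epsilon> / 2)"
    using sets_lebesgue_inner_closed[OF S(1), of "\<epsilon> / 2"] \<epsilon> by auto
  define U where "U = T \<inter> {0<..<1}"
  have m1: "measure lebesgue (T - S) < \<epsilon> / 2" using T(3,4) \<epsilon> by (simp add: emeasure_eq_measure2 ennreal_less_iff)
  have m2: "measure lebesgue (S - K) < \<epsilon> / 2" using K(3,4) \<epsilon> by (simp add: emeasure_eq_measure2 ennreal_less_iff)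
  have bK: "bounded K" using K(2) S(2) by (meson bounded_subset bounded_closed_interval greaterThanLessThan_subseteq_atLeastAtMost_iff order_trans order_refl)
  then have cK: "compact K" using K(1) compact_eq_bounded_closed by blast
  have "U - K \<subseteq> (T - S) \<union> (S - K)" by (auto simp: U_def)
  then have "measure lebesgue (U - K) \<le> measure lebesgue ((T - S) \<union> (S - K))"
    using T K cK by (intro measure_mono_fmeasurable) (auto simp: U_def intro: fmeasurable.Un)
  also have "\<dots> \<le> measure lebesgue (T - S) + measure lebesgue (S - K)"
    using T K by (intro measure_Un_le) auto
  also have "\<dots> < \<epsilon>" using m1 m2 by linarith
  finally have UK: "measure lebesgue (U - K) < \<epsilon>" .
  have "measure lebesgue S \<le> measure lebesgue (K \<union> (S - K))" using K(2) by (simp add: Un_absorb1)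
  also have "\<dots> \<le> measure lebesgue K + measure lebesgue (S - K)"
    using K cK by (intro measure_Un_le) auto
  finally have "measure lebesgue S \<le> measure lebesgue K + \<epsilon>" using m2 \<epsilon> by linarith
  moreover have "S \<subseteq> U" "open U" "U \<subseteq> {0<..<1}" using T S(2) by (auto simp: U_def)
  ultimately show thesis using that[of K U] cK K(2) UK by blast
qed

text \<open>\<delta> is a lower bound for the distance from \<open>K\<close> to the complement of
  \<open>U\<close>; intervals shorter than \<delta> that meet \<open>K\<close> stay in
  \<open>U\<close>.\<close>

lemma partition_between:
  assumes K: "compact K" "K \<subseteq> U" "open U" "U \<subseteq> {0<..<1}"
  shows "\<exists>\<delta>>0. (\<forall>x\<in>K. \<forall>y. \<bar>y - x\<bar> < \<delta> \<longrightarrow> y \<in> U) \<and>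
    (\<forall>N a. unit_partition N a \<longrightarrow> (\<forall>j<N. a (Suc j) - a j < \<delta>) \<longrightarrow>
       (\<exists>T\<subseteq>{..<N}. K \<subseteq> (\<Union>j\<in>T. {a j..<a (Suc j)}) \<and> (\<Union>j\<in>T. {a j..<a (Suc j)}) \<subseteq> U))"
proof -
  obtain \<delta> where \<delta>: "0 < \<delta>" "(\<Union>x\<in>K. ball x \<delta>) \<subseteq> U"
    using compact_subset_open_imp_ball_epsilon_subset[OF K(1,3,2)] by blast
  have near: "y \<in> U" if "x \<in> K" "\<bar>y - x\<bar> < \<delta>" for x y
  proof -
    have "y \<in> ball x \<delta>" using that(2) by (simp add: dist_real_def abs_minus_commute)
    then show ?thesis using \<delta>(2) that(1) by blast
  qed
  show ?thesis
  proof (intro exI[of _ \<delta>] conjI \<delta>(1) ballI allI impI)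
    fix x y assume "x \<in> K" "\<bar>y - x\<bar> < \<delta>"
    then show "y \<in> U" by (rule near)
  next
    fix N a assume p: "unit_partition N a" "\<forall>j<N. a (Suc j) - a j < \<delta>"
    define T where "T = {j. j < N \<and> {a j..<a (Suc j)} \<inter> K \<noteq> {}}"
    have "K \<subseteq> (\<Union>j\<in>T. {a j..<a (Suc j)})"
    proof
      fix x assume x: "x \<in> K"
      then have "0 \<le> x" "x < 1" using K(2,4) by (auto dest!: subsetD)
      then obtain j where "j < N" "x \<in> {a j..<a (Suc j)}" using unit_partition_cover[OF p(1)] by blast
      then have "j \<in> T" "x \<in> {a j..<a (Suc j)}" using x unfolding T_def by blast+
      then show "x \<in> (\<Union>j\<in>T. {a j..<a (Suc j)})" by blast
    qed
    moreover have "(\<Union>j\<in>T. {a j..<a (Suc j)}) \<subseteq> U"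
    proof
      fix y assume "y \<in> (\<Union>j\<in>T. {a j..<a (Suc j)})"
      then obtain j where jT: "j \<in> T" "y \<in> {a j..<a (Suc j)}" by blast
      then obtain x where j: "j < N" "x \<in> K" "x \<in> {a j..<a (Suc j)}" unfolding T_def by blast
      then have "\<bar>y - x\<bar> < a (Suc j) - a j" using jT(2) by auto
      then show "y \<in> U" using near[OF j(2)] p(2) j(1) by force
    qed
    ultimately show "\<exists>T\<subseteq>{..<N}. K \<subseteq> (\<Union>j\<in>T. {a j..<a (Suc j)}) \<and> (\<Union>j\<in>T. {a j..<a (Suc j)}) \<subseteq> U"
      by (intro exI[of _ T]) (auto simp: T_def)
  qed
qed

lemma subset_unit_lmeasurable:
  fixes X :: "real set"
  shows "X \<in> sets lebesgue \<Longrightarrow> X \<subseteq> {a..b} \<Longrightarrow> X \<in> lmeasurable"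
  by (meson bounded_closed_interval bounded_subset bounded_set_imp_lmeasurable)

lemma measure_Union_partition:
  assumes p: "unit_partition N a" and T: "T \<subseteq> {..<N}" and P: "P \<in> sets lebesgue"
  shows "measure lebesgue (P \<inter> (\<Union>j\<in>T. {a j..<a (Suc j)})) = (\<Sum>j\<in>T. measure lebesgue (P \<inter> {a j..<a (Suc j)}))"
proof -
  have fT: "finite T" using T finite_subset by blast
  have "P \<inter> (\<Union>j\<in>T. {a j..<a (Suc j)}) = (\<Union>j\<in>T. P \<inter> {a j..<a (Suc j)})" by blast
  moreover have "disjoint_family_on (\<lambda>j. P \<inter> {a j..<a (Suc j)}) T"
    using disjoint_family_on_mono[OF T unit_partition_disjoint[OF p]] unfolding disjoint_family_on_def by blast
  moreover have "P \<inter> {a j..<a (Suc j)} \<in> lmeasurable" for j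
    using P by (intro subset_unit_lmeasurable[of _ "a j" "a (Suc j)"]) auto
  ultimately show ?thesis
    using measure_finite_Union[OF fT, of "\<lambda>j. P \<inter> {a j..<a (Suc j)}" lebesgue] P fmeasurableD2[of _ lebesgue]
    by (metis (no_types, lifting) fmeasurableD image_subset_iff infinity_ennreal_def)
qed


lemma diffeo_image_measure_ge:
  assumes F: "diffeo F" and S: "S \<in> sets lebesgue" "S \<subseteq> {a..b}" and c: "0 \<le> c" "\<And>x. x \<in> S \<Longrightarrow> c \<le> deriv F x"
  shows "c * measure lebesgue S \<le> measure lebesgue (F ` S)"
proof -
  have S': "S \<in> lmeasurable" by (rule subset_unit_lmeasurable[OF S])
  have "F ` S \<subseteq> {F a..F b}" using S(2) diffeo_le_iff[OF F] by auto
  then have FS: "F ` S \<in> lmeasurable" using subset_unit_lmeasurable diffeo_image_lebesgue[OF F S(1)] by blast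
  have "ennreal (c * measure lebesgue S) = ennreal c * emeasure lebesgue S"
    using S' c by (simp add: emeasure_eq_measure2 ennreal_mult)
  also have "\<dots> = (\<integral>\<^sup>+x. ennreal c * indicator S x \<partial>lebesgue)"
    by (rule nn_integral_cmult_indicator[symmetric, OF S(1)])
  also have "\<dots> \<le> (\<integral>\<^sup>+x. ennreal (deriv F x) * indicator S x \<partial>lebesgue)"
    by (intro nn_integral_mono) (auto simp: indicator_def c ennreal_leI)
  also have "\<dots> = emeasure lebesgue (F ` S)" by (rule emeasure_diffeo_image[OF F S, symmetric])
  also have "\<dots> = ennreal (measure lebesgue (F ` S))" using FS by (simp add: emeasure_eq_measure2)
  finally show ?thesis by (subst (asm) ennreal_le_iff) auto
qed

text \<open>A form of the density theorem that is uniform over all fine partitions. If every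
  interval were at most 3/4 full, summing over those near a compact part \<open>K\<close> of
  \<open>S\<close> would leave \<open>K\<close> at most 3/4 of the measure of the surrounding open
  set \<open>U\<close>.\<close>

lemma dense_atom:
  fixes S :: "real set"
  assumes S: "S \<in> sets lebesgue" "S \<subseteq> {0<..<1}" "0 < measure lebesgue S"
  shows "\<exists>\<delta>>0. \<forall>N a. unit_partition N a \<longrightarrow> (\<forall>j<N. a (Suc j) - a j < \<delta>) \<longrightarrow>
    (\<exists>j<N. 3 / 4 * (a (Suc j) - a j) < measure lebesgue (S \<inter> {a j..<a (Suc j)}))"
proof -
  \<comment> \<open>With an eighth, \<open>K\<close> keeps 7/8 of the measure of \<open>S\<close>,
    while the failure would force it down to 3/8.\<close>
  define \<epsilon> where "\<epsilon> = measure lebesgue S / 8"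
  obtain K U where KU: "compact K" "K \<subseteq> S" "S \<subseteq> U" "open U" "U \<subseteq> {0<..<1}"
    "measure lebesgue (U - K) < \<epsilon>" "measure lebesgue S \<le> measure lebesgue K + \<epsilon>"
    using inner_compact_outer_open[OF S(1,2), of \<epsilon>] S(3) unfolding \<epsilon>_def by auto
  have K: "K \<in> lmeasurable" using KU(1) by (rule lmeasurable_compact)
  have U: "U \<in> lmeasurable" using KU(4,5) by (intro subset_unit_lmeasurable[of _ 0 1]) auto
  have KU2: "K \<subseteq> U" using KU by blast
  obtain \<delta> where \<delta>1: "0 < \<delta>"
    and \<delta>: "\<forall>N a. unit_partition N a \<longrightarrow> (\<forall>j<N. a (Suc j) - a j < \<delta>) \<longrightarrow>
       (\<exists>T\<subseteq>{..<N}. K \<subseteq> (\<Union>j\<in>T. {a j..<a (Suc j)}) \<and> (\<Union>j\<in>T. {a j..<a (Suc j)}) \<subseteq> U)"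
    using partition_between[OF KU(1) KU2 KU(4,5)] by (elim exE conjE)
  show ?thesis
  proof (intro exI[of _ \<delta>] conjI \<delta>1 allI impI)
    fix N a assume p: "unit_partition N a" "\<forall>j<N. a (Suc j) - a j < \<delta>"
    obtain T where T: "T \<subseteq> {..<N}" "K \<subseteq> (\<Union>j\<in>T. {a j..<a (Suc j)})" "(\<Union>j\<in>T. {a j..<a (Suc j)}) \<subseteq> U"
      using \<delta>[rule_format, OF p(1)] p(2) by blast
    have fT: "finite T" using T(1) finite_subset by blast
    show "\<exists>j<N. 3 / 4 * (a (Suc j) - a j) < measure lebesgue (S \<inter> {a j..<a (Suc j)})"
    proof (rule ccontr)
      assume neg: "\<not> ?thesis"
      have len: "measure lebesgue {a j..<a (Suc j)} = a (Suc j) - a j" if "j \<in> T" for j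
        using p(1) T(1) that by (auto simp: unit_partition_def)
      have "measure lebesgue K = measure lebesgue (K \<inter> (\<Union>j\<in>T. {a j..<a (Suc j)}))" using T(2) by (simp add: Int_absorb2)
      also have "\<dots> = (\<Sum>j\<in>T. measure lebesgue (K \<inter> {a j..<a (Suc j)}))"
        by (rule measure_Union_partition[OF p(1) T(1)]) (use K in auto)
      also have "\<dots> \<le> (\<Sum>j\<in>T. 3 / 4 * measure lebesgue (UNIV \<inter> {a j..<a (Suc j)}))"
      proof (rule sum_mono)
        fix j assume j: "j \<in> T"
        have "measure lebesgue (K \<inter> {a j..<a (Suc j)}) \<le> measure lebesgue (S \<inter> {a j..<a (Suc j)})"
          using KU(2) K S by (intro measure_mono_fmeasurable subset_unit_lmeasurable[of "S \<inter> _" 0 1]) auto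
        also have "\<dots> \<le> 3 / 4 * (a (Suc j) - a j)" using neg j T(1) by (meson lessThan_iff not_less subsetD)
        finally show "measure lebesgue (K \<inter> {a j..<a (Suc j)}) \<le> 3 / 4 * measure lebesgue (UNIV \<inter> {a j..<a (Suc j)})"
          using len[OF j] by simp
      qed
      also have "\<dots> = 3 / 4 * measure lebesgue (UNIV \<inter> (\<Union>j\<in>T. {a j..<a (Suc j)}))"
        by (subst measure_Union_partition[OF p(1) T(1)]) (auto simp: sum_distrib_left)
      also have "\<dots> \<le> 3 / 4 * measure lebesgue U"
        using T(3) U fT by (intro mult_left_mono measure_mono_fmeasurable) auto
      also have "measure lebesgue U \<le> measure lebesgue K + measure lebesgue (U - K)"
        using measure_Un_le[of K lebesgue "U - K"] K U KU2 by (simp add: Un_absorb1)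
      finally have "measure lebesgue K \<le> 3 / 4 * (measure lebesgue K + measure lebesgue (U - K))" by simp
      then show False using KU(6,7) S(3) by (simp add: \<epsilon>_def)
    qed
  qed
qed

lemma measure_open_unit:
  fixes P :: "real set"
  assumes "P \<in> sets lebesgue"
  shows "emeasure lebesgue (P \<inter> {0..<1}) = ennreal (measure lebesgue (P \<inter> {0<..<1}))"
proof -
  have "emeasure lebesgue (P \<inter> {0..<1}) = emeasure lebesgue (P \<inter> {0..<1} - {0})"
    using assms by (intro emeasure_Diff_null_set[symmetric]) auto
  also have "P \<inter> {0..<1} - {0} = P \<inter> {0<..<1}" by auto
  also have "P \<inter> {0<..<1} \<in> lmeasurable" using assms by (intro subset_unit_lmeasurable[of _ 0 1]) auto
  then have "emeasure lebesgue (P \<inter> {0<..<1}) = ennreal (measure lebesgue (P \<inter> {0<..<1}))"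
    by (simp add: emeasure_eq_measure2)
  finally show ?thesis .
qed

lemma emeasure_cm_eq: "A \<in> sets cm \<Longrightarrow> emeasure cm A = ennreal (measure lebesgue (proj -` A \<inter> {0<..<1}))"
  using emeasure_circle_measure measure_open_unit sets_cm_iff by simp

text \<open>An invariant set that is dense in one atom of the partition is carried to a set dense in any other atom.\<close>

lemma ergodic_criterion:
  assumes G: "diffeo G"
    and mix: "\<And>\<delta>. 0 < \<delta> \<Longrightarrow> \<exists>N a. unit_partition N a \<and> (\<forall>j<N. a (Suc j) - a j < \<delta>) \<and>
      (\<forall>j<N. \<forall>l<N. \<exists>i. \<exists>k::int.
         (\<forall>y. a j \<le> y \<longrightarrow> y \<le> a (Suc j) \<longrightarrow> 7 / 8 * (a (Suc l) - a l) \<le> deriv (G ^^ i) y * (a (Suc j) - a j)) \<and>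
         a l - (a (Suc l) - a l) / 16 \<le> (G ^^ i) (a j) + of_int k \<and>
         (G ^^ i) (a (Suc j)) + of_int k \<le> a (Suc l) + (a (Suc l) - a l) / 16)"
  shows "ergodic cm (cmap G)"
  unfolding ergodic_def
proof (intro conjI ballI impI)
  show "nonsingular_automorphism cm (cmap G)" by (rule cmap_nonsingular[OF G])
  fix A assume A: "A \<in> sets cm" "cmap G ` A = A"
  show "emeasure cm A = 0 \<or> emeasure cm (space cm - A) = 0"
  proof (rule ccontr)
    assume neg: "\<not> ?thesis"
    define P where "P = proj -` A"
    have P: "P \<in> sets lebesgue" using A by (simp add: P_def sets_cm_iff)
    have A': "space cm - A \<in> sets cm" using A(1) by (rule sets.compl_sets)
    have P': "- P \<in> sets lebesgue" using P by (rule Compl_in_sets_lebesgue[THEN iffD2])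
    have vA': "proj -` (space cm - A) = - P" by (auto simp: P_def)
    have m1: "0 < measure lebesgue (P \<inter> {0<..<1})" using neg emeasure_cm_eq[OF A(1)] by (auto simp: P_def less_le)
    have m2: "0 < measure lebesgue (- P \<inter> {0<..<1})" using neg emeasure_cm_eq[OF A'] unfolding vA' by (auto simp: less_le)
    have GP: "G ` P = P" using vimage_proj_cmap_image[OF G, of A] A(2) by (simp add: P_def)
    have GnP: "(G ^^ n) ` P = P" for n
    proof (induction n)
      case (Suc n)
      have "(G ^^ Suc n) ` P = G ` ((G ^^ n) ` P)" by (simp add: image_comp)
      then show ?case using Suc GP by simp
    qed simp
    have "P \<inter> {0<..<1} \<in> sets lebesgue" using P by auto
    from dense_atom[OF this _ m1] obtain \<delta>1 where \<delta>1: "0 < \<delta>1"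
      "\<forall>N a. unit_partition N a \<longrightarrow> (\<forall>j<N. a (Suc j) - a j < \<delta>1) \<longrightarrow>
      (\<exists>j<N. 3 / 4 * (a (Suc j) - a j) < measure lebesgue ((P \<inter> {0<..<1}) \<inter> {a j..<a (Suc j)}))"
      by blast
    have "- P \<inter> {0<..<1} \<in> sets lebesgue" using P' by auto
    from dense_atom[OF this _ m2] obtain \<delta>2 where \<delta>2: "0 < \<delta>2"
      "\<forall>N a. unit_partition N a \<longrightarrow> (\<forall>j<N. a (Suc j) - a j < \<delta>2) \<longrightarrow>
      (\<exists>j<N. 3 / 4 * (a (Suc j) - a j) < measure lebesgue ((- P \<inter> {0<..<1}) \<inter> {a j..<a (Suc j)}))"
      by blast
    have "0 < min \<delta>1 \<delta>2" using \<delta>1 \<delta>2 by simp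
    from mix[OF this] obtain N a where p: "unit_partition N a" "\<forall>j<N. a (Suc j) - a j < min \<delta>1 \<delta>2" and
      mix': "\<And>j l. j < N \<Longrightarrow> l < N \<Longrightarrow> \<exists>i. \<exists>k::int.
         (\<forall>y. a j \<le> y \<longrightarrow> y \<le> a (Suc j) \<longrightarrow> 7 / 8 * (a (Suc l) - a l) \<le> deriv (G ^^ i) y * (a (Suc j) - a j)) \<and>
         a l - (a (Suc l) - a l) / 16 \<le> (G ^^ i) (a j) + of_int k \<and>
         (G ^^ i) (a (Suc j)) + of_int k \<le> a (Suc l) + (a (Suc l) - a l) / 16" by blast
    obtain j where j: "j < N" "3 / 4 * (a (Suc j) - a j) < measure lebesgue ((P \<inter> {0<..<1}) \<inter> {a j..<a (Suc j)})"
      using \<delta>1(2)[rule_format, OF p(1)] p(2) by auto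
    obtain l where l: "l < N" "3 / 4 * (a (Suc l) - a l) < measure lebesgue ((- P \<inter> {0<..<1}) \<inter> {a l..<a (Suc l)})"
      using \<delta>2(2)[rule_format, OF p(1)] p(2) by auto
    let ?L = "a (Suc l) - a l" and ?J = "a (Suc j) - a j"
    have Lp: "0 < ?L" "0 < ?J" using p(1) j(1) l(1) by (auto simp: unit_partition_def)
    obtain i and k :: int where ik: "\<And>y. a j \<le> y \<Longrightarrow> y \<le> a (Suc j) \<Longrightarrow> 7 / 8 * ?L \<le> deriv (G ^^ i) y * ?J"
      "a l - ?L / 16 \<le> (G ^^ i) (a j) + of_int k" "(G ^^ i) (a (Suc j)) + of_int k \<le> a (Suc l) + ?L / 16"
      using mix'[OF j(1) l(1)] by blast
    \<comment> \<open>The translate by k is the lift of the iterate that lands near interval l;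
      \<open>P\<close> is periodic, so it is invariant under this lift as well.\<close>
    define F where "F y = (G ^^ i) y + of_int k" for y
    have F: "diffeo F" unfolding F_def[abs_def] by (intro diffeo_shift' diffeo_funpow G)
    have dF: "deriv F y = deriv (G ^^ i) y" for y
      unfolding F_def[abs_def] by (rule deriv_add_const[OF diffeo_funpow[OF G]])
    define X where "X = P \<inter> {a j..<a (Suc j)}"
    have X: "X \<in> sets lebesgue" "X \<subseteq> {a j..a (Suc j)}" using P by (auto simp: X_def)
    have "measure lebesgue ((P \<inter> {0<..<1}) \<inter> {a j..<a (Suc j)}) \<le> measure lebesgue X"
    proof (rule measure_mono_fmeasurable[OF _ _ subset_unit_lmeasurable[OF X]])
      show "P \<inter> {0<..<1} \<inter> {a j..<a (Suc j)} \<in> sets lebesgue" by (intro sets.Int P) auto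
    qed (auto simp: X_def)
    then have mX: "3 / 4 * ?J \<le> measure lebesgue X" using j(2) by linarith
    have "7 / 8 * (?L / ?J) * (3 / 4 * ?J) \<le> 7 / 8 * (?L / ?J) * measure lebesgue X"
      using Lp mX by (intro mult_left_mono) auto
    also have "\<dots> \<le> measure lebesgue (F ` X)"
    proof (rule diffeo_image_measure_ge[OF F X])
      show "7 / 8 * (?L / ?J) \<le> deriv F x" if "x \<in> X" for x
      proof -
        have "7 / 8 * ?L \<le> deriv F x * ?J" using ik(1)[of x] X(2) that by (auto simp: dF)
        then have "7 / 8 * ?L / ?J \<le> deriv F x" using Lp by (simp only: pos_divide_le_eq)
        then show ?thesis by simp
      qed
    qed (use Lp in simp)
    finally have "7 / 8 * (?L / ?J) * (3 / 4 * ?J) \<le> measure lebesgue (F ` X)" .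
    moreover have "7 / 8 * (?L / ?J) * (3 / 4 * ?J) = 21 / 32 * ?L" using Lp(2) by (simp add: field_simps)
    ultimately have lower: "21 / 32 * ?L \<le> measure lebesgue (F ` X)" by (simp only:)
    \<comment> \<open>The image may overshoot the target interval by 1/16 of its length on each
      side. Apart from these margins it lies in the part of \<open>P\<close> inside the target, at
      most 1/4 of the length: altogether 12/32, against the lower bound 7/8 * 3/4 = 21/32.\<close>
    define Y where "Y = (P \<inter> {a l..<a (Suc l)}) \<union> ({a l - ?L / 16..a l} \<union> {a (Suc l)..a (Suc l) + ?L / 16})"
    have "F ` X \<subseteq> Y"
    proof
      fix y assume "y \<in> F ` X"
      then obtain x where x: "x \<in> P" "a j \<le> x" "x < a (Suc j)" "y = F x" by (auto simp: X_def)
      have "(G ^^ i) x \<in> P" using GnP x(1) by blast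
      then have yP: "y \<in> P" by (simp add: x(4) F_def P_def)
      have "F (a j) \<le> y" "y \<le> F (a (Suc j))" using x diffeo_le_iff[OF F] by auto
      then have "a l - ?L / 16 \<le> y" "y \<le> a (Suc l) + ?L / 16" using ik(2,3) unfolding F_def by linarith+
      then show "y \<in> Y" using yP by (auto simp: Y_def)
    qed
    moreover have Yl: "P \<inter> {a l..<a (Suc l)} \<in> lmeasurable"
      using P by (intro subset_unit_lmeasurable[of _ "a l" "a (Suc l)"]) auto
    moreover have "Y \<in> lmeasurable" unfolding Y_def
      by (intro fmeasurable.Un Yl subset_unit_lmeasurable[OF _ order_refl]) auto
    ultimately have "measure lebesgue (F ` X) \<le> measure lebesgue Y"
      using diffeo_image_lebesgue[OF F X(1)] by (intro measure_mono_fmeasurable)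
    also have "\<dots> \<le> measure lebesgue (P \<inter> {a l..<a (Suc l)}) + (?L / 16 + ?L / 16)"
    proof -
      have "measure lebesgue ({a l - ?L / 16..a l} \<union> {a (Suc l)..a (Suc l) + ?L / 16}) \<le> ?L / 16 + ?L / 16"
        using measure_Un_le[of "{a l - ?L / 16..a l}" lebesgue "{a (Suc l)..a (Suc l) + ?L / 16}"] Lp by simp
      moreover have "measure lebesgue Y \<le> measure lebesgue (P \<inter> {a l..<a (Suc l)}) + measure lebesgue ({a l - ?L / 16..a l} \<union> {a (Suc l)..a (Suc l) + ?L / 16})"
        unfolding Y_def using P by (intro measure_Un_le) auto
      ultimately show ?thesis by linarith
    qed
    also have "measure lebesgue (P \<inter> {a l..<a (Suc l)}) \<le> 1 / 4 * ?L"
    proof -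
      let ?I = "{a l..<a (Suc l)}"
      have gen: "x \<le> 1 / 4 * L" if "u \<le> y" "x + y = L" "3 / 4 * L < u" for x y u L :: real using that by linarith
      have "measure lebesgue ((- P \<inter> {0<..<1}) \<inter> ?I) \<le> measure lebesgue (- P \<inter> ?I)"
      proof (rule measure_mono_fmeasurable[OF _ _ subset_unit_lmeasurable[of _ "a l" "a (Suc l)"]])
        show "- P \<inter> {0<..<1} \<inter> ?I \<in> sets lebesgue" "- P \<inter> ?I \<in> sets lebesgue" by (intro sets.Int P'; simp)+
      qed auto
      moreover have "measure lebesgue (P \<inter> ?I) + measure lebesgue (- P \<inter> ?I) = ?L"
      proof -
        have "measure lebesgue ?I = ?L" using Lp by simp
        moreover
        have "- P \<inter> ?I \<in> lmeasurable" using P' by (intro subset_unit_lmeasurable[of _ "a l" "a (Suc l)"]) auto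
        moreover have "?I = (P \<inter> ?I) \<union> (- P \<inter> ?I)" by blast
        moreover have "(P \<inter> ?I) \<inter> (- P \<inter> ?I) = {}" by blast
        ultimately show ?thesis using Yl measure_Un3[of "P \<inter> ?I" lebesgue "- P \<inter> ?I"] by simp
      qed
      ultimately show ?thesis using l(2) by (rule gen)
    qed
    finally show False using lower Lp by simp
  qed
qed

text \<open>If all points of P in a compact part K of A left K, then the M disjoint images of P, whose total size is at
  least half that of P, would have to fit into the small set U - K.\<close>

lemma ratio_lower:
  assumes G: "diffeo G" and s: "0 \<le> s"
    and H: "\<And>\<epsilon> \<delta>. 0 < \<epsilon> \<Longrightarrow> 0 < \<delta> \<Longrightarrow> \<exists>N a P M i k. unit_partition N a \<and> (\<forall>j<N. a (Suc j) - a j < \<delta>) \<and> P \<in> sets lebesgue \<and> 0 < M \<and>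
      (\<forall>j<N. (a (Suc j) - a j) / 16 \<le> measure lebesgue (P \<inter> {a j..<a (Suc j)})) \<and>
      (\<forall>m<M. \<forall>y\<in>P. \<bar>deriv (G ^^ i m) y - s\<bar> < \<epsilon> \<and> 1 / (2 * real M) \<le> deriv (G ^^ i m) y \<and> \<bar>(G ^^ i m) y + of_int (k m :: int) - y\<bar> < \<delta>) \<and>
      disjoint_family_on (\<lambda>m. (\<lambda>y. (G ^^ i m) y + of_int (k m)) ` P) {..<M}"
  shows "s \<in> ratio_set cm (cmap G)"
proof (rule ratio_setI[OF G s])
  fix A and \<epsilon> :: real assume A: "A \<in> sets cm" "0 < \<epsilon>" "0 < emeasure cm A"
  define S where "S = proj -` A \<inter> {0<..<1}"
  have S: "S \<in> sets lebesgue" "S \<subseteq> {0<..<1}" using A by (auto simp: S_def sets_cm_iff)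
  have mS: "0 < measure lebesgue S" using A(3) emeasure_cm_eq[OF A(1)] by (simp add: S_def)
  \<comment> \<open>A hundredth suffices: \<open>P \<inter> K\<close> has at least 1/16 of the
    measure of \<open>K\<close> minus that of \<open>U - K\<close>, and half of what remains still
    exceeds \<eta>.\<close>
  define \<eta> where "\<eta> = measure lebesgue S / 100"
  have \<eta>: "0 < \<eta>" using mS by (simp add: \<eta>_def)
  obtain K U where KU: "compact K" "K \<subseteq> S" "S \<subseteq> U" "open U" "U \<subseteq> {0<..<1}"
    "measure lebesgue (U - K) < \<eta>" "measure lebesgue S \<le> measure lebesgue K + \<eta>"
    using inner_compact_outer_open[OF S \<eta>] by blast
  have K: "K \<in> lmeasurable" using KU(1) by (rule lmeasurable_compact)
  have U: "U \<in> lmeasurable" using KU(4,5) by (intro subset_unit_lmeasurable[of _ 0 1]) auto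
  have KU2: "K \<subseteq> U" using KU by blast
  have UK: "U - K \<in> lmeasurable" using U K by (intro fmeasurable.Diff) auto
  obtain \<delta> where \<delta>: "0 < \<delta>" "\<forall>x\<in>K. \<forall>y. \<bar>y - x\<bar> < \<delta> \<longrightarrow> y \<in> U"
    "\<forall>N a. unit_partition N a \<longrightarrow> (\<forall>j<N. a (Suc j) - a j < \<delta>) \<longrightarrow>
       (\<exists>T\<subseteq>{..<N}. K \<subseteq> (\<Union>j\<in>T. {a j..<a (Suc j)}) \<and> (\<Union>j\<in>T. {a j..<a (Suc j)}) \<subseteq> U)"
    using partition_between[OF KU(1) KU2 KU(4,5)] by (elim exE conjE)
  obtain N a P M i k where p: "unit_partition N a" "\<forall>j<N. a (Suc j) - a j < \<delta>" and P: "P \<in> sets lebesgue" and M: "0 < M"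
    and fat: "\<forall>j<N. (a (Suc j) - a j) / 16 \<le> measure lebesgue (P \<inter> {a j..<a (Suc j)})"
    and D0: "\<forall>m<M. \<forall>y\<in>P. \<bar>deriv (G ^^ i m) y - s\<bar> < \<epsilon> \<and> 1 / (2 * real M) \<le> deriv (G ^^ i m) y \<and> \<bar>(G ^^ i m) y + of_int (k m :: int) - y\<bar> < \<delta>"
    and dj: "disjoint_family_on (\<lambda>m. (\<lambda>y. (G ^^ i m) y + of_int (k m)) ` P) {..<M}"
    using H[OF A(2) \<delta>(1)] by (elim exE conjE)
  note D = D0[rule_format, THEN conjunct1] D0[rule_format, THEN conjunct2, THEN conjunct1] D0[rule_format, THEN conjunct2, THEN conjunct2]
  define F where "F m y = (G ^^ i m) y + of_int (k m)" for m y
  have F: "diffeo (F m)" for m unfolding F_def[abs_def] by (intro diffeo_shift' diffeo_funpow G)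
  have dF: "deriv (F m) y = deriv (G ^^ i m) y" for m y
    unfolding F_def[abs_def] by (rule deriv_add_const[OF diffeo_funpow[OF G]])
  obtain T where T: "T \<subseteq> {..<N}" "K \<subseteq> (\<Union>j\<in>T. {a j..<a (Suc j)})" "(\<Union>j\<in>T. {a j..<a (Suc j)}) \<subseteq> U"
    using \<delta>(3)[rule_format, OF p(1)] p(2) by blast
  define W where "W = (\<Union>j\<in>T. {a j..<a (Suc j)})"
  have fT: "finite T" using T(1) finite_subset by blast
  have W: "W \<in> lmeasurable" using fT U T(3) by (intro fmeasurableI2[OF U]) (auto simp: W_def)
  have PK: "P \<inter> K \<in> lmeasurable" by (rule fmeasurableI2[OF K]) (use P K in auto)
  have PW: "P \<inter> W \<in> lmeasurable" by (rule fmeasurableI2[OF W]) (use P W in auto)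
  have WU: "W \<subseteq> U" using T(3) by (simp add: W_def)
  have "measure lebesgue K / 16 \<le> measure lebesgue W / 16"
    using T(2) K W by (intro divide_right_mono measure_mono_fmeasurable) (auto simp: W_def)
  also have "measure lebesgue W = (\<Sum>j\<in>T. measure lebesgue (UNIV \<inter> {a j..<a (Suc j)}))"
    using measure_Union_partition[OF p(1) T(1), of UNIV] by (simp add: W_def)
  also have "\<dots> / 16 \<le> (\<Sum>j\<in>T. measure lebesgue (P \<inter> {a j..<a (Suc j)}))"
    unfolding sum_divide_distrib
  proof (rule sum_mono)
    fix j assume "j \<in> T"
    then have j: "j < N" using T(1) by auto
    then have "a j < a (Suc j)" using p(1) by (auto simp: unit_partition_def)
    then show "measure lebesgue (UNIV \<inter> {a j..<a (Suc j)}) / 16 \<le> measure lebesgue (P \<inter> {a j..<a (Suc j)})"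
      using fat j by simp
  qed
  also have "\<dots> = measure lebesgue (P \<inter> W)"
    unfolding W_def by (rule measure_Union_partition[OF p(1) T(1) P, symmetric])
  also have "\<dots> \<le> measure lebesgue (P \<inter> K) + measure lebesgue (U - K)"
  proof -
    have "measure lebesgue (P \<inter> W) \<le> measure lebesgue ((P \<inter> K) \<union> (U - K))"
      using WU PK UK PW by (intro measure_mono_fmeasurable fmeasurable.Un) auto
    also have "\<dots> \<le> measure lebesgue (P \<inter> K) + measure lebesgue (U - K)"
      using PK UK by (intro measure_Un_le) auto
    finally show ?thesis .
  qed
  finally have PKlow: "measure lebesgue K / 16 - measure lebesgue (U - K) \<le> measure lebesgue (P \<inter> K)" by simp
  have K01: "K \<subseteq> {0..1}" using KU2 KU(5) by force
  \<comment> \<open>The points of \<open>P\<close> that start in \<open>K\<close> and land in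
    \<open>K\<close> under the m-th map; positive measure for a single m is enough.\<close>
  define B0 where "B0 m = P \<inter> K \<inter> F m -` K" for m
  have B0m: "B0 m \<in> sets lebesgue" for m
    unfolding B0_def using P K by (intro sets.Int diffeo_vimage_lebesgue[OF F]) auto
  have "\<exists>m<M. measure lebesgue (B0 m) \<noteq> 0"
  proof (rule ccontr)
    assume neg: "\<not> ?thesis"
    have lw: "1 / (2 * real M) * measure lebesgue (P \<inter> K) \<le> measure lebesgue (F m ` (P \<inter> K) - K)" if m: "m < M" for m
    proof -
      have B0n: "negligible (B0 m)"
      proof -
        have "B0 m \<in> lmeasurable" using B0m K01 by (intro subset_unit_lmeasurable[of _ 0 1]) (auto simp: B0_def)
        then show ?thesis using neg m by (simp add: negligible_iff_measure)
      qed
      have sub: "P \<inter> K - B0 m \<subseteq> {0..1}" using K01 by auto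
      have ms: "P \<inter> K - B0 m \<in> sets lebesgue" using PK B0m by auto
      have "measure lebesgue (P \<inter> K - B0 m) = measure lebesgue (P \<inter> K)"
        using PK B0n by (intro measure_Diff_null_set) (auto simp: negligible_iff_null_sets)
      then have "1 / (2 * real M) * measure lebesgue (P \<inter> K) \<le> measure lebesgue (F m ` (P \<inter> K - B0 m))"
        using diffeo_image_measure_ge[OF F ms sub, of "1 / (2 * real M)" m] D(2)[OF m] by (simp add: dF)
      also have "F m ` (P \<inter> K - B0 m) = F m ` (P \<inter> K) - K" by (auto simp: B0_def)
      finally show ?thesis .
    qed
    have img: "F m ` (P \<inter> K) - K \<subseteq> U - K" if m: "m < M" for m
      using \<delta>(2) D(3)[OF m] by (auto simp: F_def)
    have imgm: "F m ` (P \<inter> K) - K \<in> sets lebesgue" for m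
      using diffeo_image_lebesgue[OF F, of "P \<inter> K"] PK K by auto
    have imgl: "F m ` (P \<inter> K) - K \<in> lmeasurable" if m: "m < M" for m
      by (rule fmeasurableI2[OF UK img[OF m] imgm])
    \<comment> \<open>Each image has at least the share \<open>1 / (2 * M)\<close> of the measure of
      \<open>P \<inter> K\<close>. The images being disjoint, all of them together would place half
      of that measure inside \<open>U - K\<close>.\<close>
    have "1 / 2 * measure lebesgue (P \<inter> K) = (\<Sum>m<M. 1 / (2 * real M) * measure lebesgue (P \<inter> K))"
      using M by simp
    also have "\<dots> \<le> (\<Sum>m<M. measure lebesgue (F m ` (P \<inter> K) - K))" by (intro sum_mono lw) auto
    also have "\<dots> = measure lebesgue (\<Union>m<M. F m ` (P \<inter> K) - K)"
    proof (rule measure_finite_Union[symmetric])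
      show "disjoint_family_on (\<lambda>m. F m ` (P \<inter> K) - K) {..<M}"
        using dj unfolding disjoint_family_on_def F_def by fast
      show "emeasure lebesgue (F m ` (P \<inter> K) - K) \<noteq> \<infinity>" if "m \<in> {..<M}" for m
        using fmeasurableD2[OF imgl] that by simp
      show "(\<lambda>m. F m ` (P \<inter> K) - K) ` {..<M} \<subseteq> sets lebesgue" using imgm by blast
    qed simp
    also have "\<dots> \<le> measure lebesgue (U - K)"
    proof (rule measure_mono_fmeasurable[OF _ _ UK])
      show "(\<Union>m<M. F m ` (P \<inter> K) - K) \<subseteq> U - K" using img by blast
      show "(\<Union>m<M. F m ` (P \<inter> K) - K) \<in> sets lebesgue" by (intro sets.finite_UN finite_lessThan imgm)
    qed
    finally have "1 / 2 * measure lebesgue (P \<inter> K) \<le> measure lebesgue (U - K)" .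
    then show False using PKlow KU(6,7) mS by (simp add: \<eta>_def)
  qed
  then obtain m where m: "m < M" "measure lebesgue (B0 m) \<noteq> 0" by blast
  define B where "B = proj ` B0 m"
  have vB: "proj -` B = (\<Union>z::int. (\<lambda>x. x + of_int z) ` B0 m)"
    unfolding B_def by (auto simp: image_iff proj_eq_iff) (metis proj_add_int proj_eq_iff)
  have "proj -` B \<in> sets lebesgue" unfolding vB
    by (intro sets.countable_UN') (auto intro!: diffeo_image_lebesgue[OF diffeo_shift] B0m)
  then have Bm: "B \<in> sets cm" by (simp add: sets_cm_iff)
  have "B0 m \<subseteq> proj -` B \<inter> {0<..<1}" using KU2 KU(5) by (auto simp: B_def B0_def)
  then have "measure lebesgue (B0 m) \<le> measure lebesgue (proj -` B \<inter> {0<..<1})"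
    using B0m \<open>proj -` B \<in> sets lebesgue\<close> by (intro measure_mono_fmeasurable subset_unit_lmeasurable[of "_ \<inter> _" 0 1]) auto
  then have Bpos: "0 < emeasure cm B"
    using m(2) by (simp add: emeasure_cm_eq[OF Bm] zero_less_iff_neq_zero) (metis measure_nonneg order_antisym)
  have it: "iter G (int n) = G ^^ n" for n by (simp add: iter_def)
  have BA: "B \<subseteq> A" using KU(2) by (auto simp: B_def B0_def S_def)
  have img: "cmap (iter G (int (i m))) ` B \<subseteq> A"
  proof
    fix c assume "c \<in> cmap (iter G (int (i m))) ` B"
    then obtain y where y: "y \<in> B0 m" "c = cmap (G ^^ i m) (proj y)" by (auto simp: B_def it)
    have "F m y \<in> K" using y(1) by (simp add: B0_def)
    then have "proj (F m y) \<in> A" using KU(2) by (auto simp: S_def)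
    moreover have "proj (F m y) = c" using y(2) by (simp add: F_def cmap_proj[OF diffeo_funpow[OF G]])
    ultimately show "c \<in> A" by simp
  qed
  have "\<forall>c\<in>B. \<bar>cfun (deriv (iter G (int (i m)))) c - s\<bar> < \<epsilon>"
    using D(1)[OF m(1)] by (auto simp: B_def B0_def it cfun_deriv_proj[OF diffeo_funpow[OF G]])
  then show "\<exists>B\<in>sets cm. \<exists>i. 0 < emeasure cm B \<and> B \<subseteq> A \<and>
       cmap (iter G i) ` B \<subseteq> A \<and> (\<forall>c\<in>B. \<bar>cfun (deriv (iter G i)) c - s\<bar> < \<epsilon>)"
    using Bpos BA img by (intro bexI[OF _ Bm] exI[of _ "int (i m)"] conjI)
qed

section \<open>One stage of the construction\<close>

text \<open>At scale \<open>1 / q\<close> the conjugacy built so far is almost affine, its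
  derivative being constant up to the factor \<open>1 + \<eta>\<close>; inside a cell the geometry
  is then that of the new profile alone.\<close>

definition slow :: "real \<Rightarrow> (real \<Rightarrow> real) \<Rightarrow> nat \<Rightarrow> bool" where
  "slow \<eta> K q \<longleftrightarrow> 0 < q \<and> (\<forall>x y. \<bar>x - y\<bar> \<le> 2 / real q \<longrightarrow> deriv K x \<le> (1 + \<eta>) * deriv K y \<and> \<bar>K x - K y\<bar> \<le> \<eta>)"

text \<open>The derivative is Lipschitz and bounded away from 0, so its relative variation over the
  distance \<open>2 / q\<close> tends to 0.\<close>

lemma slow_eventually:
  assumes K: "diffeo K" and \<eta>: "0 < \<eta>"
  shows "\<exists>Q. \<forall>q\<ge>Q. slow \<eta> K q"
proof -
  obtain L where L: "0 < L" "\<And>x y. \<bar>K x - K y\<bar> \<le> L * \<bar>x - y\<bar>" using diffeo_lipschitz[OF K] by blast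
  obtain L' where L': "0 < L'" "\<And>x y. \<bar>deriv K x - deriv K y\<bar> \<le> L' * \<bar>x - y\<bar>"
    using smooth_bdd_lipschitz[OF diffeo_smooth_bdd[OF K]] by blast
  obtain c where c: "0 < c" "\<And>x. c \<le> deriv K x" using diffeo_lower[OF K] by blast
  obtain Q :: nat where Q: "2 * L / \<eta> + 2 * L' / (\<eta> * c) + 1 < real Q" using reals_Archimedean2 by blast
  show ?thesis
  proof (intro exI[of _ Q] allI impI)
    fix q assume q: "Q \<le> q"
    have pos: "0 \<le> 2 * L / \<eta>" "0 \<le> 2 * L' / (\<eta> * c)" using L L' c \<eta> by auto
    have qQ: "2 * L / \<eta> + 2 * L' / (\<eta> * c) + 1 < real q" using Q q by linarith
    then have q0: "0 < q" using pos by (intro Nat.gr0I) auto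
    have q1: "2 * L / real q \<le> \<eta>" "2 * L' / real q \<le> \<eta> * c"
      using qQ pos q0 \<eta> c by (simp_all add: pos_divide_le_eq pos_divide_less_eq mult.commute divide_le_eq)
         (smt (verit, best) divide_le_eq mult.commute mult_pos_pos)+
    show "slow \<eta> K q" unfolding slow_def
    proof (intro conjI q0 allI impI)
      fix x y assume xy: "\<bar>x - y\<bar> \<le> 2 / real q"
      have "\<bar>K x - K y\<bar> \<le> L * \<bar>x - y\<bar>" by (rule L)
      also have "\<dots> \<le> L * (2 / real q)" using L xy by (intro mult_left_mono) auto
      finally show "\<bar>K x - K y\<bar> \<le> \<eta>" using q1 by (simp add: mult.commute)
      have "\<bar>deriv K x - deriv K y\<bar> \<le> L' * \<bar>x - y\<bar>" by (rule L')
      also have "\<dots> \<le> L' * (2 / real q)" using L' xy by (intro mult_left_mono) auto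
      also have "\<dots> \<le> \<eta> * c" using q1 by (simp add: mult.commute)
      also have "\<dots> \<le> \<eta> * deriv K y" using c \<eta> by (intro mult_left_mono) auto
      finally show "deriv K x \<le> (1 + \<eta>) * deriv K y" by (simp add: distrib_right)
    qed
  qed
qed

text \<open>The tolerance \<eta> \<delta> c/(q C) is small against the transition arcs of length \<delta>/q after applying H and
  against the derivative of any conjugated rotation, which is at least c/C.\<close>

definition shadow :: "real \<Rightarrow> real \<Rightarrow> (real \<Rightarrow> real) \<Rightarrow> nat \<Rightarrow> (real \<Rightarrow> real) \<Rightarrow> bool" where
  "shadow \<eta> \<delta> H q G \<longleftrightarrow> (\<exists>c C. 0 < c \<and> c \<le> C \<and> 1 \<le> C \<and> (\<forall>x. c \<le> deriv H x \<and> deriv H x \<le> C) \<and>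
     (\<forall>s. \<exists>i. \<exists>k::int. C1_close (\<eta> * \<delta> * c / (real q * C)) (\<lambda>y. (G ^^ i) y + of_int k) (conj_rot H s)))"

lemma shadow_near_conj_rot:
  assumes H: "diffeo H" and \<alpha>: "\<alpha> \<notin> \<rat>" and "0 < \<eta>" "0 < \<delta>" "0 < q"
  shows "\<exists>\<rho>>0. \<forall>G. diffeo G \<longrightarrow> C1_close \<rho> G (conj_rot H \<alpha>) \<longrightarrow> shadow \<eta> \<delta> H q G"
proof -
  obtain c C0 where c: "0 < c" "c \<le> C0" "\<And>x. c \<le> deriv H x" "\<And>x. deriv H x \<le> C0" using diffeo_bounds[OF H] by blast
  define C where "C = max C0 1"
  have C: "c \<le> C" "1 \<le> C" "\<And>x. deriv H x \<le> C" using c by (auto simp: C_def intro: max.coboundedI1)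
  have "0 < \<eta> * \<delta> * c / (real q * C)" using assms c C by simp
  from iterates_shadow_conj_rot[OF H \<alpha> this] show ?thesis
    unfolding shadow_def using c(1,3) C by meson
qed

text \<open>The variation of \<open>deriv K\<close> costs a factor \<open>1 + \<eta>\<close> for the
  arc and another one for the whole cell, so an arc of the profile keeps its share of the cell up to
  the square.\<close>

lemma cell_length:
  assumes K: "diffeo K" and \<phi>: "diffeo \<phi>" "\<phi> 0 = 0" and sl: "slow \<eta> K q" and \<eta>: "0 \<le> \<eta>"
    and ab: "0 \<le> a" "a \<le> b" "b \<le> 1"
  defines "H \<equiv> \<lambda>x. K (rescale q \<phi> x)"
  shows "(\<phi> b - \<phi> a) * (K ((real j + 1) / real q) - K (real j / real q)) \<le> (1 + \<eta>)\<^sup>2 * (H ((real j + b) / real q) - H ((real j + a) / real q))"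
    and "H ((real j + b) / real q) - H ((real j + a) / real q) \<le> (1 + \<eta>)\<^sup>2 * (\<phi> b - \<phi> a) * (K ((real j + 1) / real q) - K (real j / real q))"
proof -
  have q: "0 < q" using sl by (simp add: slow_def)
  have \<phi>1: "\<phi> 1 = 1" using diffeo_add_1[OF \<phi>(1), of 0] \<phi>(2) by simp
  have mono: "0 \<le> \<phi> a" "\<phi> a \<le> \<phi> b" "\<phi> b \<le> 1"
    using ab diffeo_le_iff[OF \<phi>(1)] \<phi>(2) \<phi>1 by metis+
  have st: "rescale q \<phi> ((real j + x) / real q) = (real j + \<phi> x) / real q" for x
    using diffeo_add_nat[OF \<phi>(1), of x j] q by (simp add: rescale_def add.commute)
  let ?v = "real j / real q" let ?d = "deriv K (real j / real q)"
  have d: "0 < ?d" by (rule diffeo_deriv_pos[OF K])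
  have near: "?d / (1 + \<eta>) \<le> deriv K z \<and> deriv K z \<le> (1 + \<eta>) * ?d" if "?v \<le> z" "z \<le> (real j + 1) / real q" for z
  proof -
    have zq: "\<bar>z - ?v\<bar> \<le> 2 / real q" "\<bar>?v - z\<bar> \<le> 2 / real q" using that q by (auto simp: add_divide_distrib)
    have "?d \<le> (1 + \<eta>) * deriv K z" "deriv K z \<le> (1 + \<eta>) * ?d"
      using sl zq unfolding slow_def by blast+
    then show ?thesis using \<eta> by (simp add: pos_divide_le_eq mult.commute)
  qed
  let ?I = "K ((real j + 1) / real q) - K (real j / real q)"
  let ?X = "H ((real j + b) / real q) - H ((real j + a) / real q)"
  have I: "?d / (1 + \<eta>) * (1 / real q) \<le> ?I" "?I \<le> (1 + \<eta>) * ?d * (1 / real q)"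
  proof -
    have le: "?v \<le> (real j + 1) / real q" by (intro divide_right_mono) auto
    have "(real j + 1) / real q - ?v = 1 / real q" by (simp add: add_divide_distrib)
    then show "?d / (1 + \<eta>) * (1 / real q) \<le> ?I" "?I \<le> (1 + \<eta>) * ?d * (1 / real q)"
      using diffeo_mvt[OF K le near] by simp_all
  qed
  have len: "(real j + \<phi> b) / real q - (real j + \<phi> a) / real q = (\<phi> b - \<phi> a) * (1 / real q)"
    by (simp add: diff_divide_distrib add_divide_distrib)
  have X: "?d / (1 + \<eta>) * ((\<phi> b - \<phi> a) * (1 / real q)) \<le> ?X" "?X \<le> (1 + \<eta>) * ?d * ((\<phi> b - \<phi> a) * (1 / real q))"
  proof -
    have le: "(real j + \<phi> a) / real q \<le> (real j + \<phi> b) / real q" using mono by (intro divide_right_mono) auto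
    have nr: "?d / (1 + \<eta>) \<le> deriv K z \<and> deriv K z \<le> (1 + \<eta>) * ?d"
      if z: "(real j + \<phi> a) / real q \<le> z" "z \<le> (real j + \<phi> b) / real q" for z
    proof (rule near)
      have "?v \<le> (real j + \<phi> a) / real q" "(real j + \<phi> b) / real q \<le> (real j + 1) / real q"
        using mono by (intro divide_right_mono; simp)+
      then show "?v \<le> z" "z \<le> (real j + 1) / real q" using z by linarith+
    qed
    show "?d / (1 + \<eta>) * ((\<phi> b - \<phi> a) * (1 / real q)) \<le> ?X" "?X \<le> (1 + \<eta>) * ?d * ((\<phi> b - \<phi> a) * (1 / real q))"
      using diffeo_mvt[OF K le nr] unfolding H_def st len by auto
  qed
  have e1: "0 < 1 + \<eta>" using \<eta> by simp
  have p: "0 \<le> \<phi> b - \<phi> a" using mono by simp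
  have "(\<phi> b - \<phi> a) * ?I \<le> (\<phi> b - \<phi> a) * ((1 + \<eta>) * ?d * (1 / real q))"
    using I(2) p by (rule mult_left_mono)
  also have "\<dots> = (1 + \<eta>)\<^sup>2 * (?d / (1 + \<eta>) * ((\<phi> b - \<phi> a) * (1 / real q)))"
    using e1 by (simp add: power2_eq_square)
  also have "\<dots> \<le> (1 + \<eta>)\<^sup>2 * ?X" using X(1) by (intro mult_left_mono) auto
  finally show "(\<phi> b - \<phi> a) * ?I \<le> (1 + \<eta>)\<^sup>2 * ?X" .
  have "?X \<le> (1 + \<eta>)\<^sup>2 * (\<phi> b - \<phi> a) * (?d / (1 + \<eta>) * (1 / real q))"
    using X(2) e1 by (simp add: power2_eq_square mult_ac)
  also have "\<dots> \<le> (1 + \<eta>)\<^sup>2 * (\<phi> b - \<phi> a) * ?I" using I(1) p by (intro mult_left_mono) auto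
  finally show "?X \<le> (1 + \<eta>)\<^sup>2 * (\<phi> b - \<phi> a) * ?I" .
qed

section \<open>The intervals of a stage and their motion under rotations\<close>

lemma atoms_partition:
  assumes K: "diffeo K" "K 0 = 0" and sl: "slow \<eta> K q"
  shows "unit_partition q (\<lambda>j. K (real j / real q))" "K (real (Suc j) / real q) - K (real j / real q) \<le> \<eta>"
proof -
  have q: "0 < q" using sl by (simp add: slow_def)
  have "K 1 = 1" using diffeo_add_1[OF K(1), of 0] K(2) by simp
  then show "unit_partition q (\<lambda>j. K (real j / real q))"
    using q K by (auto simp: unit_partition_def diffeo_less_iff[OF K(1)] divide_strict_right_mono)
  have "\<bar>real (Suc j) / real q - real j / real q\<bar> \<le> 2 / real q" using q by (simp add: diff_divide_distrib[symmetric] divide_right_mono)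
  then have "\<bar>K (real (Suc j) / real q) - K (real j / real q)\<bar> \<le> \<eta>" using sl unfolding slow_def by blast
  then show "K (real (Suc j) / real q) - K (real j / real q) \<le> \<eta>" by linarith
qed

text \<open>Rotation by \<open>(l - j) / q\<close> commutes with the rescaled profile, so its
  conjugate by the new \<open>H\<close> equals its conjugate by \<open>K\<close>, which carries
  interval j exactly onto interval l with almost constant derivative. The factors 7/8 and 1/16 leave
  room for the distortion and for passing to an iterate of \<open>G\<close>.\<close>

lemma stage_mixes:
  assumes K: "diffeo K" "K 0 = 0" and \<phi>: "diffeo \<phi>" "\<phi> 0 = 0" and sl: "slow \<eta> K q" and \<eta>: "0 < \<eta>" "\<eta> \<le> 1 / 32"
    and \<delta>: "0 < \<delta>" "\<delta> \<le> 1" and sh: "shadow \<eta> \<delta> (\<lambda>x. K (rescale q \<phi> x)) q G" and G: "diffeo G"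
  defines "a \<equiv> \<lambda>j. K (real j / real q)"
  shows "\<exists>i. \<exists>k::int.
         (\<forall>y. a j \<le> y \<longrightarrow> y \<le> a (Suc j) \<longrightarrow> 7 / 8 * (a (Suc l) - a l) \<le> deriv (G ^^ i) y * (a (Suc j) - a j)) \<and>
         a l - (a (Suc l) - a l) / 16 \<le> (G ^^ i) (a j) + of_int k \<and>
         (G ^^ i) (a (Suc j)) + of_int k \<le> a (Suc l) + (a (Suc l) - a l) / 16"
proof -
  have q: "0 < q" using sl by (simp add: slow_def)
  define H where "H = (\<lambda>x. K (rescale q \<phi> x))"
  have H: "diffeo H" unfolding H_def by (rule diffeo_comp(1)[OF K(1) rescale_diffeo(1)[OF \<phi>(1) q]])
  obtain c C where c: "0 < c" "c \<le> C" "1 \<le> C" "\<And>x. c \<le> deriv H x" "\<And>x. deriv H x \<le> C"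
    and sh': "\<forall>s. \<exists>i. \<exists>k::int. C1_close (\<eta> * \<delta> * c / (real q * C)) (\<lambda>y. (G ^^ i) y + of_int k) (conj_rot H s)"
    using sh unfolding shadow_def H_def[symmetric] by (elim exE conjE) (rule that; auto)
  define s where "s = of_int (int l - int j) / real q"
  have sq: "s = (real l - real j) / real q" by (simp add: s_def)
  obtain i and k :: int where ik: "C1_close (\<eta> * \<delta> * c / (real q * C)) (\<lambda>y. (G ^^ i) y + of_int k) (conj_rot H s)"
    using sh' by blast
  have HK: "conj_rot H s = conj_rot K s" unfolding H_def s_def by (rule conj_rot_rescale[OF K(1) \<phi>(1) q])
  let ?E = "\<eta> * \<delta> * c / (real q * C)"
  have close: "\<bar>(G ^^ i) y + of_int k - conj_rot K s y\<bar> \<le> ?E" "\<bar>deriv (G ^^ i) y - deriv (conj_rot K s) y\<bar> \<le> ?E" for y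
    using ik by (auto simp: C1_close_def HK deriv_add_const[OF diffeo_funpow[OF G]])
  \<comment> \<open>The tolerance is measured in two ways: \<open>E2\<close> against the image of a
    cell, which has length at least \<open>c / q\<close>, and \<open>E3\<close> against the
    derivative of a conjugated rotation, which is at least \<open>c / C\<close>. The latter makes
    the error in the derivative a relative one.\<close>
  have E1: "?E \<le> \<eta> * c / (real q * C)"
    using \<eta> \<delta> c q by (intro divide_right_mono mult_right_mono) (auto simp: mult_left_le)
  have E2: "?E \<le> \<eta> * c / real q"
  proof -
    have "\<eta> * c / (real q * C) \<le> \<eta> * c / (real q * 1)" using c \<eta> q by (intro divide_left_mono mult_left_mono) auto
    then show ?thesis using E1 by simp
  qed
  have E3: "?E \<le> \<eta> * (c / C)"
  proof -
    have "\<eta> * c / (real q * C) \<le> \<eta> * c / (1 * C)" using c \<eta> q by (intro divide_left_mono mult_right_mono) auto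
    then show ?thesis using E1 by simp
  qed
  have Ha: "H (real m / real q) = a m" for m
  proof -
    have "rescale q \<phi> (real m / real q) = real m / real q"
      using diffeo_add_nat[OF \<phi>(1), of 0 m] \<phi>(2) q by (simp add: rescale_def)
    then show ?thesis by (simp add: H_def a_def)
  qed
  have Llow: "c / real q \<le> a (Suc m) - a m" for m
  proof -
    have "c * (real (Suc m) / real q - real m / real q) \<le> H (real (Suc m) / real q) - H (real m / real q)"
      by (rule diffeo_mvt(1)[OF H, of _ _ c C]) (use c q in \<open>auto intro: divide_right_mono\<close>)
    moreover have "real (Suc m) / real q - real m / real q = 1 / real q" by (simp add: add_divide_distrib)
    ultimately show ?thesis by (simp add: Ha del: of_nat_Suc)
  qed
  have E4: "?E \<le> (a (Suc l) - a l) / 16"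
  proof -
    have "?E \<le> \<eta> * (c / real q)" using E2 by simp
    also have "\<dots> \<le> 1 / 32 * (c / real q)" using \<eta> c q by (intro mult_right_mono) auto
    also have "\<dots> \<le> (a (Suc l) - a l) / 16"
    proof -
      have "1 / 32 * x \<le> y / 16" if "0 \<le> x" "x \<le> y" for x y :: real using that by linarith
      moreover have "0 \<le> c / real q" using c by simp
      ultimately show ?thesis using Llow[of l] by blast
    qed
    finally show ?thesis .
  qed
  have shift: "conj_rot K s (a m) = K (real m / real q + s)" for m
    using K by (simp add: conj_rot_def a_def)
  have Fj: "conj_rot K s (a j) = a l"
    unfolding shift unfolding a_def sq by (simp add: add_divide_distrib[symmetric])
  have Fj': "conj_rot K s (a (Suc j)) = a (Suc l)"
    unfolding shift unfolding a_def sq by (simp add: add_divide_distrib[symmetric])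
  have der: "7 / 8 * (a (Suc l) - a l) \<le> deriv (G ^^ i) y * (a (Suc j) - a j)" if y: "a j \<le> y" "y \<le> a (Suc j)" for y
  proof -
    define x where "x = inv K y"
    have yx: "y = K x" using K by (simp add: x_def)
    have x: "real j / real q \<le> x" "x \<le> (real j + 1) / real q"
      using y diffeo_le_iff[OF K(1)] by (auto simp: yx a_def add.commute)
    let ?u = "deriv K (x + s)" let ?v = "deriv K x"
    have u: "0 < ?u" and v: "0 < ?v" using diffeo_deriv_pos[OF K(1)] by auto
    have xs: "real l / real q \<le> x + s" "x + s \<le> (real l + 1) / real q"
      using x by (auto simp: sq diff_divide_distrib add_divide_distrib)
    have Iu: "a (Suc l) - a l \<le> (1 + \<eta>) * ?u * (1 / real q)"
    proof -
      have "K ((real l + 1) / real q) - K (real l / real q) \<le> (1 + \<eta>) * ?u * ((real l + 1) / real q - real l / real q)"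
      proof (rule diffeo_mvt(2)[OF K(1), where a = 0])
        fix z assume "real l / real q \<le> z" "z \<le> (real l + 1) / real q"
        then have "\<bar>z - (x + s)\<bar> \<le> 2 / real q" using xs q by (auto simp: add_divide_distrib)
        then show "0 \<le> deriv K z \<and> deriv K z \<le> (1 + \<eta>) * ?u"
          using sl diffeo_deriv_pos[OF K(1), of z] unfolding slow_def by (auto intro: less_imp_le)
      qed (auto intro: divide_right_mono)
      then show ?thesis by (simp add: a_def add_divide_distrib add.commute)
    qed
    have Iv: "?v / (1 + \<eta>) * (1 / real q) \<le> a (Suc j) - a j"
    proof -
      have "?v / (1 + \<eta>) * ((real j + 1) / real q - real j / real q) \<le> K ((real j + 1) / real q) - K (real j / real q)"
      proof (rule diffeo_mvt(1)[OF K(1), where b = "(1 + \<eta>) * ?v"])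
        fix z assume "real j / real q \<le> z" "z \<le> (real j + 1) / real q"
        then have "\<bar>x - z\<bar> \<le> 2 / real q" "\<bar>z - x\<bar> \<le> 2 / real q" using x q by (auto simp: add_divide_distrib)
        then have "?v \<le> (1 + \<eta>) * deriv K z" "deriv K z \<le> (1 + \<eta>) * ?v"
          using sl unfolding slow_def by blast+
        then show "?v / (1 + \<eta>) \<le> deriv K z \<and> deriv K z \<le> (1 + \<eta>) * ?v"
          using \<eta> by (simp add: pos_divide_le_eq mult.commute)
      qed (auto intro: divide_right_mono)
      then show ?thesis by (simp add: a_def add_divide_distrib add.commute)
    qed
    have F0: "deriv (conj_rot K s) y = ?u / ?v" using conj_rot_deriv[OF K(1), of s y] by (simp add: x_def)
    have "c / C \<le> ?u / ?v"
    proof -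
      have "c / C \<le> deriv H (inv H y + s) / deriv H (inv H y)" using c diffeo_deriv_pos[OF H] by (intro frac_le) (auto intro: less_imp_le)
      then show ?thesis using conj_rot_deriv[OF H, of s y] F0 by (simp add: HK)
    qed
    then have "\<eta> * (c / C) \<le> \<eta> * (?u / ?v)" using \<eta> by (intro mult_left_mono) auto
    then have G1: "(1 - \<eta>) * (?u / ?v) \<le> deriv (G ^^ i) y"
    proof -
      have "(1 - \<eta>) * R \<le> d" if "\<bar>d - R\<bar> \<le> E" "E \<le> z" "z \<le> \<eta> * R" for d R E z :: real
        using that unfolding left_diff_distrib by linarith
      then show ?thesis using close(2)[of y] E3 \<open>\<eta> * (c / C) \<le> \<eta> * (?u / ?v)\<close> unfolding F0 by blast
    qed
    have "7 / 8 * (a (Suc l) - a l) \<le> 7 / 8 * ((1 + \<eta>) * ?u * (1 / real q))" using Iu by simp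
    also have "\<dots> \<le> (1 - \<eta>) * (?u / ?v) * (?v / (1 + \<eta>) * (1 / real q))"
    proof -
      \<comment> \<open>Here \<open>\<eta> \<le> 1 / 32\<close> enters: 7/8 times the square of
        33/32 is below 31/32.\<close>
      have "7 / 8 * (1 + \<eta>) * (1 + \<eta>) \<le> 7 / 8 * (1 + 1 / 32) * (1 + 1 / 32)"
        using \<eta> by (intro mult_mono) auto
      also have "\<dots> \<le> 1 - \<eta>" using \<eta> by simp
      finally have "7 / 8 * (1 + \<eta>) \<le> (1 - \<eta>) / (1 + \<eta>)" using \<eta> by (simp add: pos_le_divide_eq)
      then have "7 / 8 * (1 + \<eta>) * (?u / real q) \<le> (1 - \<eta>) / (1 + \<eta>) * (?u / real q)"
        using u q by (intro mult_right_mono) auto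
      moreover have "7 / 8 * ((1 + \<eta>) * ?u * (1 / real q)) = 7 / 8 * (1 + \<eta>) * (?u / real q)" by (simp only: mult.assoc times_divide_eq_right mult_1_right)
      moreover have "(1 - \<eta>) * (?u / ?v) * (?v / (1 + \<eta>) * (1 / real q)) = (1 - \<eta>) / (1 + \<eta>) * (?u / real q)" using v by simp
      ultimately show ?thesis by (simp only:)
    qed
    also have "\<dots> \<le> deriv (G ^^ i) y * (a (Suc j) - a j)"
    proof (rule mult_mono[OF G1 Iv])
      show "0 \<le> deriv (G ^^ i) y" using diffeo_deriv_pos[OF diffeo_funpow[OF G]] by (simp add: less_imp_le)
      show "0 \<le> ?v / (1 + \<eta>) * (1 / real q)" using v \<eta> q by simp
    qed
    finally show ?thesis .
  qed
  have b1: "a l - (a (Suc l) - a l) / 16 \<le> (G ^^ i) (a j) + of_int k" using close(1)[of "a j"] E4 unfolding Fj by linarith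
  have b2: "(G ^^ i) (a (Suc j)) + of_int k \<le> a (Suc l) + (a (Suc l) - a l) / 16"
    using close(1)[of "a (Suc j)"] E4 unfolding Fj' by linarith
  show ?thesis using der b1 b2 by blast
qed


lemma rescale_cell:
  assumes \<phi>: "diffeo \<phi>" and q: "0 < q" and s: "0 \<le> s" "s \<le> 1 / real q"
  shows "\<bar>rescale q \<phi> (x + s) - rescale q \<phi> x\<bar> \<le> 1 / real q"
proof -
  have "rescale q \<phi> x \<le> rescale q \<phi> (x + s)" "rescale q \<phi> (x + s) \<le> rescale q \<phi> (x + of_int 1 / real q)"
    using s by (simp_all add: diffeo_le_iff[OF rescale_diffeo(1)[OF \<phi> q]])
  then show ?thesis using rescale_shift[OF \<phi> q, of x 1] by simp
qed

text \<open>\<open>P\<close> is the image of the upper plateaus of all cells. As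
  \<open>(M + 1) * w = 1\<close>, a cell has \<open>M\<close> further slots of length
  \<open>w\<close>, all on the lower plateau, and rotation by \<open>(m + 1) * w / q\<close> moves
  the upper plateau into the m-th of them with derivative about \<open>1 / t\<close>. The inequality
  \<open>t \<le> M\<close> gives the lower bound \<open>1 / (2 * M)\<close> for it, and
  \<open>M \<le> t + 1\<close> makes the plateau wide enough to hold a fixed share of each
  interval.\<close>

lemma stage_ratio:
  assumes K: "diffeo K" "K 0 = 0" and shp: "shape t w \<delta> \<phi> lo" and sl: "slow \<eta> K q" and \<eta>: "0 < \<eta>" "\<eta> \<le> 1 / 32"
    and t: "1 < t" and M: "t \<le> real M" "real M \<le> t + 1" and w: "w = 1 / (real M + 1)" and \<delta>: "0 < \<delta>" "\<delta> \<le> w / 8"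
    and sh: "shadow \<eta> \<delta> (\<lambda>x. K (rescale q \<phi> x)) q G" and G: "diffeo G"
  defines "a \<equiv> \<lambda>j. K (real j / real q)"
  shows "\<exists>P i k. P \<in> sets lebesgue \<and>
      (\<forall>j<q. (a (Suc j) - a j) / 16 \<le> measure lebesgue (P \<inter> {a j..<a (Suc j)})) \<and>
      (\<forall>m<M. \<forall>y\<in>P. \<bar>deriv (G ^^ i m) y - 1 / t\<bar> \<le> 4 * \<eta> \<and> 1 / (2 * real M) \<le> deriv (G ^^ i m) y \<and> \<bar>(G ^^ i m) y + of_int (k m :: int) - y\<bar> \<le> 2 * \<eta>) \<and>
      disjoint_family_on (\<lambda>m. (\<lambda>y. (G ^^ i m) y + of_int (k m)) ` P) {..<M}"
proof -
  have q: "0 < q" using sl by (simp add: slow_def)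
  have \<phi>: "diffeo \<phi>" "\<phi> 0 = 0" and lo: "0 < lo" and \<phi>lo: "\<And>x. w \<le> x \<Longrightarrow> x \<le> 1 \<Longrightarrow> deriv \<phi> x = lo"
    and \<phi>hi: "\<And>x. \<delta> \<le> x \<Longrightarrow> x \<le> w - \<delta> \<Longrightarrow> deriv \<phi> x = lo * t" and lo1: "1 \<le> lo * (1 + (t - 1) * w)"
    using shp unfolding shape_def by auto
  have M0: "0 < M" using t M by (intro Nat.gr0I) auto
  have w0: "0 < w" "w \<le> 1" using w M0 by (auto simp: divide_le_eq)
  have Mw: "(real M + 1) * w = 1" using w by simp
  define H where "H = (\<lambda>x. K (rescale q \<phi> x))"
  have st: "diffeo (rescale q \<phi>)" by (rule rescale_diffeo(1)[OF \<phi>(1) q])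
  have H: "diffeo H" unfolding H_def by (rule diffeo_comp(1)[OF K(1) st])
  have dH: "deriv H x = deriv K (rescale q \<phi> x) * deriv \<phi> (real q * x)" for x
    unfolding H_def diffeo_comp(2)[OF K(1) st] rescale_diffeo(2)[OF \<phi>(1) q] ..
  obtain c C where c: "0 < c" "c \<le> C" "1 \<le> C" "\<And>x. c \<le> deriv H x" "\<And>x. deriv H x \<le> C"
    and sh': "\<forall>s. \<exists>i. \<exists>k::int. C1_close (\<eta> * \<delta> * c / (real q * C)) (\<lambda>y. (G ^^ i) y + of_int k) (conj_rot H s)"
    using sh unfolding shadow_def H_def[symmetric] by (elim exE conjE) (rule that; auto)
  let ?E = "\<eta> * \<delta> * c / (real q * C)"
  define s where "s m = (real m + 1) * w / real q" for m
  have "\<forall>m. \<exists>i. \<exists>k::int. C1_close ?E (\<lambda>y. (G ^^ i) y + of_int k) (conj_rot H (s m))" using sh' by blast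
  then obtain i and k :: "nat \<Rightarrow> int" where ik: "\<And>m. C1_close ?E (\<lambda>y. (G ^^ i m) y + of_int (k m)) (conj_rot H (s m))" by metis
  define F where "F m y = (G ^^ i m) y + of_int (k m)" for m y
  have close: "\<bar>F m y - conj_rot H (s m) y\<bar> \<le> ?E" "\<bar>deriv (G ^^ i m) y - deriv (conj_rot H (s m)) y\<bar> \<le> ?E" for m y
    using ik by (auto simp: C1_close_def F_def deriv_add_const[OF diffeo_funpow[OF G]])
  have \<delta>1: "\<delta> \<le> 1" using \<delta> w0 by simp
  have q1: "1 \<le> real q" using q by simp
  have E1: "?E \<le> \<eta> * \<delta> * c / real q"
  proof -
    have "?E \<le> \<eta> * \<delta> * c / (real q * 1)" using c \<eta> q \<delta> by (intro divide_left_mono mult_left_mono mult_nonneg_nonneg mult_pos_pos) auto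
    then show ?thesis by simp
  qed
  have \<eta>\<delta>: "\<eta> * \<delta> \<le> \<eta>" using \<eta> \<delta>1 by (simp add: mult_left_le)
  have E3: "?E \<le> \<eta> * (c / C)"
  proof -
    have "?E \<le> \<eta> * \<delta> * c / (1 * C)" using c \<eta> q1 \<delta> by (intro divide_left_mono mult_right_mono mult_nonneg_nonneg mult_pos_pos) auto
    also have "\<dots> \<le> \<eta> * c / (1 * C)" using c \<eta>\<delta> by (intro divide_right_mono mult_right_mono) auto
    finally show ?thesis by simp
  qed
  have E5: "?E \<le> \<eta>"
  proof -
    have "\<eta> * (c / C) \<le> \<eta> * 1" using \<eta> c by (intro mult_left_mono) auto
    then show ?thesis using E3 by simp
  qed
  \<comment> \<open>The integer j ranges over all cells of the line, so \<open>P\<close> is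
    periodic; the transitions of length \<delta> at both ends of the plateau are cut off.\<close>
  define P where "P = {y. \<exists>j::int. \<delta> \<le> real q * inv H y - of_int j \<and> real q * inv H y - of_int j \<le> w - \<delta>}"
  have Pm: "P \<in> sets lebesgue"
  proof -
    have "P = (\<Union>j::int. (\<lambda>y. real q * inv H y - of_int j) -` {\<delta>..w - \<delta>})" by (auto simp: P_def)
    moreover have "closed ((\<lambda>y. real q * inv H y - of_int j) -` {\<delta>..w - \<delta>})" for j :: int
      by (intro closed_vimage continuous_intros diffeo_cont[OF diffeo_inv[OF H]])
    ultimately show ?thesis by (auto intro!: sets.countable_UN' borel_closed)
  qed
  \<comment> \<open>The last two bounds locate the image strictly inside its slot; they are what
    makes the images for different m disjoint.\<close>
  have pt: "\<bar>deriv (G ^^ i m) y - 1 / t\<bar> \<le> 4 * \<eta> \<and> 1 / (2 * real M) \<le> deriv (G ^^ i m) y \<and> \<bar>F m y - y\<bar> \<le> 2 * \<eta> \<and>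
     (real m + 1) * w < real q * inv H (F m y) - of_int j \<and> real q * inv H (F m y) - of_int j < (real m + 2) * w"
    if m: "m < M" and j: "\<delta> \<le> real q * inv H y - of_int j" "real q * inv H y - of_int j \<le> w - \<delta>" for m y and j :: int
  proof -
    define x where "x = inv H y"
    define u where "u = real q * x - of_int j"
    have yx: "y = H x" using H by (simp add: x_def)
    have u: "\<delta> \<le> u" "u \<le> w - \<delta>" using j by (auto simp: u_def x_def)
    have mw: "(real m + 2) * w \<le> 1"
    proof -
      have "(real m + 2) * w \<le> (real M + 1) * w" using m w0 by (intro mult_right_mono) auto
      then show ?thesis using Mw by simp
    qed
    have mw2: "(real m + 2) * w = (real m + 1) * w + w" by (simp add: algebra_simps)
    have mw3: "w \<le> (real m + 1) * w" using w0 by (simp add: algebra_simps)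
    have s01: "0 \<le> s m" "s m \<le> 1 / real q"
      using mw mw2 w0 q by (auto simp: s_def intro!: divide_right_mono)
    have qs: "real q * (x + s m) = real q * x + (real m + 1) * w" using q by (simp add: s_def distrib_left)
    have qx: "real q * x = u + of_int j" by (simp add: u_def)
    have d1: "deriv \<phi> (real q * x) = lo * t"
      unfolding qx diffeo_deriv_add_int[OF \<phi>(1)] by (rule \<phi>hi[OF u])
    have d2: "deriv \<phi> (real q * (x + s m)) = lo"
    proof -
      have "real q * (x + s m) = (u + (real m + 1) * w) + of_int j" using qs qx by simp
      moreover have "deriv \<phi> (u + (real m + 1) * w) = lo"
        using u \<delta> mw mw2 mw3 by (intro \<phi>lo) linarith+
      ultimately show ?thesis using diffeo_deriv_add_int[OF \<phi>(1)] by metis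
    qed
    let ?k1 = "deriv K (rescale q \<phi> x)" and ?k2 = "deriv K (rescale q \<phi> (x + s m))"
    have k: "0 < ?k1" "0 < ?k2" using diffeo_deriv_pos[OF K(1)] by auto
    have nearK: "\<bar>rescale q \<phi> (x + s m) - rescale q \<phi> x\<bar> \<le> 2 / real q" "\<bar>rescale q \<phi> x - rescale q \<phi> (x + s m)\<bar> \<le> 2 / real q"
      using rescale_cell[OF \<phi>(1) q s01, of x] q by (auto simp: abs_minus_commute intro: order_trans divide_right_mono)
    then have kk: "?k2 \<le> (1 + \<eta>) * ?k1" "?k1 \<le> (1 + \<eta>) * ?k2" and Kd: "\<bar>H (x + s m) - H x\<bar> \<le> \<eta>"
      using sl unfolding slow_def H_def by blast+
    have F0: "conj_rot H (s m) y = H (x + s m)" by (simp add: conj_rot_def x_def)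
    have dF0: "deriv (conj_rot H (s m)) y = (?k2 / ?k1) / t"
      using conj_rot_deriv[OF H, of "s m" y] d1 d2 lo by (simp add: x_def[symmetric] dH)
    let ?D = "deriv (G ^^ i m) y"
    have r: "1 / (1 + \<eta>) \<le> ?k2 / ?k1" "?k2 / ?k1 \<le> 1 + \<eta>"
      using kk k \<eta> by (simp_all add: field_simps)
    have cC: "c / C \<le> (?k2 / ?k1) / t"
    proof -
      have "c / C \<le> deriv H (inv H y + s m) / deriv H (inv H y)" using c diffeo_deriv_pos[OF H] by (intro frac_le) (auto intro: less_imp_le)
      then show ?thesis using conj_rot_deriv[OF H, of "s m" y] dF0 by simp
    qed
    have De: "\<bar>?D - (?k2 / ?k1) / t\<bar> \<le> \<eta> * ((?k2 / ?k1) / t)"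
    proof -
      have "\<bar>?D - (?k2 / ?k1) / t\<bar> \<le> \<eta> * (c / C)" using close(2)[of m y] E3 unfolding dF0 by linarith
      also have "\<dots> \<le> \<eta> * ((?k2 / ?k1) / t)" using cC \<eta> by (intro mult_left_mono) auto
      finally show ?thesis .
    qed
    define R where "R = ?k2 / ?k1"
    have R: "1 / (1 + \<eta>) \<le> R" "R \<le> 1 + \<eta>" "\<bar>?D - R / t\<bar> \<le> \<eta> * (R / t)" using r De by (auto simp: R_def)
    have e1: "1 - \<eta> \<le> 1 / (1 + \<eta>)"
    proof -
      have "(1 - \<eta>) * (1 + \<eta>) \<le> 1" by (simp add: algebra_simps)
      then show ?thesis using \<eta> by (simp only: pos_le_divide_eq)
    qed
    then have R1: "1 - \<eta> \<le> R" using R by linarith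
    have up: "?D * t \<le> (1 + \<eta>) * R" "(1 - \<eta>) * R \<le> ?D * t"
    proof -
      have "?D \<le> R / t + \<eta> * (R / t)" "R / t - \<eta> * (R / t) \<le> ?D" using R(3) by linarith+
      then have "?D \<le> ((1 + \<eta>) * R) / t" "((1 - \<eta>) * R) / t \<le> ?D"
        by (simp_all add: distrib_right left_diff_distrib add_divide_distrib diff_divide_distrib)
      then show "?D * t \<le> (1 + \<eta>) * R" "(1 - \<eta>) * R \<le> ?D * t" using t by (simp_all add: pos_le_divide_eq pos_divide_le_eq)
    qed
    have "(1 + \<eta>) * R \<le> (1 + \<eta>) * (1 + \<eta>)" using R \<eta> by (intro mult_left_mono) auto
    also have "\<dots> \<le> 1 + 4 * \<eta>" using \<eta> mult_right_mono[of \<eta> 1 \<eta>] by (simp add: algebra_simps)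
    finally have u1: "?D * t \<le> 1 + 4 * \<eta>" using up by linarith
    have "1 - 2 * \<eta> \<le> (1 - \<eta>) * (1 - \<eta>)" by (simp add: algebra_simps)
    also have "\<dots> \<le> (1 - \<eta>) * R" using R1 \<eta> by (intro mult_left_mono) auto
    finally have u2: "1 - 2 * \<eta> \<le> ?D * t" using up by linarith
    have A1: "\<bar>?D - 1 / t\<bar> \<le> 4 * \<eta>"
    proof -
      have "\<bar>?D * t - 1\<bar> \<le> 4 * \<eta>" using u1 u2 \<eta> by linarith
      moreover have "\<bar>?D * t - 1\<bar> = \<bar>?D - 1 / t\<bar> * t"
      proof -
        have "?D * t - 1 = (?D - 1 / t) * t" using t by (simp add: left_diff_distrib)
        then show ?thesis using t by (simp add: abs_mult)
      qed
      moreover have "\<bar>?D - 1 / t\<bar> \<le> \<bar>?D - 1 / t\<bar> * t" using t by (simp add: mult_le_cancel_left1)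
      ultimately show ?thesis by (metis order_trans)
    qed
    have A2: "1 / (2 * real M) \<le> ?D"
    proof -
      have "1 / 2 \<le> ?D * t" using u2 \<eta> by linarith
      also have "\<dots> \<le> ?D * real M" using M diffeo_deriv_pos[OF diffeo_funpow[OF G]] by (intro mult_left_mono) (auto intro: less_imp_le)
      finally show ?thesis using M0 by (simp add: pos_divide_le_eq mult.commute mult.left_commute)
    qed
    have A3: "\<bar>F m y - y\<bar> \<le> 2 * \<eta>" using close(1)[of m y] E5 Kd unfolding F0 yx[symmetric] by linarith
    \<comment> \<open>The trimmed plateau, once rotated, stays at distance \<delta> from the borders
      of its slot, and the shadowing error is smaller than the image under \<open>H\<close> of an
      arc of length \<open>\<delta> / q\<close>.\<close>
    have gap: "c * (\<delta> / real q) \<le> H (z + \<delta> / real q) - H z" for z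
      using diffeo_mvt(1)[OF H, of z "z + \<delta> / real q" c C] c \<delta> q by simp
    have Egap: "?E < c * (\<delta> / real q)"
    proof -
      have "\<eta> * (\<delta> * c / real q) < 1 * (\<delta> * c / real q)" using \<eta> \<delta> c q by (intro mult_strict_right_mono) auto
      then show ?thesis using E1 by (simp add: mult_ac)
    qed
    have "H (x + s m - \<delta> / real q) < F m y" "F m y < H (x + s m + \<delta> / real q)"
    proof -
      have g: "lo' < f" "f < hi'" if "\<bar>f - h\<bar> \<le> E" "g \<le> hi' - h" "g \<le> h - lo'" "E < g" for f h E g lo' hi' :: real
        using that by linarith+
      have "c * (\<delta> / real q) \<le> H (x + s m) - H (x + s m - \<delta> / real q)" using gap[of "x + s m - \<delta> / real q"] by simp
      from g[OF close(1)[of m y, unfolded F0] gap this Egap]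
      show "H (x + s m - \<delta> / real q) < F m y" "F m y < H (x + s m + \<delta> / real q)" .
    qed
    then have "x + s m - \<delta> / real q < inv H (F m y)" "inv H (F m y) < x + s m + \<delta> / real q"
      using diffeo_less_iff[OF H, of _ "inv H (F m y)"] diffeo_less_iff[OF H, of "inv H (F m y)"] H by auto
    then have "real q * (x + s m - \<delta> / real q) < real q * inv H (F m y)" "real q * inv H (F m y) < real q * (x + s m + \<delta> / real q)"
      using q by (auto intro: mult_strict_left_mono)
    then have z: "real q * x + (real m + 1) * w - \<delta> < real q * inv H (F m y)" "real q * inv H (F m y) < real q * x + (real m + 1) * w + \<delta>"
      using qs q by (simp_all add: right_diff_distrib distrib_left)
    have A4: "(real m + 1) * w < real q * inv H (F m y) - of_int j" "real q * inv H (F m y) - of_int j < (real m + 2) * w"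
      using z u mw2 unfolding u_def by linarith+
    show ?thesis using A1 A2 A3 A4 by blast
  qed
  have disj: "disjoint_family_on (\<lambda>m. F m ` P) {..<M}"
    unfolding disjoint_family_on_def
  proof (intro ballI impI)
    fix m m' assume mm: "m \<in> {..<M}" "m' \<in> {..<M}" "m \<noteq> m'"
    show "F m ` P \<inter> F m' ` P = {}"
    proof (rule ccontr)
      assume "\<not> ?thesis"
      then obtain y y' where y: "y \<in> P" "y' \<in> P" "F m y = F m' y'" by blast
      obtain j j' :: int where j: "\<delta> \<le> real q * inv H y - of_int j" "real q * inv H y - of_int j \<le> w - \<delta>"
        "\<delta> \<le> real q * inv H y' - of_int j'" "real q * inv H y' - of_int j' \<le> w - \<delta>" using y(1,2) unfolding P_def by blast
      define z where "z = real q * inv H (F m y)"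
      have z: "(real m + 1) * w < z - of_int j" "z - of_int j < (real m + 2) * w"
        "(real m' + 1) * w < z - of_int j'" "z - of_int j' < (real m' + 2) * w"
        using pt[of m, OF _ j(1,2)] pt[of m', OF _ j(3,4)] mm y(3) unfolding z_def by auto
      have b: "0 \<le> (real n + 1) * w" "(real n + 2) * w \<le> 1" if "n < M" for n
      proof -
        have "(real n + 2) * w \<le> (real M + 1) * w" using that w0 by (intro mult_right_mono) auto
        then show "0 \<le> (real n + 1) * w" "(real n + 2) * w \<le> 1" using Mw w0 by auto
      qed
      \<comment> \<open>All slots of a cell lie in one unit interval, so the floor recovers the
        cell; within a single cell different slots are disjoint.\<close>
      have "\<lfloor>z\<rfloor> = j" using z(1,2) b[of m] mm by (intro floor_unique) auto
      moreover have "\<lfloor>z\<rfloor> = j'" using z(3,4) b[of m'] mm by (intro floor_unique) auto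
      ultimately have jj: "j = j'" by simp
      have "(real m + 1) * w < (real m' + 2) * w" "(real m' + 1) * w < (real m + 2) * w" using z jj by linarith+
      then have "real m + 1 < real m' + 2" "real m' + 1 < real m + 2" using w0 by simp_all
      then show False using mm(3) by linarith
    qed
  qed
  have fat: "(a (Suc j) - a j) / 16 \<le> measure lebesgue (P \<inter> {a j..<a (Suc j)})" if j: "j < q" for j
  proof -
    let ?h = "\<lambda>x. H ((real j + x) / real q)"
    have wd: "0 \<le> \<delta>" "\<delta> \<le> w - \<delta>" "w - \<delta> \<le> 1" using \<delta> w0 by auto
    have \<phi>d: "lo * t * (w - 2 * \<delta>) \<le> \<phi> (w - \<delta>) - \<phi> \<delta>"
      using diffeo_mvt(1)[OF \<phi>(1) wd(2), of "lo * t" "lo * t"] \<phi>hi by simp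
    \<comment> \<open>1/8 = 1/2 * 1/3 * 3/4, where the factors bound \<open>lo\<close>,
      \<open>t * w\<close> and the fraction of the plateau left after removing the transitions. The
      case \<open>M = 1\<close> is separate because \<open>(M + 1) / 3 \<le> M - 1\<close> requires
      \<open>2 \<le> M\<close>.\<close>
    have "1 / 8 \<le> lo * t * (w - 2 * \<delta>)"
    proof -
      have tw: "1 / 3 \<le> t * w"
      proof (cases "M = 1")
        case True
        then show ?thesis using M(1) t by simp
      next
        case False
        then have "2 \<le> real M" using M0 by simp
        moreover have "(n + 1) / 3 \<le> z" if "2 \<le> n" "n \<le> z + 1" for n z :: real using that by simp
        ultimately have "(real M + 1) / 3 \<le> t" using M(2) by blast
        then have "1 / 3 \<le> t / (real M + 1)" by (simp add: pos_le_divide_eq)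
        then show ?thesis unfolding w by simp
      qed
      have "(t - 1) * w \<le> real M * w" using M w0 by (intro mult_right_mono) auto
      also have "\<dots> \<le> 1" using Mw w0 by (simp add: algebra_simps)
      finally have "lo * (1 + (t - 1) * w) \<le> lo * 2" using lo by (intro mult_left_mono) auto
      then have "1 / 2 \<le> lo" using lo1 by linarith
      then have "1 / 2 * (t * (3 / 4 * w)) \<le> lo * (t * (w - 2 * \<delta>))" using t \<delta> w0 by (intro mult_mono) auto
      then show ?thesis using tw by (simp add: mult_ac)
    qed
    then have p8: "1 / 8 \<le> \<phi> (w - \<delta>) - \<phi> \<delta>" using \<phi>d by linarith
    have len0: "0 \<le> K ((real j + 1) / real q) - K (real j / real q)"
      using diffeo_le_iff[OF K(1)] by (simp add: divide_right_mono)
    have cl: "(\<phi> (w - \<delta>) - \<phi> \<delta>) * (K ((real j + 1) / real q) - K (real j / real q)) \<le> (1 + \<eta>)\<^sup>2 * (?h (w - \<delta>) - ?h \<delta>)"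
      unfolding H_def using cell_length(1)[OF K(1) \<phi> sl _ wd] \<eta> by simp
    have "(1 + \<eta>)\<^sup>2 \<le> (1 + 1 / 32)\<^sup>2" using \<eta> by (intro power_mono) auto
    then have e2: "(1 + \<eta>)\<^sup>2 \<le> 2" by (simp add: power2_eq_square)
    have h0: "0 \<le> ?h (w - \<delta>) - ?h \<delta>" using wd diffeo_le_iff[OF H] by (simp add: divide_right_mono)
    have "1 / 8 * (a (Suc j) - a j) \<le> (\<phi> (w - \<delta>) - \<phi> \<delta>) * (K ((real j + 1) / real q) - K (real j / real q))"
      using mult_right_mono[OF p8 len0] by (simp only: a_def of_nat_Suc add.commute)
    also have "\<dots> \<le> 2 * (?h (w - \<delta>) - ?h \<delta>)" using cl mult_right_mono[OF e2 h0] by linarith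
    finally have len: "(a (Suc j) - a j) / 16 \<le> ?h (w - \<delta>) - ?h \<delta>" by simp
    have Ha: "H (real m / real q) = a m" for m
    proof -
      have "rescale q \<phi> (real m / real q) = real m / real q"
        using diffeo_add_nat[OF \<phi>(1), of 0 m] \<phi>(2) q by (simp add: rescale_def)
      then show ?thesis by (simp add: H_def a_def)
    qed
    have sub: "{?h \<delta>..?h (w - \<delta>)} \<subseteq> P \<inter> {a j..<a (Suc j)}"
    proof
      fix y assume y: "y \<in> {?h \<delta>..?h (w - \<delta>)}"
      define x where "x = inv H y"
      have yx: "y = H x" using H by (simp add: x_def)
      have x: "(real j + \<delta>) / real q \<le> x" "x \<le> (real j + (w - \<delta>)) / real q" using y diffeo_le_iff[OF H] by (auto simp: yx)
      then have xq: "real j + \<delta> \<le> real q * x" "real q * x \<le> real j + (w - \<delta>)" using q by (simp_all add: field_simps)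
      then have "\<delta> \<le> real q * inv H y - of_int (int j)" "real q * inv H y - of_int (int j) \<le> w - \<delta>" by (auto simp: x_def)
      then have "y \<in> P" unfolding P_def by blast
      moreover have "real j / real q \<le> x" "x < real (Suc j) / real q"
        using xq \<delta> w0 q by (simp_all add: field_simps)
      then have "a j \<le> y" "y < a (Suc j)" unfolding Ha[symmetric] yx using diffeo_le_iff[OF H] diffeo_less_iff[OF H] by auto
      ultimately show "y \<in> P \<inter> {a j..<a (Suc j)}" by auto
    qed
    have "?h (w - \<delta>) - ?h \<delta> = measure lebesgue {?h \<delta>..?h (w - \<delta>)}" using h0 by simp
    also have "\<dots> \<le> measure lebesgue (P \<inter> {a j..<a (Suc j)})"
      using Pm by (intro measure_mono_fmeasurable[OF sub] subset_unit_lmeasurable[of _ "a j" "a (Suc j)"]) auto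
    finally show ?thesis using len by linarith
  qed
  have P': "\<exists>j::int. \<delta> \<le> real q * inv H y - of_int j \<and> real q * inv H y - of_int j \<le> w - \<delta>" if "y \<in> P" for y
    using that by (simp add: P_def)
  have all: "\<forall>m<M. \<forall>y\<in>P. \<bar>deriv (G ^^ i m) y - 1 / t\<bar> \<le> 4 * \<eta> \<and> 1 / (2 * real M) \<le> deriv (G ^^ i m) y \<and> \<bar>(G ^^ i m) y + of_int (k m :: int) - y\<bar> \<le> 2 * \<eta>"
    using pt P' unfolding F_def by meson
  show ?thesis
    using Pm fat all disj unfolding F_def by (intro exI[of _ P] exI[of _ i] exI[of _ k] conjI allI impI) auto
qed

section \<open>The derivative cocycle of the limit\<close>

text \<open>A bound on the share of \<open>E\<close> in every interval is a bound on its measure, as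
  the lengths of the intervals sum to 1.\<close>

lemma atoms_measure_le:
  assumes K: "diffeo K" "K 0 = 0" and sl: "slow \<eta> K q" and E: "E \<in> sets lebesgue"
    and le: "\<And>j. j < q \<Longrightarrow> measure lebesgue (E \<inter> {K (real j / real q)..<K (real (Suc j) / real q)}) \<le> \<sigma> * (K (real (Suc j) / real q) - K (real j / real q))"
  shows "measure lebesgue (E \<inter> {0<..<1}) \<le> \<sigma>"
proof -
  let ?a = "\<lambda>j. K (real j / real q)"
  have p: "unit_partition q ?a" by (rule atoms_partition(1)[OF K sl])
  have sub: "{0<..<1} \<subseteq> (\<Union>j\<in>{..<q}. {?a j..<?a (Suc j)})"
  proof
    fix x :: real assume "x \<in> {0<..<1}"
    then obtain j where "j < q" "x \<in> {?a j..<?a (Suc j)}" using unit_partition_cover[OF p, of x] by auto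
    then show "x \<in> (\<Union>j\<in>{..<q}. {?a j..<?a (Suc j)})" by blast
  qed
  have U: "(\<Union>j\<in>{..<q}. {?a j..<?a (Suc j)}) \<in> lmeasurable"
  proof (intro fmeasurable.finite_UN finite_lessThan)
    show "{?a j..<?a (Suc j)} \<in> lmeasurable" for j
      by (rule subset_unit_lmeasurable[of _ "?a j" "?a (Suc j)"]) auto
  qed
  have "measure lebesgue (E \<inter> {0<..<1}) \<le> measure lebesgue (E \<inter> (\<Union>j\<in>{..<q}. {?a j..<?a (Suc j)}))"
  proof (rule measure_mono_fmeasurable)
    show "E \<inter> {0<..<1} \<subseteq> E \<inter> (\<Union>j\<in>{..<q}. {?a j..<?a (Suc j)})" using sub by blast
    show "E \<inter> {0<..<1} \<in> sets lebesgue" by (intro sets.Int E) auto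
    show "E \<inter> (\<Union>j\<in>{..<q}. {?a j..<?a (Suc j)}) \<in> lmeasurable"
      by (rule fmeasurableI2[OF U Int_lower2]) (intro sets.Int E fmeasurableD[OF U])
  qed
  also have "\<dots> = (\<Sum>j<q. measure lebesgue (E \<inter> {?a j..<?a (Suc j)}))"
    by (rule measure_Union_partition[OF p order_refl E])
  also have "\<dots> \<le> (\<Sum>j<q. \<sigma> * (?a (Suc j) - ?a j))" using le by (intro sum_mono) auto
  also have "\<dots> = \<sigma> * (?a q - ?a 0)" unfolding sum_distrib_left[symmetric] sum_lessThan_telescope[of ?a] ..
  also have "\<dots> = \<sigma>" using p by (simp add: unit_partition_def)
  finally show ?thesis .
qed

text \<open>Provides the coordinate u in \<open>[0, 1)\<close> of a point within its interval; by
  periodicity the slope of the profile over the point is \<open>deriv \<phi> u\<close>.\<close>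

lemma stage_coordinate:
  assumes K: "diffeo K" "K 0 = 0" and \<phi>: "diffeo \<phi>" "\<phi> 0 = 0" and sl: "slow \<eta> K q"
    and H_def: "H = (\<lambda>x. K (rescale q \<phi> x))"
  shows "diffeo H" "H (real j / real q) = K (real j / real q)"
    "y \<in> {K (real j / real q)..<K (real (Suc j) / real q)} \<Longrightarrow> \<exists>u. 0 \<le> u \<and> u < 1 \<and> y = H ((real j + u) / real q) \<and> real q * inv H y = real j + u"
    "x \<le> y \<Longrightarrow> H ((real j + x) / real q) \<le> H ((real j + y) / real q)"
proof -
  have q: "0 < q" using sl by (simp add: slow_def)
  show H: "diffeo H" unfolding H_def using diffeo_comp(1)[OF K(1) rescale_diffeo(1)[OF \<phi>(1) q]] .
  have Ha: "H (real m / real q) = K (real m / real q)" for m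
  proof -
    have "rescale q \<phi> (real m / real q) = real m / real q"
      using diffeo_add_nat[OF \<phi>(1), of 0 m] \<phi>(2) q by (simp add: rescale_def)
    then show ?thesis by (simp add: H_def)
  qed
  then show "H (real j / real q) = K (real j / real q)" .
  show "\<exists>u. 0 \<le> u \<and> u < 1 \<and> y = H ((real j + u) / real q) \<and> real q * inv H y = real j + u"
    if y: "y \<in> {K (real j / real q)..<K (real (Suc j) / real q)}"
  proof -
    define x where "x = inv H y"
    have yx: "y = H x" using H by (simp add: x_def)
    have x: "real j / real q \<le> x" "x < real (Suc j) / real q"
      using y diffeo_le_iff[OF H] diffeo_less_iff[OF H] unfolding Ha[symmetric] yx by auto
    then have "real j \<le> real q * x" "real q * x < real j + 1" using q by (simp_all add: field_simps)
    moreover have "(real j + (real q * x - real j)) / real q = x" using q by simp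
    ultimately show ?thesis
      by (intro exI[of _ "real q * x - real j"]) (simp only: yx[symmetric] x_def[symmetric], simp)
  qed
  show "H ((real j + x) / real q) \<le> H ((real j + y) / real q)" if "x \<le> y"
    using that by (simp add: diffeo_le_iff[OF H] divide_right_mono)
qed

text \<open>A pair of values serves both uses: the two plateaus and, with \<open>b = c\<close>, the
  upper plateau alone.\<close>

lemma sets_lebesgue_deriv_level:
  assumes \<phi>: "diffeo \<phi>" and H: "diffeo H"
  shows "{y. deriv \<phi> (real q * inv H y) \<in> {b, c}} \<in> sets lebesgue"
proof -
  have "closed ((\<lambda>y. deriv \<phi> (real q * inv H y)) -` {b, c})"
    by (intro closed_vimage continuous_on_compose2[OF diffeo_deriv_cont[OF \<phi>, of UNIV]] continuous_intros diffeo_cont[OF diffeo_inv[OF H]]) auto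
  moreover have "(\<lambda>y. deriv \<phi> (real q * inv H y)) -` {b, c} = {y. deriv \<phi> (real q * inv H y) \<in> {b, c}}" by auto
  ultimately show ?thesis using borel_closed by fastforce
qed

text \<open>Only two transition arcs per cell are left out. Each takes at most the share
  \<open>t * \<delta>\<close> under the profile, whose derivative is at most
  \<open>lo * t \<le> t\<close>, and the distortion at most doubles it.\<close>

lemma stage_good_set:
  assumes K: "diffeo K" "K 0 = 0" and shp: "shape t w \<delta> \<phi> lo" and sl: "slow \<eta> K q" and \<eta>: "0 < \<eta>" "\<eta> \<le> 1 / 32"
    and t: "1 < t" and \<delta>: "0 < \<delta>" "2 * \<delta> < w" "w \<le> 1"
  defines "H \<equiv> \<lambda>x. K (rescale q \<phi> x)"
  shows "measure lebesgue (- {y. deriv \<phi> (real q * inv H y) \<in> {lo, lo * t}} \<inter> {0<..<1}) \<le> 4 * \<delta> * t"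
proof (rule atoms_measure_le[OF K sl])
  have \<phi>: "diffeo \<phi>" "\<phi> 0 = 0" and lo: "0 < lo" and \<phi>b: "\<And>x. lo \<le> deriv \<phi> x \<and> deriv \<phi> x \<le> lo * t"
    and \<phi>lo: "\<And>x. w \<le> x \<Longrightarrow> x \<le> 1 \<Longrightarrow> deriv \<phi> x = lo"
    and \<phi>hi: "\<And>x. \<delta> \<le> x \<Longrightarrow> x \<le> w - \<delta> \<Longrightarrow> deriv \<phi> x = lo * t" and lo2: "lo * (1 + (t - 1) * (w - 2 * \<delta>)) \<le> 1"
    using shp unfolding shape_def by auto
  note co = stage_coordinate[OF K \<phi> sl H_def[THEN meta_eq_to_obj_eq]]
  have H: "diffeo H" by (rule co(1))
  let ?E = "{y. deriv \<phi> (real q * inv H y) \<in> {lo, lo * t}}"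
  show Em: "- ?E \<in> sets lebesgue" using sets_lebesgue_deriv_level[OF \<phi>(1) H] by (rule Compl_in_sets_lebesgue[THEN iffD2])
  have lo1: "lo \<le> 1"
  proof -
    have "lo * 1 \<le> lo * (1 + (t - 1) * (w - 2 * \<delta>))" using lo t \<delta> by (intro mult_left_mono) auto
    then show ?thesis using lo2 by simp
  qed
  fix j assume j: "j < q"
  let ?h = "\<lambda>x. H ((real j + x) / real q)" and ?I = "{K (real j / real q)..<K (real (Suc j) / real q)}"
  let ?L = "K (real (Suc j) / real q) - K (real j / real q)"
  have L0: "0 \<le> ?L" using diffeo_le_iff[OF K(1)] by (simp add: divide_right_mono)
  have sub: "- ?E \<inter> ?I \<subseteq> {?h 0..?h \<delta>} \<union> {?h (w - \<delta>)..?h w}"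
  proof
    fix y assume y: "y \<in> - ?E \<inter> ?I"
    then have "y \<in> ?I" by blast
    from co(3)[OF this] obtain u where u: "0 \<le> u" "u < 1" "y = ?h u" "real q * inv H y = real j + u"
      by (elim exE conjE)
    have "deriv \<phi> (real q * inv H y) = deriv \<phi> u"
      using diffeo_deriv_add_int[OF \<phi>(1), of u "int j"] u(4) by (simp add: add.commute)
    then have "\<not> (w \<le> u)" "\<not> (\<delta> \<le> u \<and> u \<le> w - \<delta>)" using y \<phi>lo[of u] \<phi>hi[of u] u by auto
    then have "u \<le> \<delta> \<or> (w - \<delta> \<le> u \<and> u \<le> w)" by auto
    then show "y \<in> {?h 0..?h \<delta>} \<union> {?h (w - \<delta>)..?h w}"
    proof (elim disjE conjE)
      assume "u \<le> \<delta>"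
      then have "?h 0 \<le> ?h u" "?h u \<le> ?h \<delta>" using co(4) u(1) by blast+
      then show ?thesis unfolding u(3) by (simp only: Un_iff atLeastAtMost_iff simp_thms)
    next
      assume "w - \<delta> \<le> u" "u \<le> w"
      then have "?h (w - \<delta>) \<le> ?h u" "?h u \<le> ?h w" using co(4) by blast+
      then show ?thesis unfolding u(3) by (simp only: Un_iff atLeastAtMost_iff simp_thms)
    qed
  qed
  have e2: "(1 + \<eta>)\<^sup>2 \<le> 2"
  proof -
    have "(1 + \<eta>)\<^sup>2 \<le> (1 + 1 / 32)\<^sup>2" using \<eta> by (intro power_mono) auto
    then show ?thesis by (simp add: power2_eq_square)
  qed
  have piece: "?h b - ?h a \<le> 2 * \<delta> * t * ?L" if ab: "0 \<le> a" "b \<le> 1" "b - a = \<delta>" for a b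
  proof -
    have le: "a \<le> b" using ab \<delta> by simp
    have "\<phi> b - \<phi> a \<le> lo * t * (b - a)" using diffeo_mvt(2)[OF \<phi>(1) le, of lo "lo * t"] \<phi>b by blast
    also have "\<dots> \<le> 1 * t * \<delta>" unfolding ab(3) using lo1 t \<delta> by (intro mult_right_mono) auto
    finally have p: "\<phi> b - \<phi> a \<le> t * \<delta>" by simp
    have p0: "0 \<le> \<phi> b - \<phi> a" using diffeo_le_iff[OF \<phi>(1)] le by simp
    have "?h b - ?h a \<le> (1 + \<eta>)\<^sup>2 * (\<phi> b - \<phi> a) * (K ((real j + 1) / real q) - K (real j / real q))"
      unfolding H_def using cell_length(2)[OF K(1) \<phi> sl _ ab(1) le ab(2)] \<eta> by simp
    also have "\<dots> = (1 + \<eta>)\<^sup>2 * (\<phi> b - \<phi> a) * ?L" by (simp only: of_nat_Suc add.commute)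
    also have "\<dots> \<le> 2 * (t * \<delta>) * ?L" using e2 p p0 L0 by (intro mult_right_mono mult_mono) auto
    finally show ?thesis by (simp only: mult_ac)
  qed
  have "measure lebesgue (- ?E \<inter> ?I) \<le> measure lebesgue ({?h 0..?h \<delta>} \<union> {?h (w - \<delta>)..?h w})"
    using Em by (intro measure_mono_fmeasurable[OF sub] sets.Int fmeasurable.Un subset_unit_lmeasurable[OF _ order_refl]) auto
  also have "\<dots> \<le> measure lebesgue {?h 0..?h \<delta>} + measure lebesgue {?h (w - \<delta>)..?h w}"
    by (intro measure_Un_le) auto
  also have "\<dots> = (?h \<delta> - ?h 0) + (?h w - ?h (w - \<delta>))"
    using co(4)[of 0 \<delta> j] co(4)[of "w - \<delta>" w j] \<delta> by simp
  also have "\<dots> \<le> 2 * \<delta> * t * ?L + 2 * \<delta> * t * ?L" using piece[of 0 \<delta>] piece[of "w - \<delta>" w] \<delta> by (intro add_mono) auto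
  also have "\<dots> = 4 * \<delta> * t * ?L" by simp
  finally show "measure lebesgue (- ?E \<inter> ?I) \<le> 4 * \<delta> * t * ?L" .
qed

text \<open>For the width 1/2 the mean value 1 forces \<open>lo * t\<close> to be at least
  \<open>2 * t / (t + 1)\<close>, so the upper plateau fills almost the whole interval when t is
  large. The three terms of the bound pay for \<open>1 - t / (t + 1)\<close>, the transitions and
  the distortion.\<close>

lemma stage_high_set:
  assumes K: "diffeo K" "K 0 = 0" and shp: "shape t (1 / 2) \<delta> \<phi> lo" and sl: "slow \<eta> K q" and \<eta>: "0 < \<eta>" "\<eta> \<le> 1 / 32"
    and t: "1 < t" and \<delta>: "0 < \<delta>" "\<delta> \<le> 1 / 8"
  defines "H \<equiv> \<lambda>x. K (rescale q \<phi> x)"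
  shows "measure lebesgue (- {y. deriv \<phi> (real q * inv H y) \<in> {lo * t, lo * t}} \<inter> {0<..<1}) \<le> 1 / t + 4 * \<delta> + 3 * \<eta>"
proof (rule atoms_measure_le[OF K sl])
  have \<phi>: "diffeo \<phi>" "\<phi> 0 = 0" and lo: "0 < lo"
    and \<phi>hi: "\<And>x. \<delta> \<le> x \<Longrightarrow> x \<le> 1 / 2 - \<delta> \<Longrightarrow> deriv \<phi> x = lo * t" and lo2: "1 \<le> lo * (1 + (t - 1) * (1 / 2))"
    using shp unfolding shape_def by auto
  note co = stage_coordinate[OF K \<phi> sl H_def[THEN meta_eq_to_obj_eq]]
  have H: "diffeo H" by (rule co(1))
  let ?E = "{y. deriv \<phi> (real q * inv H y) \<in> {lo * t, lo * t}}"
  show Em: "- ?E \<in> sets lebesgue" using sets_lebesgue_deriv_level[OF \<phi>(1) H] by (rule Compl_in_sets_lebesgue[THEN iffD2])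
  fix j assume j: "j < q"
  let ?h = "\<lambda>x. H ((real j + x) / real q)" and ?I = "{K (real j / real q)..<K (real (Suc j) / real q)}"
  let ?L = "K (real (Suc j) / real q) - K (real j / real q)" and ?w = "1 / 2 - \<delta>"
  have L0: "0 \<le> ?L" using diffeo_le_iff[OF K(1)] by (simp add: divide_right_mono)
  have wd: "0 \<le> \<delta>" "\<delta> \<le> ?w" "?w \<le> 1" using \<delta> by auto
  have h0: "?h 0 = K (real j / real q)" and h1: "?h 1 = K (real (Suc j) / real q)"
    using co(2)[of j] co(2)[of "Suc j"] by (simp_all add: add.commute)
  have sub: "- ?E \<inter> ?I \<subseteq> {?h 0..?h \<delta>} \<union> {?h ?w..?h 1}"
  proof
    fix y assume y: "y \<in> - ?E \<inter> ?I"
    then have "y \<in> ?I" by blast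
    from co(3)[OF this] obtain u where u: "0 \<le> u" "u < 1" "y = ?h u" "real q * inv H y = real j + u"
      by (elim exE conjE)
    have "deriv \<phi> (real q * inv H y) = deriv \<phi> u"
      using diffeo_deriv_add_int[OF \<phi>(1), of u "int j"] u(4) by (simp add: add.commute)
    then have "\<not> (\<delta> \<le> u \<and> u \<le> ?w)" using y \<phi>hi[of u] u by auto
    then have "u \<le> \<delta> \<or> ?w \<le> u" by auto
    then show "y \<in> {?h 0..?h \<delta>} \<union> {?h ?w..?h 1}"
    proof (elim disjE)
      assume "u \<le> \<delta>"
      then have "?h 0 \<le> ?h u" "?h u \<le> ?h \<delta>" using co(4) u(1) by blast+
      then show ?thesis unfolding u(3) by (simp only: Un_iff atLeastAtMost_iff simp_thms)
    next
      assume "?w \<le> u"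
      then have "?h ?w \<le> ?h u" "?h u \<le> ?h 1" using co(4) u(2) less_imp_le by blast+
      then show ?thesis unfolding u(3) by (simp only: Un_iff atLeastAtMost_iff simp_thms)
    qed
  qed
  have "measure lebesgue (- ?E \<inter> ?I) \<le> measure lebesgue ({?h 0..?h \<delta>} \<union> {?h ?w..?h 1})"
    using Em by (intro measure_mono_fmeasurable[OF sub] sets.Int fmeasurable.Un subset_unit_lmeasurable[OF _ order_refl]) auto
  also have "\<dots> \<le> measure lebesgue {?h 0..?h \<delta>} + measure lebesgue {?h ?w..?h 1}"
    by (intro measure_Un_le) auto
  also have "\<dots> = (?h \<delta> - ?h 0) + (?h 1 - ?h ?w)"
    using co(4)[of 0 \<delta> j] co(4)[of ?w 1 j] \<delta> by simp
  also have "\<dots> = ?L - (?h ?w - ?h \<delta>)" unfolding h0 h1 by simp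
  finally have m: "measure lebesgue (- ?E \<inter> ?I) \<le> ?L - (?h ?w - ?h \<delta>)" .
  have p: "1 - 1 / t - 4 * \<delta> \<le> \<phi> ?w - \<phi> \<delta>"
  proof -
    have "lo * t * (?w - \<delta>) \<le> \<phi> ?w - \<phi> \<delta>" by (rule diffeo_mvt(1)[OF \<phi>(1) wd(2), where b = "lo * t"]) (simp add: \<phi>hi)
    moreover have "2 * t / (t + 1) \<le> lo * t"
    proof -
      have e: "1 + (t - 1) * (1 / 2) = (t + 1) / 2" by (simp add: field_simps)
      have "2 \<le> lo * (t + 1)" using lo2 unfolding e by simp
      then have "2 / (t + 1) \<le> lo" using t by (simp add: pos_divide_le_eq)
      then have "2 / (t + 1) * t \<le> lo * t" using t by (intro mult_right_mono) auto
      then show ?thesis by simp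
    qed
    then have "2 * t / (t + 1) * (?w - \<delta>) \<le> lo * t * (?w - \<delta>)" using wd by (intro mult_right_mono) auto
    moreover have "1 - 1 / t - 4 * \<delta> \<le> 2 * t / (t + 1) * (?w - \<delta>)"
    proof -
      have "1 - 1 / t \<le> t / (t + 1)" using t by (simp add: field_simps)
      then have a: "(1 - 1 / t) * (1 - 4 * \<delta>) \<le> t / (t + 1) * (1 - 4 * \<delta>)" using \<delta> by (intro mult_right_mono) auto
      have "(1 - 1 / t) * (1 - 4 * \<delta>) = 1 - 1 / t - 4 * \<delta> + 1 / t * (4 * \<delta>)" by (simp add: algebra_simps)
      moreover have "0 \<le> 1 / t * (4 * \<delta>)" using t \<delta> by simp
      moreover have "2 * t / (t + 1) * (?w - \<delta>) = t / (t + 1) * (1 - 4 * \<delta>)" by (simp add: algebra_simps)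
      ultimately show ?thesis using a by linarith
    qed
    ultimately show ?thesis by linarith
  qed
  have cl: "(\<phi> ?w - \<phi> \<delta>) * (K ((real j + 1) / real q) - K (real j / real q)) \<le> (1 + \<eta>)\<^sup>2 * (?h ?w - ?h \<delta>)"
    unfolding H_def using cell_length(1)[OF K(1) \<phi> sl _ wd] \<eta> by simp
  have hw0: "0 \<le> ?h ?w - ?h \<delta>" using co(4)[OF wd(2)] by simp
  have hwL: "?h ?w - ?h \<delta> \<le> ?L" unfolding h0[symmetric] h1[symmetric] using co(4)[OF wd(1), of j] co(4)[OF wd(3), of j] by linarith
  have "(1 - 1 / t - 4 * \<delta>) * ?L \<le> (\<phi> ?w - \<phi> \<delta>) * ?L" using p L0 by (intro mult_right_mono) auto
  also have "\<dots> \<le> (1 + \<eta>)\<^sup>2 * (?h ?w - ?h \<delta>)" using cl by (simp only: of_nat_Suc add.commute)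
  also have "\<dots> = (?h ?w - ?h \<delta>) + (2 * \<eta> + \<eta>\<^sup>2) * (?h ?w - ?h \<delta>)" by (simp add: power2_eq_square algebra_simps)
  also have "(2 * \<eta> + \<eta>\<^sup>2) * (?h ?w - ?h \<delta>) \<le> (2 * \<eta> + \<eta>\<^sup>2) * ?L" using hwL \<eta> by (intro mult_left_mono) auto
  finally have x: "(1 - 1 / t - 4 * \<delta>) * ?L \<le> (?h ?w - ?h \<delta>) + (2 * \<eta> + \<eta>\<^sup>2) * ?L" by simp
  show "measure lebesgue (- ?E \<inter> ?I) \<le> (1 / t + 4 * \<delta> + 3 * \<eta>) * ?L"
  proof -
    have "\<eta> * \<eta> \<le> 1 * \<eta>" using \<eta> by (intro mult_right_mono) auto
    then have y: "(2 * \<eta> + \<eta>\<^sup>2) * ?L \<le> 3 * \<eta> * ?L" using L0 by (intro mult_right_mono) (auto simp: power2_eq_square)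
    have "l - X \<le> (b + d + e) * l" if "(1 - b - d) * l \<le> X + Y" "Y \<le> e * l" for b d e l X Y :: real
      using that by (simp add: algebra_simps)
    from this[OF x y] have "?L - (?h ?w - ?h \<delta>) \<le> (1 / t + 4 * \<delta> + 3 * \<eta>) * ?L" .
    then show ?thesis using m by linarith
  qed
qed


text \<open>The finished tower, with the two conditions that the limit \<open>G\<close> meets at
  every stage; both refer to \<open>K (Suc n)\<close>, the conjugacy that includes the n-th profile.
  \<eta> is explicit: at most 1/32 for the work within a stage, and summable over the
  stages.\<close>

locale tower =
  fixes K :: "nat \<Rightarrow> real \<Rightarrow> real" and q :: "nat \<Rightarrow> nat" and \<phi> :: "nat \<Rightarrow> real \<Rightarrow> real"
    and t w \<delta> lo \<eta> :: "nat \<Rightarrow> real" and G :: "real \<Rightarrow> real"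
  assumes K: "\<And>n. diffeo (K n)" and K_0: "K 0 = (\<lambda>x. x)" and K_at_0: "\<And>n. K n 0 = 0"
    and K_Suc: "\<And>n. K (Suc n) = (\<lambda>x. K n (rescale (q n) (\<phi> n) x))"
    and slow: "\<And>n. slow (\<eta> n) (K n) (q n)" and \<eta>: "\<And>n. \<eta> n = (1 / 2) ^ n / 32"
    and shape: "\<And>n. shape (t n) (w n) (\<delta> n) (\<phi> n) (lo n)"
    and t: "\<And>n. 1 < t n" and \<delta>: "\<And>n. 0 < \<delta> n" "\<And>n. 2 * \<delta> n < w n" and w: "\<And>n. w n \<le> 1"
    and G: "diffeo G"
    and cocycle: "\<And>n y. \<bar>deriv G y * deriv (inv (K (Suc n))) (G y) / deriv (inv (K (Suc n))) y - 1\<bar> \<le> \<eta> n"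
    and shadow: "\<And>n. shadow (\<eta> n) (\<delta> n) (K (Suc n)) (q n) G"
begin

lemma \<eta>_pos: "0 < \<eta> n" and \<eta>_le: "\<eta> n \<le> 1 / 32"
  by (simp_all add: \<eta> power_le_one)

lemma \<eta>_lim: "\<eta> \<longlonglongrightarrow> 0"
proof -
  have "(\<lambda>n. (1 / 2) ^ n / 32) \<longlonglongrightarrow> (0 / 32 :: real)" by (intro tendsto_intros LIMSEQ_realpow_zero) auto
  then show ?thesis by (simp add: \<eta>[abs_def])
qed

lemma q: "0 < q n"
  using slow[of n] by (simp add: slow_def)

lemma \<phi>: "diffeo (\<phi> n)" "\<phi> n 0 = 0" and lo: "0 < lo n"
  using shape[of n] by (auto simp: shape_def)

lemma ergodic_cmap: "ergodic cm (cmap G)"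
proof (rule ergodic_criterion[OF G])
  fix d :: real assume "0 < d"
  then obtain n where n: "\<eta> n < d"
    using order_tendstoD(2)[OF \<eta>_lim, of d] by (auto simp: eventually_sequentially)
  let ?a = "\<lambda>j. K n (real j / real (q n))"
  have \<delta>1: "\<delta> n \<le> 1" using \<delta>[of n] w[of n] by linarith
  show "\<exists>N a. unit_partition N a \<and> (\<forall>j<N. a (Suc j) - a j < d) \<and>
      (\<forall>j<N. \<forall>l<N. \<exists>i. \<exists>k::int.
         (\<forall>y. a j \<le> y \<longrightarrow> y \<le> a (Suc j) \<longrightarrow> 7 / 8 * (a (Suc l) - a l) \<le> deriv (G ^^ i) y * (a (Suc j) - a j)) \<and>
         a l - (a (Suc l) - a l) / 16 \<le> (G ^^ i) (a j) + of_int k \<and>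
         (G ^^ i) (a (Suc j)) + of_int k \<le> a (Suc l) + (a (Suc l) - a l) / 16)"
  proof (rule exI[of _ "q n"], rule exI[of _ ?a], intro conjI)
    show "unit_partition (q n) ?a" by (rule atoms_partition(1)[OF K K_at_0 slow])
    show "\<forall>j<q n. ?a (Suc j) - ?a j < d"
      using atoms_partition(2)[OF K K_at_0 slow, of n] n le_less_trans by blast
  qed (intro allI impI stage_mixes[OF K K_at_0 \<phi> slow \<eta>_pos \<eta>_le \<delta>(1) \<delta>1 shadow[unfolded K_Suc] G])
qed

text \<open>The target s only has to be a limit point of \<open>1 / t n\<close> along stages of
  suitable width, so 0 is reached when t tends to infinity along such stages.\<close>

lemma ratio_set_limit:
  assumes s: "0 \<le> s"
    and near: "\<And>\<epsilon> N. 0 < \<epsilon> \<Longrightarrow> \<exists>n\<ge>N. \<bar>1 / t n - s\<bar> < \<epsilon> \<and> (\<exists>M. t n \<le> real M \<and> real M \<le> t n + 1 \<and> w n = 1 / (real M + 1)) \<and> \<delta> n \<le> w n / 8"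
  shows "s \<in> ratio_set cm (cmap G)"
proof (rule ratio_lower[OF G s])
  fix \<epsilon> d :: real assume \<epsilon>: "0 < \<epsilon>" and d: "0 < d"
  have "0 < min (\<epsilon> / 8) (d / 2)" using \<epsilon> d by simp
  then obtain N where N: "\<And>n. N \<le> n \<Longrightarrow> \<eta> n < min (\<epsilon> / 8) (d / 2)"
    using order_tendstoD(2)[OF \<eta>_lim] unfolding eventually_sequentially by blast
  obtain n M where n: "N \<le> n" "\<bar>1 / t n - s\<bar> < \<epsilon> / 2" and M: "t n \<le> real M" "real M \<le> t n + 1" "w n = 1 / (real M + 1)" and \<delta>w: "\<delta> n \<le> w n / 8"
    using near[OF half_gt_zero[OF \<epsilon>], of N] by (elim exE conjE)
  have \<eta>n: "\<eta> n < \<epsilon> / 8" "\<eta> n < d / 2" using N[OF n(1)] by auto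
  let ?a = "\<lambda>j. K n (real j / real (q n))"
  obtain P i k where P: "P \<in> sets lebesgue"
      "\<forall>j<q n. (?a (Suc j) - ?a j) / 16 \<le> measure lebesgue (P \<inter> {?a j..<?a (Suc j)})"
    and D: "\<forall>m<M. \<forall>y\<in>P. \<bar>deriv (G ^^ i m) y - 1 / t n\<bar> \<le> 4 * \<eta> n \<and> 1 / (2 * real M) \<le> deriv (G ^^ i m) y \<and> \<bar>(G ^^ i m) y + of_int (k m :: int) - y\<bar> \<le> 2 * \<eta> n"
    and dj: "disjoint_family_on (\<lambda>m. (\<lambda>y. (G ^^ i m) y + of_int (k m)) ` P) {..<M}"
    using stage_ratio[OF K K_at_0 shape slow \<eta>_pos \<eta>_le t M \<delta>(1) \<delta>w shadow[unfolded K_Suc] G] by (elim exE conjE)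
  have u: "unit_partition (q n) ?a" by (rule atoms_partition(1)[OF K K_at_0 slow])
  have "\<eta> n < d" using \<eta>n d by linarith
  then have mesh: "\<forall>j<q n. ?a (Suc j) - ?a j < d"
    using atoms_partition(2)[OF K K_at_0 slow, of n] le_less_trans by blast
  have M0: "0 < M" using M(1) t[of n] by (intro Nat.gr0I) auto
  have D': "\<forall>m<M. \<forall>y\<in>P. \<bar>deriv (G ^^ i m) y - s\<bar> < \<epsilon> \<and> 1 / (2 * real M) \<le> deriv (G ^^ i m) y \<and> \<bar>(G ^^ i m) y + of_int (k m) - y\<bar> < d"
  proof (intro allI impI ballI)
    fix m y assume "m < M" "y \<in> P"
    then have a: "\<bar>deriv (G ^^ i m) y - 1 / t n\<bar> \<le> 4 * \<eta> n" "1 / (2 * real M) \<le> deriv (G ^^ i m) y" "\<bar>(G ^^ i m) y + of_int (k m) - y\<bar> \<le> 2 * \<eta> n"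
      using D by blast+
    have "\<bar>deriv (G ^^ i m) y - s\<bar> < \<epsilon>" using a(1) n(2) \<eta>n(1) by linarith
    moreover have "\<bar>(G ^^ i m) y + of_int (k m) - y\<bar> < d" using a(3) \<eta>n(2) by linarith
    ultimately show "\<bar>deriv (G ^^ i m) y - s\<bar> < \<epsilon> \<and> 1 / (2 * real M) \<le> deriv (G ^^ i m) y \<and> \<bar>(G ^^ i m) y + of_int (k m) - y\<bar> < d"
      using a(2) by blast
  qed
  show "\<exists>N a P M i k. unit_partition N a \<and> (\<forall>j<N. a (Suc j) - a j < d) \<and> P \<in> sets lebesgue \<and> 0 < M \<and>
      (\<forall>j<N. (a (Suc j) - a j) / 16 \<le> measure lebesgue (P \<inter> {a j..<a (Suc j)})) \<and>
      (\<forall>m<M. \<forall>y\<in>P. \<bar>deriv (G ^^ i m) y - s\<bar> < \<epsilon> \<and> 1 / (2 * real M) \<le> deriv (G ^^ i m) y \<and> \<bar>(G ^^ i m) y + of_int (k m :: int) - y\<bar> < d) \<and>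
      disjoint_family_on (\<lambda>m. (\<lambda>y. (G ^^ i m) y + of_int (k m)) ` P) {..<M}"
    by (intro exI[of _ "q n"] exI[of _ ?a] exI[of _ P] exI[of _ M] exI[of _ i] exI[of _ k] conjI u mesh P M0 D' dj)
qed

text \<open>The density of the measure invariant under the n-th conjugate. The sequence itself need
  not converge; what converges are its quotients along orbits of \<open>G\<close>.\<close>

definition J :: "nat \<Rightarrow> real \<Rightarrow> real" where
  "J n = deriv (inv (K n))"

text \<open>The slope of the n-th profile over the point y, read in the coordinate of
  \<open>K (Suc n)\<close>; it is the factor by which the density \<open>J\<close> is divided at
  this stage.\<close>

definition \<psi> :: "nat \<Rightarrow> real \<Rightarrow> real" where
  "\<psi> n y = deriv (\<phi> n) (real (q n) * inv (K (Suc n)) y)"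

lemma J_pos: "0 < J n y"
  unfolding J_def by (rule diffeo_deriv_pos[OF diffeo_inv[OF K]])

lemma J_0: "J 0 y = 1"
proof -
  have "inv (\<lambda>x::real. x) = (\<lambda>x. x)" using inv_id unfolding id_def .
  then show ?thesis by (simp add: J_def K_0)
qed

lemma \<psi>_pos: "0 < \<psi> n y"
  unfolding \<psi>_def by (rule diffeo_deriv_pos[OF \<phi>(1)])

lemma J_Suc: "J (Suc n) y = J n y / \<psi> n y"
proof -
  note st = rescale_diffeo[OF \<phi>(1) q, of n n]
  define x where "x = inv (K (Suc n)) y"
  have x: "rescale (q n) (\<phi> n) x = inv (K n) y"
    unfolding x_def K_Suc inv_comp_apply[OF K st(1)] using st(1) by simp
  have "deriv (K (Suc n)) x = deriv (K n) (inv (K n) y) * \<psi> n y"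
  proof -
    have "deriv (K (Suc n)) x = deriv (K n) (rescale (q n) (\<phi> n) x) * deriv (\<phi> n) (real (q n) * x)"
      unfolding K_Suc diffeo_comp(2)[OF K st(1)] st(2) ..
    then show ?thesis by (simp only: x \<psi>_def x_def[symmetric])
  qed
  then show ?thesis
    unfolding J_def diffeo_deriv_inv[OF K] x_def by (simp add: divide_inverse)
qed

text \<open>The assumption \<open>cocycle\<close> says that \<open>deriv G\<close> and the quotient
  for \<open>J (Suc n)\<close> agree up to a factor within \<open>\<eta> n\<close> of 1.\<close>

lemma J_cocycle: "(\<lambda>n. J n y / J n (G y)) \<longlonglongrightarrow> deriv G y"
proof -
  define r where "r n = deriv G y * J (Suc n) (G y) / J (Suc n) y" for n
  have "(\<lambda>n. r n - 1) \<longlonglongrightarrow> 0"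
    by (rule Lim_null_comparison[OF _ \<eta>_lim]) (use cocycle in \<open>auto simp: r_def J_def\<close>)
  then have r: "r \<longlonglongrightarrow> 1" by (simp add: LIM_zero_iff)
  have "(\<lambda>n. deriv G y / r n) \<longlonglongrightarrow> deriv G y / 1" by (intro tendsto_intros r) simp
  moreover have "deriv G y / r n = J (Suc n) y / J (Suc n) (G y)" for n
    using diffeo_deriv_pos[OF G, of y] J_pos[of "Suc n" y] J_pos[of "Suc n" "G y"] by (simp add: r_def)
  ultimately have "(\<lambda>n. J (Suc n) y / J (Suc n) (G y)) \<longlonglongrightarrow> deriv G y" by simp
  then show ?thesis by (rule LIMSEQ_imp_Suc)
qed

text \<open>By the chain rule the quotients telescope along the orbit; negative iterates use the
  reciprocal of the quotient at \<open>inv G y\<close>.\<close>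

lemma J_cocycle_iter: "(\<lambda>n. J n y / J n (iter G i y)) \<longlonglongrightarrow> deriv (iter G i) y"
proof -
  have pow: "(\<lambda>n. J n y / J n ((F ^^ m) y)) \<longlonglongrightarrow> deriv (F ^^ m) y"
    if F: "diffeo F" and lim: "\<And>y. (\<lambda>n. J n y / J n (F y)) \<longlonglongrightarrow> deriv F y" for F m y
  proof (induction m)
    case 0
    have "J n y / J n y = 1" for n using J_pos[of n y] by simp
    moreover have "deriv (F ^^ 0) y = 1" by (simp add: id_def)
    ultimately show ?case by simp
  next
    case (Suc m)
    have "(\<lambda>n. (J n ((F ^^ m) y) / J n (F ((F ^^ m) y))) * (J n y / J n ((F ^^ m) y))) \<longlonglongrightarrow> deriv F ((F ^^ m) y) * deriv (F ^^ m) y"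
      by (intro tendsto_mult lim Suc.IH)
    moreover have "(J n ((F ^^ m) y) / J n (F ((F ^^ m) y))) * (J n y / J n ((F ^^ m) y)) = J n y / J n ((F ^^ Suc m) y)" for n
      using J_pos[of n "(F ^^ m) y"] by (simp add: less_imp_neq[symmetric])
    ultimately show ?case unfolding funpow_deriv(2)[OF diffeo_DERIV[OF F]] by (simp only:)
  qed
  have inv: "(\<lambda>n. J n y / J n (inv G y)) \<longlonglongrightarrow> deriv (inv G) y" for y
  proof -
    have "(\<lambda>n. inverse (J n (inv G y) / J n (G (inv G y)))) \<longlonglongrightarrow> inverse (deriv G (inv G y))"
      using diffeo_deriv_pos[OF G, of "inv G y"] by (intro tendsto_inverse J_cocycle) simp
    then show ?thesis using G by (simp add: diffeo_deriv_inv)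
  qed
  show ?thesis using pow[OF G J_cocycle] pow[OF diffeo_inv[OF G] inv] by (simp add: iter_def)
qed

lemma J_periodic: "J n (y + 1) = J n y"
  unfolding J_def using diffeo_deriv_add_int[OF diffeo_inv[OF K], of n y 1] by simp

lemma \<psi>_periodic: "\<psi> n (y + 1) = \<psi> n y"
  unfolding \<psi>_def using diffeo_add_1[OF diffeo_inv[OF K], of "Suc n" y] diffeo_deriv_add_int[OF \<phi>(1), of n "real (q n) * inv (K (Suc n)) y" "int (q n)"]
  by (simp add: distrib_left)

lemma J_cont: "continuous_on UNIV (J n)"
  unfolding J_def by (rule diffeo_deriv_cont[OF diffeo_inv[OF K]])

lemma cfun_J: "cfun (J n) (proj y) = J n y"
  by (rule cfun_proj) (rule J_periodic)

lemma cfun_\<psi>: "cfun (\<psi> n) (proj y) = \<psi> n y"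
  by (rule cfun_proj) (rule \<psi>_periodic)

lemma cfun_J_measurable: "cfun (J n) \<in> borel_measurable cm"
  by (rule cfun_measurable[OF J_cont]) (rule J_periodic)

lemma level_set: "proj -` {c. cfun (\<psi> n) c \<in> {a, b}} = {y. deriv (\<phi> n) (real (q n) * inv (K (Suc n)) y) \<in> {a, b}}"
  by (auto simp: cfun_\<psi>) (auto simp: \<psi>_def)

lemma level_set_sets: "{c. cfun (\<psi> n) c \<in> {a, b}} \<in> sets cm"
  unfolding sets_cm_iff level_set by (rule sets_lebesgue_deriv_level[OF \<phi>(1) K])

lemma emeasure_level_compl:
  "emeasure cm (- {c. cfun (\<psi> n) c \<in> {a, b}}) =
    ennreal (measure lebesgue (- {y. deriv (\<phi> n) (real (q n) * inv (K (Suc n)) y) \<in> {a, b}} \<inter> {0<..<1}))"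
proof -
  have "UNIV - {c. cfun (\<psi> n) c \<in> {a, b}} \<in> sets cm" using sets.compl_sets[OF level_set_sets] by simp
  then have "- {c. cfun (\<psi> n) c \<in> {a, b}} \<in> sets cm" by (simp add: Compl_eq_Diff_UNIV)
  from emeasure_cm_eq[OF this] show ?thesis unfolding vimage_Compl level_set .
qed

end

section \<open>Upper bounds for the ratio set\<close>

lemma Ints_limit:
  fixes x :: real
  assumes "(\<lambda>n. of_int (z n)) \<longlonglongrightarrow> x"
  obtains k :: int where "x = of_int k"
proof -
  have "x \<in> \<int>"
    by (rule closed_sequentially[OF closed_Ints _ assms]) auto
  then show thesis using that by (auto elim: Ints_cases)
qed

context tower
begin

text \<open>At points of the good set the level-n factor is one of two values whose ratio is t n, so from stage
  n0 on the ratios J n y / J n (F y) only change by powers of l.\<close>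

lemma powers_along_good_points:
  assumes l: "1 < l" and pow: "\<And>n. n0 \<le> n \<Longrightarrow> \<exists>k::nat. t n = l ^ k"
    and y: "\<And>n. n0 \<le> n \<Longrightarrow> \<psi> n y \<in> {lo n, lo n * t n}" and y': "\<And>n. n0 \<le> n \<Longrightarrow> \<psi> n y' \<in> {lo n, lo n * t n}"
  shows "\<exists>z::int. J (n0 + m) y / J (n0 + m) y' = J n0 y / J n0 y' * l powi z"
proof (induction m)
  case 0
  then show ?case by (intro exI[of _ 0]) simp
next
  case (Suc m)
  let ?n = "n0 + m"
  obtain z where z: "J ?n y / J ?n y' = J n0 y / J n0 y' * l powi z" using Suc by blast
  obtain k where k: "t ?n = l ^ k" using pow[of ?n] by auto
  have l0: "l \<noteq> 0" using l by simp
  have "\<exists>d::int. \<psi> ?n y' / \<psi> ?n y = l powi d"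
  proof -
    have "\<psi> ?n y \<in> {lo ?n, lo ?n * l ^ k}" "\<psi> ?n y' \<in> {lo ?n, lo ?n * l ^ k}" using y[of ?n] y'[of ?n] k by auto
    then have "\<psi> ?n y' / \<psi> ?n y = l powi 0 \<or> \<psi> ?n y' / \<psi> ?n y = l powi (int k) \<or> \<psi> ?n y' / \<psi> ?n y = l powi (- int k)"
      using lo[of ?n] l0 by (auto simp: power_int_minus inverse_eq_divide)
    then show ?thesis by blast
  qed
  then obtain d where d: "\<psi> ?n y' / \<psi> ?n y = l powi d" by blast
  have "J (n0 + Suc m) y / J (n0 + Suc m) y' = (J ?n y / J ?n y') * (\<psi> ?n y' / \<psi> ?n y)"
    by (simp add: J_Suc)
  also have "\<dots> = J n0 y / J n0 y' * l powi (z + d)"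
    unfolding z d using l0 by (simp add: power_int_add)
  finally show ?case by blast
qed

text \<open>The quotients are a fixed number times powers of l and converge to a positive limit.
  Their integer exponents therefore converge, and the limit exponent is again an integer.\<close>

lemma deriv_iter_powers:
  assumes l: "1 < l" and pow: "\<And>n. n0 \<le> n \<Longrightarrow> \<exists>k::nat. t n = l ^ k"
    and y: "\<And>n. n0 \<le> n \<Longrightarrow> \<psi> n y \<in> {lo n, lo n * t n}"
    and y': "\<And>n. n0 \<le> n \<Longrightarrow> \<psi> n (iter G i y) \<in> {lo n, lo n * t n}"
  obtains z :: int where "deriv (iter G i) y = J n0 y / J n0 (iter G i y) * l powr of_int z"
proof -
  let ?F = "iter G i" let ?D = "deriv (iter G i) y" and ?\<rho> = "J n0 y / J n0 (iter G i y)"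
  have \<rho>: "0 < ?\<rho>" using J_pos by simp
  have D: "0 < ?D" by (rule diffeo_deriv_pos[OF iter_diffeo[OF G]])
  have "\<forall>m. \<exists>z::int. J (n0 + m) y / J (n0 + m) (?F y) = ?\<rho> * l powi z"
    using powers_along_good_points[OF l pow y y'] by blast
  then obtain z :: "nat \<Rightarrow> int" where z: "\<And>m. J (n0 + m) y / J (n0 + m) (?F y) = ?\<rho> * l powi z m" by metis
  have "(\<lambda>m. J (m + n0) y / J (m + n0) (?F y)) \<longlonglongrightarrow> ?D"
    by (rule LIMSEQ_ignore_initial_segment[OF J_cocycle_iter])
  then have "(\<lambda>m. ?\<rho> * l powi z m) \<longlonglongrightarrow> ?D" using z by (simp add: add.commute)
  then have "(\<lambda>m. (?\<rho> * l powi z m) / ?\<rho>) \<longlonglongrightarrow> ?D / ?\<rho>" using \<rho> by (intro tendsto_intros) auto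
  then have "(\<lambda>m. l powi z m) \<longlonglongrightarrow> ?D / ?\<rho>" using J_pos by (simp add: less_imp_neq[symmetric])
  then have "(\<lambda>m. log l (l powi z m)) \<longlonglongrightarrow> log l (?D / ?\<rho>)"
    using l D \<rho> by (intro tendsto_log tendsto_const) auto
  moreover have "log l (l powi z m) = of_int (z m)" for m
    using l by (simp add: powr_real_of_int'[symmetric])
  ultimately have "(\<lambda>m. of_int (z m)) \<longlonglongrightarrow> log l (?D / ?\<rho>)" by simp
  then obtain k :: int where k: "log l (?D / ?\<rho>) = of_int k" by (rule Ints_limit)
  have "?D / ?\<rho> = l powr (log l (?D / ?\<rho>))" using l D \<rho> by (intro powr_log_cancel[symmetric] divide_pos_pos J_pos) auto
  then have "?D = ?\<rho> * l powr of_int k"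
  proof -
    have "d = r * p" if "d / r = p" "0 < r" for d r p :: real using that by auto
    then show ?thesis using \<open>?D / ?\<rho> = l powr (log l (?D / ?\<rho>))\<close> \<rho> unfolding k by blast
  qed
  then show thesis by (rule that)
qed

text \<open>The exceptional set of stage n has measure at most \<open>4 * \<delta> n * t n\<close>;
  by hypothesis these numbers sum to at most 1/2, less than the measure of the circle.\<close>

lemma good_points_positive:
  assumes \<delta>t: "\<And>n. \<delta> n * t n \<le> (1 / 2) ^ n / 16"
  shows "0 < emeasure cm {c. \<forall>n\<ge>n0. cfun (\<psi> n) c \<in> {lo n, lo n * t n}}"
    "{c. \<forall>n\<ge>n0. cfun (\<psi> n) c \<in> {lo n, lo n * t n}} \<in> sets cm"
proof -
  let ?E = "\<lambda>n. {c. cfun (\<psi> n) c \<in> {lo n, lo n * t n}}"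
  let ?Y = "{c. \<forall>n\<ge>n0. cfun (\<psi> n) c \<in> {lo n, lo n * t n}}"
  have Y: "?Y = UNIV - (\<Union>n. - ?E (n + n0))"
    by (auto simp: le_iff_add add.commute) 
  have Em: "- ?E n \<in> sets cm" for n using sets.compl_sets[OF level_set_sets, of n] by (simp add: Compl_eq_Diff_UNIV)
  then have U: "(\<Union>n. - ?E (n + n0)) \<in> sets cm" by (intro sets.countable_UN) blast
  then show "?Y \<in> sets cm" unfolding Y using sets.compl_sets[of _ cm] by simp
  have bound: "emeasure cm (- ?E n) \<le> ennreal ((1 / 2) ^ n / 4)" for n
  proof -
    have "measure lebesgue (- {y. deriv (\<phi> n) (real (q n) * inv (K (Suc n)) y) \<in> {lo n, lo n * t n}} \<inter> {0<..<1}) \<le> 4 * \<delta> n * t n"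
      using stage_good_set[OF K K_at_0 shape slow \<eta>_pos \<eta>_le t \<delta>(1) \<delta>(2) w] by (simp only: K_Suc)
    also have "\<dots> \<le> (1 / 2) ^ n / 4" using \<delta>t[of n] by simp
    finally show ?thesis unfolding emeasure_level_compl by (rule ennreal_leI)
  qed
  have sm: "summable (\<lambda>n. (1 / 2 :: real) ^ (n + n0) / 4)"
    by (intro summable_divide summable_ignore_initial_segment summable_geometric) auto
  have "(\<Sum>n. (1 / 2 :: real) ^ (n + n0) / 4) = (1 / 2) ^ n0 / 4 * (\<Sum>n. (1 / 2) ^ n)"
    by (subst suminf_mult[symmetric]) (simp_all add: power_add mult_ac)
  also have "\<dots> = (1 / 2) ^ n0 / 2" by (subst suminf_geometric) auto
  also have "\<dots> \<le> 1 / 2" using power_le_one[of "1 / 2 :: real" n0] by simp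
  finally have S: "(\<Sum>n. (1 / 2 :: real) ^ (n + n0) / 4) \<le> 1 / 2" .
  have "emeasure cm (\<Union>n. - ?E (n + n0)) \<le> (\<Sum>n. emeasure cm (- ?E (n + n0)))"
    using Em by (intro emeasure_subadditive_countably) blast
  also have "\<dots> \<le> (\<Sum>n. ennreal ((1 / 2) ^ (n + n0) / 4))" using bound by (intro suminf_le) auto
  also have "\<dots> = ennreal (\<Sum>n. (1 / 2) ^ (n + n0) / 4)" by (rule suminf_ennreal2[OF _ sm]) simp
  also have "\<dots> \<le> ennreal (1 / 2)" by (rule ennreal_leI[OF S])
  also have "\<dots> < ennreal 1" by (rule ennreal_lessI) auto
  finally have lt: "emeasure cm (\<Union>n. - ?E (n + n0)) < 1" by simp
  show "0 < emeasure cm ?Y"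
  proof (rule ccontr)
    assume "\<not> 0 < emeasure cm ?Y"
    then have "emeasure cm ?Y = 0" by (simp add: zero_less_iff_neq_zero)
    then have "emeasure cm UNIV \<le> emeasure cm (\<Union>n. - ?E (n + n0)) + 0"
      using emeasure_subadditive[OF U \<open>?Y \<in> sets cm\<close>] Y by (simp add: Un_Diff_cancel)
    then show False using lt emeasure_cm_UNIV by simp
  qed
qed

text \<open>The initial quotient at stage n0 need not be a power of l, but on a set where
  \<open>ln (J n0)\<close> varies by at most \<epsilon> it is close to 1. Returns to such a set of
  good points put s arbitrarily near integer powers of l. The freedom in n0 allows ever sparser sets
  of powers.\<close>

lemma ratio_set_upper:
  assumes l: "1 < l" and pow: "\<And>n. n0 \<le> n \<Longrightarrow> \<exists>k::nat. t n = l ^ k" and \<delta>t: "\<And>n. \<delta> n * t n \<le> (1 / 2) ^ n / 16"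
    and s: "s \<in> ratio_set cm (cmap G)" "s \<noteq> 0"
  obtains k :: int where "s = l powi k"
proof -
  have s0: "0 < s" using ratio_set_nonneg[OF s(1)] s(2) by simp
  let ?Y = "{c. \<forall>n\<ge>n0. cfun (\<psi> n) c \<in> {lo n, lo n * t n}}"
  have Ypos: "0 < emeasure cm ?Y" and Ym: "?Y \<in> sets cm" by (rule good_points_positive[OF \<delta>t])+
  have core: "\<exists>D \<rho>. \<exists>z::int. \<bar>D - s\<bar> < \<epsilon> \<and> 0 < \<rho> \<and> \<bar>ln \<rho>\<bar> \<le> \<epsilon> \<and> D = \<rho> * l powr of_int z" if \<epsilon>: "0 < \<epsilon>" for \<epsilon>
  proof -
    \<comment> \<open>Good points sorted by \<open>ln (J n0)\<close> into slices of height
      \<epsilon>, one of which has positive measure; \<epsilon> is also the accuracy asked of the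
      ratio.\<close>
    define A where "A k = ?Y \<inter> {c. of_int k * \<epsilon> \<le> ln (cfun (J n0) c) \<and> ln (cfun (J n0) c) \<le> (of_int k + 1) * \<epsilon>}" for k :: int
    have Am: "A k \<in> sets cm" for k
    proof -
      have "{c \<in> space cm. of_int k * \<epsilon> \<le> ln (cfun (J n0) c) \<and> ln (cfun (J n0) c) \<le> (of_int k + 1) * \<epsilon>} \<in> sets cm"
        using cfun_J_measurable[of n0] by measurable
      then show ?thesis unfolding A_def using Ym by auto
    qed
    have YA: "?Y = (\<Union>k. A k)"
    proof (intro equalityI subsetI)
      fix c assume c: "c \<in> ?Y"
      define k where "k = \<lfloor>ln (cfun (J n0) c) / \<epsilon>\<rfloor>"
      have "of_int k \<le> ln (cfun (J n0) c) / \<epsilon>" "ln (cfun (J n0) c) / \<epsilon> \<le> of_int k + 1" unfolding k_def by linarith+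
      then have "of_int k * \<epsilon> \<le> ln (cfun (J n0) c)" "ln (cfun (J n0) c) \<le> (of_int k + 1) * \<epsilon>"
        using \<epsilon> by (simp_all add: pos_le_divide_eq pos_divide_le_eq)
      then show "c \<in> (\<Union>k. A k)" using c unfolding A_def by blast
    qed (auto simp: A_def)
    have "\<exists>k. emeasure cm (A k) \<noteq> 0"
    proof (rule ccontr)
      assume "\<not> ?thesis"
      then have "A k \<in> null_sets cm" for k using Am by (simp add: null_setsI)
      then have "(\<Union>k. A k) \<in> null_sets cm" by (rule null_sets_UN)
      then show False using Ypos unfolding YA[symmetric] by auto
    qed
    then obtain k where k: "0 < emeasure cm (A k)" by (auto simp: zero_less_iff_neq_zero)
    obtain B i where B: "B \<in> sets cm" "0 < emeasure cm B" "B \<subseteq> A k" "cmap (iter G i) ` B \<subseteq> A k"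
      "\<And>c. c \<in> B \<Longrightarrow> \<bar>cfun (deriv (iter G i)) c - s\<bar> < \<epsilon>"
      using ratio_setD[OF G s(1) Am \<epsilon> k] by blast
    have "B \<noteq> {}" using B(2) by auto
    then obtain c where c: "c \<in> B" by blast
    obtain y where y: "c = proj y" by (rule proj_surj)
    let ?F = "iter G i"
    have F: "diffeo ?F" by (rule iter_diffeo[OF G])
    have "cmap ?F c \<in> A k" using B(4) c by blast
    then have yA: "proj y \<in> A k" "proj (?F y) \<in> A k" using B(3) c by (auto simp: y cmap_proj[OF F])
    have g: "\<psi> n y \<in> {lo n, lo n * t n}" "\<psi> n (?F y) \<in> {lo n, lo n * t n}" if "n0 \<le> n" for n
    proof -
      have "cfun (\<psi> n) (proj y) \<in> {lo n, lo n * t n}" "cfun (\<psi> n) (proj (?F y)) \<in> {lo n, lo n * t n}"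
        using yA that unfolding A_def by blast+
      then show "\<psi> n y \<in> {lo n, lo n * t n}" "\<psi> n (?F y) \<in> {lo n, lo n * t n}" unfolding cfun_\<psi> .
    qed
    let ?\<rho> = "J n0 y / J n0 (?F y)"
    obtain z :: int where z: "deriv ?F y = ?\<rho> * l powr of_int z"
      using deriv_iter_powers[OF l pow g] by blast
    have "\<bar>deriv ?F y - s\<bar> < \<epsilon>" using B(5)[OF c] by (simp add: y cfun_deriv_proj[OF F])
    moreover have "0 < ?\<rho>" using J_pos by simp
    moreover have "\<bar>ln ?\<rho>\<bar> \<le> \<epsilon>"
    proof -
      have "of_int k * \<epsilon> \<le> ln (J n0 y)" "ln (J n0 y) \<le> (of_int k + 1) * \<epsilon>"
        "of_int k * \<epsilon> \<le> ln (J n0 (?F y))" "ln (J n0 (?F y)) \<le> (of_int k + 1) * \<epsilon>"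
        using yA by (auto simp: A_def cfun_J)
      moreover have "(of_int k + 1) * \<epsilon> = of_int k * \<epsilon> + \<epsilon>" by (simp add: distrib_right)
      moreover have "ln ?\<rho> = ln (J n0 y) - ln (J n0 (?F y))" using J_pos by (simp add: ln_div less_imp_neq[symmetric])
      ultimately show ?thesis by linarith
    qed
    ultimately show ?thesis using z by blast
  qed
  have "\<forall>m::nat. \<exists>D \<rho>. \<exists>z::int. \<bar>D - s\<bar> < 1 / real (Suc m) \<and> 0 < \<rho> \<and> \<bar>ln \<rho>\<bar> \<le> 1 / real (Suc m) \<and> D = \<rho> * l powr of_int z"
    using core by simp
  then obtain D \<rho> and z :: "nat \<Rightarrow> int" where D: "\<And>m. \<bar>D m - s\<bar> < 1 / real (Suc m)" "\<And>m. 0 < \<rho> m"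
    "\<And>m. \<bar>ln (\<rho> m)\<bar> \<le> 1 / real (Suc m)" "\<And>m. D m = \<rho> m * l powr of_int (z m)" by metis
  have h: "(\<lambda>m. 1 / real (Suc m)) \<longlonglongrightarrow> 0" by (rule LIMSEQ_Suc[OF lim_1_over_n])
  have "(\<lambda>m. D m - s) \<longlonglongrightarrow> 0" 
  proof (rule Lim_null_comparison[OF _ h])
    show "\<forall>\<^sub>F m in sequentially. norm (D m - s) \<le> 1 / real (Suc m)"
      using less_imp_le[OF D(1)] by (intro always_eventually allI) (simp only: real_norm_def)
  qed
  then have Dl: "D \<longlonglongrightarrow> s" by (simp add: LIM_zero_iff)
  have \<rho>l: "(\<lambda>m. ln (\<rho> m)) \<longlonglongrightarrow> 0" by (rule Lim_null_comparison[OF _ h]) (use D(3) in auto)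
  have "(\<lambda>m. (ln (D m) - ln (\<rho> m)) / ln l) \<longlonglongrightarrow> (ln s - 0) / ln l"
    using s0 l by (intro tendsto_intros Dl \<rho>l) auto
  moreover have "(ln (D m) - ln (\<rho> m)) / ln l = of_int (z m)" for m
    unfolding D(4) using D(2)[of m] l by (simp add: ln_mult ln_powr)
  ultimately have "(\<lambda>m. of_int (z m)) \<longlonglongrightarrow> ln s / ln l" by simp
  then obtain k :: int where k: "ln s / ln l = of_int k" by (rule Ints_limit)
  have lk: "ln s = of_int k * ln l" using k l by (simp add: field_simps)
  have "s = exp (ln s)" using s0 by simp
  also have "\<dots> = l powr of_int k" unfolding lk using l by (simp add: powr_def)
  also have "\<dots> = l powi k" using l by (simp add: powr_real_of_int')
  finally show thesis by (rule that)
qed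

end

section \<open>An infinite invariant measure\<close>

context tower
begin

text \<open>Each stage is normalised by the largest slope \<open>lo * t\<close> of its profile, so
  that \<open>V n * J n\<close> never decreases with n and is unchanged at points over the upper
  plateau.\<close>

definition V :: "nat \<Rightarrow> real" where
  "V n = (\<Prod>m<n. lo m * t m)"

text \<open>The limit of the increasing densities. Extended values are allowed because finiteness is
  established later, and only almost everywhere.\<close>

definition W :: "circle \<Rightarrow> ennreal" where
  "W c = (SUP n. ennreal (V n * cfun (J n) c))"

lemma V_pos: "0 < V n"
  unfolding V_def using lo t by (intro prod_pos) (auto intro: mult_pos_pos less_trans[OF zero_less_one])

lemma V_J_Suc: "V (Suc n) * J (Suc n) y = V n * J n y * (lo n * t n / \<psi> n y)"
  by (simp add: V_def J_Suc mult_ac)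

lemma \<psi>_le: "\<psi> n y \<le> lo n * t n"
  using shape[of n] by (simp add: shape_def \<psi>_def)

lemma V_J_mono: "V n * J n y \<le> V (Suc n) * J (Suc n) y"
proof -
  have "1 \<le> lo n * t n / \<psi> n y" using \<psi>_le[of n y] \<psi>_pos[of n y] by simp
  then have "V n * J n y * 1 \<le> V n * J n y * (lo n * t n / \<psi> n y)"
    using V_pos[of n] J_pos[of n y] by (intro mult_left_mono) (auto intro: less_imp_le)
  then show ?thesis unfolding V_J_Suc by simp
qed

lemma W_LIMSEQ: "(\<lambda>n. ennreal (V n * J n y)) \<longlonglongrightarrow> W (proj y)"
  unfolding W_def cfun_J using V_J_mono by (intro LIMSEQ_SUP incseq_SucI ennreal_leI)

lemma W_measurable: "W \<in> borel_measurable cm"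
  unfolding W_def[abs_def] using cfun_J_measurable by measurable

lemma W_ge_1: "1 \<le> W c"
proof -
  obtain y where y: "c = proj y" by (rule proj_surj)
  have "ennreal (V 0 * cfun (J 0) c) \<le> W c" unfolding W_def by (rule SUP_upper) simp
  then show ?thesis by (simp add: V_def y cfun_J J_0)
qed

text \<open>\<open>V n\<close> is the same at all points of the circle and cancels in the quotient
  along an orbit; hence the limit of \<open>V n * J n\<close> transforms by the limit of the
  quotients, which is \<open>deriv G\<close>.\<close>

lemma W_invariant: "ennreal (cfun (deriv G) c) * W (cmap G c) = W c"
proof -
  obtain y where y: "c = proj y" by (rule proj_surj)
  define r where "r n = J n y / J n (G y) / deriv G y" for n
  have D: "0 < deriv G y" by (rule diffeo_deriv_pos[OF G])
  have "(\<lambda>n. r n) \<longlonglongrightarrow> deriv G y / deriv G y"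
    unfolding r_def using D by (intro tendsto_intros J_cocycle) auto
  then have r: "(\<lambda>n. ennreal (r n)) \<longlonglongrightarrow> ennreal 1" using D by (intro tendsto_ennrealI) simp
  have a: "(\<lambda>n. ennreal (deriv G y) * ennreal (V n * J n (G y))) \<longlonglongrightarrow> ennreal (deriv G y) * W (proj (G y))"
    by (rule ennreal_tendsto_cmult[OF _ W_LIMSEQ]) simp
  have "(\<lambda>n. (ennreal (deriv G y) * ennreal (V n * J n (G y))) * ennreal (r n)) \<longlonglongrightarrow> ennreal (deriv G y) * W (proj (G y)) * ennreal 1"
    by (rule tendsto_mult_ennreal[OF a r]) auto
  moreover have "(ennreal (deriv G y) * ennreal (V n * J n (G y))) * ennreal (r n) = ennreal (V n * J n y)" for n
  proof -
    have "deriv G y * (V n * J n (G y)) * r n = V n * J n y"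
      using D J_pos[of n "G y"] by (simp add: r_def)
    moreover have "0 \<le> r n" "0 \<le> V n * J n (G y)" using D J_pos V_pos by (auto simp: r_def intro: less_imp_le)
    moreover have "ennreal (d * v * u) = ennreal d * ennreal v * ennreal u" if "0 \<le> d" "0 \<le> v" "0 \<le> u" for d v u :: real
      using that by (simp add: ennreal_mult)
    ultimately show ?thesis using D by (metis less_imp_le)
  qed
  ultimately have "(\<lambda>n. ennreal (V n * J n y)) \<longlonglongrightarrow> ennreal (deriv G y) * W (proj (G y))" by simp
  then have "ennreal (deriv G y) * W (proj (G y)) = W (proj y)" by (rule LIMSEQ_unique[OF _ W_LIMSEQ])
  then show ?thesis by (simp add: y cfun_deriv_proj[OF G] cmap_proj[OF G])
qed

text \<open>Used for the invariance of \<open>W\<close> and, with \<open>g = 1\<close> and the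
  inverse of \<open>K n\<close>, for the integral of \<open>J n\<close>.\<close>

lemma nn_integral_cmap:
  assumes F: "diffeo F" and g: "g \<in> borel_measurable cm"
  shows "(\<integral>\<^sup>+c. ennreal (cfun (deriv F) c) * g (cmap F c) \<partial>cm) = integral\<^sup>N cm g"
proof -
  note [measurable] = cmap_measurable[OF F] cmap_measurable[OF diffeo_inv[OF F]] g cfun_deriv_measurable[OF F]
  have "(\<integral>\<^sup>+c. ennreal (cfun (deriv F) c) * g (cmap F c) \<partial>cm) = (\<integral>\<^sup>+c. g (cmap F c) \<partial>density cm (\<lambda>c. ennreal (cfun (deriv F) c)))"
    by (rule nn_integral_density[symmetric]) measurable
  also have "\<dots> = (\<integral>\<^sup>+c. g (cmap F c) \<partial>distr cm cm (cmap (inv F)))" by (simp only: distr_cmap_inv[OF F])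
  also have "\<dots> = (\<integral>\<^sup>+c. g (cmap F (cmap (inv F) c)) \<partial>cm)" by (rule nn_integral_distr) measurable
  also have "\<dots> = integral\<^sup>N cm g" using F by simp
  finally show ?thesis .
qed

text \<open>By Borel-Cantelli almost every point lies over the upper plateau from some stage on,
  where the density stops growing; so \<open>W\<close> is finite almost everywhere. Its total mass
  is nevertheless at least every \<open>V n\<close>, because \<open>J n\<close> has integral
  1.\<close>

lemma type_II_infinity_cmap:
  assumes w2: "\<And>n. w n = 1 / 2" and t4: "\<And>n. t n = 4 * 2 ^ n" and \<delta>s: "\<And>n. \<delta> n \<le> (1 / 2) ^ n / 16"
  shows "type_II_infinity cm (cmap G)"
proof -
  let ?\<nu> = "density cm W"
  let ?E = "\<lambda>n. {c. cfun (\<psi> n) c \<in> {lo n * t n, lo n * t n}}"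
  have Em: "- ?E n \<in> sets cm" for n using sets.compl_sets[OF level_set_sets[of n "lo n * t n" "lo n * t n"]] by (simp add: Compl_eq_Diff_UNIV)
  have bound: "emeasure cm (- ?E n) \<le> ennreal ((1 / 2) ^ n)" for n
  proof -
    have d8: "\<delta> n \<le> 1 / 8" using \<delta>s[of n] power_le_one[of "1 / 2 :: real" n] by simp
    have "measure lebesgue (- {y. deriv (\<phi> n) (real (q n) * inv (K (Suc n)) y) \<in> {lo n * t n, lo n * t n}} \<inter> {0<..<1}) \<le> 1 / t n + 4 * \<delta> n + 3 * \<eta> n"
      using stage_high_set[OF K K_at_0 shape[unfolded w2] slow \<eta>_pos \<eta>_le t \<delta>(1) d8] by (simp only: K_Suc)
    also have "1 / t n = (1 / 2) ^ n / 4" by (simp add: t4 power_one_over)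
    also have "(1 / 2) ^ n / 4 + 4 * \<delta> n + 3 * \<eta> n \<le> (1 / 2) ^ n"
    proof -
      \<comment> \<open>1/4 + 1/4 + 3/32 < 1 are the shares of \<open>1 / t\<close>, of the
        transitions and of the distortion.\<close>
      have "p / 4 + 4 * d + 3 * (p / 32) \<le> p" if "d \<le> p / 16" "0 \<le> p" for d p :: real using that by linarith
      from this[OF \<delta>s zero_le_power, of n] show ?thesis unfolding \<eta> by (simp only: divide_nonneg_nonneg zero_le_one zero_le_numeral)
    qed
    finally show ?thesis unfolding emeasure_level_compl by (intro ennreal_leI) simp
  qed
  have "AE c in cm. eventually (\<lambda>n. c \<in> space cm - (- ?E n)) sequentially"
  proof (rule borel_cantelli_AE1[OF Em])
    show "emeasure cm (- ?E n) < \<infinity>" for n using cm.emeasure_finite[of "- ?E n"] by (simp add: less_top[symmetric])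
    show "summable (\<lambda>n. measure cm (- ?E n))"
    proof (rule summable_comparison_test[OF _ summable_geometric])
      have "measure cm (- ?E n) \<le> (1 / 2) ^ n" for n
        using bound[of n] by (simp add: cm.emeasure_eq_measure)
      then show "\<exists>N. \<forall>n\<ge>N. norm (measure cm (- ?E n)) \<le> (1 / 2) ^ n" by simp
    qed simp
  qed
  then have fin: "AE c in cm. W c \<noteq> \<infinity>"
  proof eventually_elim
    fix c assume "eventually (\<lambda>n. c \<in> space cm - (- ?E n)) sequentially"
    then obtain N where N: "\<And>n. N \<le> n \<Longrightarrow> cfun (\<psi> n) c = lo n * t n" by (auto simp: eventually_sequentially)
    obtain y where y: "c = proj y" by (rule proj_surj)
    have const: "V (N + m) * J (N + m) y = V N * J N y" for m
    proof (induction m)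
      case (Suc m)
      have "\<psi> (N + m) y = lo (N + m) * t (N + m)" using N[of "N + m"] by (simp add: y cfun_\<psi>)
      moreover note \<psi>_pos[of "N + m" y]
      ultimately have "lo (N + m) * t (N + m) / \<psi> (N + m) y = 1" by (metis divide_self less_numeral_extra(3))
      then show ?case using V_J_Suc[of "N + m" y] Suc by (simp only: add_Suc_right mult_1_right)
    qed simp
    have "(\<lambda>m. ennreal (V (m + N) * J (m + N) y)) \<longlonglongrightarrow> W (proj y)"
      by (rule LIMSEQ_ignore_initial_segment[OF W_LIMSEQ])
    moreover have "V (m + N) * J (m + N) y = V N * J N y" for m using const[of m] by (simp add: add.commute)
    ultimately have "(\<lambda>m::nat. ennreal (V N * J N y)) \<longlonglongrightarrow> W (proj y)" by simp
    from LIMSEQ_unique[OF tendsto_const this] have "W (proj y) = ennreal (V N * J N y)" by (rule sym)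
    then show "W c \<noteq> \<infinity>" by (simp add: y)
  qed
  have sf: "sigma_finite_measure ?\<nu>"
    using cm.sigma_finite_iff_density_finite[OF W_measurable] fin by blast
  have W0: "0 < W c" for c using W_ge_1[of c] by (metis less_le_trans zero_less_one)
  have eq: "equivalent_measures cm ?\<nu>" by (rule equivalent_density[OF W_measurable]) (simp add: W0)
  have sets\<nu>: "sets ?\<nu> = sets cm" by simp
  have Gm: "cmap G \<in> measurable ?\<nu> ?\<nu>"
    using cmap_measurable[OF G] measurable_cong_sets[OF sets\<nu> sets\<nu>] by blast
  have inv: "distr ?\<nu> ?\<nu> (cmap G) = ?\<nu>"
  proof (rule measure_eqI)
    fix A assume "A \<in> sets (distr ?\<nu> ?\<nu> (cmap G))"
    then have A: "A \<in> sets cm" by simp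
    note [measurable] = A W_measurable cmap_measurable[OF G]
    have GA: "cmap G -` A \<in> sets cm" using measurable_sets[OF cmap_measurable[OF G] A] by simp
    have "emeasure (distr ?\<nu> ?\<nu> (cmap G)) A = emeasure ?\<nu> (cmap G -` A)"
      using A by (subst emeasure_distr[OF Gm]) simp_all
    also have "\<dots> = (\<integral>\<^sup>+c. W c * indicator (cmap G -` A) c \<partial>cm)" by (rule emeasure_density[OF W_measurable GA])
    also have "\<dots> = (\<integral>\<^sup>+c. ennreal (cfun (deriv G) c) * (W (cmap G c) * indicator A (cmap G c)) \<partial>cm)"
    proof (rule nn_integral_cong)
      fix c
      have "indicator (cmap G -` A) c = (indicator A (cmap G c) :: ennreal)" by (simp add: indicator_def)
      then show "W c * indicator (cmap G -` A) c = ennreal (cfun (deriv G) c) * (W (cmap G c) * indicator A (cmap G c))"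
        by (simp only: mult.assoc[symmetric] W_invariant)
    qed
    also have "\<dots> = (\<integral>\<^sup>+c. W c * indicator A c \<partial>cm)"
      by (rule nn_integral_cmap[OF G, of "\<lambda>c. W c * indicator A c"]) measurable
    also have "\<dots> = emeasure ?\<nu> A" by (rule emeasure_density[OF W_measurable A, symmetric])
    finally show "emeasure (distr ?\<nu> ?\<nu> (cmap G)) A = emeasure ?\<nu> A" .
  qed simp
  have low: "ennreal (V n) \<le> emeasure ?\<nu> (space ?\<nu>)" for n
  proof -
    have iK: "diffeo (inv (K n))" by (rule diffeo_inv[OF K])
    have "integral\<^sup>N cm (\<lambda>c. 1) = emeasure cm UNIV" by simp
    then have one: "(\<integral>\<^sup>+c. ennreal (cfun (J n) c) \<partial>cm) = 1"
      using nn_integral_cmap[OF iK, of "\<lambda>c. 1"] by (simp add: J_def emeasure_cm_UNIV)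
    have "ennreal (V n) = ennreal (V n) * (\<integral>\<^sup>+c. ennreal (cfun (J n) c) \<partial>cm)" by (simp add: one)
    also have "\<dots> = (\<integral>\<^sup>+c. ennreal (V n) * ennreal (cfun (J n) c) \<partial>cm)"
      using cfun_J_measurable by (intro nn_integral_cmult[symmetric]) measurable
    also have "\<dots> \<le> (\<integral>\<^sup>+c. W c \<partial>cm)"
    proof (rule nn_integral_mono)
      fix c
      have "0 \<le> cfun (J n) c" using J_pos by (simp add: cfun_def less_imp_le)
      then have "ennreal (V n) * ennreal (cfun (J n) c) = ennreal (V n * cfun (J n) c)"
        using V_pos[of n] by (simp add: ennreal_mult)
      also have "\<dots> \<le> W c" unfolding W_def by (rule SUP_upper) simp
      finally show "ennreal (V n) * ennreal (cfun (J n) c) \<le> W c" .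
    qed
    also have "\<dots> = (\<integral>\<^sup>+c. W c * indicator (space cm) c \<partial>cm)" by simp
    also have "\<dots> = emeasure ?\<nu> (space cm)" by (rule emeasure_density[OF W_measurable sets.top, symmetric])
    finally show ?thesis by simp
  qed
  have V32: "(3 / 2) ^ n \<le> V n" for n
  proof -
    \<comment> \<open>From \<open>4 \<le> t\<close> follows
      \<open>(t + 1) / 2 \<le> 2 / 3 * t\<close>, so the upper slope is at least 3/2 at every stage
      and \<open>V\<close> grows geometrically.\<close>
    have "3 / 2 \<le> lo m * t m" for m
    proof -
      have "1 \<le> lo m * (1 + (t m - 1) * (1 / 2))" using shape[of m] by (simp add: shape_def w2)
      moreover have "1 + (t m - 1) * (1 / 2) \<le> 2 / 3 * t m"
      proof -
        have "4 \<le> t m" by (simp add: t4)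
        then show ?thesis by (simp add: left_diff_distrib diff_divide_distrib)
      qed
      then have "lo m * (1 + (t m - 1) * (1 / 2)) \<le> lo m * (2 / 3 * t m)" using lo[of m] by (intro mult_left_mono) auto
      ultimately have "1 \<le> lo m * (2 / 3 * t m)" by (rule order_trans)
      then show ?thesis by simp
    qed
    then have "(\<Prod>m<n. 3 / 2) \<le> V n" unfolding V_def by (intro prod_mono) auto
    then show ?thesis by simp
  qed
  have "emeasure ?\<nu> (space ?\<nu>) = \<infinity>"
  proof (rule ccontr)
    assume "\<not> ?thesis"
    then obtain x where x: "emeasure ?\<nu> (space ?\<nu>) = ennreal x" "0 \<le> x" by (cases "emeasure ?\<nu> (space ?\<nu>)") auto
    obtain n where n: "x < (3 / 2) ^ n" using real_arch_pow[of "3 / 2" x] by auto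
    have "ennreal (V n) \<le> ennreal x" using low[of n] x by simp
    then have "V n \<le> x" using x(2) by (simp add: ennreal_le_iff)
    then show False using n V32[of n] by linarith
  qed
  then show ?thesis
    unfolding type_II_infinity_def invariant_measure_def using ergodic_cmap sf eq inv by blast
qed

end

section \<open>Realising the types\<close>

lemma is_lift_cmap: "diffeo G \<Longrightarrow> is_lift (cmap G) G"
  by (simp add: is_lift_def diffeo_cont cmap_proj)

lemma is_lift_rotation: "is_lift (rotation s) (\<lambda>x. x + s)"
  unfolding is_lift_def by (auto intro!: continuous_intros simp: rotation.abs_eq)

lemma inv_rotation: "inv (rotation s) = rotation (- s)"
proof (rule inv_unique_comp)
  have "rotation a (rotation b c) = rotation (a + b) c" for a b c
  proof -
    obtain x where "c = proj x" by (rule proj_surj)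
    then show ?thesis by (simp add: rotation.abs_eq add_ac)
  qed
  moreover have "rotation 0 c = c" for c
  proof -
    obtain x where "c = proj x" by (rule proj_surj)
    then show ?thesis by (simp add: rotation.abs_eq)
  qed
  ultimately show "rotation s \<circ> rotation (- s) = id" "rotation (- s) \<circ> rotation s = id"
    by (simp_all add: fun_eq_iff)
qed

text \<open>The difference of two lifts is continuous and integer valued; distinct values differ by
  at least 1, so it is constant.\<close>

lemma is_lift_unique:
  assumes "is_lift f G" "is_lift f H"
  obtains k :: int where "\<And>x. H x = G x + of_int k"
proof -
  have int: "\<exists>k::int. H x = G x + of_int k" for x
    using assms by (metis is_lift_def proj_eq_iff)
  have "(\<lambda>x. H x - G x) constant_on UNIV"
  proof (rule continuous_discrete_range_constant)
    show "continuous_on UNIV (\<lambda>x. H x - G x)" using assms by (intro continuous_intros) (auto simp: is_lift_def)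
    fix x :: real
    have "1 \<le> norm ((H y - G y) - (H x - G x))" if ne: "H y - G y \<noteq> H x - G x" for y
    proof -
      obtain k l :: int where "H x = G x + of_int k" "H y = G y + of_int l" using int by meson
      then have "(H y - G y) - (H x - G x) = of_int (l - k)" "l - k \<noteq> 0" using ne by auto
      then show ?thesis by (metis norm_of_int of_int_1_le_iff of_int_abs zero_less_abs_iff int_one_le_iff_zero_less real_norm_def)
    qed
    then show "\<exists>e>0. \<forall>y. y \<in> UNIV \<and> H y - G y \<noteq> H x - G x \<longrightarrow> e \<le> norm (H y - G y - (H x - G x))"
      by (intro exI[of _ 1]) auto
  qed simp
  then obtain c where c: "\<And>x. H x - G x = c" by (auto simp: constant_on_def)
  obtain k :: int where "H 0 = G 0 + of_int k" using int by blast
  then have "H x = G x + of_int k" for x using c[of 0] c[of x] by simp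
  then show thesis by (rule that)
qed

text \<open>Boundedness makes the supremum of order 0 a genuine upper bound, and this order alone
  gives the sign.\<close>

lemma Cr_norm_nonneg:
  assumes "\<And>x. \<bar>f x\<bar> \<le> B"
  shows "0 \<le> Cr_norm r f"
proof -
  have "0 \<le> \<bar>f 0\<bar>" by simp
  also have "\<dots> \<le> (SUP x. \<bar>(deriv ^^ 0) f x\<bar>)"
    using assms by (auto intro!: cSUP_upper bdd_aboveI[of _ B])
  also have "\<dots> \<le> Cr_norm r f"
    unfolding Cr_norm_def by (rule Max_ge) (simp, rule image_eqI[where x = 0], simp_all)
  finally show ?thesis .
qed

text \<open>To bound the infimum by one candidate, the set of candidates must be bounded below.
  Lifts being unique up to integers, every pair of them has a bounded difference, hence a
  nonnegative norm.\<close>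

lemma Cr_diff_rotation_le:
  assumes G: "diffeo G" and derivs_le: "derivs_le r \<epsilon> (\<lambda>x. G x - (x + s))"
  shows "Cr_diff r (cmap G) (rotation s) \<le> \<epsilon>"
proof -
  let ?S = "{Cr_norm r (\<lambda>x. G' x - H' x) |G' H'. is_lift (cmap G) G' \<and> is_lift (rotation s) H'}"
  have "0 \<le> z" if zS: "z \<in> ?S" for z
  proof -
    obtain G' H' where z: "z = Cr_norm r (\<lambda>x. G' x - H' x)" "is_lift (cmap G) G'" "is_lift (rotation s) H'" using zS by blast
    obtain k :: int where k: "\<And>x. G' x = G x + of_int k" using is_lift_unique[OF is_lift_cmap[OF G] z(2)] by blast
    obtain l :: int where l: "\<And>x. H' x = x + s + of_int l" using is_lift_unique[OF is_lift_rotation z(3)] by blast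
    have "\<bar>G' x - H' x\<bar> \<le> \<epsilon> + \<bar>of_int k\<bar> + \<bar>of_int l\<bar>" for x
      using derivs_le_bound[OF derivs_le, of x] k[of x] l[of x] by linarith
    then show ?thesis unfolding z(1) by (rule Cr_norm_nonneg)
  qed
  then have "bdd_below ?S" by (rule bdd_belowI)
  moreover have "Cr_norm r (\<lambda>x. G x - (x + s)) \<in> ?S"
    by (intro CollectI exI[of _ G] exI[of _ "\<lambda>x. x + s"] conjI refl is_lift_cmap[OF G] is_lift_rotation)
  ultimately have "Cr_diff r (cmap G) (rotation s) \<le> Cr_norm r (\<lambda>x. G x - (x + s))"
    unfolding Cr_diff_def by (rule cInf_lower[rotated])
  also have "\<dots> \<le> \<epsilon>" by (rule Cr_norm_le[OF derivs_le])
  finally show ?thesis .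
qed

lemma cmap_diffeo:
  assumes G: "diffeo G"
  shows "cmap G \<in> diffeos"
proof -
  have "smooth_circle_map (cmap F)" if F: "diffeo F" for F
    unfolding smooth_circle_map_def by (rule exI[of _ F]) (simp add: is_lift_cmap[OF F] diffeo_smooth[OF F])
  moreover have "orientation_preserving (cmap G)"
    unfolding orientation_preserving_def by (rule exI[of _ G]) (simp add: is_lift_cmap[OF G] diffeo_strict_mono[OF G])
  ultimately show ?thesis
    using cmap_bij[OF G] G diffeo_inv[OF G] by (simp add: diffeos_def inv_cmap[OF G])
qed

lemma has_rotation_number_cmap:
  assumes G: "diffeo G" and rot: "\<And>i x. \<bar>(G ^^ i) x - x - real i * \<alpha>\<bar> \<le> 2"
  shows "has_rotation_number (cmap G) \<alpha>"
  unfolding has_rotation_number_def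
proof (intro exI[of _ G] conjI allI is_lift_cmap[OF G])
  fix x
  have "(\<lambda>n. (G ^^ n) x / real n - \<alpha>) \<longlonglongrightarrow> 0"
  proof (rule Lim_null_comparison)
    show "\<forall>\<^sub>F n in sequentially. norm ((G ^^ n) x / real n - \<alpha>) \<le> (2 + \<bar>x\<bar>) * (1 / real n)"
      using eventually_gt_at_top[of 0]
    proof eventually_elim
      fix n :: nat assume n: "0 < n"
      have "(G ^^ n) x / real n - \<alpha> = ((G ^^ n) x - real n * \<alpha>) / real n" using n by (simp add: field_simps)
      moreover have "\<bar>(G ^^ n) x - real n * \<alpha>\<bar> \<le> 2 + \<bar>x\<bar>" using rot[of n x] by linarith
      ultimately show "norm ((G ^^ n) x / real n - \<alpha>) \<le> (2 + \<bar>x\<bar>) * (1 / real n)"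
        using n by (simp add: abs_divide divide_right_mono)
    qed
    show "(\<lambda>n. (2 + \<bar>x\<bar>) * (1 / real n)) \<longlonglongrightarrow> 0" by (intro tendsto_mult_right_zero lim_1_over_n)
  qed
  then show "(\<lambda>n. (G ^^ n) x / real n) \<longlonglongrightarrow> \<alpha>" by (simp add: LIM_zero_iff)
qed

theorem tower_exists:
  fixes t w \<delta> :: "nat \<Rightarrow> real"
  assumes \<alpha>: "liouville \<alpha>" and t: "\<And>n. 1 < t n" and \<delta>: "\<And>n. 0 < \<delta> n" "\<And>n. 2 * \<delta> n < w n" and w: "\<And>n. w n \<le> 1"
  obtains K q \<phi> lo \<eta> G where "tower K q \<phi> t w \<delta> lo \<eta> G" "cmap G \<in> diffeos_rot \<alpha>" "d_Cr r (cmap G) (rotation \<alpha>) < 1 / 2 ^ r"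
proof -
  have "\<forall>n. \<exists>\<phi> lo. shape (t n) (w n) (\<delta> n) \<phi> lo" using shape_exists[OF t \<delta>(1) \<delta>(2) w] by metis
  then obtain \<phi> lo where sh: "\<And>n. shape (t n) (w n) (\<delta> n) (\<phi> n) (lo n)" by metis
  have \<phi>: "diffeo (\<phi> n)" "\<phi> n 0 = 0" for n using sh[of n] by (auto simp: shape_def)
  define \<eta> :: "nat \<Rightarrow> real" where "\<eta> n = (1 / 2) ^ n / 32" for n
  have \<eta>: "0 < \<eta> n" for n by (simp add: \<eta>_def)
  have irr: "\<alpha> \<notin> \<rat>" using \<alpha> by (simp add: liouville_def)
  \<comment> \<open>Both conditions on the limit in one predicate; each holds for all maps C^1-close
    to the conjugate, and the smaller radius serves both.\<close>
  define \<Phi> where "\<Phi> n K q G \<longleftrightarrow> (\<forall>y. \<bar>deriv G y * deriv (inv (\<lambda>x. K (rescale q (\<phi> n) x))) (G y) / deriv (inv (\<lambda>x. K (rescale q (\<phi> n) x))) y - 1\<bar> \<le> \<eta> n)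
     \<and> shadow (\<eta> n) (\<delta> n) (\<lambda>x. K (rescale q (\<phi> n) x)) q G" for n K q G
  have \<Phi>ex: "\<exists>\<rho>>0. \<forall>G. diffeo G \<longrightarrow> C1_close \<rho> G (conj_rot (\<lambda>x. K (rescale q (\<phi> n) x)) \<alpha>) \<longrightarrow> \<Phi> n K q G"
    if K: "diffeo K" and q: "0 < q" for n K and q :: nat
  proof -
    have H: "diffeo (\<lambda>x. K (rescale q (\<phi> n) x))" by (rule diffeo_comp(1)[OF K rescale_diffeo(1)[OF \<phi>(1) q]])
    obtain \<rho>1 where \<rho>1: "0 < \<rho>1" "\<forall>G. diffeo G \<longrightarrow> C1_close \<rho>1 G (conj_rot (\<lambda>x. K (rescale q (\<phi> n) x)) \<alpha>) \<longrightarrow>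
      (\<forall>y. \<bar>deriv G y * deriv (inv (\<lambda>x. K (rescale q (\<phi> n) x))) (G y) / deriv (inv (\<lambda>x. K (rescale q (\<phi> n) x))) y - 1\<bar> \<le> \<eta> n)"
      using cocycle_near_conj_rot[OF H \<eta>, of \<alpha> n] by (elim exE conjE)
    obtain \<rho>2 where \<rho>2: "0 < \<rho>2" "\<forall>G. diffeo G \<longrightarrow> C1_close \<rho>2 G (conj_rot (\<lambda>x. K (rescale q (\<phi> n) x)) \<alpha>) \<longrightarrow>
      shadow (\<eta> n) (\<delta> n) (\<lambda>x. K (rescale q (\<phi> n) x)) q G"
      using shadow_near_conj_rot[OF H irr \<eta> \<delta>(1) q, of n n] by (elim exE conjE)
    show ?thesis
    proof (intro exI[of _ "min \<rho>1 \<rho>2"] conjI allI impI)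
      show "0 < min \<rho>1 \<rho>2" using \<rho>1 \<rho>2 by simp
      fix G assume G: "diffeo G" and c: "C1_close (min \<rho>1 \<rho>2) G (conj_rot (\<lambda>x. K (rescale q (\<phi> n) x)) \<alpha>)"
      show "\<Phi> n K q G" unfolding \<Phi>_def
        using \<rho>1(2)[rule_format, OF G C1_close_mono[OF c min.cobounded1]] \<rho>2(2)[rule_format, OF G C1_close_mono[OF c min.cobounded2]] by blast
    qed
  qed
  \<comment> \<open>Half of the allowed distance, since the derivative bounds give only non-strict
    inequalities.\<close>
  have e: "(0::real) < 1 / 2 ^ Suc r" by simp
  show thesis
  proof (rule liouville_construction[OF \<alpha> e \<phi>, where \<Psi> = "\<lambda>n K q. slow (\<eta> n) K q" and \<Phi> = \<Phi>, OF slow_eventually[OF _ \<eta>] \<Phi>ex, where r = r])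
  fix K q G
  assume K: "\<And>n. diffeo (K n)" "K 0 = (\<lambda>x. x)" "\<And>n. K n 0 = 0" "\<And>n. K (Suc n) = (\<lambda>x. K n (rescale (q n) (\<phi> n) x))"
    and q: "\<And>n. 0 < q n" "\<And>n. slow (\<eta> n) (K n) (q n)" and G: "diffeo G" "\<And>n. \<Phi> n (K n) (q n) G"
    and d: "derivs_le r (1 / 2 ^ Suc r) (\<lambda>x. G x - (x + \<alpha>))" "derivs_le r (1 / 2 ^ Suc r) (\<lambda>x. inv G x - (x - \<alpha>))"
    and rot: "\<And>i x. \<bar>(G ^^ i) x - x - real i * \<alpha>\<bar> \<le> 2"
  show thesis
  proof (rule that[of K q \<phi> lo \<eta> G])
    show "tower K q \<phi> t w \<delta> lo \<eta> G"
    proof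
      show "\<bar>deriv G y * deriv (inv (K (Suc n))) (G y) / deriv (inv (K (Suc n))) y - 1\<bar> \<le> \<eta> n" for n y
        using G(2)[of n] unfolding \<Phi>_def K(4) by blast
      show "shadow (\<eta> n) (\<delta> n) (K (Suc n)) (q n) G" for n
        using G(2)[of n] unfolding \<Phi>_def K(4) by blast
    qed (fact K(1) K(2) K(3) K(4) q(2) \<eta>_def sh t \<delta> w G(1))+
    show "cmap G \<in> diffeos_rot \<alpha>"
      using cmap_diffeo[OF G(1)] has_rotation_number_cmap[OF G(1) rot] by (simp add: diffeos_rot_def)
    have "Cr_diff r (cmap G) (rotation \<alpha>) \<le> 1 / 2 ^ Suc r" by (rule Cr_diff_rotation_le[OF G(1) d(1)])
    moreover have "Cr_diff r (inv (cmap G)) (inv (rotation \<alpha>)) \<le> 1 / 2 ^ Suc r"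
      unfolding inv_cmap[OF G(1)] inv_rotation by (rule Cr_diff_rotation_le[OF diffeo_inv[OF G(1)]]) (use d(2) in simp)
    moreover have "(1::real) / 2 ^ Suc r < 1 / 2 ^ r" by (simp add: divide_strict_left_mono)
    ultimately show "d_Cr r (cmap G) (rotation \<alpha>) < 1 / 2 ^ r" by (simp add: d_Cr_def)
  qed
  qed
qed

text \<open>Unbounded t puts 0 into the ratio set, which excludes type II. What distinguishes the
  three subtypes is then only the arithmetic of the sequence t, so they share this tower.\<close>

lemma type_III_tower_exists:
  fixes t :: "nat \<Rightarrow> real"
  assumes \<alpha>: "liouville \<alpha>" and t: "\<And>n. 1 < t n" and zero: "\<And>\<epsilon> N. 0 < \<epsilon> \<Longrightarrow> \<exists>n\<ge>N. 1 / t n < \<epsilon>"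
  obtains G where "diffeo G" "cmap G \<in> diffeos_rot \<alpha>" "d_Cr r (cmap G) (rotation \<alpha>) < 1 / 2 ^ r"
    "type_III cm (cmap G)"
    "\<And>s. 0 \<le> s \<Longrightarrow> (\<And>\<epsilon> N. 0 < \<epsilon> \<Longrightarrow> \<exists>n\<ge>N. \<bar>1 / t n - s\<bar> < \<epsilon>) \<Longrightarrow> s \<in> ratio_set cm (cmap G)"
    "\<And>l n0 s. 1 < l \<Longrightarrow> (\<And>n. n0 \<le> n \<Longrightarrow> \<exists>k::nat. t n = l ^ k) \<Longrightarrow> s \<in> ratio_set cm (cmap G) \<Longrightarrow> s \<noteq> 0 \<Longrightarrow> \<exists>k::int. s = l powi k"
proof -
  define M where "M n = nat \<lceil>t n\<rceil>" for n
  define w where "w n = 1 / (real (M n) + 1)" for n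
  \<comment> \<open>The first term leaves most of the plateau for the returns; the second makes the
    transition arcs summable even after multiplication by t.\<close>
  define \<delta> where "\<delta> n = min (w n / 8) ((1 / 2) ^ n / (16 * t n))" for n
  have M: "t n \<le> real (M n)" "real (M n) \<le> t n + 1" for n
    using t[of n] unfolding M_def by linarith+
  have w: "0 < w n" "w n \<le> 1" for n by (auto simp: w_def divide_le_eq)
  have \<delta>w: "0 < \<delta> n" "\<delta> n \<le> w n / 8" for n
    using w(1)[of n] t[of n] by (auto simp: \<delta>_def)
  have \<delta>2: "2 * \<delta> n < w n" for n using \<delta>w(2)[of n] w(1)[of n] by linarith
  have \<delta>t: "\<delta> n * t n \<le> (1 / 2) ^ n / 16" for n
  proof -
    have "\<delta> n * t n \<le> (1 / 2) ^ n / (16 * t n) * t n" using t[of n] by (intro mult_right_mono) (auto simp: \<delta>_def)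
    also have "\<dots> = (1 / 2) ^ n / 16" using t[of n] by simp
    finally show ?thesis .
  qed
  obtain K q \<phi> lo \<eta> G where T: "tower K q \<phi> t w \<delta> lo \<eta> G" and Gd: "cmap G \<in> diffeos_rot \<alpha>" "d_Cr r (cmap G) (rotation \<alpha>) < 1 / 2 ^ r"
    using tower_exists[of \<alpha> t \<delta> w r, OF \<alpha> t \<delta>w(1) \<delta>2 w(2)] by blast
  interpret tower K q \<phi> t w \<delta> lo \<eta> G by (rule T)
  have lim: "s \<in> ratio_set cm (cmap G)" if s: "0 \<le> s" and near: "\<And>\<epsilon> N. 0 < \<epsilon> \<Longrightarrow> \<exists>n\<ge>N. \<bar>1 / t n - s\<bar> < \<epsilon>" for s
  proof (rule ratio_set_limit[OF s])
    fix \<epsilon> :: real and N :: nat assume "0 < \<epsilon>"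
    then obtain n where n: "N \<le> n" "\<bar>1 / t n - s\<bar> < \<epsilon>" using near by blast
    moreover have "\<exists>M. t n \<le> real M \<and> real M \<le> t n + 1 \<and> w n = 1 / (real M + 1)"
      by (intro exI[of _ "M n"] conjI M w_def)
    ultimately show "\<exists>n\<ge>N. \<bar>1 / t n - s\<bar> < \<epsilon> \<and> (\<exists>M. t n \<le> real M \<and> real M \<le> t n + 1 \<and> w n = 1 / (real M + 1)) \<and> \<delta> n \<le> w n / 8"
      using \<delta>w(2)[of n] by blast
  qed
  have "0 \<in> ratio_set cm (cmap G)"
  proof (rule lim)
    fix \<epsilon> :: real and N :: nat assume "0 < \<epsilon>"
    then obtain n where "N \<le> n" "1 / t n < \<epsilon>" using zero by blast
    moreover have "0 < 1 / t n" using t[of n] by simp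
    ultimately show "\<exists>n\<ge>N. \<bar>1 / t n - 0\<bar> < \<epsilon>" by (intro exI[of _ n]) simp
  qed simp
  then have III: "type_III cm (cmap G)"
    using ergodic_cmap not_type_II_if_zero_in_ratio_set[OF tower.G[OF T]] by (simp add: type_III_def)
  have up: "\<exists>k::int. s = l powi k"
    if "1 < l" "\<And>n. n0 \<le> n \<Longrightarrow> \<exists>k::nat. t n = l ^ k" "s \<in> ratio_set cm (cmap G)" "s \<noteq> 0" for l n0 s
    using ratio_set_upper[OF that(1,2) \<delta>t that(3,4)] by blast
  show thesis by (rule that[OF tower.G[OF T] Gd III lim up])
qed

section \<open>The choice of the quotients t for the four types\<close>

lemma in_diffeos_rot_type:
  "cmap G \<in> diffeos_rot \<alpha> \<Longrightarrow> has_type cm (cmap G) T \<Longrightarrow> cmap G \<in> diffeos_rot_type \<alpha> T"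
  by (simp add: diffeos_rot_type_def)

lemma II_infinity_exists:
  assumes \<alpha>: "liouville \<alpha>"
  shows "\<exists>f \<in> diffeos_rot_type \<alpha> II_infinity. d_Cr r f (rotation \<alpha>) < 1 / 2 ^ r"
proof -
  \<comment> \<open>t grows so that the terms \<open>1 / t\<close> are summable, while the width 1/2
    keeps the upper slope at least 3/2.\<close>
  define t w \<delta> :: "nat \<Rightarrow> real" where "t n = 4 * 2 ^ n" and "w n = 1 / 2" and "\<delta> n = (1 / 2) ^ n / 16" for n
  have t: "1 < t n" for n using one_le_power[of "2::real" n] unfolding t_def by linarith
  have \<delta>: "0 < \<delta> n" "2 * \<delta> n < w n" for n using power_le_one[of "1 / 2 :: real" n] by (simp_all add: \<delta>_def w_def)
  have w: "w n \<le> 1" for n by (simp add: w_def)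
  obtain K q \<phi> lo \<eta> G where T: "tower K q \<phi> t w \<delta> lo \<eta> G" and G: "cmap G \<in> diffeos_rot \<alpha>" "d_Cr r (cmap G) (rotation \<alpha>) < 1 / 2 ^ r"
    using tower_exists[of \<alpha> t \<delta> w r, OF \<alpha> t \<delta> w] by blast
  have "type_II_infinity cm (cmap G)"
    by (rule tower.type_II_infinity_cmap[OF T]) (simp_all add: w_def t_def \<delta>_def)
  then show ?thesis using G in_diffeos_rot_type[of G \<alpha> II_infinity] by auto
qed

lemma III_lambda_exists:
  assumes \<alpha>: "liouville \<alpha>" and l: "1 < l"
  shows "\<exists>f \<in> diffeos_rot_type \<alpha> (III_lambda l). d_Cr r f (rotation \<alpha>) < 1 / 2 ^ r"
proof -
  \<comment> \<open>Decoding pairs makes each exponent occur for infinitely many n;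
    \<open>Suc\<close> keeps every value above 1.\<close>
  define t where "t n = l ^ Suc (fst (prod_decode n))" for n
  have t: "1 < t n" for n unfolding t_def by (rule one_less_power[OF l]) simp
  have often: "\<exists>n\<ge>N. t n = l ^ Suc k" for k N
    by (rule exI[of _ "prod_encode (k, N)"]) (simp add: t_def le_prod_encode_2)
  have zero: "\<exists>n\<ge>N. 1 / t n < \<epsilon>" if "0 < \<epsilon>" for \<epsilon> N
  proof -
    obtain k where k: "1 / \<epsilon> < l ^ k" using real_arch_pow[OF l] by blast
    obtain n where n: "N \<le> n" "t n = l ^ Suc k" using often by blast
    have "l ^ k \<le> l ^ Suc k" using l by (intro power_increasing) auto
    then have "1 / \<epsilon> < t n" using k n by simp
    then have "1 / t n < \<epsilon>" using that t[of n] by (simp add: field_simps)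
    then show ?thesis using n by blast
  qed
  show ?thesis
  proof (rule type_III_tower_exists[of \<alpha> t r, OF \<alpha> t zero])
  fix G
  assume G: "diffeo G" "cmap G \<in> diffeos_rot \<alpha>" "d_Cr r (cmap G) (rotation \<alpha>) < 1 / 2 ^ r"
    "type_III cm (cmap G)"
    and lim: "\<And>s. 0 \<le> s \<Longrightarrow> (\<And>\<epsilon> N. 0 < \<epsilon> \<Longrightarrow> \<exists>n\<ge>N. \<bar>1 / t n - s\<bar> < \<epsilon>) \<Longrightarrow> s \<in> ratio_set cm (cmap G)"
    and up: "\<And>l n0 s. 1 < l \<Longrightarrow> (\<And>n. n0 \<le> n \<Longrightarrow> \<exists>k::nat. t n = l ^ k) \<Longrightarrow> s \<in> ratio_set cm (cmap G) \<Longrightarrow> s \<noteq> 0 \<Longrightarrow> \<exists>k::int. s = l powi k"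
  have inv: "1 / l ^ Suc k \<in> ratio_set cm (cmap G)" for k
  proof (rule lim)
    show "0 \<le> 1 / l ^ Suc k" using l by simp
    fix \<epsilon> :: real and N :: nat assume "0 < \<epsilon>"
    then show "\<exists>n\<ge>N. \<bar>1 / t n - 1 / l ^ Suc k\<bar> < \<epsilon>" using often[of N k] by auto
  qed
  have pos: "l ^ Suc k \<in> ratio_set cm (cmap G)" for k
    using ratio_set_inverse[OF G(1) inv[of k]] l by simp
  have z: "0 \<in> ratio_set cm (cmap G)"
  proof (rule lim)
    fix \<epsilon> :: real and N :: nat assume "0 < \<epsilon>"
    then obtain n where "N \<le> n" "1 / t n < \<epsilon>" using zero by blast
    moreover have "0 < 1 / t n" using t[of n] by simp
    ultimately show "\<exists>n\<ge>N. \<bar>1 / t n - 0\<bar> < \<epsilon>" by (intro exI[of _ n]) simp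
  qed simp
  have "ratio_set cm (cmap G) = range (\<lambda>k::int. l powi k) \<union> {0}"
  proof (intro equalityI subsetI)
    fix s assume s: "s \<in> ratio_set cm (cmap G)"
    have "\<exists>k::nat. t n = l ^ k" for n unfolding t_def by blast
    then show "s \<in> range (\<lambda>k::int. l powi k) \<union> {0}" using up[of l 0 s] l s by blast
  next
    fix s assume "s \<in> range (\<lambda>k::int. l powi k) \<union> {0}"
    then consider "s = 0" | k :: int where "s = l powi k" by blast
    then show "s \<in> ratio_set cm (cmap G)"
    proof cases
      case 1
      then show ?thesis using z by simp
    next
      case 2
      show ?thesis
      proof (cases k rule: int_cases3)
        case zero
        then show ?thesis using 2 one_in_ratio_set[OF G(1)] by simp
      next
        case (pos n)
        then obtain m where "n = Suc m" by (cases n) auto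
        then show ?thesis using 2 pos \<open>\<And>k. l ^ Suc k \<in> ratio_set cm (cmap G)\<close>[of m] by (simp only: power_int_of_nat)
      next
        case (neg n)
        then obtain m where "n = Suc m" by (cases n) auto
        then show ?thesis using 2 neg inv[of m] by (simp only: power_int_minus power_int_of_nat inverse_eq_divide)
      qed
    qed
  qed
  then show ?thesis using G in_diffeos_rot_type[of G \<alpha> "III_lambda l"] l by auto
  qed
qed

lemma III_infinity_exists:
  assumes \<alpha>: "liouville \<alpha>"
  shows "\<exists>f \<in> diffeos_rot_type \<alpha> III_infinity. d_Cr r f (rotation \<alpha>) < 1 / 2 ^ r"
proof -
  \<comment> \<open>1 / d j runs through all rationals strictly between 0 and 1.\<close>
  define d :: "nat \<Rightarrow> real" where "d j = (real (fst (prod_decode j)) + real (snd (prod_decode j)) + 2) / (real (fst (prod_decode j)) + 1)" for j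
  define t where "t n = d (fst (prod_decode n))" for n
  have t: "1 < t n" for n by (simp add: t_def d_def field_simps)
  have often: "\<exists>n\<ge>N. 1 / t n = (real a + 1) / (real a + real b + 2)" for a b N
    by (rule exI[of _ "prod_encode (prod_encode (a, b), N)"]) (simp add: t_def d_def le_prod_encode_2)
  have dense: "\<exists>n\<ge>N. \<bar>1 / t n - s\<bar> < \<epsilon>" if s: "0 \<le> s" "s < 1" and \<epsilon>: "0 < \<epsilon>" for s \<epsilon> N
  proof -
    obtain m :: nat where m: "1 / real (Suc m) < \<epsilon>" using nat_approx_posE[OF \<epsilon>] by blast
    define L where "L = m + 2"
    have L: "1 / real L < \<epsilon>"
    proof -
      have "1 / real L \<le> 1 / real (Suc m)" by (simp add: L_def frac_le)
      then show ?thesis using m by linarith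
    qed
    \<comment> \<open>The fraction \<open>(a + 1) / L\<close> has to stay below 1, so the numerator
      is capped at \<open>m + 1 = L - 1\<close>; it still lies within \<open>1 / L\<close> of
      s.\<close>
    define a where "a = min (nat \<lfloor>s * real L\<rfloor>) m"
    have sL: "0 \<le> s * real L" "s * real L < real L" using s by (auto simp: L_def)
    have a1: "\<bar>real a + 1 - s * real L\<bar> \<le> 1"
    proof (cases "nat \<lfloor>s * real L\<rfloor> \<le> m")
      case True
      then have "real a = of_int \<lfloor>s * real L\<rfloor>" using sL(1) by (simp add: a_def)
      then show ?thesis by linarith
    next
      case False
      then have "a = m" by (simp add: a_def)
      moreover have "real m + 1 \<le> s * real L" using False sL(1) by linarith
      moreover have "real L = real m + 2" by (simp add: L_def)
      ultimately show ?thesis using sL(2) by linarith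
    qed
    have am: "a \<le> m" by (simp add: a_def)
    obtain n where n: "N \<le> n" "1 / t n = (real a + 1) / (real a + real (m - a) + 2)" using often by blast
    have "real a + real (m - a) + 2 = real L" using am by (simp add: L_def)
    then have "1 / t n = (real a + 1) / real L" using n(2) by simp
    moreover have "0 < real L" by (simp add: L_def)
    ultimately have "1 / t n - s = (real a + 1 - s * real L) / real L" by (simp add: diff_divide_distrib)
    then have "\<bar>1 / t n - s\<bar> = \<bar>real a + 1 - s * real L\<bar> / real L" by (simp only: abs_divide abs_of_nat)
    also have "\<dots> \<le> 1 / real L" using a1 by (intro divide_right_mono) auto
    finally show ?thesis using L n(1) by force
  qed
  have zero: "\<exists>n\<ge>N. 1 / t n < \<epsilon>" if "0 < \<epsilon>" for \<epsilon> N
  proof -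
    obtain n where n: "N \<le> n" "\<bar>1 / t n - 0\<bar> < \<epsilon>" using dense[of 0 \<epsilon> N] \<open>0 < \<epsilon>\<close> by auto
    then have "1 / t n < \<epsilon>" by linarith
    then show ?thesis using n(1) by blast
  qed
  show ?thesis
  proof (rule type_III_tower_exists[of \<alpha> t r, OF \<alpha> t zero])
  fix G
  assume G: "diffeo G" "cmap G \<in> diffeos_rot \<alpha>" "d_Cr r (cmap G) (rotation \<alpha>) < 1 / 2 ^ r"
    "type_III cm (cmap G)"
    and lim: "\<And>s. 0 \<le> s \<Longrightarrow> (\<And>\<epsilon> N. 0 < \<epsilon> \<Longrightarrow> \<exists>n\<ge>N. \<bar>1 / t n - s\<bar> < \<epsilon>) \<Longrightarrow> s \<in> ratio_set cm (cmap G)"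
  have low: "s \<in> ratio_set cm (cmap G)" if "0 \<le> s" "s < 1" for s
    by (rule lim[OF that(1)]) (rule dense[OF that])
  have "ratio_set cm (cmap G) = {0..}"
  proof (intro equalityI subsetI)
    fix s :: real assume "s \<in> ratio_set cm (cmap G)"
    then show "s \<in> {0..}" using ratio_set_nonneg by simp
  next
    fix s :: real assume s: "s \<in> {0..}"
    consider "s < 1" | "s = 1" | "1 < s" by linarith
    then show "s \<in> ratio_set cm (cmap G)"
    proof cases
      case 3
      \<comment> \<open>The values \<open>1 / t n\<close> are all below 1; larger ratios are
        obtained as reciprocals.\<close>
      then have "inverse s \<in> ratio_set cm (cmap G)" by (intro low) (auto simp: inverse_less_1_iff)
      from ratio_set_inverse[OF G(1) this] show ?thesis using 3 by simp
    qed (use s low one_in_ratio_set[OF G(1)] in auto)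
  qed
  then show ?thesis using G in_diffeos_rot_type[of G \<alpha> III_infinity] by auto
  qed
qed

lemma III_zero_exists:
  assumes \<alpha>: "liouville \<alpha>"
  shows "\<exists>f \<in> diffeos_rot_type \<alpha> III_zero. d_Cr r f (rotation \<alpha>) < 1 / 2 ^ r"
proof -
  define t :: "nat \<Rightarrow> real" where "t n = 2 ^ (2 ^ n)" for n
  have t: "1 < t n" for n unfolding t_def by (rule one_less_power) auto
  have zero: "\<exists>n\<ge>N. 1 / t n < \<epsilon>" if "0 < \<epsilon>" for \<epsilon> N
  proof -
    obtain k where k: "1 / \<epsilon> < 2 ^ k" using real_arch_pow[of 2] by auto
    define n where "n = max N k"
    have "k \<le> n" by (simp add: n_def)
    then have "k \<le> 2 ^ n" using less_exp[of n] by linarith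
    then have "(2::real) ^ k \<le> t n" unfolding t_def by (intro power_increasing) auto
    then have "1 / \<epsilon> < t n" using k by linarith
    then have "1 / t n < \<epsilon>" using that t[of n] by (simp add: field_simps)
    then show ?thesis by (intro exI[of _ n]) (simp add: n_def)
  qed
  show ?thesis
  proof (rule type_III_tower_exists[of \<alpha> t r, OF \<alpha> t zero])
  fix G
  assume G: "diffeo G" "cmap G \<in> diffeos_rot \<alpha>" "d_Cr r (cmap G) (rotation \<alpha>) < 1 / 2 ^ r"
    "type_III cm (cmap G)"
    and lim: "\<And>s. 0 \<le> s \<Longrightarrow> (\<And>\<epsilon> N. 0 < \<epsilon> \<Longrightarrow> \<exists>n\<ge>N. \<bar>1 / t n - s\<bar> < \<epsilon>) \<Longrightarrow> s \<in> ratio_set cm (cmap G)"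
    and up: "\<And>l n0 s. 1 < l \<Longrightarrow> (\<And>n. n0 \<le> n \<Longrightarrow> \<exists>k::nat. t n = l ^ k) \<Longrightarrow> s \<in> ratio_set cm (cmap G) \<Longrightarrow> s \<noteq> 0 \<Longrightarrow> \<exists>k::int. s = l powi k"
  have z: "0 \<in> ratio_set cm (cmap G)"
  proof (rule lim)
    fix \<epsilon> :: real and N :: nat assume "0 < \<epsilon>"
    then obtain n where "N \<le> n" "1 / t n < \<epsilon>" using zero by blast
    moreover have "0 < 1 / t n" using t[of n] by simp
    ultimately show "\<exists>n\<ge>N. \<bar>1 / t n - 0\<bar> < \<epsilon>" by (intro exI[of _ n]) simp
  qed simp
  have one: "s = 1" if s: "s \<in> ratio_set cm (cmap G)" "s \<noteq> 0" for s
  proof (rule ccontr)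
    assume s1: "s \<noteq> 1"
    have s0: "0 < s" using ratio_set_nonneg[OF s(1)] s(2) by simp
    have l0: "log 2 s \<noteq> 0" using s0 s1 by (simp add: log_def)
    \<comment> \<open>From stage m on every quotient is a power of \<open>2 ^ 2 ^ m\<close>, so
      \<open>log 2 s\<close> is a multiple of \<open>2 ^ m\<close>; being smaller in absolute value
      it would have to vanish.\<close>
    obtain m where m: "\<bar>log 2 s\<bar> < 2 ^ m" using real_arch_pow[of 2] by auto
    have "\<exists>k::nat. t n = (2 ^ 2 ^ m) ^ k" if "m \<le> n" for n
      by (rule exI[of _ "2 ^ (n - m)"]) (use that in \<open>simp add: t_def power_mult[symmetric] power_add[symmetric]\<close>)
    moreover have "(1::real) < 2 ^ 2 ^ m" by (rule one_less_power) auto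
    ultimately obtain k :: int where k: "s = (2 ^ 2 ^ m) powi k" using up[of "2 ^ 2 ^ m" m s] s by blast
    have "log 2 s = of_int k * 2 ^ m"
    proof -
      have "s = (2 ^ 2 ^ m :: real) powr of_int k" unfolding k by (simp add: powr_real_of_int')
      then have "log 2 s = of_int k * log 2 (2 ^ 2 ^ m)" by (simp add: log_powr)
      then show ?thesis by (simp add: log_nat_power)
    qed
    moreover have "k \<noteq> 0" using s1 k by auto
    then have "1 \<le> \<bar>of_int k :: real\<bar>" by (metis of_int_abs of_int_1_le_iff int_one_le_iff_zero_less zero_less_abs_iff)
    then have "1 * 2 ^ m \<le> \<bar>of_int k :: real\<bar> * 2 ^ m" by (intro mult_right_mono) auto
    ultimately show False using m by (simp add: abs_mult)
  qed
  have "ratio_set cm (cmap G) = {0, 1}"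
    using one z one_in_ratio_set[OF G(1)] by blast
  then show ?thesis using G in_diffeos_rot_type[of G \<alpha> III_zero] by auto
  qed
qed

theorem proposition1p1:
  fixes \<alpha> :: real and T :: aut_type and r :: nat
  assumes "0 < \<alpha>" and "\<alpha> < 1" and "liouville \<alpha>"
    and "T \<in> {II_infinity, III_infinity, III_zero} \<union> {III_lambda l | l. l > 1}"
  shows "\<exists>f \<in> diffeos_rot_type \<alpha> T. d_Cr r f (rotation \<alpha>) < 1 / 2 ^ r"
proof -
  consider "T = II_infinity" | "T = III_infinity" | "T = III_zero" | l where "T = III_lambda l" "1 < l"
    using assms(4) by blast
  then show ?thesis
    using II_infinity_exists III_infinity_exists III_zero_exists III_lambda_exists assms(3) by cases simp_all
qed

end
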